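(* Let $\mathbb{F}=\mathbb{R}$ or $\mathbb{C}$, let $X$ be a finite-dimensional compact metric space, let $B$ be a Banach algebra over $\mathbb{F}$, and let $\zeta:E=P\times_G B\to X$ be a standard fibre bundle of Banach algebras with fibre $B$. Let $A_\zeta=\Gamma(X,E)$ be the Banach algebra of continuous sections. If $B$ is Bott-stable, then $A_\zeta$ is Bott-stable. If $B$ is rationally Bott-stable, then $A_\zeta$ is rationally Bott-stable.
   Context: $G$ is a topological group acting on $B$ by algebra automorphisms and $P\to X$ is a principal $G$-bundle. For a unital Banach algebra $A$, $\mathrm{GL}\,A$ is the topological group of invertible elements; for non-unital $A$ it is the kernel of $\mathrm{GL}(A^+)\to\mathrm{GL}(A^+/A)=\mathbb{F}\setminus\{0\}$, with $A^+$ the unitization. $\mathrm{GL}_oA$ is the identity path component. The bundle $E\to X$ is standard if either $X$ has the homotopy type of a finite complex or, if not, the structural group of the bundle reduces to some subgroup $G\subset\mathrm{Aut}(B)$ of the homotopy type of a CW-complex (equivalently, the classifying space $BG$ of the bundle has the homotopy type of a CW-complex). $K_*$ denotes real (resp. complex) topological $K$-theory of Banach algebras for $\mathbb{F}=\mathbb{R}$ (resp. $\mathbb{C}$). A Banach algebra $B$ is Bott-stable if the natural map $\pi_*(\mathrm{GL}_oB)\to K_{*+1}(B)$ (the map to $\varinjlim_n\pi_*(\mathrm{GL}_o(B\otimes M_n(\mathbb{F})))$ along upper-left-corner inclusions, followed by the Bott periodicity isomorphism with $K_{*+1}(B)$) is an isomorphism for every $*>0$. It is rationally Bott-stable if $\pi_*(\mathrm{GL}_oB)\otimes\mathbb{Q}\to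 K_{*+1}(B)\otimes\mathbb{Q}$ is an isomorphism for every $*>0$. *)

theory Defs
  imports "HOL-Analysis.Analysis" "HOL-Algebra.Free_Abelian_Groups" "HOL-Algebra.Bij"
begin

section \<open>Scalars and Banach algebras\<close>

text \<open>The scalar field is the real or the complex field, up to isometric field isomorphism.
  The instances below make the class usable with \<^typ>\<open>real\<close> and \<^typ>\<open>complex\<close> themselves.\<close>

class real_or_complex = real_normed_field +
  assumes real_or_complex:
    "(\<exists>f :: 'a \<Rightarrow> real. bij f \<and> (\<forall>x y. f (x + y) = f x + f y) \<and> (\<forall>x y. f (x * y) = f x * f y)
        \<and> (\<forall>x. norm (f x) = norm x)) \<or>
     (\<exists>f :: 'a \<Rightarrow> complex. bij f \<and> (\<forall>x y. f (x + y) = f x + f y) \<and> (\<forall>x y. f (x * y) = f x * f y)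
        \<and> (\<forall>x. norm (f x) = norm x))"

instance real :: real_or_complex
  by standard (rule disjI1, rule exI[of _ "\<lambda>x. x"], simp add: bij_def inj_def)

instance complex :: real_or_complex
  by standard (rule disjI2, rule exI[of _ "\<lambda>x. x"], simp add: bij_def inj_def)

text \<open>Banach algebras are carrier-based, because section algebras, matrix algebras and
  unitizations have to be Banach algebras again. No unit is required.\<close>

record ('k, 'a) normed_alg = "'a partial_object" +
  azero :: 'a
  aadd :: "'a \<Rightarrow> 'a \<Rightarrow> 'a"
  amult :: "'a \<Rightarrow> 'a \<Rightarrow> 'a"
  ascale :: "'k \<Rightarrow> 'a \<Rightarrow> 'a"
  anorm :: "'a \<Rightarrow> real"

text \<open>The value \<open>0\<close> off the carrier serves the axioms of \<^locale>\<open>Metric_space\<close>, which demand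
  nonnegativity and symmetry everywhere.\<close>

definition adist :: "('k::real_or_complex, 'a) normed_alg \<Rightarrow> 'a \<Rightarrow> 'a \<Rightarrow> real" where
  "adist A x y = (if x \<in> carrier A \<and> y \<in> carrier A
                  then anorm A (aadd A x (ascale A (-1) y)) else 0)"

definition atop :: "('k::real_or_complex, 'a) normed_alg \<Rightarrow> 'a topology" where
  "atop A = Metric_space.mtopology (carrier A) (adist A)"

locale banach_algebra =
  fixes A :: "('k::real_or_complex, 'a) normed_alg"
  assumes zero_closed: "azero A \<in> carrier A"
    and add_closed: "\<lbrakk>x \<in> carrier A; y \<in> carrier A\<rbrakk> \<Longrightarrow> aadd A x y \<in> carrier A"
    and mult_closed: "\<lbrakk>x \<in> carrier A; y \<in> carrier A\<rbrakk> \<Longrightarrow> amult A x y \<in> carrier A"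
    and scale_closed: "x \<in> carrier A \<Longrightarrow> ascale A c x \<in> carrier A"
    and add_assoc: "\<lbrakk>x \<in> carrier A; y \<in> carrier A; z \<in> carrier A\<rbrakk>
      \<Longrightarrow> aadd A (aadd A x y) z = aadd A x (aadd A y z)"
    and add_commute: "\<lbrakk>x \<in> carrier A; y \<in> carrier A\<rbrakk> \<Longrightarrow> aadd A x y = aadd A y x"
    and add_zero: "x \<in> carrier A \<Longrightarrow> aadd A x (azero A) = x"
    and add_minus: "x \<in> carrier A \<Longrightarrow> aadd A x (ascale A (-1) x) = azero A"
    and scale_one: "x \<in> carrier A \<Longrightarrow> ascale A 1 x = x"
    and scale_scale: "x \<in> carrier A \<Longrightarrow> ascale A c (ascale A d x) = ascale A (c * d) x"
    and scale_add_left: "x \<in> carrier A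
      \<Longrightarrow> ascale A (c + d) x = aadd A (ascale A c x) (ascale A d x)"
    and scale_add_right: "\<lbrakk>x \<in> carrier A; y \<in> carrier A\<rbrakk>
      \<Longrightarrow> ascale A c (aadd A x y) = aadd A (ascale A c x) (ascale A c y)"
    and mult_assoc: "\<lbrakk>x \<in> carrier A; y \<in> carrier A; z \<in> carrier A\<rbrakk>
      \<Longrightarrow> amult A (amult A x y) z = amult A x (amult A y z)"
    and mult_add_left: "\<lbrakk>x \<in> carrier A; y \<in> carrier A; z \<in> carrier A\<rbrakk>
      \<Longrightarrow> amult A (aadd A x y) z = aadd A (amult A x z) (amult A y z)"
    and mult_add_right: "\<lbrakk>x \<in> carrier A; y \<in> carrier A; z \<in> carrier A\<rbrakk>
      \<Longrightarrow> amult A x (aadd A y z) = aadd A (amult A x y) (amult A x z)"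
    and mult_scale_left: "\<lbrakk>x \<in> carrier A; y \<in> carrier A\<rbrakk>
      \<Longrightarrow> amult A (ascale A c x) y = ascale A c (amult A x y)"
    and mult_scale_right: "\<lbrakk>x \<in> carrier A; y \<in> carrier A\<rbrakk>
      \<Longrightarrow> amult A x (ascale A c y) = ascale A c (amult A x y)"
    and norm_nonneg: "x \<in> carrier A \<Longrightarrow> 0 \<le> anorm A x"
    and norm_eq_0: "x \<in> carrier A \<Longrightarrow> anorm A x = 0 \<longleftrightarrow> x = azero A"
    and norm_triangle: "\<lbrakk>x \<in> carrier A; y \<in> carrier A\<rbrakk>
      \<Longrightarrow> anorm A (aadd A x y) \<le> anorm A x + anorm A y"
    and norm_scale: "x \<in> carrier A \<Longrightarrow> anorm A (ascale A c x) = norm c * anorm A x"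
    and norm_mult: "\<lbrakk>x \<in> carrier A; y \<in> carrier A\<rbrakk>
      \<Longrightarrow> anorm A (amult A x y) \<le> anorm A x * anorm A y"
    and complete: "Metric_space.mcomplete (carrier A) (adist A)"

subsection \<open>Unitization, matrices and general linear groups\<close>

definition unitization :: "('k::real_or_complex, 'a) normed_alg \<Rightarrow> ('k, 'a \<times> 'k) normed_alg" where
  "unitization A = \<lparr>carrier = carrier A \<times> UNIV,
     azero = (azero A, 0),
     aadd = (\<lambda>(a, s) (b, t). (aadd A a b, s + t)),
     amult = (\<lambda>(a, s) (b, t). (aadd A (amult A a b) (aadd A (ascale A s b) (ascale A t a)), s * t)),
     ascale = (\<lambda>c (a, s). (ascale A c a, c * s)),
     anorm = (\<lambda>(a, s). anorm A a + norm s)\<rparr>"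

definition is_unit_of :: "('k, 'a) normed_alg \<Rightarrow> 'a \<Rightarrow> bool" where
  "is_unit_of A e \<longleftrightarrow> e \<in> carrier A \<and> (\<forall>x\<in>carrier A. amult A e x = x \<and> amult A x e = x)"

definition unital :: "('k, 'a) normed_alg \<Rightarrow> bool" where
  "unital A \<longleftrightarrow> (\<exists>e. is_unit_of A e)"

definition aone :: "('k, 'a) normed_alg \<Rightarrow> 'a" where
  "aone A = (THE e. is_unit_of A e)"

definition ainvertible :: "('k, 'a) normed_alg \<Rightarrow> 'a set" where
  "ainvertible A = {x \<in> carrier A. \<exists>y\<in>carrier A. amult A x y = aone A \<and> amult A y x = aone A}"

text \<open>To have one type for both cases, a unital algebra is identified with the ideal
  \<open>A \<times> {0}\<close> of its unitization (isometrically, by the choice of norm). In the non-unital case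
  the elements are the invertible elements of the unitization with scalar part \<open>1\<close>.\<close>

definition GL_set :: "('k::real_or_complex, 'a) normed_alg \<Rightarrow> ('a \<times> 'k) set" where
  "GL_set A = (if unital A then ainvertible A \<times> {0}
               else {g \<in> ainvertible (unitization A). snd g = 1})"

definition GL :: "('k::real_or_complex, 'a) normed_alg \<Rightarrow> ('a \<times> 'k) topology" where
  "GL A = subtopology (atop (unitization A)) (GL_set A)"

definition GL_one :: "('k::real_or_complex, 'a) normed_alg \<Rightarrow> 'a \<times> 'k" where
  "GL_one A = (if unital A then (aone A, 0) else (azero A, 1))"

definition GLo :: "('k::real_or_complex, 'a) normed_alg \<Rightarrow> ('a \<times> 'k) topology" where
  "GLo A = subtopology (GL A) (path_component_of_set (GL A) (GL_one A))"

definition asum :: "('k, 'a) normed_alg \<Rightarrow> (nat \<Rightarrow> 'a) \<Rightarrow> nat \<Rightarrow> 'a" where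
  "asum A f n = rec_nat (azero A) (\<lambda>i s. aadd A s (f i)) n"

text \<open>\<open>mat_alg n A\<close> is \<open>A \<otimes> M\<^sub>n\<close>, realized as \<open>n \<times> n\<close> matrices over \<open>A\<close>. Entries outside
  the upper left \<open>n \<times> n\<close> block are zero, so the corner embedding \<open>M\<^sub>m(A) \<rightarrow> M\<^sub>n(A)\<close> for
  \<open>m \<le> n\<close> is an inclusion of sets. The norm is one of the (equivalent) submultiplicative norms
  extending that of \<open>A\<close>.\<close>

definition mat_alg :: "nat \<Rightarrow> ('k::real_or_complex, 'a) normed_alg \<Rightarrow> ('k, nat \<Rightarrow> nat \<Rightarrow> 'a) normed_alg" where
  "mat_alg n A = \<lparr>carrier = {M. \<forall>i j. (i < n \<and> j < n \<longrightarrow> M i j \<in> carrier A) \<and>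
                                      (\<not> (i < n \<and> j < n) \<longrightarrow> M i j = azero A)},
     azero = (\<lambda>i j. azero A),
     aadd = (\<lambda>M N i j. aadd A (M i j) (N i j)),
     amult = (\<lambda>M N i j. asum A (\<lambda>k. amult A (M i k) (N k j)) n),
     ascale = (\<lambda>c M i j. ascale A c (M i j)),
     anorm = (\<lambda>M. \<Sum>i<n. \<Sum>j<n. anorm A (M i j))\<rparr>"

definition mat_one_one :: "('k::real_or_complex, 'a) normed_alg \<Rightarrow> 'a \<times> 'k \<Rightarrow> (nat \<Rightarrow> nat \<Rightarrow> 'a) \<times> 'k" where
  "mat_one_one A = (\<lambda>(a, s). ((\<lambda>i j. if i = 0 \<and> j = 0 then a else azero A), s))"

text \<open>The map \<open>GL(M\<^sub>m(A)) \<rightarrow> GL(M\<^sub>n(A))\<close>, \<open>m \<le> n\<close>, induced by the corner embedding. For unital \<open>A\<close>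
  it is \<open>g \<mapsto> diag(g, 1, \<dots>, 1)\<close>; otherwise the added diagonal ones are already in the scalar part.\<close>

definition corner :: "('k::real_or_complex, 'a) normed_alg \<Rightarrow> nat \<Rightarrow> nat
    \<Rightarrow> (nat \<Rightarrow> nat \<Rightarrow> 'a) \<times> 'k \<Rightarrow> (nat \<Rightarrow> nat \<Rightarrow> 'a) \<times> 'k" where
  "corner A m n = (\<lambda>(M, s).
     if unital A then ((\<lambda>i j. if m \<le> i \<and> i < n \<and> i = j then aone A else M i j), s) else (M, s))"

section \<open>Homotopy groups\<close>

definition cube :: "nat \<Rightarrow> (nat \<Rightarrow> real) topology" where
  "cube n = subtopology (Euclidean_space n) {x. \<forall>i<n. 0 \<le> x i \<and> x i \<le> 1}"

definition cube_boundary :: "nat \<Rightarrow> (nat \<Rightarrow> real) set" where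
  "cube_boundary n = {x \<in> topspace (cube n). \<exists>i<n. x i = 0 \<or> x i = 1}"

definition boundary_to :: "nat \<Rightarrow> 'a \<Rightarrow> ((nat \<Rightarrow> real) \<Rightarrow> 'a) \<Rightarrow> bool" where
  "boundary_to n x0 f \<longleftrightarrow> (\<forall>x\<in>cube_boundary n. f x = x0)"

definition hclass :: "nat \<Rightarrow> 'a topology \<Rightarrow> 'a \<Rightarrow> ((nat \<Rightarrow> real) \<Rightarrow> 'a) \<Rightarrow> ((nat \<Rightarrow> real) \<Rightarrow> 'a) set" where
  "hclass n T x0 f = {g. homotopic_with (boundary_to n x0) (cube n) T f g}"

definition concat_maps :: "((nat \<Rightarrow> real) \<Rightarrow> 'a) \<Rightarrow> ((nat \<Rightarrow> real) \<Rightarrow> 'a) \<Rightarrow> (nat \<Rightarrow> real) \<Rightarrow> 'a" where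
  "concat_maps f g x = (if x 0 \<le> 1/2 then f (x(0 := 2 * x 0)) else g (x(0 := 2 * x 0 - 1)))"

text \<open>\<open>\<pi>\<^sub>n(T, x0)\<close> for \<open>n \<ge> 1\<close>.\<close>

definition homotopy_group :: "nat \<Rightarrow> 'a topology \<Rightarrow> 'a \<Rightarrow> ((nat \<Rightarrow> real) \<Rightarrow> 'a) set monoid" where
  "homotopy_group n T x0 = \<lparr>
     carrier = {hclass n T x0 f | f. continuous_map (cube n) T f \<and> boundary_to n x0 f},
     monoid.mult = (\<lambda>C D. \<Union>f\<in>C. \<Union>g\<in>D. hclass n T x0 (concat_maps f g)),
     one = hclass n T x0 (\<lambda>_. x0)\<rparr>"

definition homotopy_map :: "nat \<Rightarrow> 'b topology \<Rightarrow> 'b \<Rightarrow> ('a \<Rightarrow> 'b)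
    \<Rightarrow> ((nat \<Rightarrow> real) \<Rightarrow> 'a) set \<Rightarrow> ((nat \<Rightarrow> real) \<Rightarrow> 'b) set" where
  "homotopy_map n T y0 \<phi> C = (\<Union>f\<in>C. hclass n T y0 (\<phi> \<circ> f))"

section \<open>Direct limits of sequences of groups\<close>

definition lim_class :: "(nat \<Rightarrow> 'a monoid) \<Rightarrow> (nat \<Rightarrow> nat \<Rightarrow> 'a \<Rightarrow> 'a) \<Rightarrow> nat \<Rightarrow> 'a \<Rightarrow> (nat \<times> 'a) set" where
  "lim_class G t m x = {(n, y). y \<in> carrier (G n) \<and> (\<exists>k\<ge>max m n. t m k x = t n k y)}"

definition direct_limit :: "(nat \<Rightarrow> 'a monoid) \<Rightarrow> (nat \<Rightarrow> nat \<Rightarrow> 'a \<Rightarrow> 'a) \<Rightarrow> (nat \<times> 'a) set monoid" where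
  "direct_limit G t = \<lparr>
     carrier = {lim_class G t m x | m x. x \<in> carrier (G m)},
     monoid.mult = (\<lambda>C D. \<Union>(m, x)\<in>C. \<Union>(n, y)\<in>D.
        lim_class G t (max m n) (t m (max m n) x \<otimes>\<^bsub>G (max m n)\<^esub> t n (max m n) y)),
     one = lim_class G t 0 \<one>\<^bsub>G 0\<^esub>\<rparr>"

definition direct_limit_map :: "(nat \<Rightarrow> 'b monoid) \<Rightarrow> (nat \<Rightarrow> nat \<Rightarrow> 'b \<Rightarrow> 'b) \<Rightarrow> (nat \<Rightarrow> 'a \<Rightarrow> 'b)
    \<Rightarrow> (nat \<times> 'a) set \<Rightarrow> (nat \<times> 'b) set" where
  "direct_limit_map H u f C = (\<Union>(m, x)\<in>C. lim_class H u m (f m x))"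

section \<open>Topological K-theory and Bott stability\<close>

text \<open>Stage \<open>m\<close> of each of the two sequences is the matrix algebra of size \<open>Suc m\<close>.\<close>

definition GLo_stage :: "nat \<Rightarrow> ('k::real_or_complex, 'a) normed_alg \<Rightarrow> nat
    \<Rightarrow> ((nat \<Rightarrow> real) \<Rightarrow> (nat \<Rightarrow> nat \<Rightarrow> 'a) \<times> 'k) set monoid" where
  "GLo_stage n A m = homotopy_group n (GLo (mat_alg (Suc m) A)) (GL_one (mat_alg (Suc m) A))"

definition GLo_trans :: "nat \<Rightarrow> ('k::real_or_complex, 'a) normed_alg \<Rightarrow> nat \<Rightarrow> nat
    \<Rightarrow> ((nat \<Rightarrow> real) \<Rightarrow> (nat \<Rightarrow> nat \<Rightarrow> 'a) \<times> 'k) set \<Rightarrow> ((nat \<Rightarrow> real) \<Rightarrow> (nat \<Rightarrow> nat \<Rightarrow> 'a) \<times> 'k) set" where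
  "GLo_trans n A m l = homotopy_map n (GLo (mat_alg (Suc l) A)) (GL_one (mat_alg (Suc l) A))
                         (corner A (Suc m) (Suc l))"

definition GL_stage :: "nat \<Rightarrow> ('k::real_or_complex, 'a) normed_alg \<Rightarrow> nat
    \<Rightarrow> ((nat \<Rightarrow> real) \<Rightarrow> (nat \<Rightarrow> nat \<Rightarrow> 'a) \<times> 'k) set monoid" where
  "GL_stage n A m = homotopy_group n (GL (mat_alg (Suc m) A)) (GL_one (mat_alg (Suc m) A))"

definition GL_trans :: "nat \<Rightarrow> ('k::real_or_complex, 'a) normed_alg \<Rightarrow> nat \<Rightarrow> nat
    \<Rightarrow> ((nat \<Rightarrow> real) \<Rightarrow> (nat \<Rightarrow> nat \<Rightarrow> 'a) \<times> 'k) set \<Rightarrow> ((nat \<Rightarrow> real) \<Rightarrow> (nat \<Rightarrow> nat \<Rightarrow> 'a) \<times> 'k) set" where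
  "GL_trans n A m l = homotopy_map n (GL (mat_alg (Suc l) A)) (GL_one (mat_alg (Suc l) A))
                        (corner A (Suc m) (Suc l))"

definition stable_GLo :: "nat \<Rightarrow> ('k::real_or_complex, 'a) normed_alg
    \<Rightarrow> (nat \<times> ((nat \<Rightarrow> real) \<Rightarrow> (nat \<Rightarrow> nat \<Rightarrow> 'a) \<times> 'k) set) set monoid" where
  "stable_GLo n A = direct_limit (GLo_stage n A) (GLo_trans n A)"

definition to_stable_GLo :: "nat \<Rightarrow> ('k::real_or_complex, 'a) normed_alg \<Rightarrow> ((nat \<Rightarrow> real) \<Rightarrow> 'a \<times> 'k) set
    \<Rightarrow> (nat \<times> ((nat \<Rightarrow> real) \<Rightarrow> (nat \<Rightarrow> nat \<Rightarrow> 'a) \<times> 'k) set) set" where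
  "to_stable_GLo n A C = lim_class (GLo_stage n A) (GLo_trans n A) 0
     (homotopy_map n (GLo (mat_alg (Suc 0) A)) (GL_one (mat_alg (Suc 0) A)) (mat_one_one A) C)"

text \<open>Higher topological K-theory of a Banach algebra, \<open>K\<^sub>i(A) = colim\<^sub>m \<pi>\<^bsub>i-1\<^esub>(GL(M\<^sub>m(A)))\<close>. The group
  structure is that of the homotopy group, so the definition is meant for \<open>i \<ge> 2\<close>, the only
  degrees occurring below.\<close>

definition K_group :: "nat \<Rightarrow> ('k::real_or_complex, 'a) normed_alg
    \<Rightarrow> (nat \<times> ((nat \<Rightarrow> real) \<Rightarrow> (nat \<Rightarrow> nat \<Rightarrow> 'a) \<times> 'k) set) set monoid" where
  "K_group i A = direct_limit (GL_stage (i - 1) A) (GL_trans (i - 1) A)"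

text \<open>With this definition of \<open>K\<^bsub>n+1\<^esub>\<close> the identification of \<open>colim\<^sub>m \<pi>\<^sub>n(GL\<^sub>o(M\<^sub>m(A)))\<close> with it is
  induced by the inclusions \<open>GL\<^sub>o \<subseteq> GL\<close>.\<close>

definition stable_GLo_to_K :: "nat \<Rightarrow> ('k::real_or_complex, 'a) normed_alg
    \<Rightarrow> (nat \<times> ((nat \<Rightarrow> real) \<Rightarrow> (nat \<Rightarrow> nat \<Rightarrow> 'a) \<times> 'k) set) set
    \<Rightarrow> (nat \<times> ((nat \<Rightarrow> real) \<Rightarrow> (nat \<Rightarrow> nat \<Rightarrow> 'a) \<times> 'k) set) set" where
  "stable_GLo_to_K n A = direct_limit_map (GL_stage n A) (GL_trans n A)
     (\<lambda>m. homotopy_map n (GL (mat_alg (Suc m) A)) (GL_one (mat_alg (Suc m) A)) id)"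

definition natural_map :: "nat \<Rightarrow> ('k::real_or_complex, 'a) normed_alg \<Rightarrow> ((nat \<Rightarrow> real) \<Rightarrow> 'a \<times> 'k) set
    \<Rightarrow> (nat \<times> ((nat \<Rightarrow> real) \<Rightarrow> (nat \<Rightarrow> nat \<Rightarrow> 'a) \<times> 'k) set) set" where
  "natural_map n A = stable_GLo_to_K n A \<circ> to_stable_GLo n A"

definition bott_stable :: "('k::real_or_complex, 'a) normed_alg \<Rightarrow> bool" where
  "bott_stable A \<longleftrightarrow>
     (\<forall>n>0. natural_map n A \<in> iso (homotopy_group n (GLo A) (GL_one A)) (K_group (n + 1) A))"

text \<open>\<open>G \<otimes> \<rat>\<close> over the integers, as the free abelian group on \<open>G \<times> \<rat>\<close> modulo biadditivity.\<close>

definition tensor_rels :: "('a, 'm) monoid_scheme \<Rightarrow> ('a \<times> rat \<Rightarrow>\<^sub>0 int) set" where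
  "tensor_rels G =
     {frag_of (x \<otimes>\<^bsub>G\<^esub> y, q) - frag_of (x, q) - frag_of (y, q) | x y q.
        x \<in> carrier G \<and> y \<in> carrier G} \<union>
     {frag_of (x, p + q) - frag_of (x, p) - frag_of (x, q) | x p q. x \<in> carrier G}"

definition tensor_sub :: "('a, 'm) monoid_scheme \<Rightarrow> ('a \<times> rat \<Rightarrow>\<^sub>0 int) set" where
  "tensor_sub G = generate (free_Abelian_group (carrier G \<times> UNIV)) (tensor_rels G)"

definition tensor_rat :: "('a, 'm) monoid_scheme \<Rightarrow> ('a \<times> rat \<Rightarrow>\<^sub>0 int) set monoid" where
  "tensor_rat G = free_Abelian_group (carrier G \<times> UNIV) Mod tensor_sub G"

definition tensor_rat_map :: "('b, 'm) monoid_scheme \<Rightarrow> ('a \<Rightarrow> 'b)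
    \<Rightarrow> ('a \<times> rat \<Rightarrow>\<^sub>0 int) set \<Rightarrow> ('b \<times> rat \<Rightarrow>\<^sub>0 int) set" where
  "tensor_rat_map H f C =
     tensor_sub H <#>\<^bsub>free_Abelian_group (carrier H \<times> UNIV)\<^esub>
       frag_extend (\<lambda>(x, q). frag_of (f x, q)) ` C"

definition rationally_bott_stable :: "('k::real_or_complex, 'a) normed_alg \<Rightarrow> bool" where
  "rationally_bott_stable A \<longleftrightarrow>
     (\<forall>n>0. tensor_rat_map (K_group (n + 1) A) (natural_map n A)
        \<in> iso (tensor_rat (homotopy_group n (GLo A) (GL_one A))) (tensor_rat (K_group (n + 1) A)))"

section \<open>Topological groups and their actions on algebras\<close>

definition topological_group :: "('g, 'm) monoid_scheme \<Rightarrow> 'g topology \<Rightarrow> bool" where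
  "topological_group G T \<longleftrightarrow> group G \<and> topspace T = carrier G \<and>
     continuous_map (prod_topology T T) T (\<lambda>(g, h). g \<otimes>\<^bsub>G\<^esub> h) \<and>
     continuous_map T T (\<lambda>g. inv\<^bsub>G\<^esub> g)"

definition algebra_automorphism :: "('k::real_or_complex, 'b) normed_alg \<Rightarrow> ('b \<Rightarrow> 'b) \<Rightarrow> bool" where
  "algebra_automorphism B f \<longleftrightarrow> homeomorphic_map (atop B) (atop B) f \<and>
     (\<forall>x\<in>carrier B. \<forall>y\<in>carrier B. f (aadd B x y) = aadd B (f x) (f y)) \<and>
     (\<forall>x\<in>carrier B. \<forall>y\<in>carrier B. f (amult B x y) = amult B (f x) (f y)) \<and>
     (\<forall>c. \<forall>x\<in>carrier B. f (ascale B c x) = ascale B c (f x))"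

definition Aut_alg :: "('k::real_or_complex, 'b) normed_alg \<Rightarrow> ('b \<Rightarrow> 'b) monoid" where
  "Aut_alg B = BijGroup (carrier B)
     \<lparr>carrier := {f \<in> carrier (BijGroup (carrier B)). algebra_automorphism B f}\<rparr>"

definition algebra_action :: "('g, 'm) monoid_scheme \<Rightarrow> 'g topology \<Rightarrow> ('k::real_or_complex, 'b) normed_alg
    \<Rightarrow> ('g \<Rightarrow> 'b \<Rightarrow> 'b) \<Rightarrow> bool" where
  "algebra_action G T B \<alpha> \<longleftrightarrow>
     (\<forall>g\<in>carrier G. algebra_automorphism B (\<alpha> g)) \<and>
     (\<forall>b\<in>carrier B. \<alpha> \<one>\<^bsub>G\<^esub> b = b) \<and>
     (\<forall>g\<in>carrier G. \<forall>h\<in>carrier G. \<forall>b\<in>carrier B. \<alpha> (g \<otimes>\<^bsub>G\<^esub> h) b = \<alpha> g (\<alpha> h b)) \<and>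
     continuous_map (prod_topology T (atop B)) (atop B) (\<lambda>(g, b). \<alpha> g b)"

section \<open>Principal bundles and associated bundles of algebras\<close>

record ('g, 'x, 'p) pbundle =
  sgrp :: "'g monoid"
  sgtop :: "'g topology"
  base :: "'x topology"
  total :: "'p topology"
  proj :: "'p \<Rightarrow> 'x"
  ract :: "'p \<Rightarrow> 'g \<Rightarrow> 'p"

definition principal_bundle :: "('g, 'x, 'p) pbundle \<Rightarrow> bool" where
  "principal_bundle \<xi> \<longleftrightarrow>
     topological_group (sgrp \<xi>) (sgtop \<xi>) \<and>
     continuous_map (total \<xi>) (base \<xi>) (proj \<xi>) \<and>
     continuous_map (prod_topology (total \<xi>) (sgtop \<xi>)) (total \<xi>) (\<lambda>(p, g). ract \<xi> p g) \<and>
     (\<forall>p\<in>topspace (total \<xi>). ract \<xi> p \<one>\<^bsub>sgrp \<xi>\<^esub> = p) \<and>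
     (\<forall>p\<in>topspace (total \<xi>). \<forall>g\<in>carrier (sgrp \<xi>). \<forall>h\<in>carrier (sgrp \<xi>).
        ract \<xi> p (g \<otimes>\<^bsub>sgrp \<xi>\<^esub> h) = ract \<xi> (ract \<xi> p g) h) \<and>
     (\<forall>x\<in>topspace (base \<xi>). \<exists>U \<phi>. openin (base \<xi>) U \<and> x \<in> U \<and>
        homeomorphic_map (prod_topology (subtopology (base \<xi>) U) (sgtop \<xi>))
          (subtopology (total \<xi>) {p \<in> topspace (total \<xi>). proj \<xi> p \<in> U}) \<phi> \<and>
        (\<forall>u\<in>U. \<forall>g\<in>carrier (sgrp \<xi>). proj \<xi> (\<phi> (u, g)) = u) \<and>
        (\<forall>u\<in>U. \<forall>g\<in>carrier (sgrp \<xi>). \<forall>h\<in>carrier (sgrp \<xi>).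
           \<phi> (u, g \<otimes>\<^bsub>sgrp \<xi>\<^esub> h) = ract \<xi> (\<phi> (u, g)) h))"

definition quotient_topology :: "'a topology \<Rightarrow> ('a \<Rightarrow> 'b) \<Rightarrow> 'b topology" where
  "quotient_topology T q =
     topology (\<lambda>U. U \<subseteq> q ` topspace T \<and> openin T {x \<in> topspace T. q x \<in> U})"

lemma openin_quotient_topology:
  "openin (quotient_topology T q) U \<longleftrightarrow>
     U \<subseteq> q ` topspace T \<and> openin T {x \<in> topspace T. q x \<in> U}"
proof -
  have "istopology (\<lambda>U. U \<subseteq> q ` topspace T \<and> openin T {x \<in> topspace T. q x \<in> U})"
    unfolding istopology_def
  proof (intro conjI allI impI)
    fix S S'
    assume S: "S \<subseteq> q ` topspace T \<and> openin T {x \<in> topspace T. q x \<in> S}"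
      and S': "S' \<subseteq> q ` topspace T \<and> openin T {x \<in> topspace T. q x \<in> S'}"
    show "S \<inter> S' \<subseteq> q ` topspace T" using S by blast
    have "{x \<in> topspace T. q x \<in> S \<inter> S'} =
      {x \<in> topspace T. q x \<in> S} \<inter> {x \<in> topspace T. q x \<in> S'}" by blast
    then show "openin T {x \<in> topspace T. q x \<in> S \<inter> S'}" using S S' by auto
  next
    fix K assume K: "\<forall>S\<in>K. S \<subseteq> q ` topspace T \<and> openin T {x \<in> topspace T. q x \<in> S}"
    then show "\<Union>K \<subseteq> q ` topspace T" by blast
    have "{x \<in> topspace T. q x \<in> \<Union>K} = (\<Union>S\<in>K. {x \<in> topspace T. q x \<in> S})" by blast
    then show "openin T {x \<in> topspace T. q x \<in> \<Union>K}" using K by auto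
  qed
  then show ?thesis by (simp add: quotient_topology_def)
qed

text \<open>A point \<open>[p, b]\<close> of \<open>P \<times>\<^sub>G B\<close> is the equivalence class of \<open>(p, b)\<close> under
  \<open>(p g, b) \<sim> (p, g b)\<close>.\<close>

definition assoc_class :: "('g, 'x, 'p) pbundle \<Rightarrow> ('g \<Rightarrow> 'b \<Rightarrow> 'b) \<Rightarrow> 'p \<times> 'b \<Rightarrow> ('p \<times> 'b) set" where
  "assoc_class \<xi> \<alpha> = (\<lambda>(p, b).
     {(ract \<xi> p g, \<alpha> (inv\<^bsub>sgrp \<xi>\<^esub> g) b) | g. g \<in> carrier (sgrp \<xi>)})"

definition assoc_total :: "('g, 'x, 'p) pbundle \<Rightarrow> ('k::real_or_complex, 'b) normed_alg
    \<Rightarrow> ('g \<Rightarrow> 'b \<Rightarrow> 'b) \<Rightarrow> ('p \<times> 'b) set topology" where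
  "assoc_total \<xi> B \<alpha> = quotient_topology (prod_topology (total \<xi>) (atop B)) (assoc_class \<xi> \<alpha>)"

definition assoc_proj :: "('g, 'x, 'p) pbundle \<Rightarrow> ('p \<times> 'b) set \<Rightarrow> 'x" where
  "assoc_proj \<xi> e = (THE x. \<exists>(p, b)\<in>e. proj \<xi> p = x)"

text \<open>Fibrewise operations: \<open>[p, a] + [p, b] = [p, a + b]\<close> and so on. Each \<open>p\<close> in the fibre of \<open>P\<close>
  occurs exactly once as a first component in a point of \<open>E\<close>, so these sets are again classes.\<close>

definition fib_zero :: "('g, 'x, 'p) pbundle \<Rightarrow> ('k, 'b) normed_alg \<Rightarrow> 'x \<Rightarrow> ('p \<times> 'b) set" where
  "fib_zero \<xi> B x = {(p, azero B) | p. p \<in> topspace (total \<xi>) \<and> proj \<xi> p = x}"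

definition fib_add :: "('k, 'b) normed_alg \<Rightarrow> ('p \<times> 'b) set \<Rightarrow> ('p \<times> 'b) set \<Rightarrow> ('p \<times> 'b) set" where
  "fib_add B d e = {(p, aadd B a b) | p a b. (p, a) \<in> d \<and> (p, b) \<in> e}"

definition fib_mult :: "('k, 'b) normed_alg \<Rightarrow> ('p \<times> 'b) set \<Rightarrow> ('p \<times> 'b) set \<Rightarrow> ('p \<times> 'b) set" where
  "fib_mult B d e = {(p, amult B a b) | p a b. (p, a) \<in> d \<and> (p, b) \<in> e}"

definition fib_scale :: "('k, 'b) normed_alg \<Rightarrow> 'k \<Rightarrow> ('p \<times> 'b) set \<Rightarrow> ('p \<times> 'b) set" where
  "fib_scale B c e = {(p, ascale B c b) | p b. (p, b) \<in> e}"

definition sections :: "('g, 'x, 'p) pbundle \<Rightarrow> ('k::real_or_complex, 'b) normed_alg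
    \<Rightarrow> ('g \<Rightarrow> 'b \<Rightarrow> 'b) \<Rightarrow> ('x \<Rightarrow> ('p \<times> 'b) set) set" where
  "sections \<xi> B \<alpha> = {s \<in> extensional (topspace (base \<xi>)).
     continuous_map (base \<xi>) (assoc_total \<xi> B \<alpha>) s \<and>
     (\<forall>x\<in>topspace (base \<xi>). assoc_proj \<xi> (s x) = x)}"

definition section_algebra :: "('g, 'x, 'p) pbundle \<Rightarrow> ('k::real_or_complex, 'b) normed_alg
    \<Rightarrow> ('g \<Rightarrow> 'b \<Rightarrow> 'b) \<Rightarrow> (('x \<Rightarrow> ('p \<times> 'b) set) \<Rightarrow> real)
    \<Rightarrow> ('k, 'x \<Rightarrow> ('p \<times> 'b) set) normed_alg" where
  "section_algebra \<xi> B \<alpha> N = \<lparr>carrier = sections \<xi> B \<alpha>,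
     azero = (\<lambda>x\<in>topspace (base \<xi>). fib_zero \<xi> B x),
     aadd = (\<lambda>s t. \<lambda>x\<in>topspace (base \<xi>). fib_add B (s x) (t x)),
     amult = (\<lambda>s t. \<lambda>x\<in>topspace (base \<xi>). fib_mult B (s x) (t x)),
     ascale = (\<lambda>c s. \<lambda>x\<in>topspace (base \<xi>). fib_scale B c (s x)),
     anorm = N\<rparr>"

definition compact_open :: "'a topology \<Rightarrow> 'b topology \<Rightarrow> ('a \<Rightarrow> 'b) topology" where
  "compact_open X Y = topology_generated_by {{f. f ` K \<subseteq> U} | K U. compactin X K \<and> openin Y U}"

text \<open>The automorphisms by which the group acts need not be isometric, so the fibres carry a norm
  only up to equivalence and the sup norm on sections depends on choices. What is canonical is the
  topology of uniform convergence, which over a compact base is the compact-open topology; a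
  section norm is any Banach algebra norm inducing it.\<close>

definition section_norm :: "('g, 'x, 'p) pbundle \<Rightarrow> ('k::real_or_complex, 'b) normed_alg
    \<Rightarrow> ('g \<Rightarrow> 'b \<Rightarrow> 'b) \<Rightarrow> (('x \<Rightarrow> ('p \<times> 'b) set) \<Rightarrow> real) \<Rightarrow> bool" where
  "section_norm \<xi> B \<alpha> N \<longleftrightarrow> banach_algebra (section_algebra \<xi> B \<alpha> N) \<and>
     atop (section_algebra \<xi> B \<alpha> N) =
       subtopology (compact_open (base \<xi>) (assoc_total \<xi> B \<alpha>)) (sections \<xi> B \<alpha>)"

definition algebra_bundle_iso :: "('g, 'x, 'p) pbundle \<Rightarrow> ('g \<Rightarrow> 'b \<Rightarrow> 'b)
    \<Rightarrow> ('h, 'x, 'q) pbundle \<Rightarrow> ('h \<Rightarrow> 'b \<Rightarrow> 'b) \<Rightarrow> ('k::real_or_complex, 'b) normed_alg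
    \<Rightarrow> (('p \<times> 'b) set \<Rightarrow> ('q \<times> 'b) set) \<Rightarrow> bool" where
  "algebra_bundle_iso \<xi> \<alpha> \<eta> \<beta> B \<Phi> \<longleftrightarrow>
     base \<xi> = base \<eta> \<and>
     homeomorphic_map (assoc_total \<xi> B \<alpha>) (assoc_total \<eta> B \<beta>) \<Phi> \<and>
     (\<forall>e\<in>topspace (assoc_total \<xi> B \<alpha>). assoc_proj \<eta> (\<Phi> e) = assoc_proj \<xi> e) \<and>
     (\<forall>d\<in>topspace (assoc_total \<xi> B \<alpha>). \<forall>e\<in>topspace (assoc_total \<xi> B \<alpha>).
        assoc_proj \<xi> d = assoc_proj \<xi> e \<longrightarrow>
          \<Phi> (fib_add B d e) = fib_add B (\<Phi> d) (\<Phi> e) \<and>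
          \<Phi> (fib_mult B d e) = fib_mult B (\<Phi> d) (\<Phi> e)) \<and>
     (\<forall>c. \<forall>e\<in>topspace (assoc_total \<xi> B \<alpha>). \<Phi> (fib_scale B c e) = fib_scale B c (\<Phi> e))"

section \<open>CW complexes, dimension and standard bundles\<close>

definition disk :: "nat \<Rightarrow> (nat \<Rightarrow> real) topology" where
  "disk n = subtopology (Euclidean_space n) {x. (\<Sum>i<n. (x i)\<^sup>2) \<le> 1}"

definition open_disk :: "nat \<Rightarrow> (nat \<Rightarrow> real) set" where
  "open_disk n = {x \<in> topspace (disk n). (\<Sum>i<n. (x i)\<^sup>2) < 1}"

definition open_cell :: "nat \<times> ((nat \<Rightarrow> real) \<Rightarrow> 'y) \<Rightarrow> 'y set" where
  "open_cell c = snd c ` open_disk (fst c)"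

text \<open>A CW structure is given by its characteristic maps, each paired with the dimension of the cell.\<close>

definition cw_structure :: "'y topology \<Rightarrow> (nat \<times> ((nat \<Rightarrow> real) \<Rightarrow> 'y)) set \<Rightarrow> bool" where
  "cw_structure Y C \<longleftrightarrow> Hausdorff_space Y \<and>
     (\<forall>(n, \<phi>)\<in>C. continuous_map (disk n) Y \<phi> \<and>
        embedding_map (subtopology (disk n) (open_disk n)) Y \<phi>) \<and>
     topspace Y = (\<Union>c\<in>C. open_cell c) \<and> disjoint_family_on open_cell C \<and>
     (\<forall>(n, \<phi>)\<in>C. \<exists>D\<subseteq>C. finite D \<and> (\<forall>d\<in>D. fst d < n) \<and>
        \<phi> ` (topspace (disk n) - open_disk n) \<subseteq> (\<Union>d\<in>D. open_cell d)) \<and>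
     (\<forall>S\<subseteq>topspace Y. (\<forall>(n, \<phi>)\<in>C. closedin (disk n) {x \<in> topspace (disk n). \<phi> x \<in> S})
        \<longrightarrow> closedin Y S)"

text \<open>The type argument is the type of the points of the complexes. As these definitions are only
  used in hypotheses, where that type is arbitrary, this places no bound on the size of a complex.\<close>

definition cw_homotopy_type :: "'y itself \<Rightarrow> 'a topology \<Rightarrow> bool" where
  "cw_homotopy_type _ X \<longleftrightarrow>
     (\<exists>(Y :: 'y topology) C. cw_structure Y C \<and> X homotopy_equivalent_space Y)"

definition finite_complex_homotopy_type :: "'y itself \<Rightarrow> 'a topology \<Rightarrow> bool" where
  "finite_complex_homotopy_type _ X \<longleftrightarrow>
     (\<exists>(Y :: 'y topology) C. cw_structure Y C \<and> finite C \<and> X homotopy_equivalent_space Y)"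

text \<open>Lebesgue covering dimension at most \<open>n\<close>.\<close>

definition covering_dim_le :: "'x topology \<Rightarrow> nat \<Rightarrow> bool" where
  "covering_dim_le X n \<longleftrightarrow>
     (\<forall>\<U>. finite \<U> \<and> (\<forall>U\<in>\<U>. openin X U) \<and> \<Union>\<U> = topspace X \<longrightarrow>
        (\<exists>\<V>. finite \<V> \<and> (\<forall>V\<in>\<V>. openin X V) \<and> \<Union>\<V> = topspace X \<and>
           (\<forall>V\<in>\<V>. \<exists>U\<in>\<U>. V \<subseteq> U) \<and> (\<forall>x\<in>topspace X. card {V \<in> \<V>. x \<in> V} \<le> n + 1)))"

definition finite_dimensional_space :: "'x topology \<Rightarrow> bool" where
  "finite_dimensional_space X \<longleftrightarrow> (\<exists>n. covering_dim_le X n)"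

text \<open>Reduction of the structural group to a subgroup \<open>H\<close> of \<open>Aut(B)\<close> of the homotopy type of a CW
  complex: \<open>E\<close> is isomorphic to \<open>Q \<times>\<^sub>H B\<close> for a principal \<open>H\<close>-bundle \<open>Q\<close>. The subgroup carries a group
  topology for which evaluation \<open>H \<times> B \<rightarrow> B\<close> is continuous. The type argument \<open>'q\<close> of the points of \<open>Q\<close>
  is arbitrary, as above.\<close>

definition reduces_to_cw_subgroup :: "'y itself \<Rightarrow> 'q itself \<Rightarrow> ('g, 'x, 'p) pbundle
    \<Rightarrow> ('k::real_or_complex, 'b) normed_alg \<Rightarrow> ('g \<Rightarrow> 'b \<Rightarrow> 'b) \<Rightarrow> bool" where
  "reduces_to_cw_subgroup ty _ \<xi> B \<alpha> \<longleftrightarrow>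
     (\<exists>H (\<eta> :: ('b \<Rightarrow> 'b, 'x, 'q) pbundle) \<Phi>.
        subgroup H (Aut_alg B) \<and> sgrp \<eta> = Aut_alg B \<lparr>carrier := H\<rparr> \<and>
        principal_bundle \<eta> \<and> algebra_action (sgrp \<eta>) (sgtop \<eta>) B (\<lambda>f b. f b) \<and>
        cw_homotopy_type ty (sgtop \<eta>) \<and>
        algebra_bundle_iso \<xi> \<alpha> \<eta> (\<lambda>f b. f b) B \<Phi>)"

definition standard_bundle :: "'y itself \<Rightarrow> 'q itself \<Rightarrow> ('g, 'x, 'p) pbundle
    \<Rightarrow> ('k::real_or_complex, 'b) normed_alg \<Rightarrow> ('g \<Rightarrow> 'b \<Rightarrow> 'b) \<Rightarrow> bool" where
  "standard_bundle ty tq \<xi> B \<alpha> \<longleftrightarrow>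
     finite_complex_homotopy_type ty (base \<xi>) \<or> reduces_to_cw_subgroup ty tq \<xi> B \<alpha>"

end

theory Submission
  imports Defs
begin

text \<open>In the coordinate \<open>a = g - 1\<close> the group \<open>GL\<^sub>n(A)\<close> becomes the set \<open>Q\<^sub>n\<close> of
  quasi-invertible \<open>n \<times> n\<close> matrices over \<open>A\<close>, with base point \<open>0\<close>, whether or not \<open>A\<close> has a unit, and the
  corner embeddings become inclusions \<open>Q\<^sub>1 \<subseteq> Q\<^sub>2 \<subseteq> \<dots>\<close> of topological groups (\<open>GL_homeomorphic\<close>). In a
  topological group loops may be multiplied pointwise instead of being concatenated. Bott stability of \<open>A\<close>
  therefore says that every loop of positive dimension in some \<open>Q\<^sub>n\<close> is homotopic in a larger \<open>Q\<^sub>m\<close> to a loop in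
  \<open>Q\<^sub>1\<close>, and that loops in \<open>Q\<^sub>1\<close> that contract in some \<open>Q\<^sub>n\<close> contract in \<open>Q\<^sub>1\<close>. As tensoring with the rationals
  kills exactly the torsion of kernel and cokernel (\<open>tensor_rat_map_iso_iff\<close>), rational Bott stability is the
  same statement up to replacing loops by powers. So both parts of the theorem are instances of one statement,
  \<open>stable S\<close>, in which exponents from a set \<open>S\<close> are allowed: \<open>S = {1}\<close> and \<open>S = {1, 2, \<dots>}\<close>
  (\<open>bott_stable_iff\<close>, \<open>rationally_bott_stable_iff\<close>).

  By the exact sequence of a pair, stability means that the homotopy of the union of the \<open>Q\<^sub>n\<close> relative to
  \<open>Q\<^sub>1\<close> vanishes up to exponents from \<open>S\<close>: each relative loop, a map from a cube to some \<open>Q\<^sub>n\<close> that sends one face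
  into the identity component of \<open>Q\<^sub>1\<close> and the other faces to the identity, has a power that contracts in some
  larger \<open>Q\<^sub>m\<close> (\<open>stable_imp_null_rel_loop\<close>, \<open>null_rel_loop_imp_stable\<close>).

  In this form stability passes from \<open>B\<close> to sections. A section of \<open>P \<times>\<^sub>G B\<close> is an equivariant function
  \<open>P \<rightarrow> B\<close>, so a relative loop for the section algebra is an equivariant family, indexed by \<open>P\<close>, of relative
  loops for \<open>B\<close> (\<open>family_of_rel\<close>), and an equivariant family of contractions is a contraction for the section
  algebra (\<open>null_rel_loop_of_families\<close>). Over a small open subset of \<open>X\<close> a family is, in a trivialization,
  close to a constant one, and the stability of \<open>B\<close> contracts a power of it (\<open>local_null\<close>). Contractions over two
  open sets differ on the intersection by an equivariant family of relative loops one degree higher; where a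
  power of that family contracts as well, the two contractions can be modified and glued (\<open>glue_null\<close>). The
  intersection to be dealt with can be shrunk to a neighbourhood of a closed set whose dimension is smaller than
  that of \<open>X\<close> (\<open>coloured_separation\<close>), so that for finite-dimensional compact \<open>X\<close> an induction on dimension and on
  the number of open sets contracts the family over all of \<open>X\<close> (\<open>local_to_global\<close>, \<open>families_null\<close>). Only finitely
  many exponents occur on the way, and their product is again in \<open>S\<close>.\<close>

section \<open>Cubes\<close>

abbreviation "Cube n \<equiv> topspace (cube n)"

lemma continuous_map_in: "continuous_map X Y f \<Longrightarrow> x \<in> topspace X \<Longrightarrow> f x \<in> topspace Y"
  by (auto simp: continuous_map_def)

lemma continuous_map_identity: "continuous_map X X (\<lambda>x. x)"
  using continuous_map_id[of X] by (simp only: id_def)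

lemma topspace_cube: "Cube n = {x. (\<forall>i\<ge>n. x i = 0) \<and> (\<forall>i<n. 0 \<le> x i \<and> x i \<le> 1)}"
  by (auto simp: cube_def topspace_Euclidean_space)

lemma cube_bounds: "z \<in> Cube n \<Longrightarrow> 0 \<le> z i \<and> z i \<le> 1"
  by (cases "i < n") (auto simp: topspace_cube)

lemma cube_eq_subtopology: "cube n = subtopology (powertop_real UNIV) (Cube n)"
  unfolding topspace_cube cube_def Euclidean_space_def subtopology_subtopology
  by (rule arg_cong[where f = "subtopology (powertop_real UNIV)"]) auto

lemma continuous_map_into_cube:
  "continuous_map Y (cube n) f \<longleftrightarrow>
     (\<forall>i<n. continuous_map Y euclideanreal (\<lambda>y. f y i)) \<and> (\<forall>y\<in>topspace Y. f y \<in> Cube n)"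
    (is "?L \<longleftrightarrow> ?R")
proof -
  have L: "?L \<longleftrightarrow> (\<forall>i. continuous_map Y euclideanreal (\<lambda>y. f y i)) \<and> (\<forall>y\<in>topspace Y. f y \<in> Cube n)"
    by (subst cube_eq_subtopology) (auto simp: continuous_map_in_subtopology continuous_map_componentwise_UNIV)
  show ?thesis
  proof
    assume ?L then show ?R using L by blast
  next
    assume R: ?R
    have "continuous_map Y euclideanreal (\<lambda>y. f y i)" for i
    proof (cases "i < n")
      case False
      then have "\<forall>y\<in>topspace Y. f y i = 0" using R by (auto simp: topspace_cube)
      then show ?thesis using continuous_map_eq[of Y euclideanreal "\<lambda>_. 0" "\<lambda>y. f y i"] by simp
    qed (use R in blast)
    then show ?L using L R by blast
  qed
qed

lemma continuous_map_cube_coordinate: "continuous_map (cube n) euclideanreal (\<lambda>z. z i)"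
proof (cases "i < n")
  case True
  then show ?thesis using continuous_map_into_cube[of "cube n" n "\<lambda>z. z"] by simp
next
  case False
  then show ?thesis using continuous_map_eq[of "cube n" euclideanreal "\<lambda>_. 0" "\<lambda>y. y i"]
    by (simp add: topspace_cube)
qed

lemma continuous_map_cube_coordinate_compose:
  "continuous_map Y (cube n) f \<Longrightarrow> continuous_map Y euclideanreal (\<lambda>y. f y i)"
  using continuous_map_compose[OF _ continuous_map_cube_coordinate[of n i]] by (simp add: comp_def)

lemma compact_space_cube: "compact_space (cube n)"
proof -
  let ?B = "\<lambda>i. if i < n then {0..1::real} else {0}"
  have "x \<in> Cube n \<longleftrightarrow> x \<in> PiE UNIV ?B" for x
  proof -
    have "x \<in> PiE UNIV ?B \<longleftrightarrow> (\<forall>i. x i \<in> ?B i)" by (simp add: PiE_iff)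
    also have "\<dots> \<longleftrightarrow> x \<in> Cube n"
      unfolding topspace_cube by (auto simp: not_less split: if_split_asm)
    finally show ?thesis by blast
  qed
  then have eq: "Cube n = PiE UNIV ?B" by blast
  have "compactin (powertop_real UNIV) (PiE UNIV ?B)"
    unfolding compactin_PiE by (intro disjI2 ballI) simp
  then show ?thesis
    unfolding eq[symmetric] by (subst cube_eq_subtopology) (rule compact_space_subtopology)
qed

text \<open>Face coordinates are inserted at position 0 and homotopy parameters appended at the end, so
  cyclic rotation converts between the two.\<close>

definition shift :: "real \<Rightarrow> (nat \<Rightarrow> real) \<Rightarrow> nat \<Rightarrow> real" where
  "shift a z = (\<lambda>i. case i of 0 \<Rightarrow> a | Suc j \<Rightarrow> z j)"

definition rotate_up :: "nat \<Rightarrow> (nat \<Rightarrow> real) \<Rightarrow> nat \<Rightarrow> real" where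
  "rotate_up n z = shift (z n) (z(n := 0))"

definition rotate_down :: "nat \<Rightarrow> (nat \<Rightarrow> real) \<Rightarrow> nat \<Rightarrow> real" where
  "rotate_down n z = (\<lambda>i. if i < n then z (Suc i) else if i = n then z 0 else 0)"

lemma shift_simps [simp]: "shift a z 0 = a" "shift a z (Suc i) = z i"
  by (simp_all add: shift_def)

lemma shift_in_cube:
  assumes "z \<in> Cube n" "0 \<le> a" "a \<le> 1" shows "shift a z \<in> Cube (Suc n)"
proof -
  have "shift a z i = 0" if "i \<ge> Suc n" for i
    using that assms(1) by (cases i) (simp_all add: topspace_cube)
  moreover have "0 \<le> shift a z i \<and> shift a z i \<le> 1" for i
    using cube_bounds[OF assms(1)] assms(2,3) by (cases i) simp_all
  ultimately show ?thesis unfolding topspace_cube by blast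
qed

lemma continuous_map_shift:
  assumes "continuous_map Y euclideanreal a" "continuous_map Y (cube n) f"
    and "\<And>y. y \<in> topspace Y \<Longrightarrow> a y \<in> {0..1}"
  shows "continuous_map Y (cube (Suc n)) (\<lambda>y. shift (a y) (f y))"
proof -
  have "f y \<in> Cube n" if "y \<in> topspace Y" for y
    using assms(2) that by (rule continuous_map_in)
  then have "shift (a y) (f y) \<in> Cube (Suc n)" if "y \<in> topspace Y" for y
    using assms(3)[OF that] that by (intro shift_in_cube) simp_all
  moreover have "continuous_map Y euclideanreal (\<lambda>y. shift (a y) (f y) i)" for i
    using assms(1) continuous_map_cube_coordinate_compose[OF assms(2)] by (cases i) simp_all
  ultimately show ?thesis
    unfolding continuous_map_into_cube by blast
qed

lemma continuous_map_cube_upd: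
  assumes "continuous_map Y euclideanreal a" "continuous_map Y (cube m) f" "k < n" "m \<le> n"
    and "\<And>y. y \<in> topspace Y \<Longrightarrow> a y \<in> {0..1}"
  shows "continuous_map Y (cube n) (\<lambda>y. (f y)(k := a y))"
proof -
  have f: "f y \<in> Cube m" if "y \<in> topspace Y" for y
    using assms(2) that by (rule continuous_map_in)
  have "(f y)(k := a y) \<in> Cube n" if "y \<in> topspace Y" for y
    using f[OF that] cube_bounds[OF f[OF that]] assms(3,4) assms(5)[OF that]
    by (simp add: topspace_cube)
  moreover have "continuous_map Y euclideanreal (\<lambda>y. ((f y)(k := a y)) i)" for i
    using assms(1) continuous_map_cube_coordinate_compose[OF assms(2)] by (cases "i = k") auto
  ultimately show ?thesis
    unfolding continuous_map_into_cube by blast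
qed

lemma continuous_map_cube_drop:
  assumes "continuous_map Y (cube (Suc n)) f"
  shows "continuous_map Y (cube n) (\<lambda>y. (f y)(n := 0))"
proof -
  have f: "f y \<in> Cube (Suc n)" if "y \<in> topspace Y" for y
    using assms that by (rule continuous_map_in)
  have "(f y)(n := 0) \<in> Cube n" if "y \<in> topspace Y" for y
    using f[OF that] by (auto simp: topspace_cube)
  moreover have "continuous_map Y euclideanreal (\<lambda>y. ((f y)(n := 0)) i)" for i
    using continuous_map_cube_coordinate_compose[OF assms] by (cases "i = n") auto
  ultimately show ?thesis
    unfolding continuous_map_into_cube by blast
qed

lemma continuous_map_rotate_up: "continuous_map (cube (Suc n)) (cube (Suc n)) (rotate_up n)"
  unfolding rotate_up_def
  by (rule continuous_map_shift[OF continuous_map_cube_coordinate continuous_map_cube_drop])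
     (simp_all add: cube_bounds)

lemma continuous_map_rotate_down: "continuous_map (cube (Suc n)) (cube (Suc n)) (rotate_down n)"
proof -
  have "continuous_map (cube (Suc n)) euclideanreal (\<lambda>y. rotate_down n y i)" for i
    by (simp add: rotate_down_def continuous_map_cube_coordinate)
  then show ?thesis
    unfolding continuous_map_into_cube by (simp add: topspace_cube rotate_down_def)
qed

lemma rotate_up_simps [simp]: "rotate_up n z 0 = z n" "i < n \<Longrightarrow> rotate_up n z (Suc i) = z i"
  by (simp_all add: rotate_up_def)

lemma rotate_down_simps [simp]: "rotate_down n z n = z 0" "i < n \<Longrightarrow> rotate_down n z i = z (Suc i)"
  by (simp_all add: rotate_down_def)

section \<open>Filtered topological groups\<close>

text \<open>The exponents that are allowed to kill a class: \<open>{1}\<close> for the integral statement, all positive integers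
  for the rational one.\<close>

definition mult_closed :: "nat set \<Rightarrow> bool" where
  "mult_closed S \<longleftrightarrow> 1 \<in> S \<and> (\<forall>a\<in>S. \<forall>b\<in>S. a * b \<in> S)"

text \<open>The groups of quasi-invertible matrices of all sizes, ordered by corner embeddings, in abstract form. The
  union carries no topology: maps into it are continuous into some stage. The identity component \<open>Fo\<close> of the
  first stage corresponds to \<open>GL\<^sub>o\<close>.\<close>

locale filtered_group = group G for G (structure) +
  fixes T :: "nat \<Rightarrow> 'a topology"
  assumes T_carrier: "topspace (T m) \<subseteq> carrier G"
    and T_one: "\<one> \<in> topspace (T m)"
    and T_sub: "m \<le> m' \<Longrightarrow> T m = subtopology (T m') (topspace (T m))"
    and T_mult: "continuous_map (prod_topology (T m) (T m)) (T m) (\<lambda>(x, y). x \<otimes> y)"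
    and T_inv: "continuous_map (T m) (T m) (\<lambda>x. inv x)"
begin

abbreviation Fo :: "'a set" where "Fo \<equiv> path_component_of_set (T 0) \<one>"

lemma T_lift: "continuous_map Y (T m) f \<Longrightarrow> m \<le> m' \<Longrightarrow> continuous_map Y (T m') f"
  by (metis T_sub continuous_map_in_subtopology)

lemma T_lower: "continuous_map Y (T m') f \<Longrightarrow> (\<And>y. y \<in> topspace Y \<Longrightarrow> f y \<in> topspace (T m)) \<Longrightarrow>
   continuous_map Y (T m) f"
proof -
  assume f: "continuous_map Y (T m') f" and v: "\<And>y. y \<in> topspace Y \<Longrightarrow> f y \<in> topspace (T m)"
  show "continuous_map Y (T m) f"
  proof (cases "m \<le> m'")
    case True
    then show ?thesis using f v T_sub[OF True] by (metis continuous_map_in_subtopology image_subsetI Pi_I)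
  next
    case False
    then show ?thesis using f T_lift by (metis nle_le)
  qed
qed

lemma cm_closed: "continuous_map Y (T m) f \<Longrightarrow> y \<in> topspace Y \<Longrightarrow> f y \<in> carrier G"
  using T_carrier continuous_map_in by fastforce

lemma cm_mult:
  assumes "continuous_map Y (T m) f" "continuous_map Y (T m) g"
  shows "continuous_map Y (T m) (\<lambda>y. f y \<otimes> g y)"
proof -
  have "continuous_map Y (prod_topology (T m) (T m)) (\<lambda>y. (f y, g y))"
    using assms by (simp add: continuous_map_paired)
  from continuous_map_compose[OF this T_mult] show ?thesis by (simp add: comp_def)
qed

lemma cm_inv: "continuous_map Y (T m) f \<Longrightarrow> continuous_map Y (T m) (\<lambda>y. inv (f y))"
  using continuous_map_compose[OF _ T_inv] by (fastforce simp: comp_def)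

lemma cm_one: "continuous_map Y (T m) (\<lambda>y. \<one>)"
  using T_one by simp

lemma cm_pow: "continuous_map Y (T m) f \<Longrightarrow> continuous_map Y (T m) (\<lambda>y. f y [^] (N::nat))"
  by (induction N) (simp_all add: cm_one cm_mult del: continuous_map_const)

lemma cm_comp: "continuous_map X Y f \<Longrightarrow> continuous_map Y (T m) g \<Longrightarrow> continuous_map X (T m) (\<lambda>x. g (f x))"
  using continuous_map_compose[of X Y f "T m" g] by (simp add: comp_def)

lemma Fo_sub: "Fo \<subseteq> topspace (T 0)"
  by (metis path_component_of_subset_topspace)

lemma one_Fo: "\<one> \<in> Fo"
  using T_one by (simp add: path_component_of_refl)

lemma Fo_pathI:
  assumes "continuous_map (top_of_set {0..1::real}) (T 0) g" "g 0 = \<one>"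
  shows "g 1 \<in> Fo"
  using assms unfolding path_component_of_def pathin_def by auto

lemma Fo_path:
  assumes "x \<in> Fo"
  obtains g where "continuous_map (top_of_set {0..1::real}) (T 0) g" "g 0 = \<one>" "g 1 = x"
  using assms unfolding path_component_of_def pathin_def by auto

lemma Fo_mult: assumes "x \<in> Fo" "y \<in> Fo" shows "x \<otimes> y \<in> Fo"
proof -
  obtain g h where "continuous_map (top_of_set {0..1::real}) (T 0) g" "g 0 = \<one>" "g 1 = x"
     "continuous_map (top_of_set {0..1::real}) (T 0) h" "h 0 = \<one>" "h 1 = y"
    using Fo_path assms by metis
  then show ?thesis using Fo_pathI[OF cm_mult, of g h] by simp
qed

lemma Fo_inv: assumes "x \<in> Fo" shows "inv x \<in> Fo"
proof -
  obtain g where "continuous_map (top_of_set {0..1::real}) (T 0) g" "g 0 = \<one>" "g 1 = x"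
    using Fo_path assms by metis
  then show ?thesis using Fo_pathI[OF cm_inv, of g] by simp
qed

subsection \<open>Loops and relative loops\<close>

text \<open>Loops are multiplied pointwise, so that their homotopy classes can be discussed without choosing paths.
  The parameter of a null-homotopy is the last coordinate of the cube. For \<open>S = {1}\<close>, \<open>stable S\<close> says that the
  inclusion of the first stage into the union is bijective on homotopy groups of positive degree.\<close>

definition loop :: "nat \<Rightarrow> nat \<Rightarrow> ((nat \<Rightarrow> real) \<Rightarrow> 'a) \<Rightarrow> bool" where
  "loop m n f \<longleftrightarrow> continuous_map (cube n) (T m) f \<and> (\<forall>z\<in>cube_boundary n. f z = \<one>)"

definition null_loop :: "nat \<Rightarrow> nat \<Rightarrow> ((nat \<Rightarrow> real) \<Rightarrow> 'a) \<Rightarrow> bool" where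
  "null_loop m n f \<longleftrightarrow> (\<exists>h. continuous_map (cube (Suc n)) (T m) h \<and>
     (\<forall>z\<in>Cube (Suc n). ((\<exists>i<n. z i = 0 \<or> z i = 1) \<or> z n = 0 \<longrightarrow> h z = \<one>) \<and>
        (z n = 1 \<longrightarrow> h z = f (z(n := 0)))))"

definition stable :: "nat set \<Rightarrow> bool" where
  "stable S \<longleftrightarrow> (\<forall>n>0.
     (\<forall>f m. loop 0 n f \<and> null_loop m n f \<longrightarrow> (\<exists>N\<in>S. null_loop 0 n (\<lambda>z. f z [^] N))) \<and>
     (\<forall>g m. loop m n g \<longrightarrow> (\<exists>N\<in>S. \<exists>m' f. loop 0 n f \<and> null_loop m' n (\<lambda>z. g z [^] N \<otimes> inv (f z)))))"

text \<open>The boundary behaviour of a representative of a relative homotopy class of the union modulo the first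
  stage: on the face \<open>z 0 = 1\<close> the values range over \<open>F\<close>, on the other faces in the coordinates \<open>0, \<dots>, n\<close> they are
  trivial. Stability concerns positive degrees only and says nothing about the components of the first stage;
  therefore \<open>F\<close> is the identity component in the definition of a relative loop.\<close>

definition admissible :: "'a set \<Rightarrow> nat \<Rightarrow> (nat \<Rightarrow> real) \<Rightarrow> 'a \<Rightarrow> bool" where
  "admissible F n z a \<longleftrightarrow> ((z 0 = 0 \<or> (\<exists>i\<in>{1..n}. z i = 0 \<or> z i = 1)) \<longrightarrow> a = \<one>) \<and> (z 0 = 1 \<longrightarrow> a \<in> F)"

definition rel_loop :: "nat \<Rightarrow> nat \<Rightarrow> ((nat \<Rightarrow> real) \<Rightarrow> 'a) \<Rightarrow> bool" where
  "rel_loop m n u \<longleftrightarrow> continuous_map (cube (Suc n)) (T m) u \<and> (\<forall>z\<in>Cube (Suc n). admissible Fo n z (u z))"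

definition null_rel_loop :: "'a set \<Rightarrow> nat \<Rightarrow> nat \<Rightarrow> ((nat \<Rightarrow> real) \<Rightarrow> 'a) \<Rightarrow> bool" where
  "null_rel_loop F m n u \<longleftrightarrow> (\<exists>h. continuous_map (cube (Suc (Suc n))) (T m) h \<and>
     (\<forall>z\<in>Cube (Suc (Suc n)). admissible F n z (h z) \<and> (z (Suc n) = 0 \<longrightarrow> h z = \<one>) \<and>
        (z (Suc n) = 1 \<longrightarrow> h z = u (z(Suc n := 0)))))"

lemma admissible_mult: "admissible Fo n z a \<Longrightarrow> admissible Fo n z b \<Longrightarrow> admissible Fo n z (a \<otimes> b)"
  unfolding admissible_def using Fo_mult by auto
lemma admissible_inv: "admissible Fo n z a \<Longrightarrow> admissible Fo n z (inv a)"
  unfolding admissible_def using Fo_inv by auto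
lemma admissible_one: "admissible Fo n z \<one>"
  unfolding admissible_def using one_Fo by auto
lemma admissible_pow: "admissible Fo n z a \<Longrightarrow> admissible Fo n z (a [^] (N::nat))"
  by (induction N) (auto intro: admissible_one admissible_mult)

lemma null_rel_loop_mult:
  assumes "null_rel_loop Fo m n u" "null_rel_loop Fo m n v" shows "null_rel_loop Fo m n (\<lambda>z. u z \<otimes> v z)"
proof -
  obtain h where h: "continuous_map (cube (Suc (Suc n))) (T m) h"
     "\<forall>z\<in>Cube (Suc (Suc n)). admissible Fo n z (h z) \<and> (z (Suc n) = 0 \<longrightarrow> h z = \<one>) \<and>
        (z (Suc n) = 1 \<longrightarrow> h z = u (z(Suc n := 0)))" using assms(1) unfolding null_rel_loop_def by blast
  obtain k where k: "continuous_map (cube (Suc (Suc n))) (T m) k"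
     "\<forall>z\<in>Cube (Suc (Suc n)). admissible Fo n z (k z) \<and> (z (Suc n) = 0 \<longrightarrow> k z = \<one>) \<and>
        (z (Suc n) = 1 \<longrightarrow> k z = v (z(Suc n := 0)))" using assms(2) unfolding null_rel_loop_def by blast
  show ?thesis unfolding null_rel_loop_def
    by (rule exI[of _ "\<lambda>z. h z \<otimes> k z"]) (use h k in \<open>auto intro: cm_mult admissible_mult\<close>)
qed

lemma null_loop_mult:
  assumes "null_loop m n u" "null_loop m n v" shows "null_loop m n (\<lambda>z. u z \<otimes> v z)"
proof -
  obtain h where h: "continuous_map (cube (Suc n)) (T m) h"
     "\<forall>z\<in>Cube (Suc n). ((\<exists>i<n. z i = 0 \<or> z i = 1) \<or> z n = 0 \<longrightarrow> h z = \<one>) \<and>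
        (z n = 1 \<longrightarrow> h z = u (z(n := 0)))" using assms(1) unfolding null_loop_def by blast
  obtain k where k: "continuous_map (cube (Suc n)) (T m) k"
     "\<forall>z\<in>Cube (Suc n). ((\<exists>i<n. z i = 0 \<or> z i = 1) \<or> z n = 0 \<longrightarrow> k z = \<one>) \<and>
        (z n = 1 \<longrightarrow> k z = v (z(n := 0)))" using assms(2) unfolding null_loop_def by blast
  show ?thesis unfolding null_loop_def
    by (rule exI[of _ "\<lambda>z. h z \<otimes> k z"]) (use h k in \<open>auto intro: cm_mult\<close>)
qed

lemma cube_drop: "z \<in> Cube (Suc n) \<Longrightarrow> z(n := 0) \<in> Cube n"
  by (auto simp: topspace_cube)

lemma null_rel_loop_cong: "null_rel_loop F m n u \<Longrightarrow> (\<And>z. z \<in> Cube (Suc n) \<Longrightarrow> u z = v z) \<Longrightarrow> null_rel_loop F m n v"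
  unfolding null_rel_loop_def by (metis cube_drop)

lemma null_loop_cong: "null_loop m n u \<Longrightarrow> (\<And>z. z \<in> Cube n \<Longrightarrow> u z = v z) \<Longrightarrow> null_loop m n v"
  unfolding null_loop_def by (metis cube_drop)

lemma null_rel_loop_lift: "null_rel_loop F m n u \<Longrightarrow> m \<le> m' \<Longrightarrow> null_rel_loop F m' n u"
  unfolding null_rel_loop_def by (metis T_lift)

lemma null_loop_lift: "null_loop m n u \<Longrightarrow> m \<le> m' \<Longrightarrow> null_loop m' n u"
  unfolding null_loop_def by (metis T_lift)

text \<open>Writing \<open>k\<close> for a contraction of \<open>v\<close>, the expression with \<open>k\<close> in place of \<open>v\<close> is a contraction: at the
  beginning \<open>k\<close> is trivial and the two powers of \<open>g\<close> cancel. Thus a power of a product changes by a contractible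
  factor if one factor of the product is contractible, although the group is not commutative.\<close>

lemma null_rel_loop_pow:
  assumes u: "rel_loop m n g" and v: "null_rel_loop Fo m n v"
  shows "null_rel_loop Fo m n (\<lambda>z. (g z \<otimes> v z) [^] N \<otimes> inv (g z [^] (N::nat)))"
proof -
  obtain k where k: "continuous_map (cube (Suc (Suc n))) (T m) k"
     "\<forall>z\<in>Cube (Suc (Suc n)). admissible Fo n z (k z) \<and> (z (Suc n) = 0 \<longrightarrow> k z = \<one>) \<and>
        (z (Suc n) = 1 \<longrightarrow> k z = v (z(Suc n := 0)))" using v unfolding null_rel_loop_def by blast
  have g: "continuous_map (cube (Suc (Suc n))) (T m) (\<lambda>z. g (z(Suc n := 0)))"
    using u unfolding rel_loop_def by (intro cm_comp[OF continuous_map_cube_drop[OF continuous_map_identity]]) simp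
  have ga: "admissible Fo n z (g (z(Suc n := 0)))" if "z\<in>Cube (Suc (Suc n))" for z
  proof -
    have "admissible Fo n (z(Suc n := 0)) (g (z(Suc n := 0)))"
      using u cube_drop[OF that] unfolding rel_loop_def by blast
    then show ?thesis by (force simp: admissible_def)
  qed
  let ?h = "\<lambda>z. (g (z(Suc n := 0)) \<otimes> k z) [^] N \<otimes> inv (g (z(Suc n := 0)) [^] (N::nat))"
  show ?thesis unfolding null_rel_loop_def
  proof (rule exI[of _ ?h], intro conjI ballI impI)
    show "continuous_map (cube (Suc (Suc n))) (T m) ?h"
      by (intro cm_mult cm_pow cm_inv g k)
    fix z assume z: "z\<in>Cube (Suc (Suc n))"
    show "admissible Fo n z (?h z)" using k z ga
      by (intro admissible_mult admissible_pow admissible_inv) auto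
    show "?h z = \<one>" if "z (Suc n) = 0" using k z that cm_closed[OF g z] by simp
    show "?h z = (g (z(Suc n := 0)) \<otimes> v (z(Suc n := 0))) [^] N \<otimes> inv (g (z(Suc n := 0)) [^] N)" if "z (Suc n) = 1"
      using k z that by simp
  qed
qed

lemma null_loop_imp_null_rel_loop: assumes "null_loop m (Suc n) v" shows "null_rel_loop Fo m n v"
proof -
  obtain h where h: "continuous_map (cube (Suc (Suc n))) (T m) h"
     "\<forall>z\<in>Cube (Suc (Suc n)). ((\<exists>i<Suc n. z i = 0 \<or> z i = 1) \<or> z (Suc n) = 0 \<longrightarrow> h z = \<one>) \<and>
        (z (Suc n) = 1 \<longrightarrow> h z = v (z(Suc n := 0)))" using assms unfolding null_loop_def by blast
  show ?thesis unfolding null_rel_loop_def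
  proof (rule exI[of _ h], intro conjI ballI impI)
    fix z assume z: "z\<in>Cube (Suc (Suc n))"
    have *: "h z = \<one>" if "i \<le> n" "z i = 0 \<or> z i = 1" for i
      using h(2) z that by (meson less_Suc_eq_le)
    show "admissible Fo n z (h z)" unfolding admissible_def using *[of 0] * one_Fo by auto
  qed (use h in auto)
qed

text \<open>A relative loop inside the first stage is contracted along its free coordinate.\<close>

lemma null_rel_loop_stage0:
  assumes v: "continuous_map (cube (Suc n)) (T 0) v"
    and b: "\<And>z. z \<in> Cube (Suc n) \<Longrightarrow> z 0 = 0 \<or> (\<exists>i\<in>{1..n}. z i = 0 \<or> z i = 1) \<Longrightarrow> v z = \<one>"
  shows "null_rel_loop Fo 0 n v"
proof -
  have Fov: "v z \<in> Fo" if z: "z \<in> Cube (Suc n)" for z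
  proof -
    have "continuous_map (top_of_set {0..1::real}) (cube (Suc n)) (\<lambda>r. z(0 := r * z 0))"
      using z by (intro continuous_map_cube_upd[where m = "Suc n"])
        (auto simp: topspace_cube mult_le_one intro!: continuous_intros)
    then have "continuous_map (top_of_set {0..1::real}) (T 0) (\<lambda>r. v (z(0 := r * z 0)))"
      using v cm_comp by fast
    moreover have "z(0 := 0) \<in> Cube (Suc n)" using z by (auto simp: topspace_cube)
    ultimately show ?thesis using Fo_pathI[of "\<lambda>r. v (z(0 := r * z 0))"] b by simp
  qed
  let ?c = "\<lambda>z::nat\<Rightarrow>real. (z(Suc n := 0))(0 := z 0 * z (Suc n))"
  have c: "continuous_map (cube (Suc (Suc n))) (cube (Suc n)) ?c"
    by (intro continuous_map_cube_upd[where m = "Suc n"] continuous_map_cube_drop continuous_map_real_mult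
        continuous_map_cube_coordinate) (auto simp: topspace_cube mult_le_one)
  have ct: "?c z \<in> Cube (Suc n)" if "z \<in> Cube (Suc (Suc n))" for z
    using c that by (rule continuous_map_in)
  show ?thesis unfolding null_rel_loop_def
  proof (rule exI[of _ "\<lambda>z. v (?c z)"], intro conjI ballI impI)
    show "continuous_map (cube (Suc (Suc n))) (T 0) (\<lambda>z. v (?c z))" by (rule cm_comp[OF c v])
    fix z assume z: "z\<in>Cube (Suc (Suc n))"
    show "admissible Fo n z (v (?c z))" unfolding admissible_def
      using Fov[OF ct[OF z]] b[OF ct[OF z]] by auto
    show "v (?c z) = \<one>" if "z (Suc n) = 0" using b[OF ct[OF z]] that by simp
    show "v (?c z) = v (z(Suc n := 0))" if "z (Suc n) = 1" using that by (simp add: fun_upd_idem)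
  qed
qed

lemma loop_carrier: "loop m n f \<Longrightarrow> z \<in> Cube n \<Longrightarrow> f z \<in> carrier G"
  unfolding loop_def by (rule cm_closed[of "cube n" m]) simp_all

lemma cube_boundary_iff: "z \<in> cube_boundary n \<longleftrightarrow> z \<in> Cube n \<and> (\<exists>i<n. z i = 0 \<or> z i = 1)"
  by (auto simp: cube_boundary_def)

lemma loop_Fo: assumes "loop 0 n f" "n > 0" "z \<in> Cube n" shows "f z \<in> Fo"
proof -
  have "continuous_map (top_of_set {0..1::real}) (cube n) (\<lambda>r. z(0 := r * z 0))"
    using assms by (intro continuous_map_cube_upd[where m = n])
      (auto simp: topspace_cube mult_le_one intro!: continuous_intros)
  then have "continuous_map (top_of_set {0..1::real}) (T 0) (\<lambda>r. f (z(0 := r * z 0)))"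
    using assms(1) cm_comp unfolding loop_def by fast
  moreover have "z(0 := 0) \<in> cube_boundary n" using assms by (auto simp: cube_boundary_iff topspace_cube)
  ultimately show ?thesis using Fo_pathI[of "\<lambda>r. f (z(0 := r * z 0))"] assms(1) by (simp add: loop_def)
qed

text \<open>The relative homotopy group of a pair sits in an exact sequence; stability says that all its
  other terms are \<open>S\<close>-isomorphic.\<close>

theorem stable_imp_null_rel_loop:
  assumes st: "stable S" and S: "mult_closed S" and u: "rel_loop m n u"
  shows "\<exists>N\<in>S. \<exists>m'. null_rel_loop Fo m' n (\<lambda>z. u z [^] (N::nat))"
proof -
  have uc: "continuous_map (cube (Suc n)) (T m) u" and ua: "\<And>z. z \<in> Cube (Suc n) \<Longrightarrow> admissible Fo n z (u z)"
    using u by (auto simp: rel_loop_def)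
  have uG: "u z \<in> carrier G" if "z \<in> Cube (Suc n)" for z using cm_closed[OF uc that] .
  \<comment> \<open>Some power of \<open>u\<close> has a boundary face that extends over the first stage.\<close>
  have "\<exists>N\<in>S. \<exists>v. continuous_map (cube (Suc n)) (T 0) v \<and>
     (\<forall>z\<in>Cube (Suc n). (z 0 = 0 \<or> (\<exists>i\<in>{1..n}. z i = 0 \<or> z i = 1) \<longrightarrow> v z = \<one>) \<and>
        (z 0 = 1 \<longrightarrow> v z = u z [^] N))"
  proof (cases "n = 0")
    case True
    let ?e = "shift 1 (\<lambda>_. 0)"
    have e: "?e \<in> Cube (Suc 0)" by (intro shift_in_cube) (auto simp: topspace_cube)
    then have "u ?e \<in> Fo" using ua[of ?e] True by (simp add: admissible_def)
    then obtain g where g: "continuous_map (top_of_set {0..1::real}) (T 0) g" "g 0 = \<one>" "g 1 = u ?e"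
      using Fo_path by blast
    have "continuous_map (cube (Suc n)) (top_of_set {0..1::real}) (\<lambda>z. z 0)"
      using continuous_map_cube_coordinate[of "Suc n" 0]
      by (auto simp: continuous_map_in_subtopology cube_bounds)
    then have c: "continuous_map (cube (Suc n)) (T 0) (\<lambda>z. g (z 0))" by (rule cm_comp) (rule g(1))
    have "z = ?e" if "z \<in> Cube (Suc 0)" "z 0 = 1" for z
    proof
      fix i show "z i = ?e i" using that by (cases i) (auto simp: topspace_cube)
    qed
    then have "\<forall>z\<in>Cube (Suc n). (z 0 = 0 \<or> (\<exists>i\<in>{1..n}. z i = 0 \<or> z i = 1) \<longrightarrow> g (z 0) = \<one>) \<and>
        (z 0 = 1 \<longrightarrow> g (z 0) = u z [^] (1::nat))"
      using True g uG[OF e[folded True]] by auto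
    then show ?thesis using c S unfolding mult_closed_def by (intro bexI[of _ 1] exI[of _ "\<lambda>z. g (z 0)"]) auto
  next
    case False
    let ?f = "\<lambda>z. u (shift 1 z)"
    have sh: "continuous_map (cube n) (cube (Suc n)) (shift 1)"
      by (intro continuous_map_shift[of _ "\<lambda>_. 1"] continuous_map_identity) auto
    have fc: "continuous_map (cube n) (T m) ?f" by (rule cm_comp[OF sh uc])
    have fFo: "?f z \<in> Fo" if "z \<in> Cube n" for z
      using ua[OF continuous_map_in[OF sh that]] by (simp add: admissible_def)
    have fc0: "continuous_map (cube n) (T 0) ?f"
      by (rule T_lower[OF fc]) (use fFo Fo_sub in blast)
    have lpf: "loop 0 n ?f" unfolding loop_def
    proof (intro conjI fc0 ballI)
      fix z assume "z \<in> cube_boundary n"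
      then obtain i where i: "z \<in> Cube n" "i < n" "z i = 0 \<or> z i = 1" by (auto simp: cube_boundary_iff)
      then have "\<exists>j\<in>{1..n}. shift 1 z j = 0 \<or> shift 1 z j = 1" by (intro bexI[of _ "Suc i"]) auto
      then show "?f z = \<one>" using ua[OF continuous_map_in[OF sh i(1)]] unfolding admissible_def by blast
    qed
    have nf: "null_loop m n ?f" unfolding null_loop_def
    proof (intro exI[of _ "\<lambda>z. u (rotate_up n z)"] conjI ballI impI)
      show "continuous_map (cube (Suc n)) (T m) (\<lambda>z. u (rotate_up n z))"
        by (rule cm_comp[OF continuous_map_rotate_up uc])
      fix z assume z: "z \<in> Cube (Suc n)"
      note a = ua[OF continuous_map_in[OF continuous_map_rotate_up z]]
      show "u (rotate_up n z) = \<one>" if "(\<exists>i<n. z i = 0 \<or> z i = 1) \<or> z n = 0"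
      proof -
        have "rotate_up n z 0 = 0 \<or> (\<exists>j\<in>{1..n}. rotate_up n z j = 0 \<or> rotate_up n z j = 1)"
        proof (cases "z n = 0")
          case False
          then obtain i where "i < n" "z i = 0 \<or> z i = 1" using \<open>(\<exists>i<n. z i = 0 \<or> z i = 1) \<or> z n = 0\<close> by blast
          then show ?thesis by - (rule disjI2, rule bexI[of _ "Suc i"], auto)
        qed simp
        then show ?thesis using a unfolding admissible_def by blast
      qed
      show "u (rotate_up n z) = u (shift 1 (z(n := 0)))" if "z n = 1" using that by (simp add: rotate_up_def)
    qed
    obtain N where N: "N \<in> S" "null_loop 0 n (\<lambda>z. ?f z [^] N)"
      using st lpf nf False unfolding stable_def by blast
    then obtain k where k: "continuous_map (cube (Suc n)) (T 0) k"
      "\<And>z. z\<in>Cube (Suc n) \<Longrightarrow> (\<exists>i<n. z i = 0 \<or> z i = 1) \<or> z n = 0 \<Longrightarrow> k z = \<one>"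
      "\<And>z. z\<in>Cube (Suc n) \<Longrightarrow> z n = 1 \<Longrightarrow> k z = ?f (z(n := 0)) [^] N" unfolding null_loop_def by blast
    let ?v = "\<lambda>z. k (rotate_down n z)"
    have vc: "continuous_map (cube (Suc n)) (T 0) ?v" by (rule cm_comp[OF continuous_map_rotate_down k(1)])
    have 1: "?v z = \<one>" if z: "z \<in> Cube (Suc n)" "z 0 = 0 \<or> (\<exists>i\<in>{1..n}. z i = 0 \<or> z i = 1)" for z
    proof (rule k(2)[OF continuous_map_in[OF continuous_map_rotate_down z(1)]])
      show "(\<exists>i<n. rotate_down n z i = 0 \<or> rotate_down n z i = 1) \<or> rotate_down n z n = 0"
      proof (cases "z 0 = 0")
        case False
        then obtain i where "i \<in> {1..n}" "z i = 0 \<or> z i = 1" using z(2) by blast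
        then show ?thesis by - (rule disjI1, rule exI[of _ "i - 1"], auto)
      qed simp
    qed
    have 2: "?v z = u z [^] N" if z: "z \<in> Cube (Suc n)" "z 0 = 1" for z
    proof -
      have "shift 1 ((rotate_down n z)(n := 0)) i = z i" for i
        using z by (cases i) (auto simp: rotate_down_def topspace_cube)
      then have "shift 1 ((rotate_down n z)(n := 0)) = z" by blast
      then show ?thesis using k(3)[OF continuous_map_in[OF continuous_map_rotate_down z(1)]] z by simp
    qed
    show ?thesis using N(1) vc 1 2 by blast
  qed
  then obtain N v where N: "N \<in> S" and v: "continuous_map (cube (Suc n)) (T 0) v"
    and v1: "\<And>z. z\<in>Cube (Suc n) \<Longrightarrow> z 0 = 0 \<or> (\<exists>i\<in>{1..n}. z i = 0 \<or> z i = 1) \<Longrightarrow> v z = \<one>"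
    and v2: "\<And>z. z\<in>Cube (Suc n) \<Longrightarrow> z 0 = 1 \<Longrightarrow> v z = u z [^] N" by blast
  have vG: "v z \<in> carrier G" if "z \<in> Cube (Suc n)" for z using cm_closed[OF v that] .
  \<comment> \<open>Dividing by that extension leaves an absolute loop.\<close>
  let ?g = "\<lambda>z. u z [^] N \<otimes> inv (v z)"
  have gc: "continuous_map (cube (Suc n)) (T m) ?g"
    by (intro cm_mult cm_pow cm_inv uc T_lift[OF v]) simp
  have lpg: "loop m (Suc n) ?g" unfolding loop_def
  proof (intro conjI gc ballI)
    fix z assume "z \<in> cube_boundary (Suc n)"
    then obtain i where i: "z \<in> Cube (Suc n)" "i < Suc n" "z i = 0 \<or> z i = 1" by (auto simp: cube_boundary_iff)
    show "?g z = \<one>"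
    proof (cases "z 0 = 1")
      case True then show ?thesis using v2[OF i(1)] uG[OF i(1)] by simp
    next
      case False
      then have "z 0 = 0 \<or> (\<exists>i\<in>{1..n}. z i = 0 \<or> z i = 1)" using i(2,3) by (cases i) auto
      then show ?thesis using v1[OF i(1)] ua[OF i(1)] unfolding admissible_def by simp
    qed
  qed
  obtain N' m' f where N': "N' \<in> S" and f: "loop 0 (Suc n) f"
    and nl: "null_loop m' (Suc n) (\<lambda>z. ?g z [^] N' \<otimes> inv (f z))"
    using st lpg unfolding stable_def by blast
  define M where "M = max m m'"
  have fc: "continuous_map (cube (Suc n)) (T 0) f" using f by (simp add: loop_def)
  have "f z = \<one>" if "z \<in> Cube (Suc n)" "z 0 = 0 \<or> (\<exists>i\<in>{1..n}. z i = 0 \<or> z i = 1)" for z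
  proof -
    have "\<exists>i<Suc n. z i = 0 \<or> z i = 1" using that(2) by (metis atLeastAtMost_iff le_imp_less_Suc zero_less_Suc)
    then show ?thesis using f that(1) unfolding loop_def by (simp add: cube_boundary_iff)
  qed
  then have f0: "null_rel_loop Fo M n f" by (intro null_rel_loop_lift[OF null_rel_loop_stage0[OF fc]]) auto
  have "null_rel_loop Fo M n (\<lambda>z. ?g z [^] N' \<otimes> inv (f z))"
    by (rule null_loop_imp_null_rel_loop[OF null_loop_lift[OF nl]]) (simp add: M_def)
  from null_rel_loop_mult[OF this f0] have gN: "null_rel_loop Fo M n (\<lambda>z. ?g z [^] N')"
    by (rule null_rel_loop_cong) (use cm_closed[OF gc] cm_closed[OF fc] in \<open>auto simp: m_assoc\<close>)
  have v0: "null_rel_loop Fo M n v" by (rule null_rel_loop_lift[OF null_rel_loop_stage0[OF v v1]]) auto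
  have "rel_loop M n ?g" unfolding rel_loop_def
  proof (intro conjI ballI)
    show "continuous_map (cube (Suc n)) (T M) ?g" by (rule T_lift[OF gc]) (simp add: M_def)
    fix z assume z: "z \<in> Cube (Suc n)"
    have "z \<in> cube_boundary (Suc n) \<Longrightarrow> ?g z = \<one>" using lpg unfolding loop_def by blast
    then have "i \<le> n \<Longrightarrow> z i = 0 \<or> z i = 1 \<Longrightarrow> ?g z = \<one>" for i unfolding cube_boundary_iff using z by (meson le_imp_less_Suc)
    from this[of 0] this show "admissible Fo n z (?g z)" using one_Fo unfolding admissible_def by auto
  qed
  from null_rel_loop_mult[OF null_rel_loop_pow[OF this v0, of N'] gN]
  have "null_rel_loop Fo M n (\<lambda>z. u z [^] (N * N'))"
    by (rule null_rel_loop_cong) (use cm_closed[OF gc] uG vG in \<open>auto simp: m_assoc nat_pow_pow\<close>)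
  then show ?thesis using S N N' unfolding mult_closed_def by blast
qed

text \<open>The other half of the exact sequence. For injectivity, a contraction in the union of a loop in the first
  stage is itself a relative loop, and the free face of a contraction of it contracts the given loop. For
  surjectivity, the free face of a contraction of a loop moves that loop into the first stage. A
  contraction joins each value on its free face to the identity within the first stage; this is why these
  values are asked to lie in the first stage rather than in its identity component.\<close>

theorem null_rel_loop_imp_stable:
  assumes S: "\<And>m n u. rel_loop m n u \<Longrightarrow> \<exists>N\<in>S. \<exists>m'. null_rel_loop (topspace (T 0)) m' n (\<lambda>z. u z [^] (N::nat))"
  shows "stable S"
  unfolding stable_def
proof (intro allI impI conjI; (elim conjE)?)
  fix n :: nat and f m assume n: "n > 0" and f: "loop 0 n f" and nf: "null_loop m n f"
  obtain k where k: "continuous_map (cube (Suc n)) (T m) k"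
      "\<And>z. z\<in>Cube (Suc n) \<Longrightarrow> (\<exists>i<n. z i = 0 \<or> z i = 1) \<or> z n = 0 \<Longrightarrow> k z = \<one>"
      "\<And>z. z\<in>Cube (Suc n) \<Longrightarrow> z n = 1 \<Longrightarrow> k z = f (z(n := 0))" using nf unfolding null_loop_def by blast
  let ?u = "\<lambda>z. k (rotate_down n z)"
  have "rel_loop m n ?u" unfolding rel_loop_def
  proof (intro conjI ballI)
    show "continuous_map (cube (Suc n)) (T m) ?u" by (rule cm_comp[OF continuous_map_rotate_down k(1)])
    fix z assume z: "z \<in> Cube (Suc n)"
    note zr = continuous_map_in[OF continuous_map_rotate_down z]
    have "?u z = \<one>" if bd: "z 0 = 0 \<or> (\<exists>i\<in>{1..n}. z i = 0 \<or> z i = 1)"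
    proof (rule k(2)[OF zr])
      show "(\<exists>i<n. rotate_down n z i = 0 \<or> rotate_down n z i = 1) \<or> rotate_down n z n = 0"
      proof (cases "z 0 = 0")
        case False
        then obtain i where "i \<in> {1..n}" "z i = 0 \<or> z i = 1" using bd by blast
        then show ?thesis by - (rule disjI1, rule exI[of _ "i - 1"], auto)
      qed simp
    qed
    moreover have "?u z \<in> Fo" if "z 0 = 1"
      using k(3)[OF zr] that loop_Fo[OF f n cube_drop[OF zr]] by simp
    ultimately show "admissible Fo n z (?u z)" unfolding admissible_def by blast
  qed
  from S[OF this] obtain N m' where N: "N \<in> S" "null_rel_loop (topspace (T 0)) m' n (\<lambda>z. ?u z [^] N)" by blast
  then obtain h where h: "continuous_map (cube (Suc (Suc n))) (T m') h"
     "\<And>z. z\<in>Cube (Suc (Suc n)) \<Longrightarrow> admissible (topspace (T 0)) n z (h z)"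
     "\<And>z. z\<in>Cube (Suc (Suc n)) \<Longrightarrow> z (Suc n) = 0 \<Longrightarrow> h z = \<one>"
     "\<And>z. z\<in>Cube (Suc (Suc n)) \<Longrightarrow> z (Suc n) = 1 \<Longrightarrow> h z = ?u (z(Suc n := 0)) [^] N"
    unfolding null_rel_loop_def by blast
  have sh: "continuous_map (cube (Suc n)) (cube (Suc (Suc n))) (shift 1)"
    by (intro continuous_map_shift[of _ "\<lambda>_. 1"] continuous_map_identity) auto
  have "null_loop 0 n (\<lambda>z. f z [^] N)" unfolding null_loop_def
  proof (intro exI[of _ "\<lambda>z. h (shift 1 z)"] conjI ballI impI)
    have "h (shift 1 z) \<in> topspace (T 0)" if "z \<in> Cube (Suc n)" for z
      using h(2)[OF continuous_map_in[OF sh that]] by (simp add: admissible_def)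
    then show "continuous_map (cube (Suc n)) (T 0) (\<lambda>z. h (shift 1 z))"
      by (rule T_lower[OF cm_comp[OF sh h(1)]])
    fix z assume z: "z \<in> Cube (Suc n)"
    note zs = continuous_map_in[OF sh z]
    show "h (shift 1 z) = \<one>" if bd: "(\<exists>i<n. z i = 0 \<or> z i = 1) \<or> z n = 0"
    proof (cases "z n = 0")
      case False
      then obtain i where "i < n" "z i = 0 \<or> z i = 1" using bd by blast
      then have "\<exists>j\<in>{1..n}. shift 1 z j = 0 \<or> shift 1 z j = 1" by (intro bexI[of _ "Suc i"]) auto
      then show ?thesis using h(2)[OF zs] unfolding admissible_def by blast
    qed (use h(3)[OF zs] in simp)
    show "h (shift 1 z) = f (z(n := 0)) [^] N" if zn: "z n = 1"
    proof -
      have "rotate_down n ((shift 1 z)(Suc n := 0)) i = z i" for i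
        using z zn by (auto simp: rotate_down_def topspace_cube)
      then have "rotate_down n ((shift 1 z)(Suc n := 0)) = z" by blast
      then show ?thesis using h(4)[OF zs] k(3)[OF z] zn by simp
    qed
  qed
  then show "\<exists>N\<in>S. null_loop 0 n (\<lambda>z. f z [^] N)" using N(1) by blast
next
  fix n :: nat and g m assume n: "n > 0" and g: "loop m n g"
  then obtain n0 where n0: "n = Suc n0" by (cases n) auto
  have "rel_loop m n0 g" unfolding rel_loop_def
  proof (intro conjI ballI)
    show "continuous_map (cube (Suc n0)) (T m) g" using g n0 by (simp add: loop_def)
    fix z assume z: "z \<in> Cube (Suc n0)"
    have "i \<le> n0 \<Longrightarrow> z i = 0 \<or> z i = 1 \<Longrightarrow> z \<in> cube_boundary n" for i
      using z unfolding cube_boundary_iff n0 by (auto intro: le_imp_less_Suc)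
    then have "i \<le> n0 \<Longrightarrow> z i = 0 \<or> z i = 1 \<Longrightarrow> g z = \<one>" for i
      using g unfolding loop_def by blast
    from this[of 0] this show "admissible Fo n0 z (g z)" using one_Fo unfolding admissible_def by auto
  qed
  from S[OF this] obtain N m' where N: "N \<in> S" "null_rel_loop (topspace (T 0)) m' n0 (\<lambda>z. g z [^] N)" by blast
  then obtain h where hc: "continuous_map (cube (Suc n)) (T m') h"
     and ha: "\<And>z. z\<in>Cube (Suc n) \<Longrightarrow> admissible (topspace (T 0)) n0 z (h z)"
     and h0: "\<And>z. z\<in>Cube (Suc n) \<Longrightarrow> z n = 0 \<Longrightarrow> h z = \<one>"
     and h1: "\<And>z. z\<in>Cube (Suc n) \<Longrightarrow> z n = 1 \<Longrightarrow> h z = g (z(n := 0)) [^] N"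
    unfolding null_rel_loop_def n0 by blast
  have hz: "h z = \<one>" if "z\<in>Cube (Suc n)" "z 0 = 0 \<or> (\<exists>i\<in>{1..n0}. z i = 0 \<or> z i = 1)" for z
    using ha[OF that(1)] that(2) unfolding admissible_def by blast
  have h11: "h z = \<one>" if "z\<in>Cube (Suc n)" "z 0 = 1" "z n = 1" for z
  proof -
    have "z(n := 0) \<in> cube_boundary n" unfolding cube_boundary_iff
      using cube_drop[OF that(1)] that(2) n by (intro conjI exI[of _ 0]) auto
    then show ?thesis using h1[OF that(1,3)] g by (simp add: loop_def)
  qed
  \<comment> \<open>\<open>h\<close> restricted to the square of its first and last coordinate is trivial on the sides through
      the origin; the remaining two sides are compared through the diagonal.\<close>
  define c where "c z a b = h (z(0 := a, n := b))" for z :: "nat \<Rightarrow> real" and a b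
  have cc: "continuous_map Y (T m') (\<lambda>y. c (w y) (a y) (b y))"
    if "continuous_map Y (cube (Suc n)) w" "continuous_map Y euclideanreal a" "continuous_map Y euclideanreal b"
      "\<And>y. y \<in> topspace Y \<Longrightarrow> a y \<in> {0..1} \<and> b y \<in> {0..1}" for Y :: "(nat \<Rightarrow> real) topology" and w a b
    unfolding c_def using that
    by (intro cm_comp[OF _ hc] continuous_map_cube_upd[where m = "Suc n"]) auto
  have ct: "z(0 := a, n := b) \<in> Cube (Suc n)" if "z \<in> Cube (Suc n)" "0 \<le> a" "a \<le> 1" "0 \<le> b" "b \<le> 1" for z a b
    using that n by (auto simp: topspace_cube less_Suc_eq)
  have cG: "c z a b \<in> carrier G" if "z \<in> Cube (Suc n)" "0 \<le> a" "a \<le> 1" "0 \<le> b" "b \<le> 1" for z a b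
    unfolding c_def using ct[OF that] by (rule cm_closed[OF hc])
  have c0: "c z a b = \<one>" if "z \<in> Cube (Suc n)" "0 \<le> a" "a \<le> 1" "0 \<le> b" "b \<le> 1"
    and side: "a = 0 \<or> b = 0 \<or> a = 1 \<and> b = 1 \<or> (\<exists>i\<in>{1..n0}. z i = 0 \<or> z i = 1)" for z a b
  proof -
    consider "a = 0" | "b = 0" | "a = 1" "b = 1" | "\<exists>i\<in>{1..n0}. z i = 0 \<or> z i = 1" using side by blast
    then show ?thesis
    proof cases
      case 4
      then have "\<exists>i\<in>{1..n0}. (z(0 := a, n := b)) i = 0 \<or> (z(0 := a, n := b)) i = 1" using n0 by auto
      then show ?thesis unfolding c_def using hz[OF ct[OF that(1-5)]] by blast
    next
      case 3
      show ?thesis unfolding c_def by (rule h11[OF ct[OF that(1-5)]]) (use 3 n in auto)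
    qed (use hz[OF ct[OF that(1-5)]] h0[OF ct[OF that(1-5)]] n in \<open>auto simp: c_def\<close>)
  qed
  let ?f = "\<lambda>z. c z 1 (z 0)"
  have id': "continuous_map (cube n) (cube (Suc n)) (\<lambda>z. z)"
    unfolding continuous_map_into_cube using continuous_map_cube_coordinate by (auto simp: topspace_cube less_Suc_eq)
  have sub: "z \<in> Cube n \<Longrightarrow> z \<in> Cube (Suc n)" for z
    using continuous_map_in[OF id'] .
  have "continuous_map (cube n) (T m') ?f"
    by (intro cc id' continuous_map_cube_coordinate) (auto simp: cube_bounds)
  moreover have "?f z \<in> topspace (T 0)" if "z \<in> Cube n" for z
    using ha[OF ct[OF sub[OF that], of 1 "z 0"]] cube_bounds[OF that, of 0] n by (auto simp: admissible_def c_def)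
  ultimately have fc: "continuous_map (cube n) (T 0) ?f" by (rule T_lower)
  have lpf: "loop 0 n ?f" unfolding loop_def
  proof (intro conjI fc ballI)
    fix z assume "z \<in> cube_boundary n"
    then obtain i where i: "z \<in> Cube n" "i < n" "z i = 0 \<or> z i = 1" by (auto simp: cube_boundary_iff)
    then have "z 0 = 0 \<or> z 0 = 1 \<or> (\<exists>i\<in>{1..n0}. z i = 0 \<or> z i = 1)" using n0 by (cases i) auto
    then show "?f z = \<one>" using c0[OF sub[OF i(1)], of 1 "z 0"] cube_bounds[OF i(1), of 0] by auto
  qed
  have bd: "z 0 = 0 \<or> z 0 = 1 \<or> (\<exists>i\<in>{1..n0}. z i = 0 \<or> z i = 1)" if ex: "\<exists>i<n. z i = 0 \<or> z i = 1" for z :: "nat \<Rightarrow> real"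
  proof -
    obtain i where "i < n" "z i = 0 \<or> z i = 1" using ex by blast
    then show ?thesis using n0 by (cases i) auto
  qed
  have sq: "0 \<le> r + (1 - r) * t \<and> r + (1 - r) * t \<le> 1 \<and> 0 \<le> 1 - r + r * t \<and> 1 - r + r * t \<le> 1" if "0 \<le> r" "r \<le> 1" "0 \<le> t" "t \<le> 1" for r t :: real
  proof -
    have "(1 - r) * t \<le> (1 - r) * 1" "r * t \<le> r * 1" using that by (intro mult_left_mono; simp)+
    moreover have "0 \<le> (1 - r) * t" "0 \<le> r * t" using that by auto
    ultimately show ?thesis using that by simp
  qed
  have const: "continuous_map Y euclideanreal (\<lambda>y. a)" for Y :: "(nat \<Rightarrow> real) topology" and a by simp
  note real_cont = continuous_map_cube_coordinate continuous_map_real_mult continuous_map_add continuous_map_diff const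
  have cdrop: "c (z(n := 0)) a b = c z a b" "c z a b = c (z(0 := a)) a b" for z a b
    by (simp_all add: c_def)
  have 1: "null_loop m' n (\<lambda>z. g z [^] N \<otimes> inv (c z (z 0) (z 0)))" unfolding null_loop_def
  proof (intro exI[of _ "\<lambda>z. c z (z 0) (z n + (1 - z n) * z 0) \<otimes> inv (c z (z 0) (z 0))"] conjI ballI impI)
    show "continuous_map (cube (Suc n)) (T m') (\<lambda>z. c z (z 0) (z n + (1 - z n) * z 0) \<otimes> inv (c z (z 0) (z 0)))"
      by (intro cm_mult cm_inv cc real_cont continuous_map_identity) (auto simp: cube_bounds sq)
    fix z assume z: "z \<in> Cube (Suc n)"
    note b = cube_bounds[OF z, of 0] cube_bounds[OF z, of n]
    show "c z (z 0) (z n + (1 - z n) * z 0) \<otimes> inv (c z (z 0) (z 0)) = \<one>"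
      if "(\<exists>i<n. z i = 0 \<or> z i = 1) \<or> z n = 0"
    proof (cases "z n = 0")
      case True then show ?thesis using cG[OF z, of "z 0" "z 0"] b by simp
    next
      case False
      then have "z 0 = 0 \<or> z 0 = 1 \<or> (\<exists>i\<in>{1..n0}. z i = 0 \<or> z i = 1)" using that bd by blast
      then have "c z (z 0) (z n + (1 - z n) * z 0) = \<one>" "c z (z 0) (z 0) = \<one>"
        using b sq[of "z n" "z 0"] by (intro c0[OF z]; auto)+
      then show ?thesis by simp
    qed
    show "c z (z 0) (z n + (1 - z n) * z 0) \<otimes> inv (c z (z 0) (z 0)) =
       g (z(n := 0)) [^] N \<otimes> inv (c (z(n := 0)) ((z(n := 0)) 0) ((z(n := 0)) 0))" if "z n = 1"
    proof -
      have "z(0 := z 0, n := 1) = z" using that by auto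
      then have "c z (z 0) 1 = g (z(n := 0)) [^] N" unfolding c_def using h1[OF z that] by simp
      then show ?thesis using that n cdrop by simp
    qed
  qed
  have 2: "null_loop m' n (\<lambda>z. c z (z 0) (z 0) \<otimes> inv (?f z))" unfolding null_loop_def
  proof (intro exI[of _ "\<lambda>z. c z (1 - z n + z n * z 0) (z 0) \<otimes> inv (c z 1 (z 0))"] conjI ballI impI)
    show "continuous_map (cube (Suc n)) (T m') (\<lambda>z. c z (1 - z n + z n * z 0) (z 0) \<otimes> inv (c z 1 (z 0)))"
      by (intro cm_mult cm_inv cc real_cont continuous_map_identity) (auto simp: cube_bounds sq)
    fix z assume z: "z \<in> Cube (Suc n)"
    note b = cube_bounds[OF z, of 0] cube_bounds[OF z, of n]
    show "c z (1 - z n + z n * z 0) (z 0) \<otimes> inv (c z 1 (z 0)) = \<one>"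
      if "(\<exists>i<n. z i = 0 \<or> z i = 1) \<or> z n = 0"
    proof (cases "z n = 0")
      case True then show ?thesis using cG[OF z, of 1 "z 0"] b by simp
    next
      case False
      then have "z 0 = 0 \<or> z 0 = 1 \<or> (\<exists>i\<in>{1..n0}. z i = 0 \<or> z i = 1)" using that bd by blast
      then have "c z (1 - z n + z n * z 0) (z 0) = \<one>" "c z 1 (z 0) = \<one>"
        using b sq[of "z n" "z 0"] by (intro c0[OF z]; auto)+
      then show ?thesis by simp
    qed
    show "c z (1 - z n + z n * z 0) (z 0) \<otimes> inv (c z 1 (z 0)) =
      c (z(n := 0)) ((z(n := 0)) 0) ((z(n := 0)) 0) \<otimes> inv (c (z(n := 0)) 1 ((z(n := 0)) 0))" if "z n = 1"
      using that n cdrop by simp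
  qed
  have "null_loop m' n (\<lambda>z. g z [^] N \<otimes> inv (?f z))"
  proof (rule null_loop_cong[OF null_loop_mult[OF 1 2]])
    fix z assume z: "z \<in> Cube n"
    have "g z \<in> carrier G" "c z (z 0) (z 0) \<in> carrier G" "?f z \<in> carrier G"
      using loop_carrier[OF g z] cG[OF sub[OF z]] cube_bounds[OF z, of 0] by auto
    then show "g z [^] N \<otimes> inv (c z (z 0) (z 0)) \<otimes> (c z (z 0) (z 0) \<otimes> inv (?f z)) = g z [^] N \<otimes> inv (?f z)"
      by (simp add: m_assoc inv_solve_left inv_solve_left' l_inv r_inv flip: m_assoc) (simp add: m_assoc)
  qed
  then show "\<exists>N\<in>S. \<exists>m' f. loop 0 n f \<and> null_loop m' n (\<lambda>z. g z [^] N \<otimes> inv (f z))" using N(1) lpf by blast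
qed

end

section \<open>Homotopy groups and their direct limits\<close>

text \<open>The cube is path connected and its boundary nonempty, so a based loop or homotopy cannot leave
  the path component of the base point.\<close>

lemma hclass_path_component:
  assumes "n > 0"
  shows "hclass n (subtopology X (path_component_of_set X x0)) x0 f = hclass n X x0 f"
proof -
  let ?C = "path_component_of_set X x0"
  have "homotopic_with (boundary_to n x0) (cube n) (subtopology X ?C) f g"
    if hom: "homotopic_with (boundary_to n x0) (cube n) X f g" for g
  proof -
    obtain h where h: "continuous_map (prod_topology (top_of_set {0..1::real}) (cube n)) X h"
      "\<forall>x. h (0, x) = f x" "\<forall>x. h (1, x) = g x" "\<forall>t\<in>{0..1}. boundary_to n x0 (\<lambda>x. h (t, x))"
      using hom unfolding homotopic_with_def by blast
    have "h (t, z) \<in> ?C" if t: "t \<in> {0..1}" and z: "z \<in> Cube n" for t z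
    proof -
      have "continuous_map (top_of_set {0..1::real}) (cube n) (\<lambda>r. z(0 := r * z 0))"
        using z cube_bounds[OF z] assms by (intro continuous_map_cube_upd[where m = n])
          (auto simp: mult_le_one intro!: continuous_intros)
      then have "continuous_map (top_of_set {0..1::real}) (prod_topology (top_of_set {0..1::real}) (cube n)) (\<lambda>r. (t, z(0 := r * z 0)))"
        using t by (simp add: continuous_map_paired)
      from continuous_map_compose[OF this h(1)]
      have c: "pathin X (\<lambda>r. h (t, z(0 := r * z 0)))" by (simp add: pathin_def comp_def)
      have "z(0 := 0) \<in> cube_boundary n" using z assms by (auto simp: cube_boundary_def topspace_cube)
      then have "h (t, z(0 := 0)) = x0" using h(4) t unfolding boundary_to_def by blast
      then show ?thesis using c unfolding path_component_of_def
        by (auto intro!: exI[of _ "\<lambda>r. h (t, z(0 := r * z 0))"])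
    qed
    then have "continuous_map (prod_topology (top_of_set {0..1::real}) (cube n)) (subtopology X ?C) h"
      using h(1) by (auto simp: continuous_map_in_subtopology)
    then show ?thesis using h(2-4) unfolding homotopic_with_def by blast
  qed
  moreover have "homotopic_with (boundary_to n x0) (cube n) X f g"
    if "homotopic_with (boundary_to n x0) (cube n) (subtopology X ?C) f g" for g
    using that unfolding homotopic_with_def continuous_map_in_subtopology by blast
  ultimately show ?thesis unfolding hclass_def by blast
qed

lemma homotopy_group_path_component:
  assumes "n > 0"
  shows "homotopy_group n (subtopology X (path_component_of_set X x0)) x0 = homotopy_group n X x0"
proof -
  let ?Y = "subtopology X (path_component_of_set X x0)"
  have hom: "continuous_map (cube n) Y f \<and> boundary_to n x0 f \<longleftrightarrow> f \<in> hclass n Y x0 f" for Y f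
    unfolding hclass_def by (auto dest: homotopic_with_imp_continuous_maps homotopic_with_imp_property)
  show ?thesis unfolding homotopy_group_def hom hclass_path_component[OF assms] ..
qed

lemma homotopy_map_path_component:
  assumes "n > 0"
  shows "homotopy_map n (subtopology X (path_component_of_set X x0)) x0 = homotopy_map n X x0"
  unfolding homotopy_map_def fun_eq_iff hclass_path_component[OF assms] by simp

lemma hclass_cong:
  assumes "\<And>z. z \<in> Cube n \<Longrightarrow> f z = g z"
  shows "hclass n X x0 f = hclass n X x0 g"
proof -
  have P: "boundary_to n x0 h = boundary_to n x0 k" if "\<And>z. z \<in> Cube n \<Longrightarrow> h z = k z" for h k
    using that by (auto simp: boundary_to_def cube_boundary_def)
  have "homotopic_with (boundary_to n x0) (cube n) X f' k"
    if "homotopic_with (boundary_to n x0) (cube n) X g' k" "\<And>z. z \<in> Cube n \<Longrightarrow> f' z = g' z" for f' g' k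
    by (rule homotopic_with_eq[OF that(1) _ _ P]) (simp_all add: that(2))
  from this[of g _ f] this[of f _ g] show ?thesis unfolding hclass_def using assms by auto
qed

lemma hclass_eqI:
  assumes "homotopic_with (boundary_to n x0) (cube n) X f g"
  shows "hclass n X x0 f = hclass n X x0 g"
  unfolding hclass_def using assms homotopic_with_trans homotopic_with_sym by blast

lemma homotopy_map_hclass:
  assumes f: "continuous_map (cube n) X f" "boundary_to n x0 f"
    and p: "continuous_map X Y p" "p x0 = y0"
  shows "homotopy_map n Y y0 p (hclass n X x0 f) = hclass n Y y0 (p \<circ> f)"
proof -
  have "hclass n Y y0 (p \<circ> g) = hclass n Y y0 (p \<circ> f)" if "g \<in> hclass n X x0 f" for g
  proof -
    have "homotopic_with (boundary_to n x0) (cube n) X f g" using that by (simp add: hclass_def)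
    then have "homotopic_with (boundary_to n y0) (cube n) Y (p \<circ> f) (p \<circ> g)"
      by (rule homotopic_with_compose_continuous_map_left[OF _ p(1)]) (auto simp: boundary_to_def p(2))
    then show ?thesis using hclass_eqI by metis
  qed
  moreover have "f \<in> hclass n X x0 f" using f by (simp add: hclass_def)
  ultimately show ?thesis unfolding homotopy_map_def by blast
qed

context filtered_group begin

lemma cancel_inv:
  assumes "a \<in> carrier G" "b \<in> carrier G"
  shows "inv a \<otimes> (a \<otimes> b) = b" "a \<otimes> (inv a \<otimes> b) = b"
  using assms by (simp_all flip: m_assoc)

lemma null_loop_inv: assumes "null_loop m n u" shows "null_loop m n (\<lambda>z. inv (u z))"
proof -
  obtain h where h: "continuous_map (cube (Suc n)) (T m) h"
     "\<forall>z\<in>Cube (Suc n). ((\<exists>i<n. z i = 0 \<or> z i = 1) \<or> z n = 0 \<longrightarrow> h z = \<one>) \<and>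
        (z n = 1 \<longrightarrow> h z = u (z(n := 0)))" using assms(1) unfolding null_loop_def by blast
  show ?thesis unfolding null_loop_def
    by (rule exI[of _ "\<lambda>z. inv (h z)"]) (use h in \<open>auto intro: cm_inv\<close>)
qed

lemma null_loop_conj:
  assumes "null_loop m n u" "continuous_map (cube n) (T m) w"
  shows "null_loop m n (\<lambda>z. w z \<otimes> u z \<otimes> inv (w z))"
proof -
  obtain h where h: "continuous_map (cube (Suc n)) (T m) h"
     "\<forall>z\<in>Cube (Suc n). ((\<exists>i<n. z i = 0 \<or> z i = 1) \<or> z n = 0 \<longrightarrow> h z = \<one>) \<and>
        (z n = 1 \<longrightarrow> h z = u (z(n := 0)))" using assms(1) unfolding null_loop_def by blast
  have w: "continuous_map (cube (Suc n)) (T m) (\<lambda>z. w (z(n := 0)))"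
    by (rule cm_comp[OF continuous_map_cube_drop[OF continuous_map_identity] assms(2)])
  show ?thesis unfolding null_loop_def
    by (rule exI[of _ "\<lambda>z. w (z(n := 0)) \<otimes> h z \<otimes> inv (w (z(n := 0)))"])
      (use h cm_closed[OF w] in \<open>auto intro!: cm_mult cm_inv w\<close>)
qed

lemma null_loop_one: "null_loop m n (\<lambda>z. \<one>)"
  unfolding null_loop_def using cm_one by (intro exI[of _ "\<lambda>_. \<one>"]) auto

lemma loop_mult: "loop m n f \<Longrightarrow> loop m n g \<Longrightarrow> loop m n (\<lambda>z. f z \<otimes> g z)"
  unfolding loop_def by (auto intro: cm_mult)

lemma loop_inv: "loop m n f \<Longrightarrow> loop m n (\<lambda>z. inv (f z))"
  unfolding loop_def by (auto intro: cm_inv)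

lemma loop_one: "loop m n (\<lambda>z. \<one>)"
  unfolding loop_def using cm_one by auto

lemma loop_pow: "loop m n f \<Longrightarrow> loop m n (\<lambda>z. f z [^] (N::nat))"
  by (induction N) (simp_all add: loop_one loop_mult)

lemma loop_lift: "loop m n f \<Longrightarrow> m \<le> m' \<Longrightarrow> loop m' n f"
  unfolding loop_def by (metis T_lift)

definition eqv :: "nat \<Rightarrow> nat \<Rightarrow> ((nat \<Rightarrow> real) \<Rightarrow> 'a) \<Rightarrow> ((nat \<Rightarrow> real) \<Rightarrow> 'a) \<Rightarrow> bool" where
  "eqv m n f g \<longleftrightarrow> null_loop m n (\<lambda>z. f z \<otimes> inv (g z))"

lemma eqvI: "loop m n f \<Longrightarrow> (\<And>z. z \<in> Cube n \<Longrightarrow> f z = g z) \<Longrightarrow> eqv m n f g"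
  unfolding eqv_def by (rule null_loop_cong[OF null_loop_one]) (metis loop_carrier r_inv)

lemma eqv_refl: "loop m n f \<Longrightarrow> eqv m n f f"
  by (rule eqvI) simp_all

lemma eqv_sym:
  assumes "eqv m n f g" "loop m n f" "loop m n g" shows "eqv m n g f"
  unfolding eqv_def
proof (rule null_loop_cong[OF null_loop_inv[OF assms(1)[unfolded eqv_def]]])
  fix z assume "z \<in> Cube n"
  then show "inv (f z \<otimes> inv (g z)) = g z \<otimes> inv (f z)"
    using loop_carrier[OF assms(2)] loop_carrier[OF assms(3)] by (simp add: inv_mult_group)
qed

lemma eqv_trans:
  assumes "eqv m n f g" "eqv m n g h" "loop m n f" "loop m n g" "loop m n h" shows "eqv m n f h"
  unfolding eqv_def
proof (rule null_loop_cong[OF null_loop_mult[OF assms(1,2)[unfolded eqv_def]]])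
  fix z assume "z \<in> Cube n"
  then show "f z \<otimes> inv (g z) \<otimes> (g z \<otimes> inv (h z)) = f z \<otimes> inv (h z)"
    using loop_carrier[OF assms(3)] loop_carrier[OF assms(4)] loop_carrier[OF assms(5)] by (simp add: m_assoc cancel_inv)
qed

lemma eqv_mult:
  assumes "eqv m n f f'" "eqv m n g g'" "loop m n f" "loop m n f'" "loop m n g" "loop m n g'"
  shows "eqv m n (\<lambda>z. f z \<otimes> g z) (\<lambda>z. f' z \<otimes> g' z)"
proof -
  have "null_loop m n (\<lambda>z. f z \<otimes> (g z \<otimes> inv (g' z)) \<otimes> inv (f z))"
    using assms by (intro null_loop_conj) (simp_all add: eqv_def loop_def)
  from null_loop_mult[OF this assms(1)[unfolded eqv_def]] show ?thesis unfolding eqv_def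
  proof (rule null_loop_cong)
    fix z assume "z \<in> Cube n"
    then have "f z \<in> carrier G" "f' z \<in> carrier G" "g z \<in> carrier G" "g' z \<in> carrier G"
      using assms loop_carrier by auto
    then show "f z \<otimes> (g z \<otimes> inv g' z) \<otimes> inv f z \<otimes> (f z \<otimes> inv f' z) = f z \<otimes> g z \<otimes> inv (f' z \<otimes> g' z)"
      by (simp add: inv_mult_group m_assoc cancel_inv)
  qed
qed

lemma eqv_lift: "eqv m n f g \<Longrightarrow> m \<le> m' \<Longrightarrow> eqv m' n f g"
  unfolding eqv_def by (rule null_loop_lift)

text \<open>Eckmann--Hilton: a concatenation is the pointwise product of its two halves, each padded with
  the constant loop, and padding does not change the class. As the padded halves have disjoint
  supports they commute.\<close>

definition first_half :: "((nat \<Rightarrow> real) \<Rightarrow> 'a) \<Rightarrow> (nat \<Rightarrow> real) \<Rightarrow> 'a" where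
  "first_half f z = f (z(0 := min 1 (2 * z 0)))"

definition second_half :: "((nat \<Rightarrow> real) \<Rightarrow> 'a) \<Rightarrow> (nat \<Rightarrow> real) \<Rightarrow> 'a" where
  "second_half f z = f (z(0 := max 0 (2 * z 0 - 1)))"

lemma loop_reparam:
  assumes n: "n > 0" and f: "loop m n f"
    and \<phi>: "\<And>Y w. continuous_map Y euclideanreal w \<Longrightarrow> continuous_map Y euclideanreal (\<lambda>y::nat\<Rightarrow>real. \<phi> (w y))"
    and end01: "\<phi> 0 = 0" "\<phi> 1 = 1" and rng: "\<And>t. 0 \<le> t \<Longrightarrow> t \<le> 1 \<Longrightarrow> 0 \<le> \<phi> t \<and> \<phi> t \<le> (1::real)"
  shows "loop m n (\<lambda>z. f (z(0 := \<phi> (z 0))))"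
  unfolding loop_def
proof (intro conjI ballI)
  have "continuous_map (cube n) (cube n) (\<lambda>z. z(0 := \<phi> (z 0)))"
    using n by (intro continuous_map_cube_upd[where m = n] \<phi> continuous_map_cube_coordinate continuous_map_identity)
      (auto simp: cube_bounds rng)
  then show "continuous_map (cube n) (T m) (\<lambda>z. f (z(0 := \<phi> (z 0))))"
    by (rule cm_comp) (use f loop_def in blast)
  fix z assume "z \<in> cube_boundary n"
  then obtain i where i: "z \<in> Cube n" "i < n" "z i = 0 \<or> z i = 1" by (auto simp: cube_boundary_iff)
  have "z(0 := \<phi> (z 0)) \<in> Cube n" using i(1) n rng cube_bounds[OF i(1)] by (auto simp: topspace_cube)
  moreover have "(z(0 := \<phi> (z 0))) i = 0 \<or> (z(0 := \<phi> (z 0))) i = 1" using i(3) end01 by (cases "i = 0") auto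
  ultimately have "z(0 := \<phi> (z 0)) \<in> cube_boundary n" using i(2) unfolding cube_boundary_iff by blast
  then show "f (z(0 := \<phi> (z 0))) = \<one>" using f unfolding loop_def by blast
qed

lemma eqv_reparam:
  assumes n: "n > 0" and f: "loop m n f"
    and \<phi>: "\<And>Y v w. continuous_map Y euclideanreal v \<Longrightarrow> continuous_map Y euclideanreal w \<Longrightarrow>
        continuous_map Y euclideanreal (\<lambda>y::nat\<Rightarrow>real. \<phi> (v y) (w y))"
    and end01: "\<And>s. 0 \<le> s \<Longrightarrow> s \<le> 1 \<Longrightarrow> \<phi> s 0 = 0 \<and> \<phi> s 1 = 1" and id: "\<And>t. 0 \<le> t \<Longrightarrow> t \<le> 1 \<Longrightarrow> \<phi> 0 t = t"
    and rng: "\<And>s t. 0 \<le> s \<Longrightarrow> s \<le> 1 \<Longrightarrow> 0 \<le> t \<Longrightarrow> t \<le> 1 \<Longrightarrow> 0 \<le> \<phi> s t \<and> \<phi> s t \<le> (1::real)"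
  shows "eqv m n (\<lambda>z. f (z(0 := \<phi> 1 (z 0)))) f"
  unfolding eqv_def null_loop_def
proof (intro exI[of _ "\<lambda>z. f (z(n := 0, 0 := \<phi> (z n) (z 0))) \<otimes> inv (f (z(n := 0)))"] conjI ballI impI)
  have c: "continuous_map (cube (Suc n)) (cube n) (\<lambda>z. z(n := 0, 0 := \<phi> (z n) (z 0)))"
    using n by (intro continuous_map_cube_upd[where m = n] \<phi> continuous_map_cube_coordinate continuous_map_cube_drop continuous_map_identity)
      (auto simp: cube_bounds rng)
  have fc: "continuous_map (cube n) (T m) f" using f by (simp add: loop_def)
  show "continuous_map (cube (Suc n)) (T m) (\<lambda>z. f (z(n := 0, 0 := \<phi> (z n) (z 0))) \<otimes> inv (f (z(n := 0))))"
    by (intro cm_mult cm_inv cm_comp[OF c fc] cm_comp[OF continuous_map_cube_drop[OF continuous_map_identity] fc])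
  fix z assume z: "z \<in> Cube (Suc n)"
  note b = cube_bounds[OF z, of 0] cube_bounds[OF z, of n]
  note cz = continuous_map_in[OF c z]
  have fG: "f (z(n := 0)) \<in> carrier G" using loop_carrier[OF f cube_drop[OF z]] .
  show "f (z(n := 0, 0 := \<phi> (z n) (z 0))) \<otimes> inv (f (z(n := 0))) = \<one>" if bd: "(\<exists>i<n. z i = 0 \<or> z i = 1) \<or> z n = 0"
  proof (cases "z n = 0")
    case True
    then have "z(n := 0, 0 := \<phi> (z n) (z 0)) = z(n := 0)" using id[of "z 0"] b n by (auto simp: fun_eq_iff)
    then show ?thesis using fG by simp
  next
    case False
    then obtain i where i: "i < n" "z i = 0 \<or> z i = 1" using bd by blast
    then have "(z(n := 0, 0 := \<phi> (z n) (z 0))) i = 0 \<or> (z(n := 0, 0 := \<phi> (z n) (z 0))) i = 1"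
      using end01 b by (cases "i = 0") auto
    then have "z(n := 0, 0 := \<phi> (z n) (z 0)) \<in> cube_boundary n" using cz i(1) unfolding cube_boundary_iff by blast
    moreover have "z(n := 0) \<in> cube_boundary n" using cube_drop[OF z] i unfolding cube_boundary_iff by auto
    ultimately show ?thesis using f by (simp add: loop_def)
  qed
  show "f (z(n := 0, 0 := \<phi> (z n) (z 0))) \<otimes> inv (f (z(n := 0))) =
    f ((z(n := 0))(0 := \<phi> 1 ((z(n := 0)) 0))) \<otimes> inv (f (z(n := 0)))" if "z n = 1"
    using that n by simp
qed

lemma half_eqv:
  assumes n: "n > 0" and f: "loop m n f"
  shows "loop m n (first_half f)" "eqv m n (first_half f) f" "loop m n (second_half f)" "eqv m n (second_half f) f"
proof -
  show "loop m n (first_half f)" unfolding first_half_def[abs_def]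
    by (rule loop_reparam[OF n f, where \<phi> = "\<lambda>t. min 1 (2 * t)"])
      (auto intro!: continuous_map_real_min continuous_map_real_mult)
  show "loop m n (second_half f)" unfolding second_half_def[abs_def]
    by (rule loop_reparam[OF n f, where \<phi> = "\<lambda>t. max 0 (2 * t - 1)"])
      (auto intro!: continuous_map_real_max continuous_map_real_mult continuous_map_diff)
  have "eqv m n (\<lambda>z. f (z(0 := min 1 ((1 + 1) * z 0)))) f"
    by (rule eqv_reparam[OF n f, where \<phi> = "\<lambda>s t. min 1 ((1 + s) * t)"])
      (auto intro!: continuous_map_real_min continuous_map_real_mult continuous_map_add)
  then show "eqv m n (first_half f) f" unfolding first_half_def[abs_def] by simp
  have le: "(1 + s) * t - s \<le> 1" if "0 \<le> s" "t \<le> 1" for s t :: real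
    using mult_left_mono[of t 1 "1 + s"] that by (simp add: algebra_simps)
  have "eqv m n (\<lambda>z. f (z(0 := max 0 ((1 + 1) * z 0 - 1)))) f"
    by (rule eqv_reparam[OF n f, where \<phi> = "\<lambda>s t. max 0 ((1 + s) * t - s)"])
      (auto intro!: continuous_map_real_max continuous_map_real_mult continuous_map_add continuous_map_diff simp: le)
  then show "eqv m n (second_half f) f" unfolding second_half_def[abs_def] by simp
qed

lemma half_disjoint:
  assumes n: "n > 0" and f: "loop m n f" and g: "loop m n g" and z: "z \<in> Cube n"
  shows "first_half f z = \<one> \<or> second_half g z = \<one>"
    and "concat_maps f g z = first_half f z \<otimes> second_half g z"
proof -
  note b = cube_bounds[OF z, of 0]
  have 1: "f (z(0 := 1)) = \<one>" "g (z(0 := 0)) = \<one>"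
  proof -
    have "z(0 := 1) \<in> cube_boundary n" "z(0 := 0) \<in> cube_boundary n"
      using z n by (auto simp: cube_boundary_iff topspace_cube)
    then show "f (z(0 := 1)) = \<one>" "g (z(0 := 0)) = \<one>" using f g by (auto simp: loop_def)
  qed
  show "first_half f z = \<one> \<or> second_half g z = \<one>"
    using 1 by (cases "z 0 \<le> 1/2") (auto simp: first_half_def second_half_def min_def max_def)
  have "first_half f z \<in> carrier G" "second_half g z \<in> carrier G"
    using half_eqv[OF n f] half_eqv[OF n g] z loop_carrier by auto
  then show "concat_maps f g z = first_half f z \<otimes> second_half g z"
    using 1 by (cases "z 0 < 1/2"; cases "2 * z 0 = 1")
      (auto simp: concat_maps_def first_half_def second_half_def min_def max_def)
qed

lemma concat_eqv:
  assumes "n > 0" "loop m n f" "loop m n g"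
  shows "loop m n (concat_maps f g)" "eqv m n (concat_maps f g) (\<lambda>z. f z \<otimes> g z)"
proof -
  note h = half_eqv[OF assms(1,2)] half_eqv[OF assms(1,3)]
  note eq = half_disjoint(2)[OF assms]
  have l: "loop m n (\<lambda>z. first_half f z \<otimes> second_half g z)" using h by (intro loop_mult)
  then have "continuous_map (cube n) (T m) (concat_maps f g)"
    unfolding loop_def using continuous_map_eq[of "cube n" "T m" "\<lambda>z. first_half f z \<otimes> second_half g z" "concat_maps f g"] eq by auto
  then show 1: "loop m n (concat_maps f g)" using l eq unfolding loop_def cube_boundary_def by auto
  have "eqv m n (concat_maps f g) (\<lambda>z. first_half f z \<otimes> second_half g z)" by (rule eqvI[OF 1]) (rule eq)
  moreover have "eqv m n (\<lambda>z. first_half f z \<otimes> second_half g z) (\<lambda>z. f z \<otimes> g z)"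
    using h assms by (intro eqv_mult)
  ultimately show "eqv m n (concat_maps f g) (\<lambda>z. f z \<otimes> g z)"
    using 1 l loop_mult[OF assms(2,3)] eqv_trans by blast
qed

lemma mult_commute_eqv:
  assumes "n > 0" "loop m n f" "loop m n g"
  shows "eqv m n (\<lambda>z. f z \<otimes> g z) (\<lambda>z. g z \<otimes> f z)"
proof -
  note h = half_eqv[OF assms(1,2)] half_eqv[OF assms(1,3)]
  have 1: "eqv m n (\<lambda>z. first_half f z \<otimes> second_half g z) (\<lambda>z. f z \<otimes> g z)"
    "eqv m n (\<lambda>z. second_half g z \<otimes> first_half f z) (\<lambda>z. g z \<otimes> f z)"
    using h assms by (auto intro!: eqv_mult)
  have l: "loop m n (\<lambda>z. first_half f z \<otimes> second_half g z)" "loop m n (\<lambda>z. second_half g z \<otimes> first_half f z)"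
    using h by (auto intro!: loop_mult)
  have "eqv m n (\<lambda>z. first_half f z \<otimes> second_half g z) (\<lambda>z. second_half g z \<otimes> first_half f z)"
  proof (rule eqvI[OF l(1)])
    fix z assume z: "z \<in> Cube n"
    have "first_half f z \<in> carrier G" "second_half g z \<in> carrier G" using h z loop_carrier by auto
    then show "first_half f z \<otimes> second_half g z = second_half g z \<otimes> first_half f z"
      using half_disjoint(1)[OF assms z] by auto
  qed
  then show ?thesis using 1 l loop_mult[OF assms(2,3)] loop_mult[OF assms(3,2)] eqv_trans eqv_sym by meson
qed

subsection \<open>Models of the stages\<close>

text \<open>A space homeomorphic to a stage has as its homotopy groups the loops in that stage under pointwise
  multiplication, modulo contractible loops.\<close>

definition is_model :: "nat \<Rightarrow> 'l topology \<Rightarrow> 'l \<Rightarrow> ('a \<Rightarrow> 'l) \<Rightarrow> bool" where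
  "is_model m X x0 j \<longleftrightarrow> homeomorphic_map (T m) X j \<and> j \<one> = x0"

lemma model_lp:
  assumes M: "is_model m X x0 j" and f: "loop m n f"
  shows "continuous_map (cube n) X (j \<circ> f)" "boundary_to n x0 (j \<circ> f)"
  using assms continuous_map_compose homeomorphic_imp_continuous_map
  unfolding is_model_def loop_def boundary_to_def by fastforce+

lemma model_loop:
  assumes M: "is_model m X x0 j" and f: "continuous_map (cube n) X f" "boundary_to n x0 f"
  obtains f' where "loop m n f'" "\<And>z. z \<in> Cube n \<Longrightarrow> f z = j (f' z)"
proof -
  obtain i where i: "homeomorphic_maps (T m) X j i" using M unfolding is_model_def homeomorphic_map_maps by blast
  have "loop m n (i \<circ> f)" unfolding loop_def
  proof (intro conjI ballI)
    show "continuous_map (cube n) (T m) (i \<circ> f)"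
      using i f(1) continuous_map_compose unfolding homeomorphic_maps_def by blast
    show "(i \<circ> f) z = \<one>" if "z \<in> cube_boundary n" for z
      using that f(2) i M T_one[of m] unfolding homeomorphic_maps_def is_model_def boundary_to_def by force
  qed
  moreover have "f z = j ((i \<circ> f) z)" if "z \<in> Cube n" for z
    using i continuous_map_in[OF f(1) that] unfolding homeomorphic_maps_def by simp
  ultimately show ?thesis by (rule that)
qed

lemma model_hclass_eq_iff:
  assumes M: "is_model m X x0 j" and f: "loop m n f" and g: "loop m n g"
  shows "hclass n X x0 (j \<circ> f) = hclass n X x0 (j \<circ> g) \<longleftrightarrow> eqv m n f g"
proof
  obtain i where i: "homeomorphic_maps (T m) X j i" using M unfolding is_model_def homeomorphic_map_maps by blast
  have fc: "continuous_map (cube n) (T m) f" "continuous_map (cube n) (T m) g" using f g by (auto simp: loop_def)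
  have ij: "i (j a) = a" if "a \<in> topspace (T m)" for a using that i by (simp add: homeomorphic_maps_def)
  {
    assume "hclass n X x0 (j \<circ> f) = hclass n X x0 (j \<circ> g)"
    moreover have "j \<circ> g \<in> hclass n X x0 (j \<circ> g)" using model_lp[OF M g] by (simp add: hclass_def)
    ultimately have "j \<circ> g \<in> hclass n X x0 (j \<circ> f)" by (simp only:)
    then obtain h where h: "continuous_map (prod_topology (top_of_set {0..1::real}) (cube n)) X h"
      "\<forall>x. h (0, x) = (j \<circ> f) x" "\<forall>x. h (1, x) = (j \<circ> g) x" "\<forall>t\<in>{0..1}. boundary_to n x0 (\<lambda>x. h (t, x))"
      unfolding homotopic_with_def hclass_def by blast
    let ?w = "\<lambda>z. (1 - z n, z(n := 0)) :: real \<times> (nat \<Rightarrow> real)"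
    have w: "continuous_map (cube (Suc n)) (prod_topology (top_of_set {0..1::real}) (cube n)) ?w"
      by (auto simp: continuous_map_paired continuous_map_in_subtopology cube_bounds
          intro!: continuous_map_cube_drop continuous_map_identity continuous_map_diff continuous_map_cube_coordinate)
    have hc: "continuous_map (cube (Suc n)) (T m) (\<lambda>z. i (h (?w z)))"
      using continuous_map_compose[OF continuous_map_compose[OF w h(1)], of "T m" i] i
      unfolding homeomorphic_maps_def by (simp add: comp_def)
    show "eqv m n f g" unfolding eqv_def null_loop_def
    proof (intro exI[of _ "\<lambda>z. i (h (?w z)) \<otimes> inv (g (z(n := 0)))"] conjI ballI impI)
      show "continuous_map (cube (Suc n)) (T m) (\<lambda>z. i (h (?w z)) \<otimes> inv (g (z(n := 0))))"
        by (intro cm_mult cm_inv hc cm_comp[OF continuous_map_cube_drop[OF continuous_map_identity] fc(2)])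
      fix z assume z: "z \<in> Cube (Suc n)"
      note gz = continuous_map_in[OF fc(2) cube_drop[OF z]] continuous_map_in[OF fc(1) cube_drop[OF z]]
      show "i (h (?w z)) \<otimes> inv (g (z(n := 0))) = \<one>" if bd: "(\<exists>i<n. z i = 0 \<or> z i = 1) \<or> z n = 0"
      proof (cases "z n = 0")
        case True
        then show ?thesis using h(3) ij[OF gz(1)] gz(1) T_carrier by (force)
      next
        case False
        then have "z(n := 0) \<in> cube_boundary n" using bd cube_drop[OF z] unfolding cube_boundary_iff by auto
        moreover from this have "h (?w z) = x0" using h(4) cube_bounds[OF z, of n] by (auto simp: boundary_to_def)
        moreover have "i x0 = \<one>" using ij T_one M unfolding is_model_def by blast
        ultimately show ?thesis using g by (simp add: loop_def)
      qed
      show "i (h (?w z)) \<otimes> inv (g (z(n := 0))) = f (z(n := 0)) \<otimes> inv (g (z(n := 0)))" if "z n = 1"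
        using that h(2) ij[OF gz(2)] by simp
    qed
  }
  assume "eqv m n f g"
  then obtain h where h: "continuous_map (cube (Suc n)) (T m) h"
     "\<And>z. z\<in>Cube (Suc n) \<Longrightarrow> (\<exists>i<n. z i = 0 \<or> z i = 1) \<or> z n = 0 \<Longrightarrow> h z = \<one>"
     "\<And>z. z\<in>Cube (Suc n) \<Longrightarrow> z n = 1 \<Longrightarrow> h z = f (z(n := 0)) \<otimes> inv (g (z(n := 0)))"
    unfolding eqv_def null_loop_def by blast
  let ?P = "prod_topology (top_of_set {0..1::real}) (cube n)"
  have w: "continuous_map ?P (cube (Suc n)) (\<lambda>p. (snd p)(n := 1 - fst p))"
    by (intro continuous_map_cube_upd[where m = n])
      (auto intro!: continuous_map_diff continuous_map_snd continuous_map_into_fulltopology[OF continuous_map_fst])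
  have wz: "z(n := 1 - t) \<in> Cube (Suc n)" if "t \<in> {0..1}" "z \<in> Cube n" for t z
    using that by (auto simp: topspace_cube less_Suc_eq)
  have zn: "z(n := 0) = z" "z n = 0" if "z \<in> Cube n" for z using that by (auto simp: topspace_cube)
  let ?H = "\<lambda>p. h ((snd p)(n := 1 - fst p)) \<otimes> g (snd p)"
  have H: "continuous_map ?P (T m) ?H"
    by (intro cm_mult cm_comp[OF w h(1)] cm_comp[OF continuous_map_snd fc(2)])
  have P: "boundary_to n x0 h = boundary_to n x0 k" if "\<And>z. z \<in> Cube n \<Longrightarrow> h z = k z" for h k
    using that by (auto simp: boundary_to_def cube_boundary_def)
  have gG: "g z \<in> carrier G" "f z \<in> carrier G" if "z \<in> Cube n" for z
    using loop_carrier[OF g that] loop_carrier[OF f that] by auto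
  have "homotopic_with (boundary_to n x0) (cube n) X (j \<circ> f) (j \<circ> g)"
  proof (subst homotopic_with[OF P], assumption, intro exI[of _ "\<lambda>p. j (?H p)"] conjI ballI)
    show "continuous_map ?P X (\<lambda>p. j (?H p))"
      using continuous_map_compose[OF H, of X j] i unfolding homeomorphic_maps_def by (simp add: comp_def)
    fix z assume z: "z \<in> Cube n"
    show "j (?H (0, z)) = (j \<circ> f) z" using h(3)[OF wz[of 0, OF _ z]] gG[OF z] zn[OF z] by (simp add: m_assoc)
    show "j (?H (1, z)) = (j \<circ> g) z" using h(2)[OF wz[of 1, OF _ z]] gG[OF z] zn[OF z] by simp
  next
    fix t :: real assume t: "t \<in> {0..1}"
    show "boundary_to n x0 (\<lambda>z. j (?H (t, z)))" unfolding boundary_to_def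
    proof
      fix z assume zb: "z \<in> cube_boundary n"
      then obtain k where k: "z \<in> Cube n" "k < n" "z k = 0 \<or> z k = 1" by (auto simp: cube_boundary_iff)
      then have "\<exists>i<n. (z(n := 1 - t)) i = 0 \<or> (z(n := 1 - t)) i = 1" by (intro exI[of _ k]) auto
      then have "h (z(n := 1 - t)) = \<one>" using h(2)[OF wz[OF t k(1)]] by blast
      moreover have "g z = \<one>" using g zb by (simp add: loop_def)
      ultimately show "j (?H (t, z)) = x0" using M by (simp add: is_model_def)
    qed
  qed
  then show "hclass n X x0 (j \<circ> f) = hclass n X x0 (j \<circ> g)" by (rule hclass_eqI)
qed

lemma model_carrier:
  assumes M: "is_model m X x0 j"
  shows "carrier (homotopy_group n X x0) = {hclass n X x0 (j \<circ> f) | f. loop m n f}"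
proof -
  have "\<exists>f'. hclass n X x0 f = hclass n X x0 (j \<circ> f') \<and> loop m n f'"
    if "continuous_map (cube n) X f" "boundary_to n x0 f" for f
    using model_loop[OF M that] hclass_cong[of n f "j \<circ> _" X x0] by (metis comp_apply)
  then show ?thesis unfolding homotopy_group_def using model_lp[OF M] by auto
qed

lemma model_mult:
  assumes M: "is_model m X x0 j" and n: "n > 0" and f: "loop m n f" and g: "loop m n g"
  shows "hclass n X x0 (j \<circ> f) \<otimes>\<^bsub>homotopy_group n X x0\<^esub> hclass n X x0 (j \<circ> g)
    = hclass n X x0 (j \<circ> (\<lambda>z. f z \<otimes> g z))"
proof -
  have 1: "hclass n X x0 (concat_maps f' g') = hclass n X x0 (j \<circ> (\<lambda>z. f z \<otimes> g z))"
    if f': "f' \<in> hclass n X x0 (j \<circ> f)" and g': "g' \<in> hclass n X x0 (j \<circ> g)" for f' g'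
  proof -
    have hf: "homotopic_with (boundary_to n x0) (cube n) X (j \<circ> f) f'"
      and hg: "homotopic_with (boundary_to n x0) (cube n) X (j \<circ> g) g'" using f' g' by (auto simp: hclass_def)
    obtain f'' where f'': "loop m n f''" "\<And>z. z \<in> Cube n \<Longrightarrow> f' z = j (f'' z)"
      using model_loop[OF M] hf homotopic_with_imp_continuous_maps homotopic_with_imp_property by metis
    obtain g'' where g'': "loop m n g''" "\<And>z. z \<in> Cube n \<Longrightarrow> g' z = j (g'' z)"
      using model_loop[OF M] hg homotopic_with_imp_continuous_maps homotopic_with_imp_property by metis
    have "hclass n X x0 (j \<circ> f) = hclass n X x0 (j \<circ> f'')" "hclass n X x0 (j \<circ> g) = hclass n X x0 (j \<circ> g'')"
      using hclass_eqI[OF hf] hclass_eqI[OF hg] hclass_cong[of n f' "j \<circ> f''" X x0] hclass_cong[of n g' "j \<circ> g''" X x0]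
        f''(2) g''(2) by auto
    then have "eqv m n f'' f" "eqv m n g'' g"
      using model_hclass_eq_iff[OF M] f g f''(1) g''(1) eqv_sym by metis+
    then have "eqv m n (\<lambda>z. f'' z \<otimes> g'' z) (\<lambda>z. f z \<otimes> g z)" using f g f''(1) g''(1) by (intro eqv_mult)
    then have "eqv m n (concat_maps f'' g'') (\<lambda>z. f z \<otimes> g z)"
      using concat_eqv[OF n f''(1) g''(1)] loop_mult f g f''(1) g''(1) eqv_trans by blast
    then have "hclass n X x0 (j \<circ> concat_maps f'' g'') = hclass n X x0 (j \<circ> (\<lambda>z. f z \<otimes> g z))"
      using model_hclass_eq_iff[OF M] concat_eqv(1)[OF n f''(1) g''(1)] loop_mult[OF f g] by blast
    moreover have "hclass n X x0 (concat_maps f' g') = hclass n X x0 (j \<circ> concat_maps f'' g'')"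
    proof (rule hclass_cong)
      fix z assume z: "z \<in> Cube n"
      have "z(0 := 2 * z 0) \<in> Cube n" if "z 0 \<le> 1/2" using z that n by (auto simp: topspace_cube)
      moreover have "z(0 := 2 * z 0 - 1) \<in> Cube n" if "\<not> z 0 \<le> 1/2" using z that n by (auto simp: topspace_cube)
      ultimately show "concat_maps f' g' z = (j \<circ> concat_maps f'' g'') z"
        unfolding concat_maps_def using f''(2) g''(2) by auto
    qed
    ultimately show ?thesis by simp
  qed
  have "j \<circ> f \<in> hclass n X x0 (j \<circ> f)" "j \<circ> g \<in> hclass n X x0 (j \<circ> g)"
    using model_lp[OF M f] model_lp[OF M g] by (auto simp: hclass_def)
  then have "(\<Union>f'\<in>hclass n X x0 (j \<circ> f). \<Union>g'\<in>hclass n X x0 (j \<circ> g). hclass n X x0 (concat_maps f' g'))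
    = hclass n X x0 (j \<circ> (\<lambda>z. f z \<otimes> g z))" using 1 by auto
  then show ?thesis by (simp add: homotopy_group_def)
qed

lemma model_one:
  assumes "is_model m X x0 j"
  shows "\<one>\<^bsub>homotopy_group n X x0\<^esub> = hclass n X x0 (j \<circ> (\<lambda>z. \<one>))"
  using assms by (simp add: homotopy_group_def is_model_def comp_def)

lemma model_comm_group:
  assumes M: "is_model m X x0 j" and n: "n > 0"
  shows "comm_group (homotopy_group n X x0)"
proof (rule comm_groupI)
  let ?H = "homotopy_group n X x0"
  define \<kappa> where "\<kappa> f = hclass n X x0 (j \<circ> f)" for f
  have car: "carrier ?H = {\<kappa> f | f. loop m n f}" and one: "\<one>\<^bsub>?H\<^esub> = \<kappa> (\<lambda>z. \<one>)"
    unfolding \<kappa>_def by (rule model_carrier[OF M], rule model_one[OF M])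
  have mlt: "\<kappa> f \<otimes>\<^bsub>?H\<^esub> \<kappa> g = \<kappa> (\<lambda>z. f z \<otimes> g z)" if "loop m n f" "loop m n g" for f g
    unfolding \<kappa>_def by (rule model_mult[OF M n that])
  have eq: "\<kappa> f = \<kappa> g" if "eqv m n f g" "loop m n f" "loop m n g" for f g
    unfolding \<kappa>_def using model_hclass_eq_iff[OF M] that by blast
  show "\<one>\<^bsub>?H\<^esub> \<in> carrier ?H" unfolding one car using loop_one by blast
  fix x assume "x \<in> carrier ?H"
  then obtain f where f: "loop m n f" "x = \<kappa> f" unfolding car by blast
  have "\<one>\<^bsub>?H\<^esub> \<otimes>\<^bsub>?H\<^esub> x = \<kappa> (\<lambda>z. \<one> \<otimes> f z)" unfolding one f(2) by (rule mlt[OF loop_one f(1)])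
  also have "\<dots> = x" unfolding f(2)
    by (intro eq eqvI loop_mult loop_one f(1)) (use loop_carrier[OF f(1)] in simp)
  finally show "\<one>\<^bsub>?H\<^esub> \<otimes>\<^bsub>?H\<^esub> x = x" .
  show "\<exists>y\<in>carrier ?H. y \<otimes>\<^bsub>?H\<^esub> x = \<one>\<^bsub>?H\<^esub>"
  proof (intro bexI)
    have "\<kappa> (\<lambda>z. inv (f z)) \<otimes>\<^bsub>?H\<^esub> x = \<kappa> (\<lambda>z. inv (f z) \<otimes> f z)" unfolding f(2) by (rule mlt[OF loop_inv[OF f(1)] f(1)])
    also have "\<dots> = \<one>\<^bsub>?H\<^esub>" unfolding one
      by (intro eq eqvI loop_mult loop_inv loop_one f(1)) (use loop_carrier[OF f(1)] in simp)
    finally show "\<kappa> (\<lambda>z. inv (f z)) \<otimes>\<^bsub>?H\<^esub> x = \<one>\<^bsub>?H\<^esub>" .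
    show "\<kappa> (\<lambda>z. inv (f z)) \<in> carrier ?H" unfolding car using loop_inv[OF f(1)] by blast
  qed
  fix y assume "y \<in> carrier ?H"
  then obtain g where g: "loop m n g" "y = \<kappa> g" unfolding car by blast
  show "x \<otimes>\<^bsub>?H\<^esub> y \<in> carrier ?H" unfolding f(2) g(2) mlt[OF f(1) g(1)] car using loop_mult[OF f(1) g(1)] by blast
  show "x \<otimes>\<^bsub>?H\<^esub> y = y \<otimes>\<^bsub>?H\<^esub> x" unfolding f(2) g(2) mlt[OF f(1) g(1)] mlt[OF g(1) f(1)]
    by (intro eq mult_commute_eqv n f(1) g(1) loop_mult)
  fix w assume "w \<in> carrier ?H"
  then obtain h where h: "loop m n h" "w = \<kappa> h" unfolding car by blast
  have "\<kappa> (\<lambda>z. f z \<otimes> g z \<otimes> h z) = \<kappa> (\<lambda>z. f z \<otimes> (g z \<otimes> h z))"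
    by (intro eq eqvI loop_mult f(1) g(1) h(1)) (use loop_carrier[OF f(1)] loop_carrier[OF g(1)] loop_carrier[OF h(1)] in \<open>simp add: m_assoc\<close>)
  then show "x \<otimes>\<^bsub>?H\<^esub> y \<otimes>\<^bsub>?H\<^esub> w = x \<otimes>\<^bsub>?H\<^esub> (y \<otimes>\<^bsub>?H\<^esub> w)"
    using f g h by (simp add: mlt loop_mult)
qed

lemma model_transfer:
  assumes M: "is_model m X x0 j" and M': "is_model l Y y0 j'" and ml: "m \<le> l"
    and p: "\<And>a. a \<in> topspace (T m) \<Longrightarrow> p (j a) = j' a" and f: "loop m n f"
  shows "homotopy_map n Y y0 p (hclass n X x0 (j \<circ> f)) = hclass n Y y0 (j' \<circ> f)"
proof -
  obtain i where i: "homeomorphic_maps (T m) X j i" using M unfolding is_model_def homeomorphic_map_maps by blast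
  have j': "continuous_map (T l) Y j'" using M' homeomorphic_imp_continuous_map unfolding is_model_def by blast
  have "continuous_map X (T l) i" using i T_lift[OF _ ml] unfolding homeomorphic_maps_def by blast
  then have "continuous_map X Y (j' \<circ> i)" using j' by (rule continuous_map_compose)
  moreover have "(j' \<circ> i) x = p x" if "x \<in> topspace X" for x
    using p[of "i x"] i that continuous_map_in[of X "T m" i] unfolding homeomorphic_maps_def by auto
  ultimately have pc: "continuous_map X Y p" by (rule continuous_map_eq)
  have "p x0 = y0" using p[OF T_one] M M' unfolding is_model_def by auto
  then have "homotopy_map n Y y0 p (hclass n X x0 (j \<circ> f)) = hclass n Y y0 (p \<circ> (j \<circ> f))"
    using homotopy_map_hclass[OF model_lp[OF M f] pc] by blast
  also have "\<dots> = hclass n Y y0 (j' \<circ> f)"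
    using p f continuous_map_in[of "cube n" "T m" f] by (intro hclass_cong) (auto simp: loop_def)
  finally show ?thesis .
qed

end

text \<open>\<open>X\<close> stands for \<open>GL(A)\<close>, \<open>L m\<close> for the general linear group of \<open>(m + 1) \<times> (m + 1)\<close> matrices, \<open>tr\<close> for the
  corner embeddings and \<open>e\<close> for the passage from elements of \<open>A\<close> to \<open>1 \<times> 1\<close> matrices. With these data \<open>colim\<close> and
  \<open>nat_map\<close> below are literally the K-group and the natural map whose bijectivity is Bott stability.\<close>

locale stage_models = filtered_group G T for G :: "('a, 'm) monoid_scheme" (structure) and T +
  fixes L :: "nat \<Rightarrow> 'l topology" and b :: "nat \<Rightarrow> 'l" and j :: "nat \<Rightarrow> 'a \<Rightarrow> 'l" and tr :: "nat \<Rightarrow> nat \<Rightarrow> 'l \<Rightarrow> 'l"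
    and X :: "'x topology" and x0 :: 'x and jX :: "'a \<Rightarrow> 'x" and e :: "'x \<Rightarrow> 'l"
  assumes model: "is_model m (L m) (b m) (j m)"
    and tr: "m \<le> l \<Longrightarrow> a \<in> topspace (T m) \<Longrightarrow> tr m l (j m a) = j l a"
    and modelX: "is_model 0 X x0 jX"
    and e: "a \<in> topspace (T 0) \<Longrightarrow> e (jX a) = j 0 a"
begin

definition stg :: "nat \<Rightarrow> nat \<Rightarrow> ((nat \<Rightarrow> real) \<Rightarrow> 'l) set monoid" where
  "stg n m = homotopy_group n (L m) (b m)"

definition trn :: "nat \<Rightarrow> nat \<Rightarrow> nat \<Rightarrow> ((nat \<Rightarrow> real) \<Rightarrow> 'l) set \<Rightarrow> ((nat \<Rightarrow> real) \<Rightarrow> 'l) set" where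
  "trn n m l = homotopy_map n (L l) (b l) (tr m l)"

definition colim :: "nat \<Rightarrow> (nat \<times> ((nat \<Rightarrow> real) \<Rightarrow> 'l) set) set monoid" where
  "colim n = direct_limit (stg n) (trn n)"

definition nat_map :: "nat \<Rightarrow> ((nat \<Rightarrow> real) \<Rightarrow> 'x) set \<Rightarrow> (nat \<times> ((nat \<Rightarrow> real) \<Rightarrow> 'l) set) set" where
  "nat_map n C = direct_limit_map (stg n) (trn n) (\<lambda>m. homotopy_map n (L m) (b m) id)
     (lim_class (stg n) (trn n) 0 (homotopy_map n (L 0) (b 0) e C))"

text \<open>The classes of a loop in its stage and in the direct limit, and of a loop of the first stage in \<open>X\<close>.\<close>

definition \<kappa> :: "nat \<Rightarrow> nat \<Rightarrow> ((nat \<Rightarrow> real) \<Rightarrow> 'a) \<Rightarrow> ((nat \<Rightarrow> real) \<Rightarrow> 'l) set" where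
  "\<kappa> n m f = hclass n (L m) (b m) (j m \<circ> f)"

definition \<Lambda> :: "nat \<Rightarrow> nat \<Rightarrow> ((nat \<Rightarrow> real) \<Rightarrow> 'a) \<Rightarrow> (nat \<times> ((nat \<Rightarrow> real) \<Rightarrow> 'l) set) set" where
  "\<Lambda> n m f = lim_class (stg n) (trn n) m (\<kappa> n m f)"

definition \<kappa>X :: "nat \<Rightarrow> ((nat \<Rightarrow> real) \<Rightarrow> 'a) \<Rightarrow> ((nat \<Rightarrow> real) \<Rightarrow> 'x) set" where
  "\<kappa>X n f = hclass n X x0 (jX \<circ> f)"

lemma \<kappa>_eq_iff: "loop m n f \<Longrightarrow> loop m n g \<Longrightarrow> \<kappa> n m f = \<kappa> n m g \<longleftrightarrow> eqv m n f g"
  unfolding \<kappa>_def by (rule model_hclass_eq_iff[OF model])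

lemma \<kappa>_carrier: "carrier (stg n m) = {\<kappa> n m f | f. loop m n f}"
  unfolding \<kappa>_def stg_def by (rule model_carrier[OF model])

lemma \<kappa>_trn: "m \<le> l \<Longrightarrow> loop m n f \<Longrightarrow> trn n m l (\<kappa> n m f) = \<kappa> n l f"
  unfolding \<kappa>_def trn_def by (rule model_transfer[OF model model]) (auto simp: tr)

lemma \<Lambda>_eq: "loop m n f \<Longrightarrow> \<Lambda> n m f = {(l, \<kappa> n l g) | l g. loop l n g \<and> (\<exists>k\<ge>max m l. eqv k n f g)}"
proof -
  assume f: "loop m n f"
  have "trn n m k (\<kappa> n m f) = trn n l k (\<kappa> n l g) \<longleftrightarrow> eqv k n f g" if "k \<ge> max m l" "loop l n g" for k l g
  proof -
    have "m \<le> k" "l \<le> k" using that by auto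
    then show ?thesis using \<kappa>_trn f that(2) \<kappa>_eq_iff loop_lift by metis
  qed
  then show ?thesis unfolding \<Lambda>_def lim_class_def \<kappa>_carrier by blast
qed

lemma \<kappa>_in_\<Lambda>: "loop m n f \<Longrightarrow> (m, \<kappa> n m f) \<in> \<Lambda> n m f"
  by (subst \<Lambda>_eq) (auto intro!: exI[of _ f] exI[of _ m] eqv_refl)

lemma \<Lambda>_eq_iff:
  assumes f: "loop m n f" and g: "loop l n g"
  shows "\<Lambda> n m f = \<Lambda> n l g \<longleftrightarrow> (\<exists>k\<ge>max m l. eqv k n f g)"
proof
  assume "\<Lambda> n m f = \<Lambda> n l g"
  moreover have "(l, \<kappa> n l g) \<in> \<Lambda> n l g" using g by (rule \<kappa>_in_\<Lambda>)
  ultimately have "(l, \<kappa> n l g) \<in> \<Lambda> n m f" by simp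
  then obtain h k where h: "\<kappa> n l g = \<kappa> n l h" "loop l n h" "k \<ge> max m l" "eqv k n f h" unfolding \<Lambda>_eq[OF f] by auto
  have "eqv k n h g" using \<kappa>_eq_iff[OF h(2) g] h(1,3) eqv_lift by auto
  then have "eqv k n f g" using eqv_trans[OF h(4)] loop_lift f g h(2,3) by auto
  then show "\<exists>k\<ge>max m l. eqv k n f g" using h(3) by blast
next
  have sub: "\<Lambda> n l g \<subseteq> \<Lambda> n m f" if f: "loop m n f" and g: "loop l n g" and ex: "\<exists>k\<ge>max m l. eqv k n f g" for f g m l
  proof -
    obtain k where k: "k \<ge> max m l" "eqv k n f g" using ex by blast
    have "\<exists>k'\<ge>max m l'. eqv k' n f h" if h: "loop l' n h" "\<exists>k'\<ge>max l l'. eqv k' n g h" for l' h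
    proof -
      obtain k' where k': "k' \<ge> max l l'" "eqv k' n g h" using h by blast
      let ?k = "max k k'"
      have le: "k \<le> ?k" "k' \<le> ?k" "m \<le> ?k" "l \<le> ?k" "l' \<le> ?k" using k(1) k'(1) by auto
      have "eqv ?k n f h"
        by (rule eqv_trans[OF eqv_lift[OF k(2) le(1)] eqv_lift[OF k'(2) le(2)] loop_lift[OF f le(3)] loop_lift[OF g le(4)] loop_lift[OF h(1) le(5)]])
      then show ?thesis using le by (intro exI[of _ ?k]) simp
    qed
    then show ?thesis unfolding \<Lambda>_eq[OF f] \<Lambda>_eq[OF g] by blast
  qed
  assume ex: "\<exists>k\<ge>max m l. eqv k n f g"
  then have "\<exists>k\<ge>max l m. eqv k n g f" using eqv_sym loop_lift f g by (metis max.bounded_iff)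
  then show "\<Lambda> n m f = \<Lambda> n l g" using sub[OF f g ex] sub[OF g f] by blast
qed

lemma \<Lambda>_lift: "loop m n f \<Longrightarrow> m \<le> l \<Longrightarrow> \<Lambda> n m f = \<Lambda> n l f"
  using \<Lambda>_eq_iff loop_lift eqv_refl by (metis max.bounded_iff order_refl)

lemma colim_carrier: "carrier (colim n) = {\<Lambda> n m f | m f. loop m n f}"
  unfolding colim_def direct_limit_def \<Lambda>_def using \<kappa>_carrier by fastforce

lemma colim_one: "\<one>\<^bsub>colim n\<^esub> = \<Lambda> n 0 (\<lambda>z. \<one>)"
  unfolding colim_def direct_limit_def \<Lambda>_def \<kappa>_def stg_def using model_one[OF model] by simp

lemma colim_mult:
  assumes n: "n > 0" and f: "loop m n f" and g: "loop m n g"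
  shows "\<Lambda> n m f \<otimes>\<^bsub>colim n\<^esub> \<Lambda> n m g = \<Lambda> n m (\<lambda>z. f z \<otimes> g z)"
proof -
  let ?t = "\<lambda>k x l y. lim_class (stg n) (trn n) (max k l) (trn n k (max k l) x \<otimes>\<^bsub>stg n (max k l)\<^esub> trn n l (max k l) y)"
  have 1: "?t k x l y = \<Lambda> n m (\<lambda>z. f z \<otimes> g z)" if fx: "(k, x) \<in> \<Lambda> n m f" and gy: "(l, y) \<in> \<Lambda> n m g" for k x l y
  proof -
    obtain f' q where f': "x = \<kappa> n k f'" "loop k n f'" "q \<ge> max m k" "eqv q n f f'" using fx unfolding \<Lambda>_eq[OF f] by auto
    obtain g' r where g': "y = \<kappa> n l g'" "loop l n g'" "r \<ge> max m l" "eqv r n g g'" using gy unfolding \<Lambda>_eq[OF g] by auto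
    let ?M = "max k l"
    have fM: "loop ?M n f'" "loop ?M n g'" using f' g' loop_lift by auto
    have "?t k x l y = lim_class (stg n) (trn n) ?M (\<kappa> n ?M f' \<otimes>\<^bsub>stg n ?M\<^esub> \<kappa> n ?M g')"
      unfolding f'(1) g'(1) using \<kappa>_trn f'(2) g'(2) by simp
    also have "\<dots> = \<Lambda> n ?M (\<lambda>z. f' z \<otimes> g' z)"
      unfolding \<Lambda>_def \<kappa>_def stg_def by (simp only: model_mult[OF model n fM])
    also have "\<dots> = \<Lambda> n m (\<lambda>z. f z \<otimes> g z)"
    proof -
      let ?k = "max (max q r) (max m ?M)"
      have le: "q \<le> ?k" "r \<le> ?k" "m \<le> ?k" "k \<le> ?k" "l \<le> ?k" by auto
      note lps = loop_lift[OF f le(3)] loop_lift[OF f'(2) le(4)] loop_lift[OF g le(3)] loop_lift[OF g'(2) le(5)]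
      have "eqv ?k n f' f" "eqv ?k n g' g"
        using eqv_sym[OF eqv_lift[OF f'(4) le(1)]] eqv_sym[OF eqv_lift[OF g'(4) le(2)]] lps by blast+
      then have "eqv ?k n (\<lambda>z. f' z \<otimes> g' z) (\<lambda>z. f z \<otimes> g z)"
        by (rule eqv_mult[OF _ _ lps(2,1,4,3)])
      then show ?thesis using \<Lambda>_eq_iff[OF loop_mult[OF fM] loop_mult[OF f g]] by (metis max.cobounded2 max.commute)
    qed
    finally show ?thesis .
  qed
  have "(m, \<kappa> n m f) \<in> \<Lambda> n m f" "(m, \<kappa> n m g) \<in> \<Lambda> n m g"
    by (rule \<kappa>_in_\<Lambda>[OF f], rule \<kappa>_in_\<Lambda>[OF g])
  then have "(\<Union>(k, x)\<in>\<Lambda> n m f. \<Union>(l, y)\<in>\<Lambda> n m g. ?t k x l y) = \<Lambda> n m (\<lambda>z. f z \<otimes> g z)"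
    using 1 by fast
  then show ?thesis by (simp add: colim_def direct_limit_def)
qed

lemma colim_common:
  assumes "x \<in> carrier (colim n)" "y \<in> carrier (colim n)"
  obtains m f g where "loop m n f" "loop m n g" "x = \<Lambda> n m f" "y = \<Lambda> n m g"
proof -
  obtain m f l g where "loop m n f" "x = \<Lambda> n m f" "loop l n g" "y = \<Lambda> n l g" using assms unfolding colim_carrier by blast
  then show ?thesis using that[of "max m l" f g] loop_lift \<Lambda>_lift by (metis max.cobounded1 max.cobounded2)
qed

lemma colim_comm_group: assumes n: "n > 0" shows "comm_group (colim n)"
proof (rule comm_groupI)
  have eq: "\<Lambda> n m f = \<Lambda> n m g" if "eqv m n f g" "loop m n f" "loop m n g" for m f g
    using \<Lambda>_eq_iff that by auto
  have one: "\<one>\<^bsub>colim n\<^esub> = \<Lambda> n m (\<lambda>z. \<one>)" for m unfolding colim_one using \<Lambda>_lift loop_one by blast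
  note car = colim_carrier
  note mlt = colim_mult[OF n]
  let ?H = "colim n"
  show "\<one>\<^bsub>?H\<^esub> \<in> carrier ?H" unfolding colim_one car using loop_one by blast
  fix x assume x: "x \<in> carrier ?H"
  then obtain m f where f: "loop m n f" "x = \<Lambda> n m f" unfolding car by blast
  have "\<one>\<^bsub>?H\<^esub> \<otimes>\<^bsub>?H\<^esub> x = \<Lambda> n m (\<lambda>z. \<one> \<otimes> f z)" unfolding one[of m] f(2) by (rule mlt[OF loop_one f(1)])
  also have "\<dots> = x" unfolding f(2)
    by (intro eq eqvI loop_mult loop_one f(1)) (use loop_carrier[OF f(1)] in simp)
  finally show "\<one>\<^bsub>?H\<^esub> \<otimes>\<^bsub>?H\<^esub> x = x" .
  show "\<exists>y\<in>carrier ?H. y \<otimes>\<^bsub>?H\<^esub> x = \<one>\<^bsub>?H\<^esub>"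
  proof (intro bexI)
    have "\<Lambda> n m (\<lambda>z. inv (f z)) \<otimes>\<^bsub>?H\<^esub> x = \<Lambda> n m (\<lambda>z. inv (f z) \<otimes> f z)" unfolding f(2) by (rule mlt[OF loop_inv[OF f(1)] f(1)])
    also have "\<dots> = \<one>\<^bsub>?H\<^esub>" unfolding one[of m]
      by (intro eq eqvI loop_mult loop_inv loop_one f(1)) (use loop_carrier[OF f(1)] in simp)
    finally show "\<Lambda> n m (\<lambda>z. inv (f z)) \<otimes>\<^bsub>?H\<^esub> x = \<one>\<^bsub>?H\<^esub>" .
    show "\<Lambda> n m (\<lambda>z. inv (f z)) \<in> carrier ?H" unfolding car using loop_inv[OF f(1)] by blast
  qed
  fix y assume y: "y \<in> carrier ?H"
  obtain l g h where gh: "loop l n g" "loop l n h" "x = \<Lambda> n l g" "y = \<Lambda> n l h" using colim_common[OF x y] .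
  show "x \<otimes>\<^bsub>?H\<^esub> y \<in> carrier ?H"
    unfolding gh(3,4) mlt[OF gh(1,2)] car using loop_mult[OF gh(1,2)] by blast
  show "x \<otimes>\<^bsub>?H\<^esub> y = y \<otimes>\<^bsub>?H\<^esub> x" unfolding gh(3,4) mlt[OF gh(1,2)] mlt[OF gh(2,1)]
    by (intro eq mult_commute_eqv n gh(1,2) loop_mult)
  fix w assume "w \<in> carrier ?H"
  then obtain k u where u: "loop k n u" "w = \<Lambda> n k u" unfolding car by blast
  define M where "M = max k l"
  have M: "loop M n u" "loop M n g" "loop M n h" using u gh loop_lift unfolding M_def by auto
  have xyw: "x = \<Lambda> n M g" "y = \<Lambda> n M h" "w = \<Lambda> n M u" unfolding gh u M_def using \<Lambda>_lift gh u by auto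
  have "\<Lambda> n M (\<lambda>z. g z \<otimes> h z \<otimes> u z) = \<Lambda> n M (\<lambda>z. g z \<otimes> (h z \<otimes> u z))"
    by (intro eq eqvI loop_mult M) (use loop_carrier[OF M(1)] loop_carrier[OF M(2)] loop_carrier[OF M(3)] in \<open>simp add: m_assoc\<close>)
  then show "x \<otimes>\<^bsub>?H\<^esub> y \<otimes>\<^bsub>?H\<^esub> w = x \<otimes>\<^bsub>?H\<^esub> (y \<otimes>\<^bsub>?H\<^esub> w)"
    unfolding xyw by (simp add: mlt loop_mult M)
qed

lemma nat_map_\<kappa>X:
  assumes f: "loop 0 n f"
  shows "nat_map n (\<kappa>X n f) = \<Lambda> n 0 f"
proof -
  have "homotopy_map n (L 0) (b 0) e (\<kappa>X n f) = \<kappa> n 0 f"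
    unfolding \<kappa>X_def \<kappa>_def by (rule model_transfer[OF modelX model]) (auto simp: e f)
  then have "nat_map n (\<kappa>X n f) = (\<Union>(m, x)\<in>\<Lambda> n 0 f. lim_class (stg n) (trn n) m (homotopy_map n (L m) (b m) id x))"
    by (simp add: nat_map_def direct_limit_map_def \<Lambda>_def)
  moreover have "lim_class (stg n) (trn n) m (homotopy_map n (L m) (b m) id x) = \<Lambda> n 0 f" if mx: "(m, x) \<in> \<Lambda> n 0 f" for m x
  proof -
    obtain g k where g: "x = \<kappa> n m g" "loop m n g" "k \<ge> max 0 m" "eqv k n f g" using mx unfolding \<Lambda>_eq[OF f] by auto
    have "homotopy_map n (L m) (b m) id x = \<kappa> n m g"
      unfolding g(1) \<kappa>_def by (rule model_transfer[OF model model]) (auto simp: g)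
    then have "lim_class (stg n) (trn n) m (homotopy_map n (L m) (b m) id x) = \<Lambda> n m g" by (simp add: \<Lambda>_def)
    then show ?thesis using \<Lambda>_eq_iff[OF f g(2)] g(3,4) by blast
  qed
  moreover have "(0, \<kappa> n 0 f) \<in> \<Lambda> n 0 f" using f by (rule \<kappa>_in_\<Lambda>)
  ultimately show ?thesis by fast
qed

lemma \<kappa>X_carrier: "carrier (homotopy_group n X x0) = {\<kappa>X n f | f. loop 0 n f}"
  unfolding \<kappa>X_def by (rule model_carrier[OF modelX])

lemma nat_map_hom: assumes n: "n > 0" shows "nat_map n \<in> hom (homotopy_group n X x0) (colim n)"
proof (rule homI)
  fix x y assume "x \<in> carrier (homotopy_group n X x0)" "y \<in> carrier (homotopy_group n X x0)"
  then obtain f g where f: "loop 0 n f" "x = \<kappa>X n f" and g: "loop 0 n g" "y = \<kappa>X n g" unfolding \<kappa>X_carrier by blast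
  show "nat_map n x \<in> carrier (colim n)" unfolding f(2) nat_map_\<kappa>X[OF f(1)] colim_carrier using f by blast
  have "x \<otimes>\<^bsub>homotopy_group n X x0\<^esub> y = \<kappa>X n (\<lambda>z. f z \<otimes> g z)"
    unfolding f(2) g(2) \<kappa>X_def by (rule model_mult[OF modelX n f(1) g(1)])
  then show "nat_map n (x \<otimes>\<^bsub>homotopy_group n X x0\<^esub> y) = nat_map n x \<otimes>\<^bsub>colim n\<^esub> nat_map n y"
    unfolding f(2) g(2) nat_map_\<kappa>X[OF f(1)] nat_map_\<kappa>X[OF g(1)] colim_mult[OF n f(1) g(1)]
    using nat_map_\<kappa>X[OF loop_mult[OF f(1) g(1)]] by simp
qed

lemma \<kappa>X_pow:
  assumes n: "n > 0" and f: "loop 0 n f"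
  shows "\<kappa>X n f [^]\<^bsub>homotopy_group n X x0\<^esub> (N::nat) = \<kappa>X n (\<lambda>z. f z [^] N)"
proof (induction N)
  case 0 show ?case unfolding \<kappa>X_def using model_one[OF modelX] by simp
next
  case (Suc N)
  then show ?case using model_mult[OF modelX n loop_pow[OF f] f] by (simp add: \<kappa>X_def)
qed

lemma \<Lambda>_pow:
  assumes n: "n > 0" and f: "loop m n f"
  shows "\<Lambda> n m f [^]\<^bsub>colim n\<^esub> (N::nat) = \<Lambda> n m (\<lambda>z. f z [^] N)"
proof (induction N)
  case 0 show ?case using colim_one \<Lambda>_lift[OF loop_one, of 0 m n] by simp
next
  case (Suc N)
  then show ?case using colim_mult[OF n loop_pow[OF f] f] by simp
qed

text \<open>Stability of loops is an isomorphism statement up to \<open>S\<close>-torsion.\<close>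

theorem stable_iff:
  "stable S \<longleftrightarrow> (\<forall>n>0.
     (\<forall>x\<in>carrier (homotopy_group n X x0). nat_map n x = \<one>\<^bsub>colim n\<^esub> \<longrightarrow>
        (\<exists>N\<in>S. x [^]\<^bsub>homotopy_group n X x0\<^esub> (N::nat) = \<one>\<^bsub>homotopy_group n X x0\<^esub>)) \<and>
     (\<forall>y\<in>carrier (colim n). \<exists>N\<in>S. \<exists>x\<in>carrier (homotopy_group n X x0). y [^]\<^bsub>colim n\<^esub> (N::nat) = nat_map n x))"
  (is "_ \<longleftrightarrow> (\<forall>n>0. ?I n \<and> ?J n)")
proof -
  have eqv1: "eqv m n f (\<lambda>z. \<one>) \<longleftrightarrow> null_loop m n f" if f: "loop m n f" for m n f
    unfolding eqv_def using null_loop_cong[of m n f "\<lambda>z. f z \<otimes> inv \<one>"] null_loop_cong[of m n "\<lambda>z. f z \<otimes> inv \<one>" f] loop_carrier[OF f]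
    by auto
  have X1: "\<kappa>X n f = \<one>\<^bsub>homotopy_group n X x0\<^esub> \<longleftrightarrow> null_loop 0 n f" if f: "loop 0 n f" for n f
    unfolding model_one[OF modelX] \<kappa>X_def model_hclass_eq_iff[OF modelX f loop_one] by (rule eqv1[OF f])
  have L1: "\<Lambda> n m f = \<one>\<^bsub>colim n\<^esub> \<longleftrightarrow> (\<exists>k\<ge>m. null_loop k n f)" if f: "loop m n f" for n m f
    unfolding colim_one \<Lambda>_eq_iff[OF f loop_one] using eqv1 loop_lift[OF f] by auto
  have up: "(\<exists>m. null_loop m n f) \<longleftrightarrow> (\<exists>k\<ge>0. null_loop k n f)" for n f by simp
  have I: "?I n \<longleftrightarrow> (\<forall>f m. loop 0 n f \<and> null_loop m n f \<longrightarrow> (\<exists>N\<in>S. null_loop 0 n (\<lambda>z. f z [^] N)))" if n: "n > 0" for n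
  proof -
    have "?I n \<longleftrightarrow> (\<forall>f. loop 0 n f \<longrightarrow> nat_map n (\<kappa>X n f) = \<one>\<^bsub>colim n\<^esub> \<longrightarrow>
        (\<exists>N\<in>S. \<kappa>X n f [^]\<^bsub>homotopy_group n X x0\<^esub> (N::nat) = \<one>\<^bsub>homotopy_group n X x0\<^esub>))"
      unfolding \<kappa>X_carrier by blast
    also have "\<dots> \<longleftrightarrow> (\<forall>f. loop 0 n f \<longrightarrow> (\<exists>k. null_loop k n f) \<longrightarrow> (\<exists>N\<in>S. null_loop 0 n (\<lambda>z. f z [^] N)))"
      using nat_map_\<kappa>X L1 \<kappa>X_pow[OF n] X1 loop_pow by (simp cong: conj_cong imp_cong)
    finally show ?thesis by blast
  qed
  have J: "?J n \<longleftrightarrow> (\<forall>g m. loop m n g \<longrightarrow> (\<exists>N\<in>S. \<exists>m' f. loop 0 n f \<and> null_loop m' n (\<lambda>z. g z [^] N \<otimes> inv (f z))))" if n: "n > 0" for n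
  proof -
    have *: "\<Lambda> n m g [^]\<^bsub>colim n\<^esub> N = nat_map n (\<kappa>X n f) \<longleftrightarrow> (\<exists>m'. null_loop m' n (\<lambda>z. g z [^] N \<otimes> inv (f z)))"
      if g: "loop m n g" and f: "loop 0 n f" for g m f and N :: nat
      unfolding \<Lambda>_pow[OF n g] nat_map_\<kappa>X[OF f] \<Lambda>_eq_iff[OF loop_pow[OF g] f] eqv_def
      by (meson null_loop_lift max.cobounded1 max.cobounded2 linorder_linear)
    have "?J n \<longleftrightarrow> (\<forall>g m. loop m n g \<longrightarrow> (\<exists>N\<in>S. \<exists>f. loop 0 n f \<and> \<Lambda> n m g [^]\<^bsub>colim n\<^esub> N = nat_map n (\<kappa>X n f)))"
      unfolding \<kappa>X_carrier colim_carrier by blast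
    also have "\<dots> \<longleftrightarrow> (\<forall>g m. loop m n g \<longrightarrow> (\<exists>N\<in>S. \<exists>m' f. loop 0 n f \<and> null_loop m' n (\<lambda>z. g z [^] N \<otimes> inv (f z))))"
      using * by (simp cong: conj_cong imp_cong) blast
    finally show ?thesis .
  qed
  show ?thesis unfolding stable_def using I J by simp
qed

end

section \<open>Tensoring with the rationals\<close>

lemma rat_scale_int: "\<exists>b::nat. b > 0 \<and> (\<exists>k::int. (q::rat) * of_nat b = of_int k)"
proof -
  obtain a d where "quotient_of q = (a, d)" by (cases "quotient_of q")
  then have d: "d > 0" "q = of_int a / of_int d"
    using quotient_of_denom_pos quotient_of_div by blast+
  then have "q * of_nat (nat d) = of_int a" by simp
  then show ?thesis using d by (intro exI[of _ "nat d"]) auto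
qed

text \<open>The exponent \<open>\<lfloor>q D\<rfloor>\<close> is defined for all rational \<open>q\<close> and is additive once \<open>D\<close> clears the denominators.\<close>

lemma floor_add_of_int_scaled:
  fixes p q :: rat
  assumes "p * of_nat b = of_int k" "q * of_nat c = of_int l" "b * c dvd D"
  shows "\<lfloor>(p + q) * of_nat D\<rfloor> = \<lfloor>p * of_nat D\<rfloor> + \<lfloor>q * of_nat D\<rfloor>"
proof -
  obtain e where D: "D = b * c * e" using assms(3) by blast
  have "p * of_nat D = of_int (k * int c * int e)"
    unfolding D using assms(1) by (simp add: algebra_simps)
  moreover have "q * of_nat D = of_int (l * int b * int e)"
    unfolding D using assms(2) by (simp add: algebra_simps)
  ultimately show ?thesis
    by (metis floor_of_int of_int_add distrib_right)
qed

context comm_group begin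

abbreviation tns :: "'a \<Rightarrow> rat \<Rightarrow> ('a \<times> rat \<Rightarrow>\<^sub>0 int)" where "tns x q \<equiv> frag_of (x, q)"

abbreviation "tfree \<equiv> free_Abelian_group (carrier G \<times> (UNIV::rat set))"

abbreviation teq :: "('a \<times> rat \<Rightarrow>\<^sub>0 int) \<Rightarrow> ('a \<times> rat \<Rightarrow>\<^sub>0 int) \<Rightarrow> bool" where
  "teq a b \<equiv> a - b \<in> tensor_sub G"

lemma tensor_rels_carrier: "tensor_rels G \<subseteq> carrier tfree"
proof
  fix a assume "a \<in> tensor_rels G"
  then have "Poly_Mapping.keys a \<subseteq> carrier G \<times> UNIV" unfolding tensor_rels_def
    by (auto dest!: subsetD[OF keys_diff] simp: keys_frag_of)
  then show "a \<in> carrier tfree" by simp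
qed

lemma tensor_sub_carrier: "tensor_sub G \<subseteq> carrier tfree"
  unfolding tensor_sub_def using group.generate_incl[OF group_free_Abelian_group tensor_rels_carrier] .

lemma tensor_sub_subgroup: "subgroup (tensor_sub G) tfree"
  unfolding tensor_sub_def by (rule group.generate_is_subgroup[OF group_free_Abelian_group tensor_rels_carrier])

lemma tensor_sub_normal: "tensor_sub G \<lhd> tfree"
  by (rule comm_group.subgroup_imp_normal[OF abelian_free_Abelian_group tensor_sub_subgroup])

lemma ts_zero: "0 \<in> tensor_sub G"
  using subgroup.one_closed[OF tensor_sub_subgroup] by simp

lemma ts_add: "a \<in> tensor_sub G \<Longrightarrow> b \<in> tensor_sub G \<Longrightarrow> a + b \<in> tensor_sub G"
  using subgroup.m_closed[OF tensor_sub_subgroup] by simp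

lemma ts_minus: "a \<in> tensor_sub G \<Longrightarrow> - a \<in> tensor_sub G"
proof -
  assume a: "a \<in> tensor_sub G"
  then have "Poly_Mapping.keys a \<subseteq> carrier G \<times> UNIV"
    using subsetD[OF tensor_sub_carrier a] by simp
  from inv_free_Abelian_group[OF this] show ?thesis
    using subgroup.m_inv_closed[OF tensor_sub_subgroup a] by simp
qed

lemma ts_diff: "a \<in> tensor_sub G \<Longrightarrow> b \<in> tensor_sub G \<Longrightarrow> a - b \<in> tensor_sub G"
  using ts_add[OF _ ts_minus] by fastforce

lemma teq_sym: "teq a b \<Longrightarrow> teq b a" using ts_minus[of "a - b"] by simp

lemma teq_trans: "teq a b \<Longrightarrow> teq b c \<Longrightarrow> teq a c" using ts_add[of "a - b" "b - c"] by simp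

lemma teq_diff: "teq a b \<Longrightarrow> teq c d \<Longrightarrow> teq (a - c) (b - d)"
  using ts_diff[of "a - b" "c - d"] by (simp add: algebra_simps)

lemma tns_mult: "x \<in> carrier G \<Longrightarrow> y \<in> carrier G \<Longrightarrow> tns (x \<otimes> y) q - tns x q - tns y q \<in> tensor_sub G"
  unfolding tensor_sub_def tensor_rels_def by (rule generate.incl) blast

lemma tns_add: "x \<in> carrier G \<Longrightarrow> tns x (p + q) - tns x p - tns x q \<in> tensor_sub G"
  unfolding tensor_sub_def tensor_rels_def by (rule generate.incl) blast

lemma tns_one: "tns \<one> q \<in> tensor_sub G"
  using ts_minus[OF tns_mult[OF one_closed one_closed, of q]] by simp

lemma tns_zero: "x \<in> carrier G \<Longrightarrow> tns x 0 \<in> tensor_sub G"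
  using ts_minus[OF tns_add[of x 0 0]] by simp

lemma tns_inv: assumes x: "x \<in> carrier G" shows "teq (tns (inv x) q) (- tns x q)"
  using ts_diff[OF tns_one[of q] tns_mult[OF x inv_closed[OF x], of q]] x by (simp add: add.commute)

lemma tns_pow: assumes x: "x \<in> carrier G" shows "teq (tns (x [^] (n::nat)) q) (frag_cmul (int n) (tns x q))"
proof (induction n)
  case 0 show ?case using tns_one by simp
next
  case (Suc n)
  have "tns (x [^] n \<otimes> x) q - tns (x [^] n) q - tns x q + (tns (x [^] n) q - frag_cmul (int n) (tns x q)) \<in> tensor_sub G"
    using x by (intro ts_add[OF tns_mult Suc]) auto
  then show ?case by (simp add: frag_cmul_distrib algebra_simps)
qed

lemma tns_scale: assumes x: "x \<in> carrier G" shows "teq (tns x (of_nat n * q)) (frag_cmul (int n) (tns x q))"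
proof (induction n)
  case 0 show ?case using tns_zero[OF x] by simp
next
  case (Suc n)
  have "tns x (of_nat n * q + q) - tns x (of_nat n * q) - tns x q + (tns x (of_nat n * q) - frag_cmul (int n) (tns x q)) \<in> tensor_sub G"
    using x by (intro ts_add[OF tns_add Suc]) auto
  then show ?case by (simp add: frag_cmul_distrib algebra_simps)
qed

lemma tns_pow_scale: "x \<in> carrier G \<Longrightarrow> teq (tns (x [^] (n::nat)) q) (tns x (of_nat n * q))"
  by (meson tns_pow tns_scale teq_trans teq_sym)

lemma tns_neg: assumes x: "x \<in> carrier G" shows "teq (tns x (- q)) (tns (inv x) q)"
proof -
  have "teq (tns x (- q)) (- tns x q)"
    using ts_diff[OF tns_zero[OF x] tns_add[OF x, of "- q" q]] by (simp add: algebra_simps)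
  then show ?thesis using teq_trans teq_sym[OF tns_inv[OF x]] by blast
qed

text \<open>Common denominators turn every tensor into an elementary one.\<close>

lemma tensor_elementary:
  assumes "a \<in> carrier tfree"
  shows "\<exists>x\<in>carrier G. \<exists>D::nat. D > 0 \<and> teq a (tns x (1 / of_nat D))"
proof -
  have "Poly_Mapping.keys a \<subseteq> carrier G \<times> UNIV" using assms by simp
  then show ?thesis
  proof (induction a rule: frag_induction)
    case zero
    show ?case using tns_one[of "1 / of_nat 1"] ts_minus by (intro bexI[of _ \<one>] exI[of _ 1]) auto
  next
    case (one xq)
    obtain x q where xq: "xq = (x, q)" "x \<in> carrier G" using one by auto
    obtain b k where b: "b > 0" "q * of_nat b = of_int k" using rat_scale_int by blast
    show ?case
    proof (cases "k \<ge> 0")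
      case True
      then have "q = of_nat (nat k) * (1 / of_nat b)" using b by (simp add: field_simps)
      then have "teq (tns (x [^] nat k) (1 / of_nat b)) (tns x q)" using tns_pow_scale[OF xq(2)] by metis
      then show ?thesis using b xq teq_sym by (intro bexI[of _ "x [^] nat k"] exI[of _ b]) auto
    next
      case False
      then have "q = - (of_nat (nat (- k)) * (1 / of_nat b))" using b by (simp add: field_simps)
      then have "teq (tns x q) (tns (inv x) (of_nat (nat (- k)) * (1 / of_nat b)))" using tns_neg[OF xq(2)] by metis
      then have "teq (tns x q) (tns (inv x [^] nat (- k)) (1 / of_nat b))"
        using teq_trans teq_sym[OF tns_pow_scale[of "inv x"]] xq(2) by blast
      then show ?thesis using b xq by (intro bexI[of _ "inv x [^] nat (- k)"] exI[of _ b]) auto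
    qed
  next
    case (diff a b)
    obtain x D where x: "x \<in> carrier G" "D > 0" "teq a (tns x (1 / of_nat D))" using diff by blast
    obtain y E where y: "y \<in> carrier G" "E > 0" "teq b (tns y (1 / of_nat E))" using diff by blast
    let ?q = "1 / of_nat (D * E) :: rat"
    have "teq (tns (x [^] E) ?q) (tns x (1 / of_nat D))" "teq (tns (y [^] D) ?q) (tns y (1 / of_nat E))"
      using tns_pow_scale[OF x(1), of E ?q] tns_pow_scale[OF y(1), of D ?q] x(2) y(2) by simp_all
    then have 1: "teq (a - b) (tns (x [^] E) ?q - tns (y [^] D) ?q)"
      using teq_diff teq_trans[OF x(3) teq_sym] teq_trans[OF y(3) teq_sym] by blast
    have "tns (x [^] E \<otimes> inv (y [^] D)) ?q - tns (x [^] E) ?q - tns (inv (y [^] D)) ?q +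
       (tns (inv (y [^] D)) ?q - (- tns (y [^] D) ?q)) \<in> tensor_sub G"
      using x y by (intro ts_add[OF tns_mult tns_inv]) auto
    then have "teq (tns (x [^] E \<otimes> inv (y [^] D)) ?q) (tns (x [^] E) ?q - tns (y [^] D) ?q)"
      by (simp add: algebra_simps)
    then have "teq (a - b) (tns (x [^] E \<otimes> inv (y [^] D)) ?q)" using teq_trans[OF 1 teq_sym] by blast
    then show ?case using x y by (intro bexI[of _ "x [^] E \<otimes> inv (y [^] D)"] exI[of _ "D * E"]) auto
  qed
qed

text \<open>A vanishing elementary tensor is witnessed by finitely many relations. Clearing all
  denominators in them by a common multiple \<open>D\<close>, the assignment \<open>x \<otimes> q \<mapsto> x\<^bsup>qD\<^esup>\<close> respects these
  relations.\<close>

lemma tensor_vanish_imp_torsion: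
  assumes x: "x \<in> carrier G" and d: "d > 0" and van: "tns x (1 / of_nat d) \<in> tensor_sub G"
  shows "\<exists>E::nat. E > 0 \<and> x [^] E = \<one>"
proof -
  have "\<exists>h. h \<in> hom tfree G \<and> (\<forall>xq\<in>carrier G \<times> UNIV. h (frag_of xq) = fst xq [^] \<lfloor>snd xq * of_nat D\<rfloor>)" for D :: nat
  proof -
    have "(\<lambda>xq. fst xq [^] \<lfloor>snd xq * of_nat D\<rfloor>) ` (carrier G \<times> UNIV) \<subseteq> carrier G" by auto
    from free_Abelian_group_universal[OF this] show ?thesis by metis
  qed
  then obtain h where h: "\<And>D. h D \<in> hom tfree G"
    "\<And>D y q. y \<in> carrier G \<Longrightarrow> h D (tns y q) = y [^] \<lfloor>q * of_nat D\<rfloor>" by (metis SigmaI UNIV_I fst_conv snd_conv)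
  have gh: "group_hom tfree G (h D)" for D
    using h(1) by (intro group_hom.intro group_hom_axioms.intro group_free_Abelian_group is_group)
  have hadd: "h D (a + b) = h D a \<otimes> h D b" if "a \<in> carrier tfree" "b \<in> carrier tfree" for D a b
    using hom_mult[OF h(1) that] by simp
  have hinv: "h D (- a) = inv (h D a)" if "a \<in> carrier tfree" for D a
    using group_hom.hom_inv[OF gh that, of D] that by simp
  have hsub: "h D (a - b) = h D a \<otimes> inv (h D b)" if "a \<in> carrier tfree" "b \<in> carrier tfree" for D a b
    using hadd[of a "- b"] hinv[of b] that by simp
  have fr: "tns y q \<in> carrier tfree" if "y \<in> carrier G" for y q using that by simp
  have fr2: "a - b \<in> carrier tfree" if "a \<in> carrier tfree" "b \<in> carrier tfree" for a b
    using that keys_diff[of a b] by auto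
  have cancel: "u \<otimes> v \<otimes> inv u \<otimes> inv v = \<one>" if "u \<in> carrier G" "v \<in> carrier G" for u v
  proof -
    have "u \<otimes> v \<otimes> inv u = v \<otimes> (u \<otimes> inv u)" using that m_comm[of u v] by (simp only: m_assoc inv_closed)
    then show ?thesis using that by simp
  qed
  have rels: "\<exists>D0>0. \<forall>D. D0 dvd D \<longrightarrow> h D a = \<one>" if rel: "a \<in> tensor_rels G" for a
  proof -
    consider (m) y z q where "a = tns (y \<otimes> z) q - tns y q - tns z q" "y \<in> carrier G" "z \<in> carrier G"
      | (p) y p q where "a = tns y (p + q) - tns y p - tns y q" "y \<in> carrier G"
      using rel unfolding tensor_rels_def by blast
    then show ?thesis
    proof cases
      case m
      then have "h D a = \<one>" for D
        by (simp add: hsub fr fr2 h(2) int_pow_distrib cancel del: carrier_free_Abelian_group_iff)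
      then show ?thesis by (intro exI[of _ 1]) simp
    next
      case p
      obtain b k c l where b: "b > 0" "p * of_nat b = of_int k" "c > 0" "q * of_nat c = of_int l"
        using rat_scale_int by metis
      have "h D a = \<one>" if "b * c dvd D" for D
        using p(2) floor_add_of_int_scaled[OF b(2,4) that]
        by (simp add: p(1) hsub fr fr2 h(2) int_pow_mult cancel del: carrier_free_Abelian_group_iff)
      then show ?thesis using b by (intro exI[of _ "b * c"]) auto
    qed
  qed
  have "\<exists>D0>0. \<forall>D. D0 dvd D \<longrightarrow> h D a = \<one>" if "a \<in> generate tfree (tensor_rels G)" for a
    using that
  proof induction
    case one
    show ?case using hom_one[OF h(1) group_free_Abelian_group is_group] by (intro exI[of _ 1]) simp
  next
    case (incl a) then show ?case using rels by blast
  next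
    case (inv a)
    then have "a \<in> carrier tfree" using tensor_rels_carrier by blast
    then show ?case using rels[OF inv] hinv by (metis carrier_free_Abelian_group_iff inv_free_Abelian_group inv_one)
  next
    case (eng a b)
    obtain D0 E0 where D: "D0 > 0" "\<forall>D. D0 dvd D \<longrightarrow> h D a = \<one>" "E0 > 0" "\<forall>D. E0 dvd D \<longrightarrow> h D b = \<one>" using eng by blast
    have ab: "a \<in> carrier tfree" "b \<in> carrier tfree"
      using eng(1,2) group.generate_in_carrier[OF group_free_Abelian_group tensor_rels_carrier] by blast+
    have "h D (a \<otimes>\<^bsub>tfree\<^esub> b) = \<one>" if "D0 * E0 dvd D" for D
    proof -
      have "D0 dvd D" "E0 dvd D" using that dvd_mult_left dvd_mult_right by blast+
      then show ?thesis using D hom_mult[OF h(1) ab] by simp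
    qed
    then show ?case using D by (intro exI[of _ "D0 * E0"]) auto
  qed
  then obtain D0 where D0: "D0 > 0" "\<forall>D. D0 dvd D \<longrightarrow> h D (tns x (1 / of_nat d)) = \<one>"
    using van unfolding tensor_sub_def by blast
  have "h (D0 * d) (tns x (1 / of_nat d)) = x [^] \<lfloor>1 / of_nat d * of_nat (D0 * d) :: rat\<rfloor>" using h(2)[OF x] .
  moreover have "1 / of_nat d * of_nat (D0 * d) = (of_int (int D0) :: rat)" using d by simp
  ultimately have "x [^] D0 = \<one>" using D0(2) by (simp add: int_pow_int)
  then show ?thesis using D0(1) by blast
qed

lemma torsion_imp_tensor_vanish:
  assumes "x \<in> carrier G" "E > 0" "x [^] (E::nat) = \<one>"
  shows "tns x q \<in> tensor_sub G"
proof -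
  have "teq (tns \<one> (q / of_nat E)) (tns x q)" using tns_pow_scale[OF assms(1), of E "q / of_nat E"] assms by simp
  then show ?thesis using ts_diff[OF tns_one[of "q / of_nat E"]] by fastforce
qed

end

text \<open>Tensoring with the rationals is exact and kills exactly the torsion elements. Both facts are obtained here
  from elementary tensors: the kernel condition by comparing \<open>x \<otimes> 1/D\<close> with its image \<open>f x \<otimes> 1/D\<close>, the cokernel
  condition by comparing \<open>y \<otimes> 1\<close> with the image of some \<open>x \<otimes> 1/D\<close>, which makes \<open>y\<^bsup>D\<^esup>\<close> and \<open>f x\<close> agree up to torsion.\<close>

lemma tensor_rat_map_iso_iff:
  assumes G: "comm_group G" and H: "comm_group H" and f: "f \<in> hom G H"
  shows "tensor_rat_map H f \<in> iso (tensor_rat G) (tensor_rat H) \<longleftrightarrow>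
    (\<forall>x\<in>carrier G. f x = \<one>\<^bsub>H\<^esub> \<longrightarrow> (\<exists>N\<in>{0<..}. x [^]\<^bsub>G\<^esub> (N::nat) = \<one>\<^bsub>G\<^esub>)) \<and>
    (\<forall>y\<in>carrier H. \<exists>N\<in>{0<..}. \<exists>x\<in>carrier G. y [^]\<^bsub>H\<^esub> (N::nat) = f x)" (is "?iso \<longleftrightarrow> ?ker \<and> ?coker")
proof -
  interpret G: comm_group G by (rule G)
  interpret H: comm_group H by (rule H)
  interpret f: group_hom G H f using f by unfold_locales
  let ?F = "frag_extend (\<lambda>(x, q). frag_of (f x, q))"
  let ?R = "tensor_sub G" and ?Q = "tensor_sub H"
  have Ft: "?F (frag_of (x, q)) = frag_of (f x, q)" for x q by simp
  have Fcar: "?F a \<in> carrier H.tfree" if a: "a \<in> carrier G.tfree" for a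
  proof -
    have "Poly_Mapping.keys a \<subseteq> carrier G \<times> UNIV" using a by simp
    then have "Poly_Mapping.keys (?F a) \<subseteq> carrier H \<times> UNIV"
    proof (induction a rule: frag_induction)
      case (diff a b)
      then show ?case using keys_diff[of "?F a" "?F b"] by (auto simp: frag_extend_diff)
    qed auto
    then show ?thesis by simp
  qed
  have Frel: "?F a \<in> ?Q" if "a \<in> tensor_rels G" for a
    using that unfolding tensor_rels_def
    by (auto simp: frag_extend_diff intro!: H.tns_mult[simplified] H.tns_add[simplified])
  have FR: "?F a \<in> ?Q" if "a \<in> ?R" for a
    using that unfolding tensor_sub_def[of G]
  proof induction
    case one then show ?case using H.ts_zero by simp
  next
    case (incl a) then show ?case using Frel by blast
  next
    case (inv a)
    then have "Poly_Mapping.keys a \<subseteq> carrier G \<times> UNIV"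
      using subsetD[OF G.tensor_rels_carrier inv] by simp
    then show ?case using Frel[OF inv] H.ts_minus by (simp add: frag_extend_minus del: minus_frag_cmul)
  next
    case (eng a b) then show ?case using H.ts_add by (simp add: frag_extend_add)
  qed
  have cos: "tensor_rat_map H f (?R #>\<^bsub>G.tfree\<^esub> a) = ?Q #>\<^bsub>H.tfree\<^esub> ?F a" for a
  proof -
    have "tensor_rat_map H f (?R #>\<^bsub>G.tfree\<^esub> a) = {q + ?F (r + a) | q r. q \<in> ?Q \<and> r \<in> ?R}"
      unfolding tensor_rat_map_def r_coset_def set_mult_def by auto
    also have "\<dots> = {q + ?F a | q. q \<in> ?Q}"
    proof (intro subset_antisym subsetI)
      fix w assume "w \<in> {q + ?F (r + a) | q r. q \<in> ?Q \<and> r \<in> ?R}"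
      then obtain q r where "w = q + ?F (r + a)" "q \<in> ?Q" "r \<in> ?R" by blast
      then have "w = (q + ?F r) + ?F a" "q + ?F r \<in> ?Q" using H.ts_add FR by (auto simp: frag_extend_add)
      then show "w \<in> {q + ?F a | q. q \<in> ?Q}" by blast
    next
      fix w assume "w \<in> {q + ?F a | q. q \<in> ?Q}"
      then obtain q where "w = q + ?F (0 + a)" "q \<in> ?Q" by auto
      then show "w \<in> {q + ?F (r + a) | q r. q \<in> ?Q \<and> r \<in> ?R}" using G.ts_zero by blast
    qed
    also have "\<dots> = ?Q #>\<^bsub>H.tfree\<^esub> ?F a" unfolding r_coset_def by auto
    finally show ?thesis .
  qed
  have coseq: "(tensor_sub K #>\<^bsub>free_Abelian_group (carrier K \<times> UNIV)\<^esub> a = tensor_sub K #>\<^bsub>free_Abelian_group (carrier K \<times> UNIV)\<^esub> b) \<longleftrightarrow> a - b \<in> tensor_sub K"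
    if K: "comm_group K" for K :: "('z, 'w) monoid_scheme" and a b
  proof -
    interpret K: comm_group K by (rule K)
    have rc: "tensor_sub K #>\<^bsub>K.tfree\<^esub> a = {r + a | r. r \<in> tensor_sub K}" for a unfolding r_coset_def by auto
    show ?thesis unfolding rc
    proof
      assume eq: "{r + a | r. r \<in> tensor_sub K} = {r + b | r. r \<in> tensor_sub K}"
      have "0 + a \<in> {r + a | r. r \<in> tensor_sub K}" using K.ts_zero by blast
      then have "0 + a \<in> {r + b | r. r \<in> tensor_sub K}" unfolding eq .
      then obtain r where "a = r + b" "r \<in> tensor_sub K" by auto
      then show "a - b \<in> tensor_sub K" by simp
    next
      have sub: "{r + a | r. r \<in> tensor_sub K} \<subseteq> {r + b | r. r \<in> tensor_sub K}" if "a - b \<in> tensor_sub K" for a b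
      proof
        fix w assume "w \<in> {r + a | r. r \<in> tensor_sub K}"
        then obtain r where "w = r + a" "r \<in> tensor_sub K" by blast
        then have "w = (r + (a - b)) + b" "r + (a - b) \<in> tensor_sub K" using that K.ts_add by auto
        then show "w \<in> {r + b | r. r \<in> tensor_sub K}" by blast
      qed
      assume "a - b \<in> tensor_sub K"
      then show "{r + a | r. r \<in> tensor_sub K} = {r + b | r. r \<in> tensor_sub K}"
        using sub[of a b] sub[of b a] K.teq_sym by blast
    qed
  qed
  have car: "carrier (tensor_rat K) = (\<lambda>a. tensor_sub K #>\<^bsub>free_Abelian_group (carrier K \<times> UNIV)\<^esub> a) ` carrier (free_Abelian_group (carrier K \<times> UNIV))"
    for K :: "('z, 'w) monoid_scheme" unfolding tensor_rat_def by (rule carrier_FactGroup)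
  have hom: "tensor_rat_map H f \<in> hom (tensor_rat G) (tensor_rat H)"
  proof (rule homI)
    fix C assume "C \<in> carrier (tensor_rat G)"
    then obtain a where a: "a \<in> carrier G.tfree" "C = ?R #>\<^bsub>G.tfree\<^esub> a" unfolding car by blast
    then show "tensor_rat_map H f C \<in> carrier (tensor_rat H)" unfolding car a(2) cos using Fcar by blast
    fix D assume "D \<in> carrier (tensor_rat G)"
    then obtain b where b: "b \<in> carrier G.tfree" "D = ?R #>\<^bsub>G.tfree\<^esub> b" unfolding car by blast
    have "C \<otimes>\<^bsub>tensor_rat G\<^esub> D = ?R #>\<^bsub>G.tfree\<^esub> (a + b)"
      using normal.rcos_sum[OF G.tensor_sub_normal a(1) b(1)] unfolding tensor_rat_def a(2) b(2) by simp
    moreover have "(?Q #>\<^bsub>H.tfree\<^esub> ?F a) \<otimes>\<^bsub>tensor_rat H\<^esub> (?Q #>\<^bsub>H.tfree\<^esub> ?F b) = ?Q #>\<^bsub>H.tfree\<^esub> (?F a + ?F b)"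
      using normal.rcos_sum[OF H.tensor_sub_normal Fcar[OF a(1)] Fcar[OF b(1)]] unfolding tensor_rat_def by simp
    ultimately show "tensor_rat_map H f (C \<otimes>\<^bsub>tensor_rat G\<^esub> D) = tensor_rat_map H f C \<otimes>\<^bsub>tensor_rat H\<^esub> tensor_rat_map H f D"
      unfolding a(2) b(2) using cos by (simp add: frag_extend_add)
  qed
  have dcar: "a - b \<in> carrier G.tfree" if "a \<in> carrier G.tfree" "b \<in> carrier G.tfree" for a b
    using that keys_diff[of a b] by auto
  have inj: "inj_on (tensor_rat_map H f) (carrier (tensor_rat G)) \<longleftrightarrow> (\<forall>a\<in>carrier G.tfree. ?F a \<in> ?Q \<longrightarrow> a \<in> ?R)"
  proof -
    have "inj_on (tensor_rat_map H f) (carrier (tensor_rat G)) \<longleftrightarrow>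
      (\<forall>a\<in>carrier G.tfree. \<forall>b\<in>carrier G.tfree. ?F a - ?F b \<in> ?Q \<longrightarrow> a - b \<in> ?R)"
      unfolding inj_on_def car ball_simps cos coseq[OF G] coseq[OF H] by simp
    also have "\<dots> \<longleftrightarrow> (\<forall>a\<in>carrier G.tfree. ?F a \<in> ?Q \<longrightarrow> a \<in> ?R)"
    proof safe
      fix a assume *: "\<forall>a\<in>carrier G.tfree. \<forall>b\<in>carrier G.tfree. ?F a - ?F b \<in> ?Q \<longrightarrow> a - b \<in> ?R"
        and a: "a \<in> carrier G.tfree" "?F a \<in> ?Q"
      show "a \<in> ?R" using *[rule_format, OF a(1), of 0] a(2) by simp
    next
      fix a b assume *: "\<forall>a\<in>carrier G.tfree. ?F a \<in> ?Q \<longrightarrow> a \<in> ?R"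
        and ab: "a \<in> carrier G.tfree" "b \<in> carrier G.tfree" "?F a - ?F b \<in> ?Q"
      show "a - b \<in> ?R" using *[rule_format, OF dcar[OF ab(1,2)]] ab(3) by (simp add: frag_extend_diff)
    qed
    finally show ?thesis .
  qed
  have surj: "tensor_rat_map H f ` carrier (tensor_rat G) = carrier (tensor_rat H) \<longleftrightarrow>
     (\<forall>b\<in>carrier H.tfree. \<exists>a\<in>carrier G.tfree. b - ?F a \<in> ?Q)" (is "?s \<longleftrightarrow> _")
  proof -
    have "?s \<longleftrightarrow> carrier (tensor_rat H) \<subseteq> tensor_rat_map H f ` carrier (tensor_rat G)"
      using hom hom_carrier by blast
    also have "\<dots> \<longleftrightarrow> (\<forall>b\<in>carrier H.tfree. \<exists>a\<in>carrier G.tfree. b - ?F a \<in> ?Q)"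
      unfolding car image_image cos subset_iff coseq[OF H, symmetric] by auto
    finally show ?thesis .
  qed
  have isoeq: "?iso \<longleftrightarrow> (\<forall>a\<in>carrier G.tfree. ?F a \<in> ?Q \<longrightarrow> a \<in> ?R) \<and> (\<forall>b\<in>carrier H.tfree. \<exists>a\<in>carrier G.tfree. b - ?F a \<in> ?Q)"
    unfolding iso_def bij_betw_def using hom inj surj by blast
  show ?thesis
  proof
    assume ?iso
    then have I: "\<And>a. a \<in> carrier G.tfree \<Longrightarrow> ?F a \<in> ?Q \<Longrightarrow> a \<in> ?R"
      and S: "\<And>b. b \<in> carrier H.tfree \<Longrightarrow> \<exists>a\<in>carrier G.tfree. b - ?F a \<in> ?Q" unfolding isoeq by blast+
    have ?ker
    proof (intro ballI impI)
      fix x assume x: "x \<in> carrier G" "f x = \<one>\<^bsub>H\<^esub>"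
      have "G.tns x (1 / of_nat 1) \<in> ?R" using I[of "G.tns x (1 / of_nat 1)"] x H.tns_one by simp
      from G.tensor_vanish_imp_torsion[OF x(1) _ this] show "\<exists>N\<in>{0<..}. x [^]\<^bsub>G\<^esub> (N::nat) = \<one>\<^bsub>G\<^esub>" by auto
    qed
    moreover have ?coker
    proof
      fix y assume y: "y \<in> carrier H"
      obtain a where a: "a \<in> carrier G.tfree" "H.tns y 1 - ?F a \<in> ?Q" using S[of "H.tns y 1"] y by auto
      obtain x D where x: "x \<in> carrier G" "D > 0" "G.teq a (G.tns x (1 / of_nat D))"
        using G.tensor_elementary[OF a(1)] by blast
      have "H.teq (?F a) (H.tns (f x) (1 / of_nat D))" using FR[OF x(3)] by (simp add: frag_extend_diff)
      then have 1: "H.teq (H.tns y 1) (H.tns (f x) (1 / of_nat D))" using H.teq_trans[OF a(2)] by blast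
      have "H.teq (H.tns (y [^]\<^bsub>H\<^esub> D) (1 / of_nat D)) (H.tns y 1)" using H.tns_pow_scale[OF y, of D "1 / of_nat D"] x(2) by simp
      then have 2: "H.teq (H.tns (y [^]\<^bsub>H\<^esub> D) (1 / of_nat D)) (H.tns (f x) (1 / of_nat D))" using H.teq_trans[OF _ 1] by blast
      let ?w = "y [^]\<^bsub>H\<^esub> D \<otimes>\<^bsub>H\<^esub> inv\<^bsub>H\<^esub> (f x)"
      have "H.tns ?w (1 / of_nat D) - H.tns (y [^]\<^bsub>H\<^esub> D) (1 / of_nat D) - H.tns (inv\<^bsub>H\<^esub> (f x)) (1 / of_nat D)
         + (H.tns (inv\<^bsub>H\<^esub> (f x)) (1 / of_nat D) - (- H.tns (f x) (1 / of_nat D)))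
         + (H.tns (y [^]\<^bsub>H\<^esub> D) (1 / of_nat D) - H.tns (f x) (1 / of_nat D)) \<in> ?Q"
        using y x by (intro H.ts_add[OF H.ts_add[OF H.tns_mult H.tns_inv] 2]) auto
      then have "H.tns ?w (1 / of_nat D) \<in> ?Q" by (simp add: algebra_simps)
      then obtain E :: nat where E: "E > 0" "?w [^]\<^bsub>H\<^esub> E = \<one>\<^bsub>H\<^esub>"
        using H.tensor_vanish_imp_torsion[of ?w D] y x by auto
      have "(y [^]\<^bsub>H\<^esub> D) [^]\<^bsub>H\<^esub> E \<otimes>\<^bsub>H\<^esub> inv\<^bsub>H\<^esub> (f x [^]\<^bsub>H\<^esub> E) = \<one>\<^bsub>H\<^esub>"
        using E(2) y x by (simp add: H.pow_mult_distrib H.m_comm H.nat_pow_inv)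
      then have "(y [^]\<^bsub>H\<^esub> D) [^]\<^bsub>H\<^esub> E = f x [^]\<^bsub>H\<^esub> E" using y x by (metis H.inv_equality H.inv_inv H.nat_pow_closed H.inv_closed f.hom_closed)
      then have "y [^]\<^bsub>H\<^esub> (D * E) = f (x [^]\<^bsub>G\<^esub> E)" using y x by (simp add: H.nat_pow_pow f.hom_nat_pow)
      then show "\<exists>N\<in>{0<..}. \<exists>x\<in>carrier G. y [^]\<^bsub>H\<^esub> (N::nat) = f x"
        using x E by (intro bexI[of _ "D * E"] bexI[of _ "x [^]\<^bsub>G\<^esub> E"]) auto
    qed
    ultimately show "?ker \<and> ?coker" by blast
  next
    assume kc: "?ker \<and> ?coker"
    show ?iso unfolding isoeq
    proof (intro conjI ballI impI)
      fix a assume a: "a \<in> carrier G.tfree" "?F a \<in> ?Q"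
      obtain x D where x: "x \<in> carrier G" "D > 0" "G.teq a (G.tns x (1 / of_nat D))"
        using G.tensor_elementary[OF a(1)] by blast
      have "H.teq (?F a) (H.tns (f x) (1 / of_nat D))" using FR[OF x(3)] by (simp add: frag_extend_diff)
      then have "H.tns (f x) (1 / of_nat D) \<in> ?Q" using H.ts_diff[OF a(2)] by fastforce
      then obtain E :: nat where E: "E > 0" "f x [^]\<^bsub>H\<^esub> E = \<one>\<^bsub>H\<^esub>"
        using H.tensor_vanish_imp_torsion[OF f.hom_closed[OF x(1)] x(2)] by blast
      then have "f (x [^]\<^bsub>G\<^esub> E) = \<one>\<^bsub>H\<^esub>" using x(1) by (simp add: f.hom_nat_pow)
      then obtain N :: nat where N: "N > 0" "(x [^]\<^bsub>G\<^esub> E) [^]\<^bsub>G\<^esub> N = \<one>\<^bsub>G\<^esub>" using kc x(1) by auto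
      then have "x [^]\<^bsub>G\<^esub> (E * N) = \<one>\<^bsub>G\<^esub>" using x(1) by (simp add: G.nat_pow_pow)
      then have "G.tns x (1 / of_nat D) \<in> ?R"
        using G.torsion_imp_tensor_vanish[OF x(1), of "E * N"] E N by simp
      then show "a \<in> ?R" using G.ts_add[OF x(3)] by fastforce
    next
      fix b assume b: "b \<in> carrier H.tfree"
      obtain y D where y: "y \<in> carrier H" "D > 0" "H.teq b (H.tns y (1 / of_nat D))"
        using H.tensor_elementary[OF b] by blast
      obtain N :: nat and x where N: "N > 0" "x \<in> carrier G" "y [^]\<^bsub>H\<^esub> N = f x" using kc y(1) by auto
      have "H.teq (H.tns (f x) (1 / of_nat (D * N))) (H.tns y (1 / of_nat D))"
        using H.tns_pow_scale[OF y(1), of N "1 / of_nat (D * N)"] N by simp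
      then have "H.teq b (?F (G.tns x (1 / of_nat (D * N))))" using H.teq_trans[OF y(3) H.teq_sym] by simp
      then show "\<exists>a\<in>carrier G.tfree. b - ?F a \<in> ?Q" using N by (intro bexI[of _ "G.tns x (1 / of_nat (D * N))"]) auto
    qed
  qed
qed

section \<open>Covering dimension and separation\<close>

text \<open>\<open>coloured X K j\<close> says that \<open>K\<close> has dimension below \<open>j\<close>: it can be covered by \<open>j\<close> finite
  disjoint families of arbitrarily small closed sets. In this form the dimension visibly drops
  when a separator avoids one of the families.\<close>

definition coloured :: "'x topology \<Rightarrow> 'x set \<Rightarrow> nat \<Rightarrow> bool" where
  "coloured X K j \<longleftrightarrow> (\<forall>\<W>. (\<forall>W\<in>\<W>. openin X W) \<and> K \<subseteq> \<Union>\<W> \<longrightarrow>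
     (\<exists>\<C> :: nat \<Rightarrow> 'x set set. (\<forall>c<j. finite (\<C> c) \<and> pairwise disjnt (\<C> c) \<and>
        (\<forall>C\<in>\<C> c. closedin X C \<and> (\<exists>W\<in>\<W>. C \<subseteq> W))) \<and> K \<subseteq> (\<Union>c<j. \<Union>(\<C> c))))"

lemma coloured_subset:
  assumes K: "coloured X K j" and L: "closedin X L" "L \<subseteq> K" "K \<subseteq> topspace X"
  shows "coloured X L j"
  unfolding coloured_def
proof (intro allI impI, elim conjE)
  fix \<W> assume W: "\<forall>W\<in>\<W>. openin X W" "L \<subseteq> \<Union>\<W>"
  have "\<forall>W\<in>insert (topspace X - L) \<W>. openin X W" "K \<subseteq> \<Union>(insert (topspace X - L) \<W>)"
    using W L by auto
  then obtain \<C> :: "nat \<Rightarrow> 'a set set" where C: "\<And>c. c < j \<Longrightarrow> finite (\<C> c) \<and> pairwise disjnt (\<C> c) \<and>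
        (\<forall>C\<in>\<C> c. closedin X C \<and> (\<exists>W\<in>insert (topspace X - L) \<W>. C \<subseteq> W))" "K \<subseteq> (\<Union>c<j. \<Union>(\<C> c))"
    using K[unfolded coloured_def, rule_format, of "insert (topspace X - L) \<W>"] by blast
  let ?D = "\<lambda>c. {C \<in> \<C> c. \<exists>W\<in>\<W>. C \<subseteq> W}"
  have "finite (?D c) \<and> pairwise disjnt (?D c) \<and> (\<forall>C\<in>?D c. closedin X C \<and> (\<exists>W\<in>\<W>. C \<subseteq> W))" if "c < j" for c
    using C(1)[OF that] by (auto intro: pairwise_subset)
  moreover have "L \<subseteq> (\<Union>c<j. \<Union>(?D c))"
  proof
    fix x assume x: "x \<in> L"
    then obtain c C' where c: "c < j" "C' \<in> \<C> c" "x \<in> C'" using C(2) L(2) by blast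
    then have "\<exists>W\<in>\<W>. C' \<subseteq> W" using C(1)[OF c(1)] x by blast
    then show "x \<in> (\<Union>c<j. \<Union>(?D c))" using c by blast
  qed
  ultimately show "\<exists>\<C> :: nat \<Rightarrow> 'a set set. (\<forall>c<j. finite (\<C> c) \<and> pairwise disjnt (\<C> c) \<and>
        (\<forall>C\<in>\<C> c. closedin X C \<and> (\<exists>W\<in>\<W>. C \<subseteq> W))) \<and> L \<subseteq> (\<Union>c<j. \<Union>(\<C> c))"
    by (intro exI[of _ ?D]) blast
qed

text \<open>Urysohn functions for a shrinking of the cover. The closed sets where they are at least \<open>1/2\<close> still cover,
  and they lie inside the members of the cover.\<close>

lemma bump_functions:
  assumes X: "compact_space X" "normal_space X" "t1_space X"
    and U: "finite A" "\<And>a. a \<in> A \<Longrightarrow> openin X (U a)" "topspace X \<subseteq> (\<Union>a\<in>A. U a)"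
  shows "\<exists>\<phi> :: 'a \<Rightarrow> 'x \<Rightarrow> real. (\<forall>a\<in>A. continuous_map X euclideanreal (\<phi> a) \<and>
     (\<forall>x\<in>topspace X. 0 \<le> \<phi> a x \<and> (x \<notin> U a \<longrightarrow> \<phi> a x = 0))) \<and> (\<forall>x\<in>topspace X. \<exists>a\<in>A. \<phi> a x > 1/2)"
proof -
  have "\<exists>a f. a \<in> A \<and> continuous_map X euclideanreal f \<and> f x = (1::real) \<and>
     (\<forall>y\<in>topspace X. 0 \<le> f y \<and> (y \<notin> U a \<longrightarrow> f y = 0))" if x: "x \<in> topspace X" for x
  proof -
    obtain a where a: "a \<in> A" "x \<in> U a" using U(3) x by blast
    have "closedin X {x}" using X(3) x by (simp add: t1_space_closedin_singleton)
    moreover have "closedin X (topspace X - U a)" using U(2)[OF a(1)] by blast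
    moreover have "disjnt (topspace X - U a) {x}" using a by (auto simp: disjnt_def)
    ultimately obtain f where f: "continuous_map X (top_of_set {0..1::real}) f" "f ` (topspace X - U a) \<subseteq> {0}" "f ` {x} \<subseteq> {1}"
      using Urysohn_lemma[OF X(2), of "topspace X - U a" "{x}" 0 1] by auto
    then show ?thesis using a by (intro exI[of _ a] exI[of _ f]) (auto simp: continuous_map_in_subtopology)
  qed
  then obtain ia f where f: "\<And>x. x \<in> topspace X \<Longrightarrow> ia x \<in> A \<and> continuous_map X euclideanreal (f x) \<and> f x x = (1::real) \<and>
     (\<forall>y\<in>topspace X. 0 \<le> f x y \<and> (y \<notin> U (ia x) \<longrightarrow> f x y = 0))" by metis
  let ?N = "\<lambda>x. {y \<in> topspace X. f x y \<in> {1/2<..}}"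
  have "openin X (?N x)" if "x \<in> topspace X" for x
    using openin_continuous_map_preimage[of X euclideanreal "f x" "{1/2<..}"] f[OF that] by simp
  then have "\<forall>U\<in>?N ` topspace X. openin X U" by (simp only: ball_simps) simp
  moreover have "x \<in> ?N x" if "x \<in> topspace X" for x using f[OF that] that by simp
  then have "topspace X \<subseteq> \<Union>(?N ` topspace X)" by (meson UN_I subsetI)
  ultimately have "\<exists>F. finite F \<and> F \<subseteq> ?N ` topspace X \<and> topspace X \<subseteq> \<Union>F"
    by (intro X(1)[unfolded compact_space_alt, rule_format] conjI)
  then obtain F where F: "finite F" "F \<subseteq> ?N ` topspace X" "topspace X \<subseteq> \<Union>F" by (elim exE conjE)
  obtain F0 where F0': "F0 \<subseteq> topspace X" "finite F0" "F = ?N ` F0"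
    using finite_subset_image[OF F(1,2)] by blast
  then have F0: "finite F0" "F0 \<subseteq> topspace X" "topspace X \<subseteq> \<Union>(?N ` F0)" using F(3) by simp_all
  define \<phi> where "\<phi> a y = (\<Sum>x\<in>{x\<in>F0. ia x = a}. f x y)" for a y
  have fin: "finite {x \<in> F0. ia x = a}" for a using F0 by simp
  have "continuous_map X euclideanreal (\<phi> a)" for a
    unfolding \<phi>_def using F0 f fin by (intro continuous_map_sum) auto
  moreover have nn: "0 \<le> \<phi> a y" if "y \<in> topspace X" for a y
    unfolding \<phi>_def using f F0 that by (intro sum_nonneg) auto
  moreover have "\<phi> a y = 0" if "y \<in> topspace X" "y \<notin> U a" for a y
    unfolding \<phi>_def using f F0 that by (intro sum.neutral) auto
  moreover have "\<exists>a\<in>A. \<phi> a y > 1/2" if y: "y \<in> topspace X" for y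
  proof -
    obtain x where x: "x \<in> F0" "f x y > 1/2" using F0(3) y by auto
    have "f x y \<le> \<phi> (ia x) y" unfolding \<phi>_def using x f F0 fin y
      by (intro member_le_sum) auto
    then show ?thesis using x f F0 by (intro bexI[of _ "ia x"]) auto
  qed
  ultimately show ?thesis by blast
qed

text \<open>Functions subordinate to a cover of order \<open>d + 1\<close> map the space to a \<open>d\<close>-dimensional nerve. The open stars
  of the barycentres of its simplices, sorted by the dimension of the simplex, form \<open>d + 1\<close> disjoint families.\<close>

lemma covering_dim_le_imp_coloured:
  assumes X: "compact_space X" "normal_space X" "t1_space X" and d: "covering_dim_le X d"
  shows "coloured X (topspace X) (Suc d)"
  unfolding coloured_def
proof (intro allI impI, elim conjE)
  fix \<W> assume W: "\<forall>W\<in>\<W>. openin X W" "topspace X \<subseteq> \<Union>\<W>"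
  have "\<exists>\<W>'. finite \<W>' \<and> \<W>' \<subseteq> \<W> \<and> topspace X \<subseteq> \<Union>\<W>'"
    by (rule X(1)[unfolded compact_space_alt, rule_format]) (use W in blast)
  then obtain \<W>' where W': "finite \<W>'" "\<W>' \<subseteq> \<W>" "topspace X \<subseteq> \<Union>\<W>'" by (elim exE conjE)
  then have "finite \<W>' \<and> (\<forall>U\<in>\<W>'. openin X U) \<and> \<Union>\<W>' = topspace X"
    using W(1) openin_subset by blast
  from d[unfolded covering_dim_le_def, rule_format, OF this] obtain \<V> where V: "finite \<V>" "\<forall>V\<in>\<V>. openin X V" "\<Union>\<V> = topspace X"
     "\<forall>V\<in>\<V>. \<exists>U\<in>\<W>'. V \<subseteq> U" "\<forall>x\<in>topspace X. card {V \<in> \<V>. x \<in> V} \<le> d + 1"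
    by (elim exE conjE)
  obtain \<phi> :: "'a set \<Rightarrow> 'a \<Rightarrow> real" where \<phi>: "\<And>V. V \<in> \<V> \<Longrightarrow> continuous_map X euclideanreal (\<phi> V)"
     "\<And>V x. V \<in> \<V> \<Longrightarrow> x \<in> topspace X \<Longrightarrow> 0 \<le> \<phi> V x" "\<And>V x. V \<in> \<V> \<Longrightarrow> x \<in> topspace X \<Longrightarrow> x \<notin> V \<Longrightarrow> \<phi> V x = 0"
     "\<And>x. x \<in> topspace X \<Longrightarrow> \<exists>V\<in>\<V>. \<phi> V x > 1/2"
    using bump_functions[OF X V(1), of "\<lambda>V. V"] V(2,3) by auto blast
  \<comment> \<open>The open cells of the nerve: the functions in \<open>I\<close> are positive and dominate all others.
    Cells with equally many vertices are disjoint.\<close>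
  define cell where "cell I = {x \<in> topspace X. (\<forall>V\<in>I. \<phi> V x > 0) \<and> (\<forall>V\<in>I. \<forall>V'\<in>\<V> - I. \<phi> V x > \<phi> V' x)}" for I
  define \<I> where "\<I> = {I. I \<subseteq> \<V> \<and> I \<noteq> {} \<and> card I \<le> Suc d}"
  have fI: "finite \<I>" unfolding \<I>_def using V(1) by simp
  have cell_open: "openin X (cell I)" if "I \<in> \<I>" for I
  proof -
    have I: "finite I" "I \<subseteq> \<V>" "I \<noteq> {}" using that V(1) finite_subset unfolding \<I>_def by auto
    have gt: "openin X {x \<in> topspace X. f x > g x}" if "continuous_map X euclideanreal f" "continuous_map X euclideanreal g" for f g
      using openin_continuous_map_preimage[OF continuous_map_diff[OF that], of "{0<..}"] by simp
    have "cell I = ((\<Inter>V\<in>I. {x \<in> topspace X. \<phi> V x > 0}) \<inter> topspace X) \<inter>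
       ((\<Inter>V\<in>I. ((\<Inter>V'\<in>\<V> - I. {x \<in> topspace X. \<phi> V x > \<phi> V' x}) \<inter> topspace X)) \<inter> topspace X)"
      unfolding cell_def by auto
    moreover have "openin X \<dots>"
    proof -
      have 1: "openin X {x \<in> topspace X. \<phi> V x > 0}" if "V \<in> I" for V
        using gt[of "\<phi> V" "\<lambda>_. 0"] \<phi>(1)[of V] I that by auto
      have 2: "openin X {x \<in> topspace X. \<phi> V x > \<phi> V' x}" if "V \<in> I" "V' \<in> \<V> - I" for V V'
        using gt[of "\<phi> V" "\<phi> V'"] \<phi>(1)[of V] \<phi>(1)[of V'] I that by auto
      show ?thesis using I(1) V(1) by (intro openin_Int openin_INT 1 2) auto
    qed
    ultimately show ?thesis by simp
  qed
  have cell_cover: "topspace X \<subseteq> (\<Union>I\<in>\<I>. cell I)"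
  proof
    fix x assume x: "x \<in> topspace X"
    let ?I = "{V \<in> \<V>. \<phi> V x > 0}"
    have "?I \<subseteq> {V \<in> \<V>. x \<in> V}" using \<phi>(3)[OF _ x] by force
    then have "card ?I \<le> Suc d" using V(1,5) x card_mono[of "{V \<in> \<V>. x \<in> V}" ?I] by fastforce
    moreover have "?I \<noteq> {}" using \<phi>(4)[OF x] by force
    ultimately have "?I \<in> \<I>" unfolding \<I>_def by auto
    moreover have "x \<in> cell ?I" unfolding cell_def using x \<phi>(2)[OF _ x] by force
    ultimately show "x \<in> (\<Union>I\<in>\<I>. cell I)" by blast
  qed
  obtain \<psi> :: "'a set set \<Rightarrow> 'a \<Rightarrow> real" where \<psi>: "\<And>I. I \<in> \<I> \<Longrightarrow> continuous_map X euclideanreal (\<psi> I)"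
     "\<And>I x. I \<in> \<I> \<Longrightarrow> x \<in> topspace X \<Longrightarrow> x \<notin> cell I \<Longrightarrow> \<psi> I x = 0"
     "\<And>x. x \<in> topspace X \<Longrightarrow> \<exists>I\<in>\<I>. \<psi> I x > 1/2"
    using bump_functions[OF X fI, of cell] cell_open cell_cover by auto blast
  define D where "D I = {x \<in> topspace X. \<psi> I x \<in> {1/2..}}" for I
  have D_closed: "closedin X (D I)" if "I \<in> \<I>" for I
    unfolding D_def using closedin_continuous_map_preimage[OF \<psi>(1)[OF that], of "{1/2..}"] by simp
  have D_cell: "D I \<subseteq> cell I" if "I \<in> \<I>" for I
    unfolding D_def using \<psi>(2)[OF that] by force
  define \<C> where "\<C> c = D ` {I \<in> \<I>. card I = Suc c}" for c
  have "finite (\<C> c)" for c unfolding \<C>_def using fI by simp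
  moreover have "pairwise disjnt (\<C> c)" for c
  proof (rule pairwiseI)
    fix C C' assume CC: "C \<in> \<C> c" "C' \<in> \<C> c" "C \<noteq> C'"
    obtain I J where I': "I \<in> \<I>" "J \<in> \<I>" "card I = Suc c" "card J = Suc c" "C = D I" "C' = D J"
      using CC(1,2) unfolding \<C>_def by blast
    then have I: "I \<in> \<I>" "J \<in> \<I>" "card I = card J" "I \<noteq> J" "C = D I" "C' = D J" using CC(3) by auto
    have fin: "finite I" "finite J" using I V(1) finite_subset unfolding \<I>_def by auto
    have "cell I \<inter> cell J = {}"
    proof -
      have "\<not> I \<subseteq> J" "\<not> J \<subseteq> I" using I(3,4) fin card_subset_eq by metis+
      then obtain V V' where "V \<in> I" "V \<notin> J" "V' \<in> J" "V' \<notin> I" by blast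
      moreover have "V \<in> \<V>" "V' \<in> \<V>" using calculation I unfolding \<I>_def by auto
      ultimately have "x \<in> cell I \<Longrightarrow> x \<in> cell J \<Longrightarrow> \<phi> V x > \<phi> V' x \<and> \<phi> V' x > \<phi> V x" for x unfolding cell_def by blast
      then show ?thesis by force
    qed
    then show "disjnt C C'" using D_cell[OF I(1)] D_cell[OF I(2)] I(5,6) unfolding disjnt_def by blast
  qed
  moreover have "closedin X C \<and> (\<exists>W\<in>\<W>. C \<subseteq> W)" if "C \<in> \<C> c" for c C
  proof -
    obtain I where I: "I \<in> \<I>" "C = D I" using \<open>C \<in> \<C> c\<close> unfolding \<C>_def by auto
    then have "I \<subseteq> \<V>" "I \<noteq> {}" unfolding \<I>_def by simp_all
    then obtain V where V': "V \<in> I" "V \<in> \<V>" by auto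
    have "cell I \<subseteq> V" unfolding cell_def using V' \<phi>(3)[OF V'(2)] by force
    then have "C \<subseteq> V" using D_cell[OF I(1)] I(2) by simp
    moreover obtain W where "W \<in> \<W>'" "V \<subseteq> W" using V(4) V'(2) by (elim ballE bexE) auto
    ultimately have "\<exists>W\<in>\<W>. C \<subseteq> W" using W'(2) by (intro bexI[of _ W]) auto
    then show ?thesis using D_closed[OF I(1)] I(2) by simp
  qed
  moreover have "topspace X \<subseteq> (\<Union>c<Suc d. \<Union>(\<C> c))"
  proof
    fix x assume x: "x \<in> topspace X"
    obtain I where I: "I \<in> \<I>" "\<psi> I x > 1/2" using \<psi>(3)[OF x] by blast
    have "finite I" "I \<noteq> {}" using I(1) finite_subset[OF _ V(1), of I] unfolding \<I>_def by simp_all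
    then have "card I \<noteq> 0" by simp
    moreover have "card I \<le> Suc d" using I(1) unfolding \<I>_def by simp
    ultimately have c: "card I - 1 < Suc d" "card I = Suc (card I - 1)" by linarith+
    then have "D I \<in> \<C> (card I - 1)" unfolding \<C>_def using I(1) by simp
    moreover have "x \<in> D I" unfolding D_def using x I(2) by simp
    ultimately show "x \<in> (\<Union>c<Suc d. \<Union>(\<C> c))" using c(1) by (intro UN_I[of "card I - 1"] UnionI[of "D I"]) simp_all
  qed
  ultimately show "\<exists>\<C> :: nat \<Rightarrow> 'a set set. (\<forall>c<Suc d. finite (\<C> c) \<and> pairwise disjnt (\<C> c) \<and>
        (\<forall>C\<in>\<C> c. closedin X C \<and> (\<exists>W\<in>\<W>. C \<subseteq> W))) \<and> topspace X \<subseteq> (\<Union>c<Suc d. \<Union>(\<C> c))"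
    by (intro exI[of _ \<C>]) blast
qed

lemma normal_space_disjoint_closures:
  assumes "normal_space X" "closedin X S" "closedin X T" "S \<inter> T = {}"
  obtains U V where "openin X U" "openin X V" "S \<subseteq> U" "T \<subseteq> V" "X closure_of U \<inter> X closure_of V = {}"
proof -
  have "openin X (topspace X - T)" "S \<subseteq> topspace X - T" using assms closedin_subset by blast+
  then obtain U where U: "openin X U" "S \<subseteq> U" "X closure_of U \<subseteq> topspace X - T"
    using assms(1,2) unfolding normal_space_alt by meson
  have "openin X (topspace X - X closure_of U)" "T \<subseteq> topspace X - X closure_of U"
    using U(3) closedin_subset[OF assms(3)] by auto
  then obtain V where V: "openin X V" "T \<subseteq> V" "X closure_of V \<subseteq> topspace X - X closure_of U"
    using assms(1,3) unfolding normal_space_alt by meson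
  then show ?thesis using that U by blast
qed

text \<open>Pieces of the first colour are put on the side of \<open>A\<close> if they meet it and on the side of \<open>B\<close>
  otherwise; both sides are then slightly enlarged. Repeating this at finer and finer scales leaves
  a separator that avoids the first colour at every scale.\<close>

lemma coloured_separation:
  assumes X: "compact_space X" "metrizable_space X" and K: "coloured X K (Suc j)" "closedin X K"
    and A: "closedin X A" and B: "closedin X B" and AB: "A \<inter> B = {}"
  obtains A' B' where "openin X A'" "openin X B'" "A \<subseteq> A'" "B \<subseteq> B'" "A' \<inter> B' = {}" "coloured X (K - (A' \<union> B')) j"
proof -
  obtain M d where Md: "Metric_space M d" "X = Metric_space.mtopology M d"
    using X(2) unfolding metrizable_space_def by blast
  interpret Metric_space M d by (rule Md(1))
  have X_M: "topspace X = M" using Md(2) by simp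
  have normal: "normal_space X" using metrizable_imp_normal_space[OF X(2)] .
  let ?P = "\<lambda>(k::nat) (P, Q). closedin X P \<and> closedin X Q \<and> P \<inter> Q = {} \<and> (k = 0 \<longrightarrow> P = A \<and> Q = B)"
  let ?S = "\<lambda>(k::nat) (P, Q) (P', Q'). \<exists>U V (\<C> :: nat \<Rightarrow> 'a set set). openin X U \<and> openin X V \<and> P \<subseteq> U \<and> U \<subseteq> P' \<and> Q \<subseteq> V \<and> V \<subseteq> Q' \<and>
     (\<forall>c<j. finite (\<C> c) \<and> pairwise disjnt (\<C> c) \<and> (\<forall>C\<in>\<C> c. closedin X C \<and> (\<exists>x\<in>M. C \<subseteq> mball x (1 / Suc k)))) \<and>
     K \<subseteq> U \<union> V \<union> (\<Union>c<j. \<Union>(\<C> c))"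
  have step: "\<exists>PQ'. ?P (Suc k) PQ' \<and> ?S k PQ PQ'" if PQ: "?P k PQ" for PQ k
  proof -
    obtain P Q where pq: "PQ = (P, Q)" by (cases PQ)
    then have P: "closedin X P" "closedin X Q" "P \<inter> Q = {}" using PQ by auto
    define \<W> where "\<W> = {W. openin X W \<and> (\<exists>x\<in>M. W \<subseteq> mball x (1 / Suc k)) \<and> (W \<inter> P = {} \<or> W \<inter> Q = {})}"
    have "K \<subseteq> \<Union>\<W>"
    proof
      fix x assume "x \<in> K"
      then have x: "x \<in> M" using K(2) closedin_subset X_M by blast
      have ob: "openin X (mball x (1 / Suc k))" "x \<in> mball x (1 / Suc k)" using x Md(2) by auto
      have 1: "openin X (mball x (1 / Suc k) - P)" "openin X (mball x (1 / Suc k) - Q)"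
        using ob P openin_diff by blast+
      have "mball x (1 / Suc k) - P \<in> \<W>" "mball x (1 / Suc k) - Q \<in> \<W>" unfolding \<W>_def using 1 x by auto
      then show "x \<in> \<Union>\<W>" using P(3) ob(2) by blast
    qed
    moreover have "\<forall>W\<in>\<W>. openin X W" unfolding \<W>_def by blast
    ultimately obtain \<C> :: "nat \<Rightarrow> 'a set set" where C: "\<And>c. c < Suc j \<Longrightarrow> finite (\<C> c) \<and> pairwise disjnt (\<C> c) \<and>
        (\<forall>C\<in>\<C> c. closedin X C \<and> (\<exists>W\<in>\<W>. C \<subseteq> W))" "K \<subseteq> (\<Union>c<Suc j. \<Union>(\<C> c))"
      using K(1)[unfolded coloured_def, rule_format, of \<W>] by blast
    define P1 where "P1 = P \<union> \<Union>{C \<in> \<C> 0. C \<inter> P \<noteq> {}}"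
    define Q1 where "Q1 = Q \<union> \<Union>{C \<in> \<C> 0. C \<inter> P = {}}"
    have C0: "finite (\<C> 0)" "pairwise disjnt (\<C> 0)" "\<And>C. C \<in> \<C> 0 \<Longrightarrow> closedin X C"
      "\<And>C. C \<in> \<C> 0 \<Longrightarrow> C \<inter> P = {} \<or> C \<inter> Q = {}" using C(1)[of 0] unfolding \<W>_def by blast+
    have "closedin X P1" "closedin X Q1" unfolding P1_def Q1_def
      using P C0 by (auto intro!: closedin_Un closedin_Union)
    moreover have "P1 \<inter> Q1 = {}"
    proof -
      have "C \<inter> C' = {}" if "C \<in> \<C> 0" "C' \<in> \<C> 0" "C \<inter> P \<noteq> {}" "C' \<inter> P = {}" for C C'
      proof -
        have "C \<noteq> C'" using that(3,4) by blast
        then show ?thesis using C0(2) that(1,2) unfolding pairwise_def disjnt_def by blast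
      qed
      moreover have "C \<inter> Q = {}" if "C \<in> \<C> 0" "C \<inter> P \<noteq> {}" for C using C0(4) that by blast
      ultimately show ?thesis using P(3) unfolding P1_def Q1_def by blast
    qed
    ultimately obtain U V where UV: "openin X U" "openin X V" "P1 \<subseteq> U" "Q1 \<subseteq> V" "X closure_of U \<inter> X closure_of V = {}"
      using normal_space_disjoint_closures[OF normal] by metis
    let ?C = "\<lambda>c. \<C> (Suc c)"
    have "\<forall>c<j. finite (?C c) \<and> pairwise disjnt (?C c) \<and> (\<forall>C\<in>?C c. closedin X C \<and> (\<exists>x\<in>M. C \<subseteq> mball x (1 / Suc k)))"
    proof (intro allI impI conjI ballI)
      fix c assume c: "c < j"
      then show "finite (?C c)" "pairwise disjnt (?C c)" using C(1)[of "Suc c"] by auto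
      fix C' assume C': "C' \<in> ?C c"
      then show "closedin X C'" using C(1)[of "Suc c"] c by auto
      obtain W where "W \<in> \<W>" "C' \<subseteq> W" using C(1)[of "Suc c"] c C' by auto
      then show "\<exists>x\<in>M. C' \<subseteq> mball x (1 / Suc k)" unfolding \<W>_def by blast
    qed
    moreover have "K \<subseteq> U \<union> V \<union> (\<Union>c<j. \<Union>(?C c))"
    proof
      fix x assume "x \<in> K"
      then obtain c C' where c: "c < Suc j" "C' \<in> \<C> c" "x \<in> C'" using C(2) by blast
      show "x \<in> U \<union> V \<union> (\<Union>c<j. \<Union>(?C c))"
      proof (cases c)
        case 0
        then have "x \<in> P1 \<union> Q1" unfolding P1_def Q1_def using c by blast
        then show ?thesis using UV by blast
      qed (use c in auto)
    qed
    moreover have "P \<subseteq> U" "Q \<subseteq> V" using UV unfolding P1_def Q1_def by blast+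
    moreover have "U \<subseteq> X closure_of U" "V \<subseteq> X closure_of V" using UV openin_subset closure_of_subset by metis+
    ultimately have st: "?S k (P, Q) (X closure_of U, X closure_of V)" unfolding prod.case
      by (intro exI[of _ U] exI[of _ V] exI[of _ ?C] conjI UV(1,2))
    have "?P (Suc k) (X closure_of U, X closure_of V)" using UV(5) by simp
    from conjI[OF this st] show ?thesis unfolding pq by (rule exI)
  qed
  have base: "\<exists>PQ. ?P 0 PQ" using A B AB by (intro exI[of _ "(A, B)"]) simp
  from dependent_nat_choice[where P = ?P and Q = ?S, OF base step]
  obtain PQ where PQ': "\<forall>k. ?P k (PQ k) \<and> ?S k (PQ k) (PQ (Suc k))" by (rule exE)
  have PQ: "?P k (PQ k)" "?S k (PQ k) (PQ (Suc k))" for k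
    by (rule conjunct1[OF PQ'[rule_format]], rule conjunct2[OF PQ'[rule_format]])
  define P Q where "P k = fst (PQ k)" and "Q k = snd (PQ k)" for k
  have Pk: "closedin X (P k)" "closedin X (Q k)" "P k \<inter> Q k = {}" "P 0 = A" "Q 0 = B" for k
    using PQ(1)[of k] PQ(1)[of 0] unfolding P_def Q_def by (auto split: prod.splits)
  have "\<exists>U V (\<C> :: nat \<Rightarrow> 'a set set). openin X U \<and> openin X V \<and> P k \<subseteq> U \<and> U \<subseteq> P (Suc k) \<and> Q k \<subseteq> V \<and> V \<subseteq> Q (Suc k) \<and>
     (\<forall>c<j. finite (\<C> c) \<and> pairwise disjnt (\<C> c) \<and> (\<forall>C\<in>\<C> c. closedin X C \<and> (\<exists>x\<in>M. C \<subseteq> mball x (1 / Suc k)))) \<and>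
     K \<subseteq> U \<union> V \<union> (\<Union>c<j. \<Union>(\<C> c))" for k
    using PQ(2)[of k] unfolding P_def Q_def by (simp add: case_prod_unfold)
  then obtain U V and \<C> :: "nat \<Rightarrow> nat \<Rightarrow> 'a set set" where UV: "\<And>k. openin X (U k)" "\<And>k. openin X (V k)"
     "\<And>k. P k \<subseteq> U k" "\<And>k. U k \<subseteq> P (Suc k)" "\<And>k. Q k \<subseteq> V k" "\<And>k. V k \<subseteq> Q (Suc k)"
     "\<And>k c. c < j \<Longrightarrow> finite (\<C> k c) \<and> pairwise disjnt (\<C> k c) \<and> (\<forall>C\<in>\<C> k c. closedin X C \<and> (\<exists>x\<in>M. C \<subseteq> mball x (1 / Suc k)))"
     "\<And>k. K \<subseteq> U k \<union> V k \<union> (\<Union>c<j. \<Union>(\<C> k c))" by metis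
  have mono: "P k \<subseteq> P l \<and> Q k \<subseteq> Q l" if "k \<le> l" for k l
    using that by (induction l rule: dec_induct) (use UV in blast)+
  define A' B' where "A' = (\<Union>k. U k)" and "B' = (\<Union>k. V k)"
  have "A' \<inter> B' = {}"
  proof -
    have "U k \<inter> V l = {}" for k l
    proof -
      have "U k \<subseteq> P (Suc (max k l))" "V l \<subseteq> Q (Suc (max k l))"
        using UV(4)[of k] UV(6)[of l] mono[of "Suc k" "Suc (max k l)"] mono[of "Suc l" "Suc (max k l)"] by auto
      then show ?thesis using Pk(3) by blast
    qed
    then show ?thesis unfolding A'_def B'_def by blast
  qed
  moreover have "openin X A'" "openin X B'" unfolding A'_def B'_def using UV(1,2) by blast+
  moreover have "A \<subseteq> A'" "B \<subseteq> B'" unfolding A'_def B'_def using UV(3)[of 0] UV(5)[of 0] Pk(4,5) by blast+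
  moreover have "coloured X (K - (A' \<union> B')) j"
    unfolding coloured_def
  proof (intro allI impI, elim conjE)
    fix \<W> assume W: "\<forall>W\<in>\<W>. openin X W" "K - (A' \<union> B') \<subseteq> \<Union>\<W>"
    let ?L = "K - (A' \<union> B')"
    have Lc: "closedin X ?L" using K(2) calculation by (intro closedin_diff) auto
    then have "compactin mtopology ?L" using X(1) closedin_compact_space Md(2) by blast
    then obtain \<epsilon> where \<epsilon>: "\<epsilon> > 0" "\<And>x. x \<in> ?L \<Longrightarrow> \<exists>W\<in>\<W>. mball x \<epsilon> \<subseteq> W"
      using lebesgue_number[of ?L \<W>] W Md(2) by blast
    obtain k where k: "1 / Suc k < \<epsilon> / 2" using \<epsilon>(1) by (metis half_gt_zero nat_approx_posE)
    let ?D = "\<lambda>c. {C \<inter> ?L | C. C \<in> \<C> k c \<and> C \<inter> ?L \<noteq> {}}"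
    have D: "finite (?D c) \<and> pairwise disjnt (?D c) \<and> (\<forall>C\<in>?D c. closedin X C \<and> (\<exists>W\<in>\<W>. C \<subseteq> W))" if c: "c < j" for c
    proof (intro conjI ballI)
      show "finite (?D c)" using UV(7)[OF c, of k] by simp
      show "pairwise disjnt (?D c)" using UV(7)[OF c, of k] unfolding pairwise_def disjnt_def by blast
      fix C' assume "C' \<in> ?D c"
      then obtain C x where C: "C \<in> \<C> k c" "C' = C \<inter> ?L" "x \<in> C" "x \<in> ?L" by blast
      then show "closedin X C'" using UV(7)[OF c, of k] Lc by blast
      obtain w where w: "w \<in> M" "C \<subseteq> mball w (1 / Suc k)" using UV(7)[OF c, of k] C(1) by blast
      have "C \<subseteq> mball x \<epsilon>"
      proof
        fix y assume "y \<in> C"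
        then have y: "y \<in> M" "d w y < 1 / Suc k" and x: "x \<in> M" "d w x < 1 / Suc k" using w C(3) by auto
        have "d x y \<le> d x w + d w y" using triangle x y w by blast
        then show "y \<in> mball x \<epsilon>" using x y k commute[of x w] by simp
      qed
      then show "\<exists>W\<in>\<W>. C' \<subseteq> W" using \<epsilon>(2)[OF C(4)] C(2) by blast
    qed
    moreover have "?L \<subseteq> (\<Union>c<j. \<Union>(?D c))"
    proof
      fix x assume x: "x \<in> ?L"
      then have "x \<in> (\<Union>c<j. \<Union>(\<C> k c))" using UV(8)[of k] unfolding A'_def B'_def by blast
      then show "x \<in> (\<Union>c<j. \<Union>(?D c))" using x by blast
    qed
    ultimately show "\<exists>\<C> :: nat \<Rightarrow> 'a set set. (\<forall>c<j. finite (\<C> c) \<and> pairwise disjnt (\<C> c) \<and>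
        (\<forall>C\<in>\<C> c. closedin X C \<and> (\<exists>W\<in>\<W>. C \<subseteq> W))) \<and> ?L \<subseteq> (\<Union>c<j. \<Union>(\<C> c))"
      by (intro exI[of _ ?D]) blast
  qed
  ultimately show ?thesis using that by blast
qed

text \<open>The local-to-global principle: a class that dies locally is killed on all of a finite-dimensional
  set by gluing. The obstruction to gluing two contractions lives on a separator, which has smaller
  dimension, in one degree higher. Here \<open>\<Gamma> n O' u\<close> says that \<open>u\<close> is a class of degree \<open>n\<close> over \<open>O'\<close>, and
  \<open>Null n u N W\<close> that the \<open>N\<close>-th power of \<open>u\<close> is killed over \<open>W\<close>. The outer induction is on the dimension of \<open>K\<close>,
  the inner one on the number of open sets over which a contraction is given.\<close>

lemma local_to_global:
  fixes \<Gamma> :: "nat \<Rightarrow> 'x set \<Rightarrow> 'u \<Rightarrow> bool" and Null :: "nat \<Rightarrow> 'u \<Rightarrow> nat \<Rightarrow> 'x set \<Rightarrow> bool"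
  assumes X: "compact_space X" "metrizable_space X"
    and S: "1 \<in> S" "\<And>a b. a \<in> S \<Longrightarrow> b \<in> S \<Longrightarrow> a * b \<in> S"
    and empty: "\<And>n O' u N. \<Gamma> n O' u \<Longrightarrow> Null n u N {}"
    and anti: "\<And>n O' u N W W'. \<Gamma> n O' u \<Longrightarrow> Null n u N W \<Longrightarrow> openin X W' \<Longrightarrow> W' \<subseteq> W \<Longrightarrow> Null n u N W'"
    and local: "\<And>n O' u x. \<Gamma> n O' u \<Longrightarrow> openin X O' \<Longrightarrow> x \<in> O' \<Longrightarrow> \<exists>N\<in>S. \<exists>W. openin X W \<and> x \<in> W \<and> W \<subseteq> O' \<and> Null n u N W"
    and pow: "\<And>n O' u N M W. \<Gamma> n O' u \<Longrightarrow> W \<subseteq> O' \<Longrightarrow> Null n u N W \<Longrightarrow> Null n u (N * M) W"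
    and glue: "\<And>n O' u N V1 V2. \<Gamma> n O' u \<Longrightarrow> openin X O' \<Longrightarrow> openin X V1 \<Longrightarrow> openin X V2 \<Longrightarrow> V1 \<subseteq> O' \<Longrightarrow> V2 \<subseteq> O' \<Longrightarrow>
       Null n u N V1 \<Longrightarrow> Null n u N V2 \<Longrightarrow> \<exists>k. \<Gamma> (Suc n) (V1 \<inter> V2) k \<and> (\<forall>M W V1' V2'. openin X W \<and> W \<subseteq> V1 \<inter> V2 \<and>
         Null (Suc n) k M W \<and> openin X V1' \<and> V1' \<subseteq> V1 \<and> openin X V2' \<and> V2' \<subseteq> V2 \<and> X closure_of (V1' \<inter> V2') \<subseteq> W \<longrightarrow>
           Null n u (N * M) (V1' \<union> V2'))"
    and K: "coloured X K j" "closedin X K" and u: "\<Gamma> n O' u" "openin X O'" "K \<subseteq> O'"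
  shows "\<exists>N\<in>S. \<exists>W. openin X W \<and> K \<subseteq> W \<and> W \<subseteq> O' \<and> Null n u N W"
  using K u
proof (induction j arbitrary: K n O' u)
  case 0
  then have "K = {}"
    using 0(1)[unfolded coloured_def, rule_format, of "{topspace X}"] closedin_subset[OF 0(2)] by auto
  then show ?case using S(1) empty[OF 0(3)] by (intro bexI[of _ 1] exI[of _ "{}"]) auto
next
  case (Suc j)
  note outer = Suc.IH
  have normal: "normal_space X" using metrizable_imp_normal_space[OF X(2)] .
  have finite_case: "\<exists>N'\<in>S. \<exists>W. openin X W \<and> K' \<subseteq> W \<and> W \<subseteq> O' \<and> Null n u (N * N') W"
    if "finite \<W>" "\<And>W. W \<in> \<W> \<Longrightarrow> openin X W \<and> W \<subseteq> O' \<and> Null n u N W" "coloured X K' (Suc j)" "closedin X K'" "K' \<subseteq> \<Union>\<W>" for \<W> N K'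
    using that
  proof (induction \<W> arbitrary: K')
    case empty
    then show ?case using S(1) assms(5)[OF Suc.prems(3)] by (intro bexI[of _ 1] exI[of _ "{}"]) auto
  next
    case (insert W1 \<W>)
    have W1: "openin X W1" "W1 \<subseteq> O'" "Null n u N W1" using insert.prems(1) by auto
    have oW: "openin X (\<Union>\<W>)" using insert.prems(1) by auto
    have KX: "K' \<subseteq> topspace X" using insert.prems(3) closedin_subset by blast
    have "closedin X (K' - \<Union>\<W>)" "closedin X (K' - W1)" "(K' - \<Union>\<W>) \<inter> (K' - W1) = {}"
      using insert.prems(3,4) oW W1 by (auto intro: closedin_diff)
    then obtain A B where AB: "openin X A" "openin X B" "K' - \<Union>\<W> \<subseteq> A" "K' - W1 \<subseteq> B" "A \<inter> B = {}" "coloured X (K' - (A \<union> B)) j"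
      using coloured_separation[OF X insert.prems(2,3)] by metis
    \<comment> \<open>\<open>K'\<close> is split into a part covered by \<open>W1\<close> and a part covered by the other sets; the two parts meet
      in the separator.\<close>
    define K1 K2 where "K1 = K' - B" and "K2 = K' - A"
    have K12c: "closedin X K1" "closedin X K2" unfolding K1_def K2_def using insert.prems(3) AB(1,2) by (auto intro: closedin_diff)
    have K12: "K1 \<subseteq> W1" "K2 \<subseteq> \<Union>\<W>" "K1 \<union> K2 = K'" "K1 \<inter> K2 = K' - (A \<union> B)" using AB unfolding K1_def K2_def by blast+
    have "coloured X K2 (Suc j)" using coloured_subset[OF insert.prems(2) K12c(2) _ KX] unfolding K2_def by blast
    then obtain N' W2 where N': "N' \<in> S" "openin X W2" "K2 \<subseteq> W2" "W2 \<subseteq> O'" "Null n u (N * N') W2"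
      using insert.IH[OF insert.prems(1) _ K12c(2) K12(2)] by blast
    have "Null n u (N * N') W1" using pow[OF Suc.prems(3) W1(2,3)] .
    from glue[OF Suc.prems(3,4) W1(1) N'(2) W1(2) N'(4) this N'(5)] obtain k where k: "\<Gamma> (Suc n) (W1 \<inter> W2) k"
      and k': "\<forall>M W V1' V2'. openin X W \<and> W \<subseteq> W1 \<inter> W2 \<and>
         Null (Suc n) k M W \<and> openin X V1' \<and> V1' \<subseteq> W1 \<and> openin X V2' \<and> V2' \<subseteq> W2 \<and> X closure_of (V1' \<inter> V2') \<subseteq> W \<longrightarrow>
           Null n u (N * N' * M) (V1' \<union> V2')" by (elim exE conjE)
    have "closedin X (K1 \<inter> K2)" using K12c by (rule closedin_Int)
    moreover have "K1 \<inter> K2 \<subseteq> W1 \<inter> W2" using K12(1) N'(3) by blast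
    ultimately obtain M W where M: "M \<in> S" "openin X W" "K1 \<inter> K2 \<subseteq> W" "W \<subseteq> W1 \<inter> W2" "Null (Suc n) k M W"
      using outer[of "K1 \<inter> K2" "Suc n" "W1 \<inter> W2" k] AB(6) k openin_Int[OF W1(1) N'(2)] K12(4) by auto
    \<comment> \<open>The two open sets are shrunk until the closure of their intersection lies in \<open>W\<close>, where the
      difference of the contractions dies.\<close>
    have "closedin X (K1 - W)" "closedin X (K2 - W)" "(K1 - W) \<inter> (K2 - W) = {}" using K12c M by (auto intro: closedin_diff)
    then obtain P Q where PQ: "openin X P" "openin X Q" "K1 - W \<subseteq> P" "K2 - W \<subseteq> Q" "X closure_of P \<inter> X closure_of Q = {}"
      using normal_space_disjoint_closures[OF normal] by metis
    have PQ0: "P \<inter> Q = {}" using PQ(5) closure_of_subset[OF openin_subset[OF PQ(1)]] closure_of_subset[OF openin_subset[OF PQ(2)]] by blast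
    have "closedin X ((K1 - P) \<union> (K2 - Q))" using K12c PQ by (auto intro: closedin_diff)
    moreover have "(K1 - P) \<union> (K2 - Q) \<subseteq> W" using PQ by blast
    ultimately obtain R where R: "openin X R" "(K1 - P) \<union> (K2 - Q) \<subseteq> R" "X closure_of R \<subseteq> W"
      using normal M(2) unfolding normal_space_alt by meson
    define V1 V2 where "V1 = W1 \<inter> (P \<union> R)" and "V2 = W2 \<inter> (Q \<union> R)"
    have "V1 \<inter> V2 \<subseteq> R" using PQ0 unfolding V1_def V2_def by blast
    then have cl: "X closure_of (V1 \<inter> V2) \<subseteq> W" using R(3) closure_of_mono by blast
    have V: "openin X V1" "openin X V2" "V1 \<subseteq> W1" "V2 \<subseteq> W2" unfolding V1_def V2_def using W1 N' PQ R by auto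
    have "Null n u (N * N' * M) (V1 \<union> V2)"
      by (rule k'[rule_format, of W]) (intro conjI M(2,4,5) V cl)
    moreover have "K' \<subseteq> V1 \<union> V2" using K12 N'(3) R(2) unfolding V1_def V2_def by blast
    moreover have "V1 \<union> V2 \<subseteq> O'" "openin X (V1 \<union> V2)" using V W1 N' by auto
    ultimately show ?case using S(2)[OF N'(1) M(1)] by (intro bexI[of _ "N' * M"] exI[of _ "V1 \<union> V2"]) (auto simp: mult.assoc)
  qed
  have "\<exists>N W. N \<in> S \<and> openin X W \<and> x \<in> W \<and> W \<subseteq> O' \<and> Null n u N W" if "x \<in> K" for x
    using local[OF Suc.prems(3,4)] that Suc.prems(5) by blast
  then obtain Nx Wx where NW: "\<And>x. x \<in> K \<Longrightarrow> Nx x \<in> S \<and> openin X (Wx x) \<and> x \<in> Wx x \<and> Wx x \<subseteq> O' \<and> Null n u (Nx x) (Wx x)" by metis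
  have "compactin X K" using Suc.prems(2) X(1) closedin_compact_space by blast
  moreover have "\<And>W. W \<in> Wx ` K \<Longrightarrow> openin X W" "K \<subseteq> \<Union>(Wx ` K)" using NW by blast+
  ultimately obtain \<F> where "finite \<F>" "\<F> \<subseteq> Wx ` K" "K \<subseteq> \<Union>\<F>" unfolding compactin_def by meson
  then obtain F where F: "finite F" "F \<subseteq> K" "K \<subseteq> \<Union>(Wx ` F)" by (metis finite_subset_image)
  define N where "N = (\<Prod>x\<in>F. Nx x)"
  have NS: "(\<Prod>x\<in>F'. Nx x) \<in> S" if "F' \<subseteq> F" for F'
    using finite_subset[OF that F(1)] that
  proof (induction F')
    case empty then show ?case using S(1) by simp
  next
    case (insert x F') then show ?case using S(2) NW F(2) by auto
  qed
  have "Null n u N (Wx x)" if "x \<in> F" for x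
  proof -
    have "N = Nx x * (\<Prod>x\<in>F - {x}. Nx x)" unfolding N_def using F(1) that by (simp add: prod.remove)
    then show ?thesis using pow[OF Suc.prems(3)] NW[of x] F(2) that by auto
  qed
  then have imageW: "\<And>W. W \<in> Wx ` F \<Longrightarrow> openin X W \<and> W \<subseteq> O' \<and> Null n u N W" using NW F(2) by auto
  have "\<exists>N'\<in>S. \<exists>W. openin X W \<and> K \<subseteq> W \<and> W \<subseteq> O' \<and> Null n u (N * N') W"
    by (rule finite_case[OF finite_imageI[OF F(1)] _ Suc.prems(1,2) F(3)]) (rule imageW)
  then obtain N' W where "N' \<in> S" "openin X W" "K \<subseteq> W" "W \<subseteq> O'" "Null n u (N * N') W" by (elim exE conjE bexE)
  then show ?case using S(2)[OF NS[of F]] unfolding N_def by blast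
qed

section \<open>Principal bundles\<close>

locale principal =
  fixes \<xi> :: "('g, 'x, 'p) pbundle"
  assumes principal: "principal_bundle \<xi>"
begin

abbreviation "\<G> \<equiv> sgrp \<xi>"

definition over :: "'x set \<Rightarrow> 'p topology" where
  "over W = subtopology (total \<xi>) {p \<in> topspace (total \<xi>). proj \<xi> p \<in> W}"

abbreviation "Over W \<equiv> topspace (over W)"

lemma topgroup: "topological_group \<G> (sgtop \<xi>)"
  and proj_cont: "continuous_map (total \<xi>) (base \<xi>) (proj \<xi>)"
  and ract_cont: "continuous_map (prod_topology (total \<xi>) (sgtop \<xi>)) (total \<xi>) (\<lambda>(p, g). ract \<xi> p g)"
  and ract_one: "p \<in> topspace (total \<xi>) \<Longrightarrow> ract \<xi> p \<one>\<^bsub>\<G>\<^esub> = p"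
  and ract_mult: "p \<in> topspace (total \<xi>) \<Longrightarrow> g \<in> carrier \<G> \<Longrightarrow> h \<in> carrier \<G> \<Longrightarrow>
     ract \<xi> p (g \<otimes>\<^bsub>\<G>\<^esub> h) = ract \<xi> (ract \<xi> p g) h"
  using principal unfolding principal_bundle_def by blast+

lemma sgroup: "group \<G>" and sgtop_carrier: "topspace (sgtop \<xi>) = carrier \<G>"
  and sinv_cont: "continuous_map (sgtop \<xi>) (sgtop \<xi>) (\<lambda>g. inv\<^bsub>\<G>\<^esub> g)"
  using topgroup unfolding topological_group_def by blast+

lemma ract_closed: "p \<in> topspace (total \<xi>) \<Longrightarrow> g \<in> carrier \<G> \<Longrightarrow> ract \<xi> p g \<in> topspace (total \<xi>)"
  using continuous_map_in[OF ract_cont, of "(p, g)"] sgtop_carrier by simp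

lemma proj_in: "p \<in> topspace (total \<xi>) \<Longrightarrow> proj \<xi> p \<in> topspace (base \<xi>)"
  by (rule continuous_map_in[OF proj_cont])

lemma topspace_over [simp]: "Over W = {p \<in> topspace (total \<xi>). proj \<xi> p \<in> W}"
  by (auto simp: over_def)

lemma over_topspace: "over (topspace (base \<xi>)) = total \<xi>"
proof -
  have "topspace (total \<xi>) \<subseteq> {p \<in> topspace (total \<xi>). proj \<xi> p \<in> topspace (base \<xi>)}"
    using proj_in by blast
  then show ?thesis unfolding over_def by (rule subtopology_superset)
qed

text \<open>A local trivialization, given by a section \<open>\<sigma>\<close> and the coordinate \<open>\<gamma>\<close> in the structure group.\<close>

definition trivial :: "'x set \<Rightarrow> ('x \<Rightarrow> 'p) \<Rightarrow> ('p \<Rightarrow> 'g) \<Rightarrow> bool" where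
  "trivial U \<sigma> \<gamma> \<longleftrightarrow> openin (base \<xi>) U \<and> continuous_map (subtopology (base \<xi>) U) (total \<xi>) \<sigma> \<and>
     (\<forall>y\<in>U. proj \<xi> (\<sigma> y) = y) \<and> continuous_map (over U) (sgtop \<xi>) \<gamma> \<and>
     (\<forall>p\<in>Over U. p = ract \<xi> (\<sigma> (proj \<xi> p)) (\<gamma> p)) \<and>
     (\<forall>p\<in>Over U. \<forall>g\<in>carrier \<G>. proj \<xi> (ract \<xi> p g) = proj \<xi> p \<and> \<gamma> (ract \<xi> p g) = \<gamma> p \<otimes>\<^bsub>\<G>\<^esub> g)"

lemma locally_trivial:
  assumes x: "x \<in> topspace (base \<xi>)"
  obtains U \<sigma> \<gamma> where "x \<in> U" "trivial U \<sigma> \<gamma>"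
proof -
  interpret sg: group \<G> by (rule sgroup)
  obtain U \<phi> where U: "openin (base \<xi>) U" "x \<in> U" and
    hom0: "homeomorphic_map (prod_topology (subtopology (base \<xi>) U) (sgtop \<xi>))
      (subtopology (total \<xi>) {p \<in> topspace (total \<xi>). proj \<xi> p \<in> U}) \<phi>" and
    pr0: "\<forall>u\<in>U. \<forall>g\<in>carrier \<G>. proj \<xi> (\<phi> (u, g)) = u" and
    eq0: "\<forall>u\<in>U. \<forall>g\<in>carrier \<G>. \<forall>h\<in>carrier \<G>. \<phi> (u, g \<otimes>\<^bsub>\<G>\<^esub> h) = ract \<xi> (\<phi> (u, g)) h"
    using principal[unfolded principal_bundle_def, THEN conjunct2, THEN conjunct2, THEN conjunct2,
        THEN conjunct2, THEN conjunct2, rule_format, OF x]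
    by (elim exE conjE)
  note hom = hom0[folded over_def]
  have pr: "proj \<xi> (\<phi> (u, g)) = u" if "u \<in> U" "g \<in> carrier \<G>" for u g using pr0 that by blast
  have eq: "\<phi> (u, g \<otimes>\<^bsub>\<G>\<^esub> h) = ract \<xi> (\<phi> (u, g)) h" if "u \<in> U" "g \<in> carrier \<G>" "h \<in> carrier \<G>" for u g h
    using eq0 that by blast
  have UX: "U \<subseteq> topspace (base \<xi>)" using U openin_subset by blast
  obtain \<psi> where \<psi>: "homeomorphic_maps (prod_topology (subtopology (base \<xi>) U) (sgtop \<xi>)) (over U) \<phi> \<psi>"
    using hom unfolding homeomorphic_map_maps by blast
  have \<phi>c: "continuous_map (prod_topology (subtopology (base \<xi>) U) (sgtop \<xi>)) (over U) \<phi>"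
    and \<psi>c: "continuous_map (over U) (prod_topology (subtopology (base \<xi>) U) (sgtop \<xi>)) \<psi>"
    and \<psi>\<phi>: "\<And>u g. u \<in> U \<Longrightarrow> g \<in> carrier \<G> \<Longrightarrow> \<psi> (\<phi> (u, g)) = (u, g)"
    and \<phi>\<psi>: "\<And>p. p \<in> Over U \<Longrightarrow> \<phi> (\<psi> p) = p"
    using \<psi> UX sgtop_carrier unfolding homeomorphic_maps_def by auto
  have one: "\<one>\<^bsub>\<G>\<^esub> \<in> carrier \<G>" by simp
  define \<sigma> where "\<sigma> y = \<phi> (y, \<one>\<^bsub>\<G>\<^esub>)" for y
  define \<gamma> where "\<gamma> p = snd (\<psi> p)" for p
  have \<psi>p: "\<psi> p = (proj \<xi> p, \<gamma> p)" "\<gamma> p \<in> carrier \<G>" "proj \<xi> p \<in> U" if "p \<in> Over U" for p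
  proof -
    have "\<psi> p \<in> topspace (prod_topology (subtopology (base \<xi>) U) (sgtop \<xi>))" using continuous_map_in[OF \<psi>c that] .
    then obtain u g where ug: "\<psi> p = (u, g)" "u \<in> U" "g \<in> carrier \<G>" using sgtop_carrier by auto
    then have "proj \<xi> p = u" using \<phi>\<psi>[OF that] pr by metis
    then show "\<psi> p = (proj \<xi> p, \<gamma> p)" "\<gamma> p \<in> carrier \<G>" "proj \<xi> p \<in> U" using ug by (auto simp: \<gamma>_def)
  qed
  have "continuous_map (subtopology (base \<xi>) U) (over U) (\<phi> \<circ> (\<lambda>y. (y, \<one>\<^bsub>\<G>\<^esub>)))"
    using sgtop_carrier by (intro continuous_map_compose[OF _ \<phi>c]) (simp add: continuous_map_paired continuous_map_identity)
  then have "continuous_map (subtopology (base \<xi>) U) (total \<xi>) \<sigma>"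
    unfolding over_def continuous_map_in_subtopology \<sigma>_def comp_def by simp
  moreover have "continuous_map (over U) (sgtop \<xi>) \<gamma>"
    using continuous_map_compose[OF \<psi>c continuous_map_snd] by (simp add: \<gamma>_def[abs_def] comp_def)
  moreover have "p = ract \<xi> (\<sigma> (proj \<xi> p)) (\<gamma> p)" if "p \<in> Over U" for p
    using eq[OF \<psi>p(3)[OF that] one \<psi>p(2)[OF that]] \<phi>\<psi>[OF that] \<psi>p[OF that] by (simp add: \<sigma>_def)
  moreover have "proj \<xi> (ract \<xi> p g) = proj \<xi> p \<and> \<gamma> (ract \<xi> p g) = \<gamma> p \<otimes>\<^bsub>\<G>\<^esub> g"
    if "p \<in> Over U" "g \<in> carrier \<G>" for p g
  proof -
    have "ract \<xi> p g = \<phi> (proj \<xi> p, \<gamma> p \<otimes>\<^bsub>\<G>\<^esub> g)"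
      using eq[OF \<psi>p(3,2)[OF that(1)] that(2)] \<phi>\<psi>[OF that(1)] \<psi>p(1)[OF that(1)] by simp
    then show ?thesis using pr[OF \<psi>p(3)[OF that(1)]] \<psi>\<phi>[OF \<psi>p(3)[OF that(1)]] \<psi>p(2)[OF that(1)] that(2)
      by (simp add: \<gamma>_def)
  qed
  ultimately have "trivial U \<sigma> \<gamma>" unfolding trivial_def using U(1) pr one by (simp add: \<sigma>_def)
  then show ?thesis using that U(2) by blast
qed

lemma trivialD:
  assumes "trivial U \<sigma> \<gamma>"
  shows "openin (base \<xi>) U" "continuous_map (subtopology (base \<xi>) U) (total \<xi>) \<sigma>"
    "y \<in> U \<Longrightarrow> proj \<xi> (\<sigma> y) = y" "y \<in> U \<Longrightarrow> \<sigma> y \<in> topspace (total \<xi>)" "continuous_map (over U) (sgtop \<xi>) \<gamma>"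
    "p \<in> Over U \<Longrightarrow> \<gamma> p \<in> carrier \<G>"
    "p \<in> Over U \<Longrightarrow> ract \<xi> (\<sigma> (proj \<xi> p)) (\<gamma> p) = p"
    "p \<in> Over U \<Longrightarrow> g \<in> carrier \<G> \<Longrightarrow> \<gamma> (ract \<xi> p g) = \<gamma> p \<otimes>\<^bsub>\<G>\<^esub> g"
proof -
  have U: "openin (base \<xi>) U" and s: "continuous_map (subtopology (base \<xi>) U) (total \<xi>) \<sigma>"
    and g: "continuous_map (over U) (sgtop \<xi>) \<gamma>" using assms unfolding trivial_def by blast+
  show "openin (base \<xi>) U" "continuous_map (subtopology (base \<xi>) U) (total \<xi>) \<sigma>" "continuous_map (over U) (sgtop \<xi>) \<gamma>"
    by fact+
  show "y \<in> U \<Longrightarrow> proj \<xi> (\<sigma> y) = y" using assms unfolding trivial_def by blast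
  show "y \<in> U \<Longrightarrow> \<sigma> y \<in> topspace (total \<xi>)" using continuous_map_in[OF s, of y] openin_subset[OF U] by auto
  show "p \<in> Over U \<Longrightarrow> \<gamma> p \<in> carrier \<G>" using continuous_map_in[OF g, of p] sgtop_carrier by simp
  show "p \<in> Over U \<Longrightarrow> ract \<xi> (\<sigma> (proj \<xi> p)) (\<gamma> p) = p" using assms unfolding trivial_def by metis
  show "p \<in> Over U \<Longrightarrow> g \<in> carrier \<G> \<Longrightarrow> \<gamma> (ract \<xi> p g) = \<gamma> p \<otimes>\<^bsub>\<G>\<^esub> g" using assms unfolding trivial_def by blast
qed

lemma proj_ract: assumes p: "p \<in> topspace (total \<xi>)" and g: "g \<in> carrier \<G>" shows "proj \<xi> (ract \<xi> p g) = proj \<xi> p"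
proof -
  obtain U \<sigma> \<gamma> where "proj \<xi> p \<in> U" "trivial U \<sigma> \<gamma>" using locally_trivial[OF proj_in[OF p]] .
  then show ?thesis using p g unfolding trivial_def topspace_over by blast
qed

lemma openin_over: "openin (base \<xi>) V \<Longrightarrow> V \<subseteq> W \<Longrightarrow> openin (over W) (Over V)"
  unfolding over_def openin_subtopology
  using openin_continuous_map_preimage[OF proj_cont, of V] by (intro exI[of _ "{p \<in> topspace (total \<xi>). proj \<xi> p \<in> V}"]) auto

lemma over_sub: "V \<subseteq> W \<Longrightarrow> over V = subtopology (over W) (Over V)"
  unfolding topspace_over unfolding over_def subtopology_subtopology
  by (rule arg_cong[where f = "subtopology (total \<xi>)"]) auto

lemma over_incl: "V \<subseteq> W \<Longrightarrow> continuous_map (over V) (over W) (\<lambda>p. p)"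
  by (metis over_sub continuous_map_identity continuous_map_in_subtopology)

lemma proj_over_cont: "continuous_map (over W) (base \<xi>) (proj \<xi>)"
  unfolding over_def by (rule continuous_map_from_subtopology[OF proj_cont])

end

section \<open>Equivariant families of relative loops\<close>

text \<open>The structure group acts on all stages. The last assumption provides neighbourhoods of the identity that
  contract to it; they make families that are close to a constant one contractible relative to it.\<close>

locale equivariant_bundle = principal \<xi> + filtered_group G T
  for \<xi> :: "('g, 'x, 'p) pbundle" and G :: "('a, 'm) monoid_scheme" (structure) and T :: "nat \<Rightarrow> 'a topology" +
  fixes \<beta> :: "'g \<Rightarrow> 'a \<Rightarrow> 'a"
  assumes \<beta>_closed: "g \<in> carrier (sgrp \<xi>) \<Longrightarrow> a \<in> carrier G \<Longrightarrow> \<beta> g a \<in> carrier G"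
    and \<beta>_hom: "g \<in> carrier (sgrp \<xi>) \<Longrightarrow> a \<in> carrier G \<Longrightarrow> b \<in> carrier G \<Longrightarrow> \<beta> g (a \<otimes> b) = \<beta> g a \<otimes> \<beta> g b"
    and \<beta>_one: "a \<in> carrier G \<Longrightarrow> \<beta> \<one>\<^bsub>sgrp \<xi>\<^esub> a = a"
    and \<beta>_mult: "g \<in> carrier (sgrp \<xi>) \<Longrightarrow> h \<in> carrier (sgrp \<xi>) \<Longrightarrow> a \<in> carrier G \<Longrightarrow> \<beta> (g \<otimes>\<^bsub>sgrp \<xi>\<^esub> h) a = \<beta> g (\<beta> h a)"
    and \<beta>_cont: "continuous_map (prod_topology (sgtop \<xi>) (T m)) (T m) (\<lambda>(g, a). \<beta> g a)"
    and contraction: "\<exists>\<O> c. openin (T m) \<O> \<and> \<one> \<in> \<O> \<and>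
       continuous_map (prod_topology (top_of_set {0..1::real}) (subtopology (T m) \<O>)) (T m) (\<lambda>(s, a). c s a) \<and>
       (\<forall>a\<in>\<O>. c 0 a = \<one> \<and> c 1 a = a) \<and> (\<forall>s\<in>{0..1}. c s \<one> = \<one>) \<and>
       (\<forall>s\<in>{0..1}. \<forall>a\<in>\<O> \<inter> topspace (T 0). c s a \<in> Fo)"
begin

lemma \<beta>_unit: assumes g: "g \<in> carrier \<G>" shows "\<beta> g \<one> = \<one>"
proof -
  have "\<beta> g \<one> \<otimes> \<beta> g \<one> = \<beta> g \<one>" using \<beta>_hom[OF g, of \<one> \<one>] by simp
  then show ?thesis using \<beta>_closed[OF g one_closed] by simp
qed

lemma \<beta>_inv: assumes g: "g \<in> carrier \<G>" and a: "a \<in> carrier G" shows "\<beta> g (inv a) = inv (\<beta> g a)"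
proof -
  have "\<beta> g (inv a) \<otimes> \<beta> g a = \<one>" using \<beta>_hom[OF g, of "inv a" a] \<beta>_unit[OF g] a by simp
  then show ?thesis using inv_equality \<beta>_closed[OF g] a by (metis inv_closed)
qed

lemma \<beta>_pow: assumes g: "g \<in> carrier \<G>" and a: "a \<in> carrier G" shows "\<beta> g (a [^] (N::nat)) = \<beta> g a [^] N"
  by (induction N) (simp_all add: \<beta>_unit g \<beta>_hom a)

lemma cm_\<beta>:
  assumes "continuous_map Y (sgtop \<xi>) g" "continuous_map Y (T m) a"
  shows "continuous_map Y (T m) (\<lambda>y. \<beta> (g y) (a y))"
proof -
  have "continuous_map Y (prod_topology (sgtop \<xi>) (T m)) (\<lambda>y. (g y, a y))"
    using assms by (simp add: continuous_map_paired)
  from continuous_map_compose[OF this \<beta>_cont] show ?thesis by (simp add: comp_def)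
qed

lemma \<beta>_Fo: assumes g: "g \<in> carrier \<G>" and a: "a \<in> Fo" shows "\<beta> g a \<in> Fo"
proof -
  obtain f where f: "continuous_map (top_of_set {0..1::real}) (T 0) f" "f 0 = \<one>" "f 1 = a" using Fo_path[OF a] .
  have "continuous_map (top_of_set {0..1::real}) (T 0) (\<lambda>r. \<beta> g (f r))"
    using g sgtop_carrier by (intro cm_\<beta> f(1)) simp
  from Fo_pathI[OF this] show ?thesis using f \<beta>_unit[OF g] by simp
qed

lemma admissible_\<beta>: "g \<in> carrier \<G> \<Longrightarrow> admissible Fo n z a \<Longrightarrow> admissible Fo n z (\<beta> g a)"
  unfolding admissible_def using \<beta>_Fo \<beta>_unit by auto

text \<open>\<open>family k n W m h\<close>: \<open>h\<close> is an equivariant family over \<open>W\<close>, parametrized by the \<open>k\<close>-cube, with the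
  boundary behaviour of relative loops in the first \<open>n + 1\<close> coordinates. For \<open>k = n + 1\<close> it is a family of relative
  loops; a contraction has one more coordinate, \<open>k = n + 2\<close>.\<close>

definition family :: "nat \<Rightarrow> nat \<Rightarrow> 'x set \<Rightarrow> nat \<Rightarrow> ('p \<Rightarrow> (nat \<Rightarrow> real) \<Rightarrow> 'a) \<Rightarrow> bool" where
  "family k n W m h \<longleftrightarrow> continuous_map (prod_topology (over W) (cube k)) (T m) (\<lambda>(p, z). h p z) \<and>
     (\<forall>p\<in>Over W. \<forall>z\<in>Cube k. admissible Fo n z (h p z) \<and>
        (\<forall>g\<in>carrier \<G>. h (ract \<xi> p g) z = \<beta> (inv\<^bsub>\<G>\<^esub> g) (h p z)))"

definition contracts :: "nat \<Rightarrow> 'x set \<Rightarrow> nat \<Rightarrow> ('p \<Rightarrow> (nat \<Rightarrow> real) \<Rightarrow> 'a) \<Rightarrow> ('p \<Rightarrow> (nat \<Rightarrow> real) \<Rightarrow> 'a) \<Rightarrow> bool" where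
  "contracts n W m h v \<longleftrightarrow> family (Suc (Suc n)) n W m h \<and> (\<forall>p\<in>Over W. \<forall>z\<in>Cube (Suc (Suc n)).
     (z (Suc n) = 0 \<longrightarrow> h p z = \<one>) \<and> (z (Suc n) = 1 \<longrightarrow> h p z = v p (z(Suc n := 0))))"

definition null_family :: "nat \<Rightarrow> 'x set \<Rightarrow> ('p \<Rightarrow> (nat \<Rightarrow> real) \<Rightarrow> 'a) \<Rightarrow> bool" where
  "null_family n W v \<longleftrightarrow> (\<exists>m h. contracts n W m h v)"

lemma family_closed: "family k n W m h \<Longrightarrow> p \<in> Over W \<Longrightarrow> z \<in> Cube k \<Longrightarrow> h p z \<in> carrier G"
  unfolding family_def using cm_closed[of "prod_topology (over W) (cube k)" m "\<lambda>(p, z). h p z" "(p, z)"] by simp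

lemma family_cont: "family k n W m h \<Longrightarrow> continuous_map (prod_topology (over W) (cube k)) (T m) (\<lambda>y. h (fst y) (snd y))"
  unfolding family_def by (simp add: case_prod_unfold)

lemma family_adm: "family k n W m h \<Longrightarrow> p \<in> Over W \<Longrightarrow> z \<in> Cube k \<Longrightarrow> admissible Fo n z (h p z)"
  unfolding family_def by blast

lemma family_equi: "family k n W m h \<Longrightarrow> p \<in> Over W \<Longrightarrow> z \<in> Cube k \<Longrightarrow> g \<in> carrier \<G> \<Longrightarrow>
   h (ract \<xi> p g) z = \<beta> (inv\<^bsub>\<G>\<^esub> g) (h p z)"
  unfolding family_def by blast

lemma familyI:
  assumes "continuous_map (prod_topology (over W) (cube k)) (T m) (\<lambda>y. h (fst y) (snd y))"
    and "\<And>p z. p \<in> Over W \<Longrightarrow> z \<in> Cube k \<Longrightarrow> admissible Fo n z (h p z)"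
    and "\<And>p z g. p \<in> Over W \<Longrightarrow> z \<in> Cube k \<Longrightarrow> g \<in> carrier \<G> \<Longrightarrow> h (ract \<xi> p g) z = \<beta> (inv\<^bsub>\<G>\<^esub> g) (h p z)"
  shows "family k n W m h"
  using assms unfolding family_def by (simp add: case_prod_unfold)

lemma sinv: "g \<in> carrier \<G> \<Longrightarrow> inv\<^bsub>\<G>\<^esub> g \<in> carrier \<G>"
  using group.inv_closed[OF sgroup] .

lemma family_one: "family k n W m (\<lambda>p z. \<one>)"
  by (rule familyI) (simp_all add: cm_one admissible_one \<beta>_unit sinv del: continuous_map_const)

lemma family_mult: assumes "family k n W m h" "family k n W m h'" shows "family k n W m (\<lambda>p z. h p z \<otimes> h' p z)"
  by (rule familyI) (use assms family_closed in \<open>simp_all add: cm_mult[OF family_cont family_cont] admissible_mult family_adm family_equi \<beta>_hom sinv\<close>)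

lemma family_inv: assumes "family k n W m h" shows "family k n W m (\<lambda>p z. inv (h p z))"
  by (rule familyI) (use assms family_closed in \<open>simp_all add: cm_inv[OF family_cont] admissible_inv family_adm family_equi \<beta>_inv sinv\<close>)

lemma family_pow: "family k n W m h \<Longrightarrow> family k n W m (\<lambda>p z. h p z [^] (N::nat))"
  by (induction N) (simp_all add: family_one family_mult)

lemma family_lift: "family k n W m h \<Longrightarrow> m \<le> m' \<Longrightarrow> family k n W m' h"
  unfolding family_def by (metis T_lift)

lemma family_subset: assumes "family k n W m h" "V \<subseteq> W" shows "family k n V m h"
proof (rule familyI)
  have "continuous_map (prod_topology (over V) (cube k)) (prod_topology (over W) (cube k)) (\<lambda>y. (fst y, snd y))"
    unfolding continuous_map_paired
    using continuous_map_compose[OF continuous_map_fst over_incl[OF assms(2)], of "cube k"]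
    by (intro conjI continuous_map_snd) (simp only: comp_def)
  then have "continuous_map (prod_topology (over V) (cube k)) (prod_topology (over W) (cube k)) (\<lambda>y. y)" by simp
  from cm_comp[OF this family_cont[OF assms(1)]]
  show "continuous_map (prod_topology (over V) (cube k)) (T m) (\<lambda>y. h (fst y) (snd y))" .
  have sub: "Over V \<subseteq> Over W" using assms(2) by auto
  show "admissible Fo n z (h p z)" if "p \<in> Over V" "z \<in> Cube k" for p z
    using family_adm[OF assms(1)] that sub by blast
  show "h (ract \<xi> p g) z = \<beta> (inv\<^bsub>\<G>\<^esub> g) (h p z)" if "p \<in> Over V" "z \<in> Cube k" "g \<in> carrier \<G>" for p z g
    using family_equi[OF assms(1)] that sub by blast
qed

lemma family_reparam:
  assumes h: "family k' n' W m h"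
    and \<rho>: "continuous_map (prod_topology (over W) (cube k)) (cube k') (\<lambda>y. \<rho> (fst y) (snd y))"
    and admissible: "\<And>p z a. p \<in> Over W \<Longrightarrow> z \<in> Cube k \<Longrightarrow> admissible Fo n' (\<rho> p z) a \<Longrightarrow> admissible Fo n z a"
    and inv: "\<And>p z g. p \<in> Over W \<Longrightarrow> g \<in> carrier \<G> \<Longrightarrow> \<rho> (ract \<xi> p g) z = \<rho> p z"
  shows "family k n W m (\<lambda>p z. h p (\<rho> p z))"
proof (rule familyI)
  have "continuous_map (prod_topology (over W) (cube k)) (prod_topology (over W) (cube k')) (\<lambda>y. (fst y, \<rho> (fst y) (snd y)))"
    unfolding continuous_map_paired using \<rho> continuous_map_fst by blast
  from cm_comp[OF this family_cont[OF h]]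
  show "continuous_map (prod_topology (over W) (cube k)) (T m) (\<lambda>y. h (fst y) (\<rho> (fst y) (snd y)))" by simp
  have \<rho>in: "\<rho> p z \<in> Cube k'" if "p \<in> Over W" "z \<in> Cube k" for p z
    using continuous_map_in[OF \<rho>, of "(p, z)"] that by simp
  show "admissible Fo n z (h p (\<rho> p z))" if "p \<in> Over W" "z \<in> Cube k" for p z
    using admissible[OF that] family_adm[OF h that(1) \<rho>in[OF that]] by blast
  show "h (ract \<xi> p g) (\<rho> (ract \<xi> p g) z) = \<beta> (inv\<^bsub>\<G>\<^esub> g) (h p (\<rho> p z))"
    if "p \<in> Over W" "z \<in> Cube k" "g \<in> carrier \<G>" for p z g
    using inv[OF that(1,3)] family_equi[OF h that(1) \<rho>in[OF that(1,2)] that(3)] by simp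
qed

lemma family_paste:
  assumes W: "openin (base \<xi>) W1" "openin (base \<xi>) W2" and h: "family k n W1 m h" "family k n W2 m h'"
    and agree: "\<And>p z. p \<in> Over W1 \<Longrightarrow> p \<in> Over W2 \<Longrightarrow> z \<in> Cube k \<Longrightarrow> h p z = h' p z"
  shows "family k n (W1 \<union> W2) m (\<lambda>p. if proj \<xi> p \<in> W1 then h p else h' p)"
proof (rule familyI)
  let ?Y = "prod_topology (over (W1 \<union> W2)) (cube k)"
  define O' where "O' i = Over (if i then W1 else W2) \<times> Cube k" for i
  have sub: "subtopology ?Y (O' i) = prod_topology (over (if i then W1 else W2)) (cube k)" for i
  proof -
    have "over (if i then W1 else W2) = subtopology (over (W1 \<union> W2)) (Over (if i then W1 else W2))"
      by (rule over_sub) auto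
    then show ?thesis unfolding O'_def subtopology_Times subtopology_topspace by (rule arg_cong2[OF sym refl])
  qed
  show "continuous_map ?Y (T m) (\<lambda>y. (if proj \<xi> (fst y) \<in> W1 then h (fst y) else h' (fst y)) (snd y))"
  proof (rule pasting_lemma[where I = UNIV and T = O' and f = "\<lambda>i y. if i then h (fst y) (snd y) else h' (fst y) (snd y)"])
    show "openin ?Y (O' i)" for i unfolding O'_def
      using openin_over[of "if i then W1 else W2" "W1 \<union> W2"] W by (intro openin_prod_Times_iff[THEN iffD2] disjI2) auto
    show "continuous_map (subtopology ?Y (O' i)) (T m) (\<lambda>y. if i then h (fst y) (snd y) else h' (fst y) (snd y))" for i
      unfolding sub using family_cont[OF h(1)] family_cont[OF h(2)] by (cases i) simp_all
    show "(if i then h (fst y) (snd y) else h' (fst y) (snd y)) = (if j then h (fst y) (snd y) else h' (fst y) (snd y))"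
      if "y \<in> topspace ?Y \<inter> O' i \<inter> O' j" for i j y
      using that agree[of "fst y" "snd y"] by (cases i; cases j) (auto simp: O'_def)
    show "\<exists>j. j \<in> UNIV \<and> y \<in> O' j \<and> (if proj \<xi> (fst y) \<in> W1 then h (fst y) else h' (fst y)) (snd y) =
       (if j then h (fst y) (snd y) else h' (fst y) (snd y))" if "y \<in> topspace ?Y" for y
      using that by (intro exI[of _ "proj \<xi> (fst y) \<in> W1"]) (auto simp: O'_def)
  qed
  show "admissible Fo n z ((if proj \<xi> p \<in> W1 then h p else h' p) z)"
    if "p \<in> Over (W1 \<union> W2)" "z \<in> Cube k" for p z
    using that family_adm[OF h(1), of p z] family_adm[OF h(2), of p z] by auto
  show "(if proj \<xi> (ract \<xi> p g) \<in> W1 then h (ract \<xi> p g) else h' (ract \<xi> p g)) z =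
      \<beta> (inv\<^bsub>\<G>\<^esub> g) ((if proj \<xi> p \<in> W1 then h p else h' p) z)"
    if "p \<in> Over (W1 \<union> W2)" "z \<in> Cube k" "g \<in> carrier \<G>" for p z g
    using that family_equi[OF h(1), of p z g] family_equi[OF h(2), of p z g] proj_ract[of p g] by auto
qed

lemma null_familyI:
  assumes "family (Suc (Suc n)) n W m h"
    "\<And>p z. p \<in> Over W \<Longrightarrow> z \<in> Cube (Suc (Suc n)) \<Longrightarrow> z (Suc n) = 0 \<Longrightarrow> h p z = \<one>"
    "\<And>p z. p \<in> Over W \<Longrightarrow> z \<in> Cube (Suc (Suc n)) \<Longrightarrow> z (Suc n) = 1 \<Longrightarrow> h p z = v p (z(Suc n := 0))"
  shows "null_family n W v"
  using assms unfolding null_family_def contracts_def by blast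

lemma contractsD:
  assumes "contracts n W m h v"
  shows "family (Suc (Suc n)) n W m h"
    "\<And>p z. p \<in> Over W \<Longrightarrow> z \<in> Cube (Suc (Suc n)) \<Longrightarrow> z (Suc n) = 0 \<Longrightarrow> h p z = \<one>"
    "\<And>p z. p \<in> Over W \<Longrightarrow> z \<in> Cube (Suc (Suc n)) \<Longrightarrow> z (Suc n) = 1 \<Longrightarrow> h p z = v p (z(Suc n := 0))"
  using assms unfolding contracts_def by blast+

lemma null_familyE:
  assumes "null_family n W v"
  obtains m h where "contracts n W m h v"
  using assms unfolding null_family_def by blast

lemma null_family_cong:
  assumes "null_family n W v" "\<And>p z. p \<in> Over W \<Longrightarrow> z \<in> Cube (Suc n) \<Longrightarrow> v p z = w p z"
  shows "null_family n W w"
proof -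
  obtain m h where "contracts n W m h v" using null_familyE[OF assms(1)] .
  note h = contractsD[OF this]
  show ?thesis by (rule null_familyI[OF h(1,2)]) (use h(3) assms(2) cube_drop in auto)
qed

lemma null_family_one: "null_family n W (\<lambda>p z. \<one>)"
  by (rule null_familyI[OF family_one]) auto

lemma null_family_subset: assumes "null_family n W v" "V \<subseteq> W" shows "null_family n V v"
proof -
  obtain m h where "contracts n W m h v" using null_familyE[OF assms(1)] .
  note h = contractsD[OF this]
  show ?thesis by (rule null_familyI[OF family_subset[OF h(1) assms(2)]]) (use h(2,3) assms(2) in auto)
qed

lemma null_family_mult: assumes "null_family n W v" "null_family n W w" shows "null_family n W (\<lambda>p z. v p z \<otimes> w p z)"
proof -
  obtain m h where "contracts n W m h v" using null_familyE[OF assms(1)] .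
  note h = contractsD[OF this]
  obtain m' h' where "contracts n W m' h' w" using null_familyE[OF assms(2)] .
  note h' = contractsD[OF this]
  show ?thesis
    by (rule null_familyI[OF family_mult[OF family_lift[OF h(1), of "max m m'"] family_lift[OF h'(1), of "max m m'"]]]) (simp_all add: h h')
qed

lemma null_family_pow: "null_family n W v \<Longrightarrow> null_family n W (\<lambda>p z. v p z [^] (N::nat))"
  by (induction N) (simp_all add: null_family_one null_family_mult)

lemma null_family_conj: assumes w: "family (Suc n) n W m' w" and v: "null_family n W v" shows "null_family n W (\<lambda>p z. w p z \<otimes> v p z \<otimes> inv (w p z))"
proof -
  obtain m h where "contracts n W m h v" using null_familyE[OF v] .
  note h = contractsD[OF this]
  have c: "continuous_map (prod_topology (over W) (cube (Suc (Suc n)))) (cube (Suc n)) (\<lambda>y. (snd y)(Suc n := 0))"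
    by (rule continuous_map_cube_drop[OF continuous_map_snd])
  have w': "family (Suc (Suc n)) n W m' (\<lambda>p z. w p (z(Suc n := 0)))"
    by (rule family_reparam[OF w c]) (auto simp: admissible_def)
  have wc: "w p (z(Suc n := 0)) \<in> carrier G" if "p \<in> Over W" "z \<in> Cube (Suc (Suc n))" for p z
    using family_closed[OF w that(1) cube_drop[OF that(2)]] .
  let ?M = "max m m'"
  show ?thesis
    by (rule null_familyI[OF family_mult[OF family_mult[OF family_lift[OF w', of ?M] family_lift[OF h(1), of ?M]] family_inv[OF family_lift[OF w', of ?M]]]])
      (simp_all add: h wc)
qed

text \<open>Near a point, an equivariant family is determined up to contraction by its value at that point.\<close>

lemma local_null:
  assumes fibre: "\<And>m w. rel_loop m n w \<Longrightarrow> \<exists>N\<in>S. \<exists>m'. null_rel_loop Fo m' n (\<lambda>z. w z [^] (N::nat))"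
    and u: "family (Suc n) n O' m u" and O': "openin (base \<xi>) O'" and x: "x \<in> O'"
  shows "\<exists>N\<in>S. \<exists>W. openin (base \<xi>) W \<and> x \<in> W \<and> W \<subseteq> O' \<and> null_family n W (\<lambda>p z. u p z [^] N)"
proof -
  interpret sg: group \<G> by (rule sgroup)
  have xX: "x \<in> topspace (base \<xi>)" using O' x openin_subset by blast
  obtain U \<sigma> \<gamma> where U: "x \<in> U" "trivial U \<sigma> \<gamma>" using locally_trivial[OF xX] .
  note t = trivialD[OF U(2)]
  define V0 where "V0 = U \<inter> O'"
  have V0: "openin (base \<xi>) V0" "x \<in> V0" "V0 \<subseteq> U" "V0 \<subseteq> O'" unfolding V0_def using t(1) O' U(1) x by auto
  have \<sigma>O: "\<sigma> y \<in> Over O'" if "y \<in> V0" for y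
  proof -
    have "y \<in> U" "y \<in> O'" using that V0 by auto
    then show ?thesis using t(3,4)[of y] by simp
  qed
  let ?X0 = "subtopology (base \<xi>) V0"
  have tX0: "topspace ?X0 = V0" using openin_subset[OF V0(1)] by auto
  have \<sigma>c: "continuous_map ?X0 (over O') \<sigma>"
  proof -
    have "continuous_map ?X0 (total \<xi>) \<sigma>"
      using continuous_map_from_subtopology_mono[OF t(2) V0(3)] .
    then show ?thesis unfolding over_def continuous_map_in_subtopology
      using \<sigma>O tX0 by auto
  qed
  define w where "w z = u (\<sigma> x) z" for z
  have relw: "rel_loop m n w" unfolding rel_loop_def
  proof (intro conjI ballI)
    have "continuous_map (cube (Suc n)) (prod_topology (over O') (cube (Suc n))) (\<lambda>z. (\<sigma> x, z))"
      using \<sigma>O[OF V0(2)] by (simp add: continuous_map_paired continuous_map_identity)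
    from cm_comp[OF this family_cont[OF u]] show "continuous_map (cube (Suc n)) (T m) w" by (simp add: w_def[abs_def])
    show "admissible Fo n z (w z)" if "z \<in> Cube (Suc n)" for z
      unfolding w_def using family_adm[OF u \<sigma>O[OF V0(2)] that] .
  qed
  obtain N m' where N: "N \<in> S" "null_rel_loop Fo m' n (\<lambda>z. w z [^] N)" using fibre[OF relw] by blast
  then obtain h0 where h0: "continuous_map (cube (Suc (Suc n))) (T m') h0"
     "\<And>z. z\<in>Cube (Suc (Suc n)) \<Longrightarrow> admissible Fo n z (h0 z)"
     "\<And>z. z\<in>Cube (Suc (Suc n)) \<Longrightarrow> z (Suc n) = 0 \<Longrightarrow> h0 z = \<one>"
     "\<And>z. z\<in>Cube (Suc (Suc n)) \<Longrightarrow> z (Suc n) = 1 \<Longrightarrow> h0 z = w (z(Suc n := 0)) [^] N"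
    unfolding null_rel_loop_def by blast
  define M where "M = max m m'"
  define e where "e y z = inv (w z [^] N) \<otimes> u (\<sigma> y) z [^] N" for y z
  let ?Y = "prod_topology ?X0 (cube (Suc n))"
  have uc: "continuous_map ?Y (T M) (\<lambda>q. u (\<sigma> (fst q)) (snd q))"
  proof -
    have "continuous_map ?Y (prod_topology (over O') (cube (Suc n))) (\<lambda>q. (\<sigma> (fst q), snd q))"
      unfolding continuous_map_paired
      using continuous_map_compose[OF continuous_map_fst \<sigma>c, of "cube (Suc n)"]
      by (intro conjI continuous_map_snd) (simp only: comp_def)
    from cm_comp[OF this family_cont[OF u]] show ?thesis using T_lift[of ?Y m _ M] unfolding M_def by simp
  qed
  have wc: "continuous_map (cube (Suc n)) (T M) w" using relw T_lift[of _ m w M] unfolding rel_loop_def M_def by simp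
  have ec: "continuous_map ?Y (T M) (\<lambda>q. e (fst q) (snd q))"
    unfolding e_def by (intro cm_mult cm_inv cm_pow uc cm_comp[OF continuous_map_snd wc])
  have uG: "u (\<sigma> y) z \<in> carrier G" if "y \<in> V0" "z \<in> Cube (Suc n)" for y z
    using family_closed[OF u \<sigma>O[OF that(1)] that(2)] .
  have wG: "w z \<in> carrier G" if "z \<in> Cube (Suc n)" for z
    unfolding w_def using uG[OF V0(2) that] .
  have eadm: "admissible Fo n z (e y z)" if "y \<in> V0" "z \<in> Cube (Suc n)" for y z
    unfolding e_def w_def using family_adm[OF u \<sigma>O that(2)] that(1) V0(2) by (intro admissible_mult admissible_inv admissible_pow) auto
  obtain \<O> c where c: "openin (T M) \<O>" "\<one> \<in> \<O>"
       "continuous_map (prod_topology (top_of_set {0..1::real}) (subtopology (T M) \<O>)) (T M) (\<lambda>(s, a). c s a)"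
       "\<And>a. a\<in>\<O> \<Longrightarrow> c 0 a = \<one>" "\<And>a. a\<in>\<O> \<Longrightarrow> c 1 a = a" "\<And>s. s\<in>{0..1} \<Longrightarrow> c s \<one> = \<one>"
       "\<And>s a. s\<in>{0..1} \<Longrightarrow> a\<in>\<O> \<Longrightarrow> a \<in> topspace (T 0) \<Longrightarrow> c s a \<in> Fo"
    using contraction[of M] by blast
  have op: "openin ?Y {q \<in> topspace ?Y. e (fst q) (snd q) \<in> \<O>}"
    by (rule openin_continuous_map_preimage[OF ec c(1)])
  have cp: "compactin (cube (Suc n)) (Cube (Suc n))"
    using compact_space_cube unfolding compact_space_def .
  have sl: "{x} \<times> Cube (Suc n) \<subseteq> {q \<in> topspace ?Y. e (fst q) (snd q) \<in> \<O>}"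
    using V0 tX0 c(2) wG by (auto simp: e_def w_def[symmetric])
  have "x \<in> topspace ?X0" using V0(2) tX0 by simp
  from tube_lemma_right[OF op cp this sl] obtain V V' where V': "openin ?X0 V" "x \<in> V" "Cube (Suc n) \<subseteq> V'"
    "V \<times> V' \<subseteq> {q \<in> topspace ?Y. e (fst q) (snd q) \<in> \<O>}"
    by (elim exE conjE)
  have "openin (base \<xi>) V" by (rule openin_trans_full[OF V'(1) V0(1)])
  moreover have "V \<subseteq> V0" using openin_subset[OF V'(1)] unfolding tX0 .
  ultimately have V: "openin (base \<xi>) V" "V \<subseteq> V0" "x \<in> V" using V'(2) by simp_all
  have e\<O>: "e y z \<in> \<O>" if "y \<in> V" "z \<in> Cube (Suc n)" for y z
    using V'(3,4) that by fastforce
  \<comment> \<open>Contract along the section first and spread the contraction out by equivariance.\<close>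
  define H0 where "H0 y z = h0 z \<otimes> c (z (Suc n)) (e y (z(Suc n := 0)))" for y z
  define H where "H p z = \<beta> (inv\<^bsub>\<G>\<^esub> (\<gamma> p)) (H0 (proj \<xi> p) z)" for p z
  let ?Z = "prod_topology (over V) (cube (Suc (Suc n)))"
  have overVU: "Over V \<subseteq> Over U" using V V0 by auto
  have pc: "continuous_map (over V) ?X0 (proj \<xi>)"
    unfolding continuous_map_in_subtopology using proj_over_cont V(2) by auto
  have dropc: "continuous_map ?Z (cube (Suc n)) (\<lambda>q. (snd q)(Suc n := 0))"
    by (rule continuous_map_cube_drop[OF continuous_map_snd])
  have e1: "continuous_map ?Z (T M) (\<lambda>q. e (proj \<xi> (fst q)) ((snd q)(Suc n := 0)))"
  proof -
    have "continuous_map ?Z ?Y (\<lambda>q. (proj \<xi> (fst q), (snd q)(Suc n := 0)))"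
      unfolding continuous_map_paired
      using dropc continuous_map_compose[OF continuous_map_fst pc, of "cube (Suc (Suc n))"] by (simp add: comp_def)
    from cm_comp[OF this ec] show ?thesis by simp
  qed
  have c1: "continuous_map ?Z (T M) (\<lambda>q. c (snd q (Suc n)) (e (proj \<xi> (fst q)) ((snd q)(Suc n := 0))))"
  proof -
    have "e (proj \<xi> (fst q)) ((snd q)(Suc n := 0)) \<in> \<O>" if "q \<in> topspace ?Z" for q
      using that by (intro e\<O> cube_drop) auto
    then have "continuous_map ?Z (subtopology (T M) \<O>) (\<lambda>q. e (proj \<xi> (fst q)) ((snd q)(Suc n := 0)))"
      using e1 unfolding continuous_map_in_subtopology by auto
    moreover have "continuous_map ?Z (top_of_set {0..1}) (\<lambda>q. snd q (Suc n))"
      using continuous_map_cube_coordinate_compose[OF continuous_map_snd, of "over V" "Suc (Suc n)" "Suc n"]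
      unfolding continuous_map_in_subtopology by (auto simp: cube_bounds)
    ultimately have "continuous_map ?Z (prod_topology (top_of_set {0..1}) (subtopology (T M) \<O>))
       (\<lambda>q. (snd q (Suc n), e (proj \<xi> (fst q)) ((snd q)(Suc n := 0))))" by (simp add: continuous_map_paired)
    from cm_comp[OF this c(3)] show ?thesis by simp
  qed
  have h1: "continuous_map ?Z (T M) (\<lambda>q. h0 (snd q))"
    by (rule cm_comp[OF continuous_map_snd T_lift[OF h0(1)]]) (simp add: M_def)
  have H0c: "continuous_map ?Z (T M) (\<lambda>q. H0 (proj \<xi> (fst q)) (snd q))"
    unfolding H0_def by (intro cm_mult h1 c1)
  have gc: "continuous_map ?Z (sgtop \<xi>) (\<lambda>q. inv\<^bsub>\<G>\<^esub> (\<gamma> (fst q)))"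
  proof -
    have "continuous_map (over V) (sgtop \<xi>) \<gamma>" using t(5) over_sub[of V U] V V0 continuous_map_from_subtopology by (metis order_trans)
    from continuous_map_compose[OF continuous_map_compose[OF continuous_map_fst this] sinv_cont]
    show ?thesis by (simp add: comp_def)
  qed
  have H0adm: "admissible Fo n z (H0 y z)" if y: "y \<in> V" and z: "z \<in> Cube (Suc (Suc n))" for y z
  proof -
    let ?z = "z(Suc n := 0)"
    have "admissible Fo n ?z (e y ?z)" using eadm[of y ?z] y V(2) cube_drop[OF z] by blast
    then have "admissible Fo n z (e y ?z)" by (force simp: admissible_def)
    moreover have "z (Suc n) \<in> {0..1}" using cube_bounds[OF z] by simp
    ultimately have "admissible Fo n z (c (z (Suc n)) (e y ?z))"
      using c(6,7) e\<O>[OF y cube_drop[OF z]] Fo_sub unfolding admissible_def by (metis subsetD)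
    then show ?thesis unfolding H0_def using h0(2)[OF z] by (rule admissible_mult[rotated])
  qed
  have H0G: "H0 y z \<in> carrier G" if y: "y \<in> V" and z: "z \<in> Cube (Suc (Suc n))" for y z
  proof -
    have \<sigma>V: "\<sigma> y \<in> Over V" "proj \<xi> (\<sigma> y) = y" using t(3,4)[of y] y V V0 by auto
    then show ?thesis using cm_closed[OF H0c, of "(\<sigma> y, z)"] z by simp
  qed
  have "null_family n V (\<lambda>p z. u p z [^] N)"
  proof (rule null_familyI[where m = M and h = H])
    show "family (Suc (Suc n)) n V M H"
    proof (rule familyI)
      show "continuous_map ?Z (T M) (\<lambda>q. H (fst q) (snd q))" unfolding H_def by (rule cm_\<beta>[OF gc H0c])
      fix p z assume p: "p \<in> Over V" and z: "z \<in> Cube (Suc (Suc n))"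
      have pU: "p \<in> Over U" and pV: "proj \<xi> p \<in> V" using p overVU by auto
      show "admissible Fo n z (H p z)" unfolding H_def using H0adm[OF pV z] t(6)[OF pU] sinv by (intro admissible_\<beta>) auto
      fix g assume g: "g \<in> carrier \<G>"
      have "inv\<^bsub>\<G>\<^esub> (\<gamma> (ract \<xi> p g)) = inv\<^bsub>\<G>\<^esub> g \<otimes>\<^bsub>\<G>\<^esub> inv\<^bsub>\<G>\<^esub> (\<gamma> p)"
        using t(8)[OF pU g] t(6)[OF pU] g by (simp add: sg.inv_mult_group)
      moreover have "proj \<xi> (ract \<xi> p g) = proj \<xi> p" using proj_ract p g by simp
      ultimately show "H (ract \<xi> p g) z = \<beta> (inv\<^bsub>\<G>\<^esub> g) (H p z)"
        unfolding H_def using \<beta>_mult[OF sinv[OF g] sinv[OF t(6)[OF pU]] H0G[OF pV z]] by simp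
    qed
    fix p z assume p: "p \<in> Over V" and z: "z \<in> Cube (Suc (Suc n))"
    have pU: "p \<in> Over U" and pV: "proj \<xi> p \<in> V" using p overVU by auto
    note ez = e\<O>[OF pV cube_drop[OF z]]
    show "H p z = \<one>" if "z (Suc n) = 0"
      unfolding H_def H0_def using that h0(3)[OF z] c(4)[OF ez] \<beta>_unit sinv[OF t(6)[OF pU]] by simp
    show "H p z = u p (z(Suc n := 0)) [^] N" if "z (Suc n) = 1"
    proof -
      let ?z = "z(Suc n := 0)"
      have yV0: "proj \<xi> p \<in> V0" using pV V(2) by blast
      have "H0 (proj \<xi> p) z = w ?z [^] N \<otimes> (inv (w ?z [^] N) \<otimes> u (\<sigma> (proj \<xi> p)) ?z [^] N)"
        unfolding H0_def using that h0(4)[OF z] c(5)[OF ez] by (simp add: e_def)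
      also have "\<dots> = u (\<sigma> (proj \<xi> p)) ?z [^] N"
        using wG[OF cube_drop[OF z]] uG[OF yV0 cube_drop[OF z]] by (simp add: cancel_inv)
      finally have "H p z = \<beta> (inv\<^bsub>\<G>\<^esub> (\<gamma> p)) (u (\<sigma> (proj \<xi> p)) ?z) [^] N"
        unfolding H_def using \<beta>_pow[OF sinv[OF t(6)[OF pU]] uG[OF yV0 cube_drop[OF z]]] by simp
      also have "\<beta> (inv\<^bsub>\<G>\<^esub> (\<gamma> p)) (u (\<sigma> (proj \<xi> p)) ?z) = u p ?z"
        using family_equi[OF u \<sigma>O[OF yV0] cube_drop[OF z] t(6)[OF pU]] t(7)[OF pU] by simp
      finally show ?thesis .
    qed
  qed
  then show ?thesis using N(1) V V0 by blast
qed

text \<open>A path \<open>a\<close> starting at the identity conjugates loops trivially up to contraction, since it can be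
  shrunk along itself. Hence dividing \<open>(a k)\<^bsup>M\<^esup>\<close> by \<open>a\<^bsup>M\<^esup>\<close> leaves \<open>k\<^bsup>M\<^esup>\<close> up to contraction.\<close>

lemma path_conj_null:
  assumes a: "family (Suc (Suc n)) n W m a" and a0: "\<And>p z. p \<in> Over W \<Longrightarrow> z \<in> Cube (Suc (Suc n)) \<Longrightarrow> z (Suc n) = 0 \<Longrightarrow> a p z = \<one>"
    and k: "family (Suc (Suc n)) (Suc n) W m k"
  shows "null_family (Suc n) W (\<lambda>p z. inv (a p z) \<otimes> k p z \<otimes> a p z \<otimes> inv (k p z))"
proof -
  let ?n = "Suc (Suc n)" let ?c = "Suc (Suc (Suc n))"
  define \<rho> where "\<rho> z = (z(?n := 0))(Suc n := z (Suc n) * z ?n)" for z :: "nat \<Rightarrow> real"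
  have \<rho>c: "continuous_map (prod_topology (over W) (cube ?c)) (cube ?n) (\<lambda>y. \<rho> (snd y))" unfolding \<rho>_def
    by (rule continuous_map_cube_upd[OF _ continuous_map_cube_drop[OF continuous_map_snd]])
      (auto intro!: continuous_map_real_mult continuous_map_cube_coordinate_compose[OF continuous_map_snd] simp: cube_bounds mult_le_one)
  have dc: "continuous_map (prod_topology (over W) (cube ?c)) (cube ?n) (\<lambda>y. (snd y)(?n := 0))"
    by (rule continuous_map_cube_drop[OF continuous_map_snd])
  have a': "family ?c n W m (\<lambda>p z. a p (\<rho> z))"
    by (rule family_reparam[OF a \<rho>c]) (auto simp: admissible_def \<rho>_def)
  have k': "family ?c n W m (\<lambda>p z. k p (z(?n := 0)))"
    by (rule family_reparam[OF k dc]) (auto simp: admissible_def)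
  let ?h = "\<lambda>p z. inv (a p (\<rho> z)) \<otimes> k p (z(?n := 0)) \<otimes> a p (\<rho> z) \<otimes> inv (k p (z(?n := 0)))"
  have h: "family ?c n W m ?h" by (intro family_mult family_inv a' k')
  have aG: "a p (\<rho> z) \<in> carrier G" and kG: "k p (z(?n := 0)) \<in> carrier G"
    if "p \<in> Over W" "z \<in> Cube ?c" for p z
    using family_closed[OF a' that] family_closed[OF k' that] .
  have k1: "k p (z(?n := 0)) = \<one>" if "p \<in> Over W" "z \<in> Cube ?c" "z (Suc n) = 0 \<or> z (Suc n) = 1" for p z
    using family_adm[OF k that(1) cube_drop[OF that(2)]] that(3) unfolding admissible_def by force
  have hE: "family ?c (Suc n) W m ?h"
  proof (rule familyI)
    show "continuous_map (prod_topology (over W) (cube ?c)) (T m) (\<lambda>y. ?h (fst y) (snd y))" by (rule family_cont[OF h])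
    show "admissible Fo (Suc n) z (?h p z)" if "p \<in> Over W" "z \<in> Cube ?c" for p z
    proof -
      have "?h p z = \<one>" if "z (Suc n) = 0 \<or> z (Suc n) = 1"
        using k1[OF \<open>p \<in> _\<close> \<open>z \<in> _\<close> that] aG[OF \<open>p \<in> _\<close> \<open>z \<in> _\<close>] by simp
      then show ?thesis using family_adm[OF h that] unfolding admissible_def by (auto simp: le_Suc_eq)
    qed
    show "?h (ract \<xi> p g) z = \<beta> (inv\<^bsub>\<G>\<^esub> g) (?h p z)" if "p \<in> Over W" "z \<in> Cube ?c" "g \<in> carrier \<G>" for p z g
      by (rule family_equi[OF h that])
  qed
  show ?thesis
  proof (rule null_familyI[OF hE])
    fix p z assume p: "p \<in> Over W" and z: "z \<in> Cube ?c"
    have \<rho>z: "\<rho> z \<in> Cube ?n" using continuous_map_in[OF \<rho>c, of "(p, z)"] p z by simp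
    show "?h p z = \<one>" if "z ?n = 0"
    proof -
      have "a p (\<rho> z) = \<one>" by (rule a0[OF p \<rho>z]) (simp add: \<rho>_def that)
      then show ?thesis using kG[OF p z] by simp
    qed
    show "?h p z = inv (a p (z(?n := 0))) \<otimes> k p (z(?n := 0)) \<otimes> a p (z(?n := 0)) \<otimes> inv (k p (z(?n := 0)))" if "z ?n = 1"
    proof -
      have "\<rho> z = z(?n := 0)" using that by (auto simp: \<rho>_def)
      then show ?thesis by simp
    qed
  qed
qed

lemma path_pow_null:
  assumes a: "family (Suc (Suc n)) n W m a" and a0: "\<And>p z. p \<in> Over W \<Longrightarrow> z \<in> Cube (Suc (Suc n)) \<Longrightarrow> z (Suc n) = 0 \<Longrightarrow> a p z = \<one>"
    and k: "family (Suc (Suc n)) (Suc n) W m k"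
  shows "null_family (Suc n) W (\<lambda>p z. inv (a p z [^] (M::nat)) \<otimes> (a p z \<otimes> k p z) [^] M \<otimes> inv (k p z [^] M))"
proof (induction M)
  case 0 show ?case by (rule null_family_cong[OF null_family_one]) simp
next
  case (Suc M)
  have aM: "family (Suc (Suc n)) n W m (\<lambda>p z. a p z [^] M)" by (rule family_pow[OF a])
  have "null_family (Suc n) W (\<lambda>p z. inv (a p z [^] M) \<otimes> k p z \<otimes> a p z [^] M \<otimes> inv (k p z))"
    by (rule path_conj_null[OF aM _ k]) (simp add: a0)
  from null_family_mult[OF this null_family_conj[OF k Suc]]
  show ?case
  proof (rule null_family_cong)
    fix p z assume p: "p \<in> Over W" and z: "z \<in> Cube (Suc (Suc n))"
    have aG: "a p z \<in> carrier G" and kG: "k p z \<in> carrier G" using family_closed[OF a p z] family_closed[OF k p z] .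
    let ?A = "a p z [^] M" and ?K = "k p z [^] M" and ?X = "(a p z \<otimes> k p z) [^] M"
    have AG: "?A \<in> carrier G" "?K \<in> carrier G" "?X \<in> carrier G" using aG kG by auto
    have "inv ?A \<otimes> k p z \<otimes> ?A \<otimes> inv (k p z) \<otimes> (k p z \<otimes> (inv ?A \<otimes> ?X \<otimes> inv ?K) \<otimes> inv (k p z))
      = inv ?A \<otimes> (k p z \<otimes> (?X \<otimes> (inv ?K \<otimes> inv (k p z))))"
      using aG kG AG by (simp add: m_assoc cancel_inv)
    also have "\<dots> = inv (a p z [^] Suc M) \<otimes> (a p z \<otimes> k p z) [^] Suc M \<otimes> inv (k p z [^] Suc M)"
    proof -
      have "(a p z \<otimes> k p z) [^] Suc M = a p z \<otimes> (k p z \<otimes> ?X)"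
        using aG kG nat_pow_Suc2[of "a p z \<otimes> k p z" M] by (simp add: m_assoc del: nat_pow_Suc)
      moreover have "inv (a p z [^] Suc M) = inv ?A \<otimes> inv (a p z)"
        using aG nat_pow_Suc2[of "a p z" M] by (simp add: inv_mult_group del: nat_pow_Suc)
      moreover have "inv (k p z [^] Suc M) = inv ?K \<otimes> inv (k p z)"
        using kG nat_pow_Suc2[of "k p z" M] by (simp add: inv_mult_group del: nat_pow_Suc)
      ultimately show ?thesis using aG kG AG by (simp add: m_assoc cancel_inv del: nat_pow_Suc)
    qed
    finally show "inv ?A \<otimes> k p z \<otimes> ?A \<otimes> inv (k p z) \<otimes> (k p z \<otimes> (inv ?A \<otimes> ?X \<otimes> inv ?K) \<otimes> inv (k p z))
      = inv (a p z [^] Suc M) \<otimes> (a p z \<otimes> k p z) [^] Suc M \<otimes> inv (k p z [^] Suc M)" .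
  qed
qed

text \<open>Two contractions of the same class differ on the overlap by a loop one degree higher. Where a
  power of this loop contracts, a bump function interpolates between the two contractions.\<close>

lemma glue_null:
  assumes X: "normal_space (base \<xi>)" and V: "openin (base \<xi>) V1" "openin (base \<xi>) V2"
    and u: "family (Suc n) n O' mu u" and VO: "V1 \<subseteq> O'" "V2 \<subseteq> O'"
    and null_family: "null_family n V1 (\<lambda>p z. u p z [^] (N::nat))" "null_family n V2 (\<lambda>p z. u p z [^] N)"
  shows "\<exists>m k. family (Suc (Suc n)) (Suc n) (V1 \<inter> V2) m k \<and> (\<forall>M W V1' V2'. openin (base \<xi>) W \<and> W \<subseteq> V1 \<inter> V2 \<and>
      null_family (Suc n) W (\<lambda>p z. k p z [^] (M::nat)) \<and> openin (base \<xi>) V1' \<and> V1' \<subseteq> V1 \<and> openin (base \<xi>) V2' \<and> V2' \<subseteq> V2 \<and>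
      base \<xi> closure_of (V1' \<inter> V2') \<subseteq> W \<longrightarrow> null_family n (V1' \<union> V2') (\<lambda>p z. u p z [^] (N * M)))"
proof -
  obtain m1 h1 where "contracts n V1 m1 h1 (\<lambda>p z. u p z [^] N)" using null_familyE[OF null_family(1)] .
  note h1' = contractsD[OF this]
  obtain m2 h2 where "contracts n V2 m2 h2 (\<lambda>p z. u p z [^] N)" using null_familyE[OF null_family(2)] .
  note h2' = contractsD[OF this]
  define m where "m = max m1 m2"
  have h1: "family (Suc (Suc n)) n V1 m h1" and h2: "family (Suc (Suc n)) n V2 m h2"
    using family_lift[OF h1'(1)] family_lift[OF h2'(1)] unfolding m_def by auto
  define k where "k p z = inv (h2 p z) \<otimes> h1 p z" for p z
  let ?V = "V1 \<inter> V2"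
  have in12: "p \<in> Over V1" "p \<in> Over V2" if "p \<in> Over ?V" for p using that by auto
  have uG: "u p z \<in> carrier G" if "p \<in> Over O'" "z \<in> Cube (Suc n)" for p z
    using family_closed[OF u that] .
  have k0: "family (Suc (Suc n)) n ?V m k" unfolding k_def[abs_def]
    by (intro family_mult family_inv family_subset[OF h1] family_subset[OF h2]) auto
  have kE: "family (Suc (Suc n)) (Suc n) ?V m k"
  proof (rule familyI)
    show "continuous_map (prod_topology (over ?V) (cube (Suc (Suc n)))) (T m) (\<lambda>y. k (fst y) (snd y))" by (rule family_cont[OF k0])
    show "admissible Fo (Suc n) z (k p z)" if p: "p \<in> Over ?V" and z: "z \<in> Cube (Suc (Suc n))" for p z
    proof -
      have "k p z = \<one>" if "z (Suc n) = 0 \<or> z (Suc n) = 1"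
      proof -
        have "u p (z(Suc n := 0)) \<in> carrier G" by (rule uG[OF _ cube_drop[OF z]]) (use p VO in auto)
        then show ?thesis
          using h1'(2,3)[OF in12(1)[OF p] z] h2'(2,3)[OF in12(2)[OF p] z] that by (auto simp: k_def)
      qed
      then show ?thesis using family_adm[OF k0 p z] unfolding admissible_def by (auto simp: le_Suc_eq)
    qed
    show "k (ract \<xi> p g) z = \<beta> (inv\<^bsub>\<G>\<^esub> g) (k p z)"
      if "p \<in> Over ?V" "z \<in> Cube (Suc (Suc n))" "g \<in> carrier \<G>" for p z g
      by (rule family_equi[OF k0 that])
  qed
  have "null_family n (V1' \<union> V2') (\<lambda>p z. u p z [^] (N * M))"
    if W: "openin (base \<xi>) W" "W \<subseteq> ?V" "null_family (Suc n) W (\<lambda>p z. k p z [^] M)"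
      and V': "openin (base \<xi>) V1'" "V1' \<subseteq> V1" "openin (base \<xi>) V2'" "V2' \<subseteq> V2" "base \<xi> closure_of (V1' \<inter> V2') \<subseteq> W"
    for M W V1' V2'
  proof -
    have WV1: "W \<subseteq> V1" and WV2: "W \<subseteq> V2" using W(2) by auto
    have GW: "h1 p z \<in> carrier G \<and> h2 p z \<in> carrier G" if "p \<in> Over W" "z \<in> Cube (Suc (Suc n))" for p z
      using family_closed[OF h1, of p z] family_closed[OF h2, of p z] that WV1 WV2 by auto
    have "null_family (Suc n) W (\<lambda>p z. inv (h2 p z [^] M) \<otimes> (h2 p z \<otimes> k p z) [^] M \<otimes> inv (k p z [^] M))"
      by (rule path_pow_null[OF family_subset[OF h2 WV2] h2'(2) family_subset[OF kE W(2)]]) (use WV2 in auto)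
    from null_family_mult[OF this W(3)]
    have "null_family (Suc n) W (\<lambda>p z. inv (h2 p z [^] M) \<otimes> h1 p z [^] M)"
    proof (rule null_family_cong)
      fix p z assume pz: "p \<in> Over W" "z \<in> Cube (Suc (Suc n))"
      then show "inv (h2 p z [^] M) \<otimes> (h2 p z \<otimes> k p z) [^] M \<otimes> inv (k p z [^] M) \<otimes> k p z [^] M = inv (h2 p z [^] M) \<otimes> h1 p z [^] M"
        using GW[OF pz] by (simp add: k_def cancel_inv m_assoc)
    qed
    then obtain m3 \<kappa> where "contracts (Suc n) W m3 \<kappa> (\<lambda>p z. inv (h2 p z [^] M) \<otimes> h1 p z [^] M)" by (rule null_familyE)
    note \<kappa> = contractsD[OF this]
    obtain R where R: "openin (base \<xi>) R" "base \<xi> closure_of (V1' \<inter> V2') \<subseteq> R" "base \<xi> closure_of R \<subseteq> W"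
      using X W(1) V'(5) unfolding normal_space_alt by (meson closedin_closure_of)
    have "closedin (base \<xi>) (topspace (base \<xi>) - R)" "closedin (base \<xi>) (base \<xi> closure_of (V1' \<inter> V2'))"
      "disjnt (topspace (base \<xi>) - R) (base \<xi> closure_of (V1' \<inter> V2'))" using R unfolding disjnt_def by auto
    then obtain \<phi> where \<phi>: "continuous_map (base \<xi>) (top_of_set {0..1::real}) \<phi>" "\<phi> ` (topspace (base \<xi>) - R) \<subseteq> {0}"
      "\<phi> ` (base \<xi> closure_of (V1' \<inter> V2')) \<subseteq> {1}"
      using Urysohn_lemma[OF X, of _ _ 0 1] by (metis zero_le_one)
    have \<phi>b: "\<phi> y \<in> {0..1}" if "y \<in> topspace (base \<xi>)" for y using continuous_map_in[OF \<phi>(1) that] by simp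
    have \<phi>0: "\<phi> y = 0" if "y \<in> topspace (base \<xi>)" "y \<notin> R" for y using \<phi>(2) that by auto
    have V12X: "V1' \<inter> V2' \<subseteq> topspace (base \<xi>)" using V'(1) openin_subset by blast
    have V12c: "V1' \<inter> V2' \<subseteq> base \<xi> closure_of (V1' \<inter> V2')" by (rule closure_of_subset[OF V12X])
    have \<phi>1: "\<phi> y = 1" if "y \<in> V1' \<inter> V2'" for y using \<phi>(3) V12c that by blast
    have V12W: "V1' \<inter> V2' \<subseteq> W" using V12c V'(5) by blast
    \<comment> \<open>The correction factor, extended by the identity off the support of \<open>\<phi>\<close>.\<close>
    let ?\<rho> = "\<lambda>p z. z(Suc (Suc n) := \<phi> (proj \<xi> p)) :: nat \<Rightarrow> real"
    have \<rho>c: "continuous_map (prod_topology (over W) (cube (Suc (Suc n)))) (cube (Suc (Suc (Suc n)))) (\<lambda>y. ?\<rho> (fst y) (snd y))"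
    proof (rule continuous_map_cube_upd[OF _ continuous_map_snd])
      have "continuous_map (over W) euclideanreal (\<lambda>p. \<phi> (proj \<xi> p))"
        using continuous_map_compose[OF proj_over_cont \<phi>(1), of W] by (auto simp: continuous_map_in_subtopology comp_def)
      from continuous_map_compose[OF continuous_map_fst this]
      show "continuous_map (prod_topology (over W) (cube (Suc (Suc n)))) euclideanreal (\<lambda>y. \<phi> (proj \<xi> (fst y)))" by (simp add: comp_def)
      show "\<phi> (proj \<xi> (fst y)) \<in> {0..1}" if "y \<in> topspace (prod_topology (over W) (cube (Suc (Suc n))))" for y
        using that by (intro \<phi>b proj_in) auto
    qed auto
    have \<rho>in: "?\<rho> p z \<in> Cube (Suc (Suc (Suc n)))" if "p \<in> Over W" "z \<in> Cube (Suc (Suc n))" for p z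
      using continuous_map_in[OF \<rho>c, of "(p, z)"] that by simp
    have c1: "family (Suc (Suc n)) (Suc n) W m3 (\<lambda>p z. \<kappa> p (?\<rho> p z))"
      by (rule family_reparam[OF \<kappa>(1) \<rho>c]) (auto simp: admissible_def proj_ract)
    let ?W1 = "V2' \<inter> W" and ?W2 = "V2' \<inter> (topspace (base \<xi>) - base \<xi> closure_of R)"
    have W12: "openin (base \<xi>) ?W1" "openin (base \<xi>) ?W2" "?W1 \<union> ?W2 = V2'"
      using W V'(3) R(3) openin_subset[OF V'(3)]
      by (auto intro!: openin_Int openin_diff)
    have RcR: "R \<subseteq> base \<xi> closure_of R" by (rule closure_of_subset[OF openin_subset[OF R(1)]])
    define C where "C p = (if proj \<xi> p \<in> ?W1 then (\<lambda>z. \<kappa> p (?\<rho> p z)) else (\<lambda>z. \<one>))" for p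
    have C: "family (Suc (Suc n)) (Suc n) V2' m3 C"
    proof -
      have "family (Suc (Suc n)) (Suc n) (?W1 \<union> ?W2) m3 C" unfolding C_def[abs_def]
      proof (rule family_paste[OF W12(1,2) family_subset[OF c1] family_one])
        fix p z assume p: "p \<in> Over ?W1" "p \<in> Over ?W2" and z: "z \<in> Cube (Suc (Suc n))"
        have pW: "p \<in> Over W" using p(1) by auto
        have "\<phi> (proj \<xi> p) = 0" using p(2) RcR by (intro \<phi>0) auto
        then show "\<kappa> p (?\<rho> p z) = \<one>" using \<kappa>(2)[OF pW \<rho>in[OF pW z]] by simp
      qed auto
      then show ?thesis unfolding W12(3) .
    qed
    have C0: "family (Suc (Suc n)) n V2' m3 C"
    proof (rule familyI)
      show "continuous_map (prod_topology (over V2') (cube (Suc (Suc n)))) (T m3) (\<lambda>y. C (fst y) (snd y))" by (rule family_cont[OF C])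
      show "admissible Fo n z (C p z)" if "p \<in> Over V2'" "z \<in> Cube (Suc (Suc n))" for p z
        using family_adm[OF C that] by (auto simp: admissible_def)
      show "C (ract \<xi> p g) z = \<beta> (inv\<^bsub>\<G>\<^esub> g) (C p z)"
        if "p \<in> Over V2'" "z \<in> Cube (Suc (Suc n))" "g \<in> carrier \<G>" for p z g
        by (rule family_equi[OF C that])
    qed
    have Cend: "C p z = \<one>" if "p \<in> Over V2'" "z \<in> Cube (Suc (Suc n))" "z (Suc n) = 0 \<or> z (Suc n) = 1" for p z
      using family_adm[OF C that(1,2)] that(3) by (auto simp: admissible_def)
    let ?M = "max m m3"
    define H where "H p = (if proj \<xi> p \<in> V1' then (\<lambda>z. h1 p z [^] M) else (\<lambda>z. h2 p z [^] M \<otimes> C p z))" for p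
    have HE: "family (Suc (Suc n)) n (V1' \<union> V2') ?M H" unfolding H_def[abs_def]
    proof (rule family_paste[OF V'(1,3)])
      show "family (Suc (Suc n)) n V1' ?M (\<lambda>p z. h1 p z [^] M)"
        by (rule family_lift[OF family_pow[OF family_subset[OF h1 V'(2)]]]) simp
      show "family (Suc (Suc n)) n V2' ?M (\<lambda>p z. h2 p z [^] M \<otimes> C p z)"
        by (rule family_mult[OF family_lift[OF family_pow[OF family_subset[OF h2 V'(4)]]] family_lift[OF C0]]) simp_all
      fix p z assume p: "p \<in> Over V1'" "p \<in> Over V2'" and z: "z \<in> Cube (Suc (Suc n))"
      have y: "proj \<xi> p \<in> V1' \<inter> V2'" and pW: "p \<in> Over W" using p V12W by auto
      have zz: "(?\<rho> p z)(Suc (Suc n) := 0) = z" using z by (auto simp: topspace_cube)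
      have "C p z = \<kappa> p (?\<rho> p z)" unfolding C_def using y V12W by auto
      also have "\<dots> = inv (h2 p z [^] M) \<otimes> h1 p z [^] M"
        using \<kappa>(3)[OF pW \<rho>in[OF pW z]] \<phi>1[OF y] unfolding zz by simp
      finally show "h1 p z [^] M = h2 p z [^] M \<otimes> C p z" using GW[OF pW z] by (simp add: cancel_inv)
    qed
    show ?thesis
    proof (rule null_familyI[OF HE])
      fix p z assume p: "p \<in> Over (V1' \<union> V2')" and z: "z \<in> Cube (Suc (Suc n))"
      have pv: "p \<in> Over V1" if "proj \<xi> p \<in> V1'" using that p V'(2) by auto
      have pv2: "p \<in> Over V2" "p \<in> Over V2'" if "proj \<xi> p \<notin> V1'" using that p V'(4) by auto
      have "p \<in> Over O'" using p V' VO by auto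
      then have uz: "u p (z(Suc n := 0)) \<in> carrier G" using uG cube_drop[OF z] by blast
      show "H p z = \<one>" if z0: "z (Suc n) = 0"
        using h1'(2)[OF pv z z0] h2'(2)[OF pv2(1) z z0] Cend[OF pv2(2) z] z0 by (auto simp: H_def)
      show "H p z = u p (z(Suc n := 0)) [^] (N * M)" if z1: "z (Suc n) = 1"
        using h1'(3)[OF pv z z1] h2'(3)[OF pv2(1) z z1] Cend[OF pv2(2) z] z1 uz
        by (auto simp: H_def nat_pow_pow)
    qed
  qed
  then show ?thesis using kE by blast
qed

text \<open>The local-to-global principle for equivariant families of relative loops: they can be contracted locally
  because this is possible in the fibre, and glued at the price of a family of one degree more.\<close>

theorem families_null:
  assumes X: "compact_space (base \<xi>)" "metrizable_space (base \<xi>)" "finite_dimensional_space (base \<xi>)"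
    and S: "mult_closed S"
    and fibre: "\<And>m n w. rel_loop m n w \<Longrightarrow> \<exists>N\<in>S. \<exists>m'. null_rel_loop Fo m' n (\<lambda>z. w z [^] (N::nat))"
    and u: "family (Suc n) n (topspace (base \<xi>)) m u"
  shows "\<exists>N\<in>S. null_family n (topspace (base \<xi>)) (\<lambda>p z. u p z [^] N)"
proof -
  have normal: "normal_space (base \<xi>)" using metrizable_imp_normal_space[OF X(2)] .
  have t1: "t1_space (base \<xi>)" using metrizable_imp_t1_space[OF X(2)] .
  obtain d where "covering_dim_le (base \<xi>) d" using X(3) unfolding finite_dimensional_space_def by blast
  then have col: "coloured (base \<xi>) (topspace (base \<xi>)) (Suc d)"
    by (rule covering_dim_le_imp_coloured[OF X(1) normal t1])
  have "\<exists>N\<in>S. \<exists>W. openin (base \<xi>) W \<and> topspace (base \<xi>) \<subseteq> W \<and> W \<subseteq> topspace (base \<xi>) \<and> null_family n W (\<lambda>p z. u p z [^] N)"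
  proof (rule local_to_global[where \<Gamma> = "\<lambda>n O' u. \<exists>m. family (Suc n) n O' m u" and Null = "\<lambda>n u N W. null_family n W (\<lambda>p z. u p z [^] N)"
        and S = S, OF X(1,2) _ _ _ _ _ _ _ col closedin_topspace])
    show "1 \<in> S" "\<And>a b. a \<in> S \<Longrightarrow> b \<in> S \<Longrightarrow> a * b \<in> S" using S unfolding mult_closed_def by auto
    show "null_family n {} (\<lambda>p z. u p z [^] N)" for n u and N :: nat
      by (rule null_familyI[OF family_one]) auto
    show "null_family n W' (\<lambda>p z. u p z [^] N)" if "null_family n W (\<lambda>p z. u p z [^] N)" "W' \<subseteq> W" for n u W W' and N :: nat
      by (rule null_family_subset[OF that])
    show "\<exists>N\<in>S. \<exists>W. openin (base \<xi>) W \<and> x \<in> W \<and> W \<subseteq> O' \<and> null_family n W (\<lambda>p z. u p z [^] N)"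
      if "\<exists>m. family (Suc n) n O' m u" "openin (base \<xi>) O'" "x \<in> O'" for n O' u x
      using that(1) by (rule exE) (rule local_null[OF fibre _ that(2,3)])
    show "null_family n W (\<lambda>p z. u p z [^] (N * M))"
      if ex: "\<exists>m. family (Suc n) n O' m u" and WO: "W \<subseteq> O'" and nl: "null_family n W (\<lambda>p z. u p z [^] N)" for n O' u W and N M :: nat
    proof -
      obtain m where m: "family (Suc n) n O' m u" using ex by blast
      show ?thesis
      proof (rule null_family_cong[OF null_family_pow[OF nl, of M]])
        fix p z assume "p \<in> Over W" "z \<in> Cube (Suc n)"
        then have "u p z \<in> carrier G" using WO by (intro family_closed[OF m]) auto
        then show "(u p z [^] N) [^] M = u p z [^] (N * M)" by (rule nat_pow_pow)
      qed
    qed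
    show "\<exists>k. (\<exists>m. family (Suc (Suc n)) (Suc n) (V1 \<inter> V2) m k) \<and> (\<forall>M W V1' V2'. openin (base \<xi>) W \<and> W \<subseteq> V1 \<inter> V2 \<and>
        null_family (Suc n) W (\<lambda>p z. k p z [^] M) \<and> openin (base \<xi>) V1' \<and> V1' \<subseteq> V1 \<and> openin (base \<xi>) V2' \<and> V2' \<subseteq> V2 \<and>
        base \<xi> closure_of (V1' \<inter> V2') \<subseteq> W \<longrightarrow> null_family n (V1' \<union> V2') (\<lambda>p z. u p z [^] (N * M)))"
      if ex: "\<exists>m. family (Suc n) n O' m u" and V: "openin (base \<xi>) V1" "openin (base \<xi>) V2" "V1 \<subseteq> O'" "V2 \<subseteq> O'"
        "null_family n V1 (\<lambda>p z. u p z [^] N)" "null_family n V2 (\<lambda>p z. u p z [^] N)" for n O' u V1 V2 and N :: nat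
    proof -
      obtain mu where "family (Suc n) n O' mu u" using ex by blast
      from glue_null[OF normal V(1,2) this V(3-6)] show ?thesis by metis
    qed
    show "\<exists>m. family (Suc n) n (topspace (base \<xi>)) m u" using u by blast
  qed auto
  then show ?thesis by (metis subset_antisym)
qed

end

section \<open>Quasi-invertible elements of Banach algebras\<close>

text \<open>An element \<open>a\<close> is quasi-invertible if \<open>1 + a\<close> is invertible. This makes sense without a unit
  and treats the unital and the non-unital case alike: in these coordinates the general linear group
  is a subset of the algebra itself, with base point \<open>0\<close>, and corner embeddings are inclusions.\<close>

definition circ :: "('k, 'a) normed_alg \<Rightarrow> 'a \<Rightarrow> 'a \<Rightarrow> 'a" where
  "circ R a b = aadd R (aadd R a b) (amult R a b)"

definition quasi :: "('k, 'a) normed_alg \<Rightarrow> 'a set" where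
  "quasi R = {a \<in> carrier R. \<exists>b\<in>carrier R. circ R a b = azero R \<and> circ R b a = azero R}"

definition qtop :: "('k::real_or_complex, 'a) normed_alg \<Rightarrow> 'a topology" where
  "qtop R = subtopology (atop R) (quasi R)"

context banach_algebra
begin

abbreviation pls (infixl "\<boxplus>" 65) where "x \<boxplus> y \<equiv> aadd A x y"
abbreviation mlt (infixl "\<boxdot>" 70) where "x \<boxdot> y \<equiv> amult A x y"
abbreviation Z where "Z \<equiv> azero A"
abbreviation neg where "neg x \<equiv> ascale A (-1) x"
abbreviation "C \<equiv> carrier A"

lemma add_left_commute: "x \<in> C \<Longrightarrow> y \<in> C \<Longrightarrow> z \<in> C \<Longrightarrow> x \<boxplus> (y \<boxplus> z) = y \<boxplus> (x \<boxplus> z)"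
  using add_assoc add_commute by metis

lemmas add_ac' = add_assoc add_commute add_left_commute

lemmas closed [simp] = zero_closed add_closed mult_closed scale_closed

lemma zero_add: "x \<in> C \<Longrightarrow> Z \<boxplus> x = x"
  using add_zero add_commute zero_closed by metis

lemma add_neg_cancel: "x \<in> C \<Longrightarrow> y \<in> C \<Longrightarrow> x \<boxplus> (neg x \<boxplus> y) = y"
  "x \<in> C \<Longrightarrow> y \<in> C \<Longrightarrow> neg x \<boxplus> (x \<boxplus> y) = y"
  using add_minus zero_add add_assoc add_commute scale_closed by metis+

lemma add_cancel: "x \<in> C \<Longrightarrow> y \<in> C \<Longrightarrow> z \<in> C \<Longrightarrow> x \<boxplus> y = x \<boxplus> z \<longleftrightarrow> y = z"
  using add_neg_cancel(2) by metis

lemma add_eq_zero: "x \<in> C \<Longrightarrow> y \<in> C \<Longrightarrow> x \<boxplus> y = Z \<longleftrightarrow> y = neg x"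
  using add_cancel add_minus scale_closed by metis

lemma scale_zero: "x \<in> C \<Longrightarrow> ascale A 0 x = Z"
proof -
  assume x: "x \<in> C"
  have "ascale A 0 x \<boxplus> ascale A 0 x = ascale A 0 x \<boxplus> Z" using scale_add_left[OF x, of 0 0] add_zero x by simp
  then show ?thesis using add_cancel x by simp
qed

lemma zero_scale: "ascale A c Z = Z"
proof -
  have "ascale A c Z \<boxplus> ascale A c Z = ascale A c Z \<boxplus> Z"
    using scale_add_right[of Z Z c] zero_add[of Z] add_zero by simp
  then show ?thesis using add_cancel by simp
qed

lemma zero_mult: "x \<in> C \<Longrightarrow> Z \<boxdot> x = Z"
  using mult_scale_left[of Z x 0] scale_zero zero_scale by (metis mult_closed zero_closed)

lemma mult_zero: "x \<in> C \<Longrightarrow> x \<boxdot> Z = Z"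
  using mult_scale_right[of x Z 0] scale_zero zero_scale by (metis mult_closed zero_closed)

lemma neg_mult: "x \<in> C \<Longrightarrow> y \<in> C \<Longrightarrow> neg x \<boxdot> y = neg (x \<boxdot> y)" "x \<in> C \<Longrightarrow> y \<in> C \<Longrightarrow> x \<boxdot> neg y = neg (x \<boxdot> y)"
  by (simp_all add: mult_scale_left mult_scale_right)

lemma neg_neg: "x \<in> C \<Longrightarrow> neg (neg x) = x"
  by (simp add: scale_scale scale_one)

lemma norm_zero: "anorm A Z = 0"
  using norm_eq_0 by simp

lemma norm_neg: "x \<in> C \<Longrightarrow> anorm A (neg x) = anorm A x"
  by (simp add: norm_scale)

subsection \<open>Topology\<close>

abbreviation ds where "ds x y \<equiv> anorm A (x \<boxplus> neg y)"

lemma adist_eq: "x \<in> C \<Longrightarrow> y \<in> C \<Longrightarrow> adist A x y = ds x y"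
  by (simp add: adist_def)

lemma Metric: "Metric_space C (adist A)"
proof
  show "0 \<le> adist A x y" for x y by (simp add: adist_def norm_nonneg)
  show "adist A x y = adist A y x" for x y
  proof (cases "x \<in> C \<and> y \<in> C")
    case True
    then have "neg (x \<boxplus> neg y) = y \<boxplus> neg x" by (simp add: scale_add_right neg_neg add_commute)
    then show ?thesis using True norm_neg[of "x \<boxplus> neg y"] by (simp add: adist_def)
  qed (auto simp: adist_def)
  show "adist A x y = 0 \<longleftrightarrow> x = y" if "x \<in> C" "y \<in> C" for x y
    using that norm_eq_0[of "x \<boxplus> neg y"] by (simp add: adist_eq) (metis add_minus add_commute add_eq_zero neg_neg scale_closed)
  show "adist A x z \<le> adist A x y + adist A y z" if "x \<in> C" "y \<in> C" "z \<in> C" for x y z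
  proof -
    have "x \<boxplus> neg z = (x \<boxplus> neg y) \<boxplus> (y \<boxplus> neg z)" using that by (simp add: add_assoc add_neg_cancel)
    then show ?thesis using norm_triangle[of "x \<boxplus> neg y" "y \<boxplus> neg z"] that by (simp add: adist_eq)
  qed
qed

interpretation M: Metric_space C "adist A" by (rule Metric)

lemma topspace_atop [simp]: "topspace (atop A) = C"
  by (simp add: atop_def)

lemma cont_iff:
  "continuous_map Y (atop A) f \<longleftrightarrow> (\<forall>y\<in>topspace Y. f y \<in> C) \<and>
     (\<forall>y\<in>topspace Y. \<forall>e>0. \<exists>U. openin Y U \<and> y \<in> U \<and> (\<forall>w\<in>U. ds (f w) (f y) < e))" (is "?L \<longleftrightarrow> ?R")
proof
  assume L: ?L
  then have c: "f y \<in> C" if "y \<in> topspace Y" for y using that continuous_map_image_subset_topspace by fastforce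
  show ?R
  proof (intro conjI ballI allI impI)
    fix y and e :: real assume y: "y \<in> topspace Y" and e: "e > 0"
    then obtain U where U: "openin Y U" "y \<in> U" "\<forall>w\<in>U. f w \<in> M.mball (f y) e"
      using L unfolding atop_def M.continuous_map_to_metric by blast
    have "ds (f w) (f y) < e" if "w \<in> U" for w
    proof -
      have "w \<in> topspace Y" using U(1) that openin_subset by blast
      then have cw: "f w \<in> C" by (rule c)
      have "adist A (f y) (f w) < e" using U(3) that by auto
      then show ?thesis using M.commute[of "f w" "f y"] adist_eq[OF cw c[OF y]] by linarith
    qed
    then show "\<exists>U. openin Y U \<and> y \<in> U \<and> (\<forall>w\<in>U. ds (f w) (f y) < e)" using U by blast
  qed (rule c)
next
  assume R: ?R
  show ?L unfolding atop_def M.continuous_map_to_metric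
  proof (intro ballI allI impI)
    fix y and e :: real assume y: "y \<in> topspace Y" and e: "e > 0"
    then obtain U where U: "openin Y U" "y \<in> U" "\<forall>w\<in>U. ds (f w) (f y) < e" using R by blast
    have "f w \<in> M.mball (f y) e" if "w \<in> U" for w
    proof -
      have "w \<in> topspace Y" using U(1) that openin_subset by blast
      then have wC: "f w \<in> C" and yC: "f y \<in> C" using R y by auto
      have "ds (f w) (f y) < e" using U(3) that by blast
      then have "adist A (f y) (f w) < e" using M.commute[of "f w" "f y"] adist_eq[OF wC yC] by linarith
      then show ?thesis using wC yC by simp
    qed
    then show "\<exists>U. openin Y U \<and> y \<in> U \<and> (\<forall>w\<in>U. f w \<in> M.mball (f y) e)" using U by blast
  qed
qed

lemma cont_closed: "continuous_map Y (atop A) f \<Longrightarrow> y \<in> topspace Y \<Longrightarrow> f y \<in> C"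
  unfolding cont_iff by blast

text \<open>A criterion covering sums, products and multiples: the increment is dominated by a real
  function that is continuous and vanishes at the point in question.\<close>

lemma cont_dominated:
  assumes "\<And>y. y \<in> topspace Y \<Longrightarrow> f y \<in> C"
    and "\<And>y. y \<in> topspace Y \<Longrightarrow> continuous_map Y euclideanreal (g y) \<and> g y y = 0 \<and>
       (\<forall>w\<in>topspace Y. ds (f w) (f y) \<le> g y w)"
  shows "continuous_map Y (atop A) f"
  unfolding cont_iff
proof (intro conjI ballI allI impI)
  fix y and e :: real assume y: "y \<in> topspace Y" and e: "e > 0"
  let ?U = "{w \<in> topspace Y. g y w \<in> {..<e}}"
  have "openin Y ?U" using assms(2)[OF y] by (intro openin_continuous_map_preimage) auto
  moreover have "y \<in> ?U" using y e assms(2)[OF y] by simp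
  moreover have "ds (f w) (f y) < e" if "w \<in> ?U" for w
  proof -
    have "ds (f w) (f y) \<le> g y w" "g y w < e" using that assms(2)[OF y] by auto
    then show ?thesis by linarith
  qed
  ultimately show "\<exists>U. openin Y U \<and> y \<in> U \<and> (\<forall>w\<in>U. ds (f w) (f y) < e)" by blast
qed (rule assms(1))

lemma cont_ds:
  assumes f: "continuous_map Y (atop A) f" and c: "c \<in> C"
  shows "continuous_map Y euclideanreal (\<lambda>w. ds (f w) c)"
proof -
  have "continuous_map Y Met_TC.mtopology (\<lambda>w. adist A (f w) c)"
    unfolding Met_TC.continuous_map_to_metric
  proof (intro ballI allI impI)
    fix y and e :: real assume y: "y \<in> topspace Y" "e > 0"
    then obtain U where U: "openin Y U" "y \<in> U" "\<forall>w\<in>U. ds (f w) (f y) < e" using f unfolding cont_iff by blast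
    have "\<bar>adist A (f y) c - adist A (f w) c\<bar> < e" if w: "w \<in> U" for w
    proof -
      have wC: "f w \<in> C" and yC: "f y \<in> C" using w U(1) openin_subset cont_closed[OF f] y by blast+
      have "\<bar>adist A (f w) c - adist A c (f y)\<bar> \<le> adist A (f w) (f y)" by (rule M.mdist_reverse_triangle[OF wC c yC])
      moreover have "adist A (f w) (f y) < e" using U(3) w adist_eq[OF wC yC] by simp
      ultimately show ?thesis using M.commute[of c "f y"] by linarith
    qed
    then show "\<exists>U. openin Y U \<and> y \<in> U \<and> (\<forall>w\<in>U. adist A (f w) c \<in> Met_TC.mball (adist A (f y) c) e)"
      using U(1,2) by (intro exI[of _ U]) (auto simp: dist_real_def)
  qed
  then have "continuous_map Y euclideanreal (\<lambda>w. adist A (f w) c)" by simp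
  then show ?thesis by (rule continuous_map_eq) (use cont_closed[OF f] c in \<open>simp add: adist_eq\<close>)
qed

lemma cont_norm:
  assumes f: "continuous_map Y (atop A) f" shows "continuous_map Y euclideanreal (\<lambda>w. anorm A (f w))"
proof -
  have "continuous_map Y euclideanreal (\<lambda>w. ds (f w) Z)" by (rule cont_ds[OF f]) simp
  then show ?thesis by (rule continuous_map_eq) (use cont_closed[OF f] in \<open>simp add: zero_scale add_zero\<close>)
qed

lemma ds_zero: "x \<in> C \<Longrightarrow> ds x x = 0"
  by (simp add: add_minus norm_zero)

lemma cont_add:
  assumes f: "continuous_map Y (atop A) f" and g: "continuous_map Y (atop A) g"
  shows "continuous_map Y (atop A) (\<lambda>y. f y \<boxplus> g y)"
proof (rule cont_dominated[where g = "\<lambda>y w. ds (f w) (f y) + ds (g w) (g y)"])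
  note c = cont_closed[OF f] cont_closed[OF g]
  show "f y \<boxplus> g y \<in> C" if "y \<in> topspace Y" for y using c[OF that] by simp
  fix y assume y: "y \<in> topspace Y"
  have "ds (f w \<boxplus> g w) (f y \<boxplus> g y) \<le> ds (f w) (f y) + ds (g w) (g y)" if w: "w \<in> topspace Y" for w
  proof -
    have "f w \<boxplus> g w \<boxplus> neg (f y \<boxplus> g y) = (f w \<boxplus> neg (f y)) \<boxplus> (g w \<boxplus> neg (g y))"
      using c[OF w] c[OF y] by (simp add: scale_add_right add_ac')
    then show ?thesis using norm_triangle[of "f w \<boxplus> neg (f y)" "g w \<boxplus> neg (g y)"] c[OF w] c[OF y] by simp
  qed
  then show "continuous_map Y euclideanreal (\<lambda>w. ds (f w) (f y) + ds (g w) (g y)) \<and>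
     ds (f y) (f y) + ds (g y) (g y) = 0 \<and> (\<forall>w\<in>topspace Y. ds (f w \<boxplus> g w) (f y \<boxplus> g y) \<le> ds (f w) (f y) + ds (g w) (g y))"
    using c[OF y] by (simp add: ds_zero continuous_map_add cont_ds[OF f] cont_ds[OF g])
qed

lemma cont_mult:
  assumes f: "continuous_map Y (atop A) f" and g: "continuous_map Y (atop A) g"
  shows "continuous_map Y (atop A) (\<lambda>y. f y \<boxdot> g y)"
proof (rule cont_dominated[where g = "\<lambda>y w. ds (f w) (f y) * anorm A (g w) + anorm A (f y) * ds (g w) (g y)"])
  note c = cont_closed[OF f] cont_closed[OF g]
  show "f y \<boxdot> g y \<in> C" if "y \<in> topspace Y" for y using c[OF that] by simp
  fix y assume y: "y \<in> topspace Y"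
  have "ds (f w \<boxdot> g w) (f y \<boxdot> g y) \<le> ds (f w) (f y) * anorm A (g w) + anorm A (f y) * ds (g w) (g y)" if w: "w \<in> topspace Y" for w
  proof -
    have "f w \<boxdot> g w \<boxplus> neg (f y \<boxdot> g y) = (f w \<boxplus> neg (f y)) \<boxdot> g w \<boxplus> f y \<boxdot> (g w \<boxplus> neg (g y))"
      using c[OF w] c[OF y] by (simp add: mult_add_left mult_add_right neg_mult add_assoc add_neg_cancel)
    then show ?thesis using norm_triangle[of "(f w \<boxplus> neg (f y)) \<boxdot> g w" "f y \<boxdot> (g w \<boxplus> neg (g y))"]
        norm_mult[of "f w \<boxplus> neg (f y)" "g w"] norm_mult[of "f y" "g w \<boxplus> neg (g y)"] c[OF w] c[OF y] by simp
  qed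
  then show "continuous_map Y euclideanreal (\<lambda>w. ds (f w) (f y) * anorm A (g w) + anorm A (f y) * ds (g w) (g y)) \<and>
     ds (f y) (f y) * anorm A (g y) + anorm A (f y) * ds (g y) (g y) = 0 \<and>
     (\<forall>w\<in>topspace Y. ds (f w \<boxdot> g w) (f y \<boxdot> g y) \<le> ds (f w) (f y) * anorm A (g w) + anorm A (f y) * ds (g w) (g y))"
    using c[OF y] by (simp add: ds_zero continuous_map_add continuous_map_real_mult cont_ds[OF f] cont_ds[OF g] cont_norm[OF g])
qed

lemma cont_scale:
  assumes s: "continuous_map Y euclidean s" and f: "continuous_map Y (atop A) f"
  shows "continuous_map Y (atop A) (\<lambda>y. ascale A (s y) (f y))"
proof (rule cont_dominated[where g = "\<lambda>y w. norm (s w) * ds (f w) (f y) + norm (s w - s y) * anorm A (f y)"])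
  note c = cont_closed[OF f]
  show "ascale A (s y) (f y) \<in> C" if "y \<in> topspace Y" for y using c[OF that] by simp
  fix y assume y: "y \<in> topspace Y"
  have "ds (ascale A (s w) (f w)) (ascale A (s y) (f y)) \<le> norm (s w) * ds (f w) (f y) + norm (s w - s y) * anorm A (f y)"
    if w: "w \<in> topspace Y" for w
  proof -
    have "ascale A (s w) (f y) \<boxplus> neg (ascale A (s y) (f y)) = ascale A (s w - s y) (f y)"
      using scale_add_left[of "f y" "s w" "- s y"] c[OF y] by (simp add: scale_scale)
    then have "ascale A (s w) (f w) \<boxplus> neg (ascale A (s y) (f y)) = ascale A (s w) (f w \<boxplus> neg (f y)) \<boxplus> ascale A (s w - s y) (f y)"
      using c[OF w] c[OF y] scale_scale[of "f y" "s w" "- 1"] scale_scale[of "f y" "- 1" "s w"]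
      by (simp add: scale_add_right add_assoc scale_scale) (metis (no_types) add_neg_cancel(2) scale_closed scale_scale mult_minus1)
    then show ?thesis using norm_triangle[of "ascale A (s w) (f w \<boxplus> neg (f y))" "ascale A (s w - s y) (f y)"] c[OF w] c[OF y]
      by (simp add: norm_scale)
  qed
  moreover have "continuous_map Y euclideanreal (\<lambda>w. norm (s w))" "continuous_map Y euclideanreal (\<lambda>w. norm (s w - s y))"
    using s by (auto intro!: continuous_map_norm continuous_map_diff)
  ultimately show "continuous_map Y euclideanreal (\<lambda>w. norm (s w) * ds (f w) (f y) + norm (s w - s y) * anorm A (f y)) \<and>
     norm (s y) * ds (f y) (f y) + norm (s y - s y) * anorm A (f y) = 0 \<and>
     (\<forall>w\<in>topspace Y. ds (ascale A (s w) (f w)) (ascale A (s y) (f y)) \<le> norm (s w) * ds (f w) (f y) + norm (s w - s y) * anorm A (f y))"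
    using c[OF y] by (simp add: ds_zero continuous_map_add continuous_map_real_mult cont_ds[OF f])
qed

subsection \<open>The group of quasi-invertible elements\<close>

abbreviation crc (infixl "\<circ>\<^sub>q" 65) where "a \<circ>\<^sub>q b \<equiv> circ A a b"

lemma circ_closed [simp]: "a \<in> C \<Longrightarrow> b \<in> C \<Longrightarrow> a \<circ>\<^sub>q b \<in> C"
  by (simp add: circ_def)

lemma circ_assoc: "a \<in> C \<Longrightarrow> b \<in> C \<Longrightarrow> c \<in> C \<Longrightarrow> (a \<circ>\<^sub>q b) \<circ>\<^sub>q c = a \<circ>\<^sub>q (b \<circ>\<^sub>q c)"
  by (simp add: circ_def mult_add_left mult_add_right mult_assoc add_ac')

lemma circ_zero: "a \<in> C \<Longrightarrow> a \<circ>\<^sub>q Z = a" "a \<in> C \<Longrightarrow> Z \<circ>\<^sub>q a = a"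
  by (simp_all add: circ_def mult_zero zero_mult add_zero zero_add)

lemma circ_minus: assumes "a \<in> C" "b \<in> C" shows "(a \<circ>\<^sub>q b) \<boxplus> neg b = a \<boxplus> a \<boxdot> b"
proof -
  have "a \<boxplus> b \<boxplus> a \<boxdot> b \<boxplus> neg b = (a \<boxplus> a \<boxdot> b) \<boxplus> (b \<boxplus> neg b)" using assms by (simp add: add_ac')
  then show ?thesis unfolding circ_def using assms by (simp add: add_minus add_zero)
qed

lemma cont_circ:
  "continuous_map Y (atop A) f \<Longrightarrow> continuous_map Y (atop A) g \<Longrightarrow> continuous_map Y (atop A) (\<lambda>y. f y \<circ>\<^sub>q g y)"
  unfolding circ_def by (intro cont_add cont_mult)

lemma quasi_closed: "a \<in> quasi A \<Longrightarrow> a \<in> C"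
  by (simp add: quasi_def)

lemma quasi_zero: "Z \<in> quasi A"
  unfolding quasi_def using circ_zero by auto

lemma circ_inverse_unique: "a \<in> C \<Longrightarrow> b \<in> C \<Longrightarrow> c \<in> C \<Longrightarrow> b \<circ>\<^sub>q a = Z \<Longrightarrow> a \<circ>\<^sub>q c = Z \<Longrightarrow> b = c"
  using circ_assoc[of b a c] circ_zero by simp

lemma quasi_circ: "a \<in> quasi A \<Longrightarrow> b \<in> quasi A \<Longrightarrow> a \<circ>\<^sub>q b \<in> quasi A"
proof -
  assume "a \<in> quasi A" "b \<in> quasi A"
  then obtain a' b' where ab: "a \<in> C" "b \<in> C" "a' \<in> C" "b' \<in> C" "a \<circ>\<^sub>q a' = Z" "a' \<circ>\<^sub>q a = Z" "b \<circ>\<^sub>q b' = Z" "b' \<circ>\<^sub>q b = Z"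
    unfolding quasi_def by blast
  have "(a \<circ>\<^sub>q b) \<circ>\<^sub>q (b' \<circ>\<^sub>q a') = a \<circ>\<^sub>q ((b \<circ>\<^sub>q b') \<circ>\<^sub>q a')" using ab(1-4) by (simp add: circ_assoc)
  moreover have "(b' \<circ>\<^sub>q a') \<circ>\<^sub>q (a \<circ>\<^sub>q b) = b' \<circ>\<^sub>q ((a' \<circ>\<^sub>q a) \<circ>\<^sub>q b)" using ab(1-4) by (simp add: circ_assoc)
  ultimately show ?thesis unfolding quasi_def using ab by (auto simp: circ_zero intro!: bexI[of _ "b' \<circ>\<^sub>q a'"])
qed

definition qinv where "qinv a = (THE b. b \<in> C \<and> a \<circ>\<^sub>q b = Z \<and> b \<circ>\<^sub>q a = Z)"

lemma qinv: assumes "a \<in> quasi A" shows "qinv a \<in> quasi A" "a \<circ>\<^sub>q qinv a = Z" "qinv a \<circ>\<^sub>q a = Z"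
proof -
  have "\<exists>!b. b \<in> C \<and> a \<circ>\<^sub>q b = Z \<and> b \<circ>\<^sub>q a = Z"
    using assms circ_inverse_unique[of a] unfolding quasi_def by auto
  from theI'[OF this, folded qinv_def] have *: "qinv a \<in> C \<and> a \<circ>\<^sub>q qinv a = Z \<and> qinv a \<circ>\<^sub>q a = Z" .
  then show "a \<circ>\<^sub>q qinv a = Z" "qinv a \<circ>\<^sub>q a = Z" by auto
  show "qinv a \<in> quasi A" unfolding quasi_def using * assms quasi_closed by blast
qed

text \<open>The Neumann series, as the fixed point of the contraction \<open>b \<mapsto> - a - a b\<close>.\<close>

lemma small_right_inverse:
  assumes a: "a \<in> C" "anorm A a < 1" and op: "\<And>b c. b \<in> C \<Longrightarrow> c \<in> C \<Longrightarrow> m b \<in> C \<and> m b \<boxplus> neg (m c) = m (b \<boxplus> neg c)"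
    and nrm: "\<And>b. b \<in> C \<Longrightarrow> anorm A (m b) \<le> anorm A a * anorm A b"
  shows "\<exists>b\<in>C. (a \<boxplus> b) \<boxplus> m b = Z"
proof -
  let ?f = "\<lambda>b. neg (a \<boxplus> m b)"
  have f: "?f \<in> C \<rightarrow> C" using a op by auto
  have contr: "adist A (?f b) (?f c) \<le> anorm A a * adist A b c" if bc: "b \<in> C" "c \<in> C" for b c
  proof -
    have mC: "m b \<in> C" "m c \<in> C" "m (b \<boxplus> neg c) \<in> C" using op bc by (metis add_closed scale_closed)+
    have "(a \<boxplus> m b) \<boxplus> neg (a \<boxplus> m c) = (a \<boxplus> neg a) \<boxplus> (m b \<boxplus> neg (m c))"
      using a mC by (simp only: scale_add_right add_ac' closed)
    also have "\<dots> = m (b \<boxplus> neg c)" using a mC op[OF bc] by (simp add: add_minus zero_add)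
    finally have 1: "(a \<boxplus> m b) \<boxplus> neg (a \<boxplus> m c) = m (b \<boxplus> neg c)" .
    have "?f b \<boxplus> neg (?f c) = neg ((a \<boxplus> m b) \<boxplus> neg (a \<boxplus> m c))" using a mC by (simp only: scale_add_right closed)
    then have "ds (?f b) (?f c) = anorm A (m (b \<boxplus> neg c))" using 1 norm_neg[OF mC(3)] by simp
    then show ?thesis using nrm[of "b \<boxplus> neg c"] bc a mC by (simp add: adist_eq)
  qed
  have ne: "C \<noteq> {}" using zero_closed by blast
  obtain b where b: "b \<in> C" "?f b = b"
    using M.Banach_fixedpoint_thm[OF complete ne f a(2) contr] by metis
  have mb: "m b \<in> C" using op b(1) by blast
  have "(a \<boxplus> b) \<boxplus> m b = (a \<boxplus> m b) \<boxplus> b" using a b(1) mb by (simp add: add_ac')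
  also have "\<dots> = (a \<boxplus> m b) \<boxplus> neg (a \<boxplus> m b)" using b(2) by simp
  also have "\<dots> = Z" using a mb by (intro add_minus) simp
  finally show ?thesis using b(1) by blast
qed

lemma quasi_small: assumes a: "a \<in> C" "anorm A a < 1" shows "a \<in> quasi A"
proof -
  obtain b where b: "b \<in> C" "a \<circ>\<^sub>q b = Z"
    using small_right_inverse[OF a, of "\<lambda>b. a \<boxdot> b"] a norm_mult[OF a(1)]
    by (auto simp: circ_def mult_add_right neg_mult)
  have "\<exists>c\<in>C. (a \<boxplus> c) \<boxplus> c \<boxdot> a = Z"
    by (rule small_right_inverse[OF a, of "\<lambda>c. c \<boxdot> a"])
      (use a norm_mult[OF _ a(1)] in \<open>auto simp: mult_add_left neg_mult mult.commute\<close>)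
  then obtain c where c: "c \<in> C" "c \<circ>\<^sub>q a = Z" unfolding circ_def using a add_commute by auto
  then have "c = b" using circ_inverse_unique[OF a(1) c(1) b(1)] b by simp
  then show ?thesis unfolding quasi_def using a b c by auto
qed

lemma qinv_small: assumes a: "a \<in> C" "anorm A a \<le> 1/2" shows "anorm A (qinv a) \<le> 2 * anorm A a"
proof -
  have q: "a \<in> quasi A" using quasi_small a by simp
  let ?b = "qinv a"
  have b: "?b \<in> C" using qinv(1)[OF q] quasi_closed by blast
  have "?b \<boxplus> (a \<boxplus> a \<boxdot> ?b) = Z" using qinv(2)[OF q] a b by (simp add: circ_def add_ac')
  then have "a \<boxplus> a \<boxdot> ?b = neg ?b" using add_eq_zero[of ?b "a \<boxplus> a \<boxdot> ?b"] a b by simp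
  then have "anorm A ?b = anorm A (a \<boxplus> a \<boxdot> ?b)" using norm_neg[OF b] by simp
  also have "\<dots> \<le> anorm A a + anorm A a * anorm A ?b"
    using norm_triangle[of a "a \<boxdot> ?b"] norm_mult[of a ?b] a b by simp
  also have "\<dots> \<le> anorm A a + 1/2 * anorm A ?b" using mult_right_mono[OF a(2) norm_nonneg[OF b]] by simp
  finally show ?thesis by simp
qed

lemma topspace_qtop [simp]: "topspace (qtop A) = quasi A"
  unfolding qtop_def using quasi_closed by auto

lemma qtop_iff: "continuous_map Y (qtop A) f \<longleftrightarrow> continuous_map Y (atop A) f \<and> (\<forall>y\<in>topspace Y. f y \<in> quasi A)"
  unfolding qtop_def continuous_map_in_subtopology by auto

text \<open>If \<open>b\<close> is the quasi-inverse of \<open>f y\<close>, then that of \<open>f w\<close> is \<open>v \<circ> b\<close>, where \<open>v\<close> is the quasi-inverse of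
  \<open>b \<circ> f w\<close>, which is small for \<open>w\<close> close to \<open>y\<close>.\<close>

lemma cont_qinv:
  assumes f: "continuous_map Y (qtop A) f"
  shows "continuous_map Y (qtop A) (\<lambda>y. qinv (f y))"
proof -
  have fc: "continuous_map Y (atop A) f" and fq: "\<And>y. y \<in> topspace Y \<Longrightarrow> f y \<in> quasi A" using f unfolding qtop_iff by auto
  note iq = qinv[OF fq]
  note iC = quasi_closed[OF iq(1)]
  have "continuous_map Y (atop A) (\<lambda>y. qinv (f y))"
    unfolding cont_iff
  proof (intro conjI ballI allI impI)
    fix y and e :: real assume y: "y \<in> topspace Y" and e: "e > 0"
    let ?b = "qinv (f y)"
    let ?u = "\<lambda>w. ?b \<circ>\<^sub>q f w"
    define K where "K = 1 + anorm A ?b"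
    have K: "K \<ge> 1" unfolding K_def using norm_nonneg[OF iC[OF y]] by simp
    have uc: "continuous_map Y (atop A) ?u" using iC[OF y] by (intro cont_circ fc) simp
    let ?U = "{w \<in> topspace Y. anorm A (?u w) \<in> {..<min (1/2) (e / (2 * K))}}"
    have "openin Y ?U" by (rule openin_continuous_map_preimage[OF cont_norm[OF uc]]) simp
    moreover have "y \<in> ?U" using iq(3)[OF y] y e K norm_zero by simp
    moreover have "ds (qinv (f w)) ?b < e" if "w \<in> ?U" for w
    proof -
      have w: "w \<in> topspace Y" "anorm A (?u w) < 1/2" "anorm A (?u w) < e / (2 * K)" using that by auto
      have uC: "?u w \<in> C" using cont_closed[OF uc w(1)] .
      have uq: "?u w \<in> quasi A" using quasi_circ[OF iq(1)[OF y] fq[OF w(1)]] .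
      let ?v = "qinv (?u w)"
      have vC: "?v \<in> C" using quasi_closed[OF qinv(1)[OF uq]] .
      have fwC: "f w \<in> C" using quasi_closed[OF fq[OF w(1)]] .
      have "(?v \<circ>\<^sub>q ?b) \<circ>\<^sub>q f w = Z" using circ_assoc[OF vC iC[OF y] fwC] qinv(3)[OF uq] by simp
      then have eq: "qinv (f w) = ?v \<circ>\<^sub>q ?b"
        using circ_inverse_unique[OF fwC, of "?v \<circ>\<^sub>q ?b" "qinv (f w)"] iq(2)[OF w(1)] iC[OF w(1)] vC iC[OF y] by simp
      have "qinv (f w) \<boxplus> neg ?b = ?v \<boxplus> ?v \<boxdot> ?b" unfolding eq by (rule circ_minus[OF vC iC[OF y]])
      then have "ds (qinv (f w)) ?b \<le> anorm A ?v + anorm A ?v * anorm A ?b"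
        using norm_triangle[of ?v "?v \<boxdot> ?b"] norm_mult[of ?v ?b] vC iC[OF y] by simp
      also have "\<dots> = anorm A ?v * K" by (simp add: K_def algebra_simps)
      also have "\<dots> \<le> 2 * anorm A (?u w) * K" using qinv_small[OF uC] w(2) K by (intro mult_right_mono) auto
      also have "\<dots> < e" using w(3) K by (simp add: field_simps)
      finally show ?thesis .
    qed
    ultimately show "\<exists>U. openin Y U \<and> y \<in> U \<and> (\<forall>w\<in>U. ds (qinv (f w)) ?b < e)" by blast
  qed (rule iC)
  then show ?thesis unfolding qtop_iff using iq(1) by blast
qed

end

section \<open>Matrix algebras\<close>

lemma banach_matI:
  "carrier (mat_alg n A) = {M. \<forall>i j. (i < n \<and> j < n \<longrightarrow> M i j \<in> carrier A) \<and> (\<not> (i < n \<and> j < n) \<longrightarrow> M i j = azero A)}"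
  "azero (mat_alg n A) = (\<lambda>i j. azero A)"
  "aadd (mat_alg n A) = (\<lambda>M N i j. aadd A (M i j) (N i j))"
  "amult (mat_alg n A) = (\<lambda>M N i j. asum A (\<lambda>k. amult A (M i k) (N k j)) n)"
  "ascale (mat_alg n A) = (\<lambda>c M i j. ascale A c (M i j))"
  "anorm (mat_alg n A) = (\<lambda>M. \<Sum>i<n. \<Sum>j<n. anorm A (M i j))"
  by (simp_all add: mat_alg_def)

lemma asum_0 [simp]: "asum A f 0 = azero A" and asum_Suc [simp]: "asum A f (Suc n) = aadd A (asum A f n) (f n)"
  by (simp_all add: asum_def)

context banach_algebra begin

lemma asum_closed: "(\<And>i. i < n \<Longrightarrow> f i \<in> C) \<Longrightarrow> asum A f n \<in> C"
  by (induction n) auto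

lemma asum_add: "(\<And>i. i < n \<Longrightarrow> f i \<in> C) \<Longrightarrow> (\<And>i. i < n \<Longrightarrow> g i \<in> C) \<Longrightarrow>
   asum A (\<lambda>i. f i \<boxplus> g i) n = asum A f n \<boxplus> asum A g n"
proof (induction n)
  case (Suc n)
  then have "asum A f n \<in> C" "asum A g n \<in> C" "f n \<in> C" "g n \<in> C" by (auto intro: asum_closed)
  then show ?case using Suc by (simp add: add_ac')
qed (simp add: add_zero)

lemma asum_scale: "(\<And>i. i < n \<Longrightarrow> f i \<in> C) \<Longrightarrow> asum A (\<lambda>i. ascale A c (f i)) n = ascale A c (asum A f n)"
  by (induction n) (auto simp: zero_scale scale_add_right asum_closed)

lemma asum_mult_left: "(\<And>i. i < n \<Longrightarrow> f i \<in> C) \<Longrightarrow> x \<in> C \<Longrightarrow> asum A (\<lambda>i. x \<boxdot> f i) n = x \<boxdot> asum A f n"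
  by (induction n) (auto simp: mult_zero mult_add_right asum_closed)

lemma asum_mult_right: "(\<And>i. i < n \<Longrightarrow> f i \<in> C) \<Longrightarrow> x \<in> C \<Longrightarrow> asum A (\<lambda>i. f i \<boxdot> x) n = asum A f n \<boxdot> x"
  by (induction n) (auto simp: zero_mult mult_add_left asum_closed)

lemma asum_zero: "(\<And>i. i < n \<Longrightarrow> f i = Z) \<Longrightarrow> asum A f n = Z"
  by (induction n) (auto simp: add_zero)

lemma asum_swap: "(\<And>i j. i < n \<Longrightarrow> j < m \<Longrightarrow> f i j \<in> C) \<Longrightarrow>
   asum A (\<lambda>i. asum A (f i) m) n = asum A (\<lambda>j. asum A (\<lambda>i. f i j) n) m"
proof (induction n)
  case 0 then show ?case by (simp add: asum_zero)
next
  case (Suc n)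
  then show ?case by (simp add: asum_add asum_closed)
qed

lemma asum_extend: "n \<le> n' \<Longrightarrow> (\<And>i. i < n \<Longrightarrow> f i \<in> C) \<Longrightarrow> (\<And>i. n \<le> i \<Longrightarrow> f i = Z) \<Longrightarrow> asum A f n' = asum A f n"
  by (induction n' rule: dec_induct) (auto simp: add_zero asum_closed)

lemma norm_asum: "(\<And>i. i < n \<Longrightarrow> f i \<in> C) \<Longrightarrow> anorm A (asum A f n) \<le> (\<Sum>i<n. anorm A (f i))"
proof (induction n)
  case (Suc n)
  then have "anorm A (asum A f n \<boxplus> f n) \<le> anorm A (asum A f n) + anorm A (f n)"
    by (intro norm_triangle asum_closed) auto
  then show ?case using Suc by force
qed (simp add: norm_zero)

abbreviation "mats n \<equiv> carrier (mat_alg n A)"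

lemma mats_entry: "M \<in> mats n \<Longrightarrow> M i j \<in> C"
  unfolding banach_matI by (cases "i < n \<and> j < n") auto

lemma mats_out: "M \<in> mats n \<Longrightarrow> \<not> (i < n \<and> j < n) \<Longrightarrow> M i j = Z"
  unfolding banach_matI by blast

lemma matsI: "(\<And>i j. M i j \<in> C) \<Longrightarrow> (\<And>i j. \<not> (i < n \<and> j < n) \<Longrightarrow> M i j = Z) \<Longrightarrow> M \<in> mats n"
  unfolding banach_matI by blast

lemma mat_mult_entry_closed: "M \<in> mats n \<Longrightarrow> N \<in> mats n \<Longrightarrow> asum A (\<lambda>k. M i k \<boxdot> N k j) n \<in> C"
  by (intro asum_closed mult_closed mats_entry)

lemma mat_metric_facts:
  assumes "M \<in> mats n"
  shows "0 \<le> anorm (mat_alg n A) M" "i < n \<Longrightarrow> j < n \<Longrightarrow> anorm A (M i j) \<le> anorm (mat_alg n A) M"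
proof -
  have nn: "0 \<le> anorm A (M i j)" for i j using norm_nonneg[OF mats_entry[OF assms]] .
  show "0 \<le> anorm (mat_alg n A) M" unfolding banach_matI by (intro sum_nonneg nn)
  assume ij: "i < n" "j < n"
  have "anorm A (M i j) \<le> (\<Sum>j<n. anorm A (M i j))" using ij nn by (intro member_le_sum) auto
  also have "\<dots> \<le> anorm (mat_alg n A) M" unfolding banach_matI using ij nn by (intro member_le_sum sum_nonneg) auto
  finally show "anorm A (M i j) \<le> anorm (mat_alg n A) M" .
qed

theorem mat_banach: "banach_algebra (mat_alg n A)"
proof -
  note mo = mats_entry mats_out
  have complete': "Metric_space.mcomplete (mats n) (adist (mat_alg n A))"
    if MS: "Metric_space (mats n) (adist (mat_alg n A))"
  proof -
    interpret A: Metric_space C "adist A" by (rule Metric)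
    interpret MM: Metric_space "mats n" "adist (mat_alg n A)" by (rule MS)
    have ent: "adist A (M i j) (N i j) \<le> adist (mat_alg n A) M N" if MN: "M \<in> mats n" "N \<in> mats n" and ij: "i < n" "j < n" for M N i j
    proof -
      have "(\<lambda>i j. M i j \<boxplus> neg (N i j)) \<in> mats n"
        using mo[OF MN(1)] mo[OF MN(2)] by (intro matsI) (auto simp: zero_scale add_zero)
      from mat_metric_facts(2)[OF this ij] show ?thesis
        using MN mats_entry[OF MN(1)] mats_entry[OF MN(2)] by (simp add: adist_def banach_matI(3,5))
    qed
    have dsum: "adist (mat_alg n A) M N = (\<Sum>i<n. \<Sum>j<n. adist A (M i j) (N i j))" if "M \<in> mats n" "N \<in> mats n" for M N
      using that mats_entry[OF that(1)] mats_entry[OF that(2)] by (simp add: adist_def banach_matI(3,5,6))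
    show ?thesis unfolding MM.mcomplete_def
    proof (intro allI impI)
      fix \<sigma> assume \<sigma>: "MM.MCauchy \<sigma>"
      then have \<sigma>m: "\<sigma> k \<in> mats n" for k unfolding MM.MCauchy_def by blast
      have "A.MCauchy (\<lambda>k. \<sigma> k i j)" if ij: "i < n" "j < n" for i j
        unfolding A.MCauchy_def
      proof (intro conjI allI impI)
        show "range (\<lambda>k. \<sigma> k i j) \<subseteq> C" using mats_entry[OF \<sigma>m] by blast
        fix e :: real assume "e > 0"
        then obtain K where "\<forall>k l. K \<le> k \<longrightarrow> K \<le> l \<longrightarrow> adist (mat_alg n A) (\<sigma> k) (\<sigma> l) < e"
          using \<sigma> unfolding MM.MCauchy_def by blast
        then show "\<exists>K. \<forall>k l. K \<le> k \<longrightarrow> K \<le> l \<longrightarrow> adist A (\<sigma> k i j) (\<sigma> l i j) < e"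
          using ent[OF \<sigma>m \<sigma>m ij] by (meson le_less_trans)
      qed
      then have "\<exists>x. limitin A.mtopology (\<lambda>k. \<sigma> k i j) x sequentially" if "i < n" "j < n" for i j
        using complete that unfolding A.mcomplete_def by blast
      then obtain L where L: "\<And>i j. i < n \<Longrightarrow> j < n \<Longrightarrow> limitin A.mtopology (\<lambda>k. \<sigma> k i j) (L i j) sequentially" by metis
      define L' where "L' i j = (if i < n \<and> j < n then L i j else Z)" for i j
      have LC: "L i j \<in> C" if "i < n" "j < n" for i j using L[OF that] by (simp add: A.limit_metric_sequentially)
      have L'm: "L' \<in> mats n" unfolding L'_def using LC by (intro matsI) auto
      have "(\<lambda>k. adist A (\<sigma> k i j) (L' i j)) \<longlonglongrightarrow> 0" if ij: "i < n" "j < n" for i j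
        unfolding LIMSEQ_iff
      proof (intro allI impI)
        fix r :: real assume "r > 0"
        then obtain K where "\<forall>k\<ge>K. \<sigma> k i j \<in> C \<and> adist A (\<sigma> k i j) (L i j) < r"
          using L[OF ij] unfolding A.limit_metric_sequentially by blast
        then show "\<exists>K. \<forall>k\<ge>K. norm (adist A (\<sigma> k i j) (L' i j) - 0) < r" using ij by (auto simp: L'_def)
      qed
      then have "(\<lambda>k. \<Sum>i<n. \<Sum>j<n. adist A (\<sigma> k i j) (L' i j)) \<longlonglongrightarrow> (\<Sum>i<n. \<Sum>j<n. 0)"
        by (intro tendsto_sum) auto
      then have lim: "(\<lambda>k. adist (mat_alg n A) (\<sigma> k) L') \<longlonglongrightarrow> 0" using dsum[OF \<sigma>m L'm] by simp
      have "limitin MM.mtopology \<sigma> L' sequentially" unfolding MM.limit_metric_sequentially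
      proof (intro conjI allI impI L'm)
        fix r :: real assume "r > 0"
        then obtain K where "\<forall>k\<ge>K. norm (adist (mat_alg n A) (\<sigma> k) L' - 0) < r" using lim unfolding LIMSEQ_iff by blast
        then show "\<exists>K. \<forall>k\<ge>K. \<sigma> k \<in> mats n \<and> adist (mat_alg n A) (\<sigma> k) L' < r" using \<sigma>m by (intro exI[of _ K]) auto
      qed
      then show "\<exists>x. limitin MM.mtopology \<sigma> x sequentially" by blast
    qed
  qed
  have base: "Metric_space (mats n) (adist (mat_alg n A))"
  proof
    interpret A: Metric_space C "adist A" by (rule Metric)
    have dsum: "adist (mat_alg n A) M N = (\<Sum>i<n. \<Sum>j<n. adist A (M i j) (N i j))" if "M \<in> mats n" "N \<in> mats n" for M N
      using that mats_entry[OF that(1)] mats_entry[OF that(2)] by (simp add: adist_def banach_matI(3,5,6))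
    have d0: "adist (mat_alg n A) M N = 0" if "\<not> (M \<in> mats n \<and> N \<in> mats n)" for M N
      using that unfolding adist_def by meson
    show "0 \<le> adist (mat_alg n A) M N" for M N
      by (cases "M \<in> mats n \<and> N \<in> mats n") (auto simp: d0 dsum intro!: sum_nonneg)
    show "adist (mat_alg n A) M N = adist (mat_alg n A) N M" for M N
      by (cases "M \<in> mats n \<and> N \<in> mats n") (auto simp: d0 dsum A.commute)
    show "adist (mat_alg n A) M N = 0 \<longleftrightarrow> M = N" if MN: "M \<in> mats n" "N \<in> mats n" for M N
    proof
      assume "adist (mat_alg n A) M N = 0"
      then have "\<forall>i<n. \<forall>j<n. adist A (M i j) (N i j) = 0"
        unfolding dsum[OF MN] by (subst (asm) sum_nonneg_eq_0_iff; (force intro: sum_nonneg)?) (auto simp: sum_nonneg_eq_0_iff)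
      then have "M i j = N i j" for i j
        using mo[OF MN(1)] mo[OF MN(2)] A.zero by (cases "i < n \<and> j < n") (auto)
      then show "M = N" by blast
    qed (use MN mats_entry[OF MN(1)] in \<open>simp add: dsum\<close>)
    show "adist (mat_alg n A) L N \<le> adist (mat_alg n A) L M + adist (mat_alg n A) M N"
      if LMN: "L \<in> mats n" "M \<in> mats n" "N \<in> mats n" for L M N
      unfolding dsum[OF LMN(1,3)] dsum[OF LMN(1,2)] dsum[OF LMN(2,3)] sum.distrib[symmetric]
      using LMN mats_entry by (intro sum_mono A.triangle) auto
  qed
  show ?thesis
  proof
    show "azero (mat_alg n A) \<in> mats n" by (simp add: banach_matI)
    fix M assume M: "M \<in> mats n"
    note MC = mats_entry[OF M]
    show "ascale (mat_alg n A) c M \<in> mats n" for c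
      unfolding banach_matI(5) using mo[OF M] by (intro matsI) (auto simp: zero_scale)
    show "aadd (mat_alg n A) M (azero (mat_alg n A)) = M" using MC by (simp add: banach_matI add_zero)
    show "aadd (mat_alg n A) M (ascale (mat_alg n A) (-1) M) = azero (mat_alg n A)" using MC by (simp add: banach_matI add_minus)
    show "ascale (mat_alg n A) 1 M = M" using MC by (simp add: banach_matI scale_one)
    show "ascale (mat_alg n A) c (ascale (mat_alg n A) d M) = ascale (mat_alg n A) (c * d) M" for c d using MC by (simp add: banach_matI scale_scale)
    show "ascale (mat_alg n A) (c + d) M = aadd (mat_alg n A) (ascale (mat_alg n A) c M) (ascale (mat_alg n A) d M)" for c d
      using MC by (simp add: banach_matI scale_add_left)
    show "0 \<le> anorm (mat_alg n A) M" by (rule mat_metric_facts[OF M])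
    show "anorm (mat_alg n A) M = 0 \<longleftrightarrow> M = azero (mat_alg n A)"
    proof
      assume nz: "anorm (mat_alg n A) M = 0"
      have "M i j = Z" for i j
      proof (cases "i < n \<and> j < n")
        case True
        then have "anorm A (M i j) = 0" using mat_metric_facts(2)[OF M, of i j] nz norm_nonneg[OF MC, of i j] by simp
        then show ?thesis using norm_eq_0[OF MC] by blast
      qed (use mo[OF M] in blast)
      then show "M = azero (mat_alg n A)" by (simp add: banach_matI fun_eq_iff)
    qed (simp add: banach_matI norm_zero)
    show "anorm (mat_alg n A) (ascale (mat_alg n A) c M) = norm c * anorm (mat_alg n A) M" for c
      using MC by (simp add: banach_matI norm_scale sum_distrib_left)
    fix N assume N: "N \<in> mats n"
    note NC = mats_entry[OF N]
    show "aadd (mat_alg n A) M N \<in> mats n"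
      unfolding banach_matI(3) using mo[OF M] mo[OF N] by (intro matsI) (auto simp: add_zero)
    show "amult (mat_alg n A) M N \<in> mats n"
      unfolding banach_matI(4)
    proof (rule matsI)
      show "asum A (\<lambda>k. M i k \<boxdot> N k j) n \<in> C" for i j by (rule mat_mult_entry_closed[OF M N])
      fix i j assume "\<not> (i < n \<and> j < n)"
      then show "asum A (\<lambda>k. M i k \<boxdot> N k j) n = Z"
        using mo[OF M] mo[OF N] by (intro asum_zero) (auto simp: zero_mult mult_zero)
    qed
    show "aadd (mat_alg n A) M N = aadd (mat_alg n A) N M" using MC NC by (simp add: banach_matI add_commute)
    show "ascale (mat_alg n A) c (aadd (mat_alg n A) M N) = aadd (mat_alg n A) (ascale (mat_alg n A) c M) (ascale (mat_alg n A) c N)" for c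
      using MC NC by (simp add: banach_matI scale_add_right)
    show "amult (mat_alg n A) (ascale (mat_alg n A) c M) N = ascale (mat_alg n A) c (amult (mat_alg n A) M N)"
      "amult (mat_alg n A) M (ascale (mat_alg n A) c N) = ascale (mat_alg n A) c (amult (mat_alg n A) M N)" for c
      using MC NC by (simp_all add: banach_matI mult_scale_left mult_scale_right asum_scale)
    show "anorm (mat_alg n A) (aadd (mat_alg n A) M N) \<le> anorm (mat_alg n A) M + anorm (mat_alg n A) N"
      unfolding banach_matI sum.distrib[symmetric] by (intro sum_mono norm_triangle MC NC)
    show "anorm (mat_alg n A) (amult (mat_alg n A) M N) \<le> anorm (mat_alg n A) M * anorm (mat_alg n A) N"
    proof -
      let ?m = "\<lambda>i k. anorm A (M i k)" and ?n = "\<lambda>k j. anorm A (N k j)"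
      have nn: "0 \<le> ?m i k" "0 \<le> ?n i k" for i k using norm_nonneg MC NC by auto
      have "anorm A (asum A (\<lambda>k. M i k \<boxdot> N k j) n) \<le> (\<Sum>k<n. ?m i k * ?n k j)" for i j
        by (rule order_trans[OF norm_asum sum_mono]) (simp_all add: MC NC norm_mult)
      then have "anorm (mat_alg n A) (amult (mat_alg n A) M N) \<le> (\<Sum>i<n. \<Sum>j<n. \<Sum>k<n. ?m i k * ?n k j)"
        unfolding banach_matI by (intro sum_mono)
      also have "\<dots> = (\<Sum>i<n. \<Sum>k<n. ?m i k * (\<Sum>j<n. ?n k j))"
        unfolding sum_distrib_left by (intro sum.cong refl sum.swap)
      also have "\<dots> \<le> (\<Sum>i<n. \<Sum>k<n. ?m i k * (\<Sum>k<n. \<Sum>j<n. ?n k j))"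
        using nn by (intro sum_mono mult_left_mono member_le_sum sum_nonneg) auto
      also have "\<dots> = anorm (mat_alg n A) M * anorm (mat_alg n A) N"
        unfolding banach_matI by (simp add: sum_distrib_right)
      finally show ?thesis .
    qed
    fix L assume L: "L \<in> mats n"
    note LC = mats_entry[OF L]
    show "aadd (mat_alg n A) (aadd (mat_alg n A) M N) L = aadd (mat_alg n A) M (aadd (mat_alg n A) N L)"
      using MC NC LC by (simp add: banach_matI add_assoc)
    show "amult (mat_alg n A) (aadd (mat_alg n A) M N) L = aadd (mat_alg n A) (amult (mat_alg n A) M L) (amult (mat_alg n A) N L)"
      "amult (mat_alg n A) M (aadd (mat_alg n A) N L) = aadd (mat_alg n A) (amult (mat_alg n A) M N) (amult (mat_alg n A) M L)"
      using MC NC LC by (simp_all add: banach_matI mult_add_left mult_add_right asum_add)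
    show "amult (mat_alg n A) (amult (mat_alg n A) M N) L = amult (mat_alg n A) M (amult (mat_alg n A) N L)"
    proof -
      have "asum A (\<lambda>k. asum A (\<lambda>l. M i l \<boxdot> N l k) n \<boxdot> L k j) n = asum A (\<lambda>k. M i k \<boxdot> asum A (\<lambda>l. N k l \<boxdot> L l j) n) n" for i j
      proof -
        have "asum A (\<lambda>k. asum A (\<lambda>l. M i l \<boxdot> N l k) n \<boxdot> L k j) n = asum A (\<lambda>k. asum A (\<lambda>l. (M i l \<boxdot> N l k) \<boxdot> L k j) n) n"
          using MC NC LC by (simp add: asum_mult_right)
        also have "\<dots> = asum A (\<lambda>l. asum A (\<lambda>k. (M i l \<boxdot> N l k) \<boxdot> L k j) n) n"
          using MC NC LC by (intro asum_swap) auto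
        also have "\<dots> = asum A (\<lambda>l. M i l \<boxdot> asum A (\<lambda>k. N l k \<boxdot> L k j) n) n"
          using MC NC LC by (simp add: mult_assoc asum_mult_left)
        finally show ?thesis .
      qed
      then show ?thesis by (simp add: banach_matI)
    qed
  qed (rule complete'[OF base])
qed

lemma mat_cont_iff:
  "continuous_map Y (atop (mat_alg n A)) F \<longleftrightarrow> (\<forall>y\<in>topspace Y. F y \<in> mats n) \<and>
     (\<forall>i j. continuous_map Y (atop A) (\<lambda>y. F y i j))" (is "?L \<longleftrightarrow> ?R")
proof
  interpret M: banach_algebra "mat_alg n A" by (rule mat_banach)
  {
    assume L: ?L
    note c = M.cont_closed[OF L]
    have "continuous_map Y (atop A) (\<lambda>y. F y i j)" for i j
    proof (cases "i < n \<and> j < n")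
      case True
      show ?thesis
      proof (rule cont_dominated[where g = "\<lambda>y w. M.ds (F w) (F y)"])
        show "F y i j \<in> C" if "y \<in> topspace Y" for y using mats_entry[OF c[OF that]] .
        fix y assume y: "y \<in> topspace Y"
        have "ds (F w i j) (F y i j) \<le> M.ds (F w) (F y)" if "w \<in> topspace Y" for w
        proof -
          have "M.pls (F w) (M.neg (F y)) \<in> mats n" using c[OF y] c[OF that] by (intro M.add_closed M.scale_closed)
          from mat_metric_facts(2)[OF this, of i j] show ?thesis using True by (simp add: banach_matI(3,5))
        qed
        then show "continuous_map Y euclideanreal (\<lambda>w. M.ds (F w) (F y)) \<and> M.ds (F y) (F y) = 0 \<and>
          (\<forall>w\<in>topspace Y. ds (F w i j) (F y i j) \<le> M.ds (F w) (F y))"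
          using M.cont_ds[OF L c[OF y]] M.ds_zero[OF c[OF y]] by blast
      qed
    next
      case False
      then have "F y i j = Z" if "y \<in> topspace Y" for y using mats_out[OF c[OF that]] by blast
      then show ?thesis by (intro continuous_map_eq[of Y _ "\<lambda>_. Z" "\<lambda>y. F y i j"]) auto
    qed
    then show ?R using c by blast
  }
  assume R: ?R
  show ?L
  proof (rule M.cont_dominated[where g = "\<lambda>y w. \<Sum>i<n. \<Sum>j<n. ds (F w i j) (F y i j)"])
    show "F y \<in> mats n" if "y \<in> topspace Y" for y using R that by blast
    fix y assume y: "y \<in> topspace Y"
    have "F y i j \<in> C" for i j using R y mats_entry by blast
    then show "continuous_map Y euclideanreal (\<lambda>w. \<Sum>i<n. \<Sum>j<n. ds (F w i j) (F y i j)) \<and>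
       (\<Sum>i<n. \<Sum>j<n. ds (F y i j) (F y i j)) = 0 \<and>
       (\<forall>w\<in>topspace Y. M.ds (F w) (F y) \<le> (\<Sum>i<n. \<Sum>j<n. ds (F w i j) (F y i j)))"
      using R by (auto intro!: continuous_map_sum cont_ds simp: ds_zero banach_matI(3,5,6))
  qed
qed

lemma mats_mono: "n \<le> n' \<Longrightarrow> mats n \<subseteq> mats n'"
  using mats_entry mats_out by (auto intro!: matsI) (metis le_trans not_le)+

lemma atop_mats: "n \<le> n' \<Longrightarrow> atop (mat_alg n A) = subtopology (atop (mat_alg n' A)) (mats n)"
proof -
  assume le: "n \<le> n'"
  let ?X = "atop (mat_alg n A)" and ?Y = "subtopology (atop (mat_alg n' A)) (mats n)"
  have ts: "topspace ?X = topspace ?Y"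
    using mats_mono[OF le] banach_algebra.topspace_atop[OF mat_banach] by auto
  have tX: "topspace ?X = mats n" using banach_algebra.topspace_atop[OF mat_banach] by auto
  have "continuous_map ?X ?X (\<lambda>x. x)" "continuous_map ?Y ?Y (\<lambda>x. x)"
    using continuous_map_id[of ?X] continuous_map_id[of ?Y] by (simp_all only: id_def)
  then have "continuous_map ?X ?Y id" "continuous_map ?Y ?X id"
    unfolding id_def continuous_map_in_subtopology mat_cont_iff using ts tX mats_mono[OF le] by auto
  then show ?thesis using topology_finer_continuous_id[OF ts] topology_finer_continuous_id[OF ts[symmetric]]
    by (metis topology_eq)
qed

lemma norm_mats: "n \<le> n' \<Longrightarrow> M \<in> mats n \<Longrightarrow> anorm (mat_alg n' A) M = anorm (mat_alg n A) M"
proof -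
  assume le: "n \<le> n'" and M: "M \<in> mats n"
  have z: "anorm A (M i j) = 0" if "\<not> (i < n \<and> j < n)" for i j using mats_out[OF M that] norm_zero by simp
  have "(\<Sum>j<n'. anorm A (M i j)) = (\<Sum>j<n. anorm A (M i j))" for i
    using le z by (intro sum.mono_neutral_right) auto
  moreover have "(\<Sum>i<n'. \<Sum>j<n. anorm A (M i j)) = (\<Sum>i<n. \<Sum>j<n. anorm A (M i j))"
    using le z by (intro sum.mono_neutral_right) auto
  ultimately show ?thesis by (simp add: banach_matI)
qed

lemma mat_mult_mats:
  assumes "n \<le> n'" and M: "M \<in> mats n" and N: "N \<in> mats n"
  shows "amult (mat_alg n' A) M N = amult (mat_alg n A) M N"
proof -
  have "asum A (\<lambda>k. M i k \<boxdot> N k j) n' = asum A (\<lambda>k. M i k \<boxdot> N k j) n" for i j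
    using mats_entry[OF M] mats_entry[OF N] mats_out[OF M] zero_mult by (intro asum_extend[OF assms(1)]) auto
  then show ?thesis by (simp add: banach_matI(4))
qed

lemma circ_mats: "n \<le> n' \<Longrightarrow> M \<in> mats n \<Longrightarrow> N \<in> mats n \<Longrightarrow> circ (mat_alg n' A) M N = circ (mat_alg n A) M N"
  unfolding circ_def using mat_mult_mats by (simp add: banach_matI(3))

text \<open>Enlarging matrices by zeros creates no new quasi-inverses, so each stage is the part of the next one that
  consists of the smaller matrices.\<close>

lemma quasi_mats: "n \<le> n' \<Longrightarrow> quasi (mat_alg n A) = quasi (mat_alg n' A) \<inter> mats n"
proof (intro subset_antisym subsetI)
  assume le: "n \<le> n'"
  interpret M: banach_algebra "mat_alg n' A" by (rule mat_banach)
  interpret M0: banach_algebra "mat_alg n A" by (rule mat_banach)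
  have zz: "azero (mat_alg n A) = azero (mat_alg n' A)" by (simp add: banach_matI)
  fix a
  {
    assume "a \<in> quasi (mat_alg n A)"
    then obtain b where ab: "a \<in> mats n" "b \<in> mats n" "circ (mat_alg n A) a b = azero (mat_alg n A)" "circ (mat_alg n A) b a = azero (mat_alg n A)"
      unfolding quasi_def by blast
    then show "a \<in> quasi (mat_alg n' A) \<inter> mats n"
      unfolding quasi_def using mats_mono[OF le] circ_mats[OF le ab(1,2)] circ_mats[OF le ab(2,1)] zz by auto
  }
  assume "a \<in> quasi (mat_alg n' A) \<inter> mats n"
  then obtain b where ab: "a \<in> mats n" "b \<in> mats n'" "circ (mat_alg n' A) a b = azero (mat_alg n' A)" "circ (mat_alg n' A) b a = azero (mat_alg n' A)"
    unfolding quasi_def by blast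
  note aC = mats_entry[OF ab(1)] and bC = mats_entry[OF ab(2)]
  \<comment> \<open>The quasi-inverse satisfies \<open>b = - a - a b = - a - b a\<close>, so its support is as small as that of \<open>a\<close>.\<close>
  have e1: "a i j \<boxplus> b i j \<boxplus> asum A (\<lambda>k. a i k \<boxdot> b k j) n' = Z"
    "b i j \<boxplus> a i j \<boxplus> asum A (\<lambda>k. b i k \<boxdot> a k j) n' = Z" for i j
    using fun_cong[OF fun_cong[OF ab(3)], of i j] fun_cong[OF fun_cong[OF ab(4)], of i j] by (simp_all add: circ_def banach_matI)
  have "b \<in> mats n"
  proof (rule matsI[OF bC])
    fix i j assume out: "\<not> (i < n \<and> j < n)"
    show "b i j = Z"
    proof (cases "i < n")
      case False
      then have "a i k = Z" for k using mats_out[OF ab(1)] by blast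
      then show ?thesis using e1(1)[of i j] bC by (simp add: zero_mult asum_zero add_zero zero_add)
    next
      case True
      then have "a k j = Z" for k using mats_out[OF ab(1)] out by blast
      then show ?thesis using e1(2)[of i j] bC by (simp add: mult_zero asum_zero add_zero)
    qed
  qed
  then show "a \<in> quasi (mat_alg n A)" unfolding quasi_def using ab circ_mats[OF le ab(1)] circ_mats[OF le _ ab(1)] zz by auto
qed

end

section \<open>The stable group of quasi-invertible matrices\<close>

text \<open>The product \<open>a + b + a b\<close> of two matrices is the same in all sizes that contain both, so the least such size
  can be used to define it.\<close>

definition matrix_size :: "('k::real_or_complex, 'a) normed_alg \<Rightarrow> (nat \<Rightarrow> nat \<Rightarrow> 'a) \<Rightarrow> (nat \<Rightarrow> nat \<Rightarrow> 'a) \<Rightarrow> nat" where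
  "matrix_size A M N = (LEAST n. M \<in> carrier (mat_alg n A) \<and> N \<in> carrier (mat_alg n A))"

definition stable_group :: "('k::real_or_complex, 'a) normed_alg \<Rightarrow> (nat \<Rightarrow> nat \<Rightarrow> 'a) monoid" where
  "stable_group A = \<lparr>carrier = (\<Union>m. quasi (mat_alg (Suc m) A)),
     monoid.mult = (\<lambda>M N. circ (mat_alg (matrix_size A M N) A) M N), one = (\<lambda>i j. azero A)\<rparr>"

abbreviation stage_top :: "('k::real_or_complex, 'a) normed_alg \<Rightarrow> nat \<Rightarrow> (nat \<Rightarrow> nat \<Rightarrow> 'a) topology" where
  "stage_top A m \<equiv> qtop (mat_alg (Suc m) A)"

context banach_algebra begin

lemma stable_group_mult:
  assumes M: "M \<in> mats n" and N: "N \<in> mats n"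
  shows "M \<otimes>\<^bsub>stable_group A\<^esub> N = circ (mat_alg n A) M N"
proof -
  let ?P = "\<lambda>n. M \<in> mats n \<and> N \<in> mats n"
  have "?P (LEAST n. ?P n)" by (rule LeastI[of ?P n]) (use M N in blast)
  moreover have "(LEAST n. ?P n) \<le> n" by (rule Least_le) (use M N in blast)
  ultimately have "circ (mat_alg n A) M N = circ (mat_alg (LEAST n. ?P n) A) M N"
    by (intro circ_mats) auto
  then show ?thesis by (simp add: stable_group_def matrix_size_def)
qed

lemma quasi_mats_mono: "n \<le> n' \<Longrightarrow> quasi (mat_alg n A) \<subseteq> quasi (mat_alg n' A)"
  using quasi_mats[of n n'] by auto

lemma quasi_mats_sub: "quasi (mat_alg n A) \<subseteq> mats n"
  unfolding quasi_def by auto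

lemma stable_group_carrier: "x \<in> carrier (stable_group A) \<longleftrightarrow> (\<exists>m. x \<in> quasi (mat_alg (Suc m) A))"
  by (simp add: stable_group_def)

lemma stable_group_one: "\<one>\<^bsub>stable_group A\<^esub> = azero (mat_alg n A)"
  by (simp add: stable_group_def banach_matI)

lemma stable_group_common:
  assumes "x \<in> carrier (stable_group A)" "y \<in> carrier (stable_group A)" "z \<in> carrier (stable_group A)"
  obtains m where "x \<in> quasi (mat_alg (Suc m) A)" "y \<in> quasi (mat_alg (Suc m) A)" "z \<in> quasi (mat_alg (Suc m) A)"
proof -
  obtain a b c where "x \<in> quasi (mat_alg (Suc a) A)" "y \<in> quasi (mat_alg (Suc b) A)" "z \<in> quasi (mat_alg (Suc c) A)"
    using assms unfolding stable_group_carrier by blast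
  moreover have "Suc a \<le> Suc (max a (max b c))" "Suc b \<le> Suc (max a (max b c))" "Suc c \<le> Suc (max a (max b c))" by auto
  ultimately show ?thesis using that[of "max a (max b c)"] quasi_mats_mono by blast
qed

lemma stable_group_group: "group (stable_group A)"
proof (rule groupI)
  let ?G = "stable_group A"
  fix x assume x: "x \<in> carrier ?G"
  {
    fix y assume y: "y \<in> carrier ?G"
    {
      fix z assume z: "z \<in> carrier ?G"
      obtain m where m: "x \<in> quasi (mat_alg (Suc m) A)" "y \<in> quasi (mat_alg (Suc m) A)" "z \<in> quasi (mat_alg (Suc m) A)"
        using stable_group_common[OF x y z] .
      interpret M: banach_algebra "mat_alg (Suc m) A" by (rule mat_banach)
      note mm = M.quasi_closed[OF m(1)] M.quasi_closed[OF m(2)] M.quasi_closed[OF m(3)]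
      show "x \<otimes>\<^bsub>?G\<^esub> y \<otimes>\<^bsub>?G\<^esub> z = x \<otimes>\<^bsub>?G\<^esub> (y \<otimes>\<^bsub>?G\<^esub> z)"
        using mm by (simp add: stable_group_mult[of _ "Suc m"] M.circ_assoc)
    }
    obtain m where m: "x \<in> quasi (mat_alg (Suc m) A)" "y \<in> quasi (mat_alg (Suc m) A)"
      using stable_group_common[OF x y y] by metis
    interpret M: banach_algebra "mat_alg (Suc m) A" by (rule mat_banach)
    show "x \<otimes>\<^bsub>?G\<^esub> y \<in> carrier ?G"
      using M.quasi_circ[OF m] stable_group_mult[OF M.quasi_closed[OF m(1)] M.quasi_closed[OF m(2)]]
      unfolding stable_group_carrier by auto
  }
  obtain m where m: "x \<in> quasi (mat_alg (Suc m) A)" using x unfolding stable_group_carrier by blast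
  interpret M: banach_algebra "mat_alg (Suc m) A" by (rule mat_banach)
  note q = M.qinv[OF m]
  show "\<one>\<^bsub>?G\<^esub> \<otimes>\<^bsub>?G\<^esub> x = x"
    unfolding stable_group_one[of "Suc m"] using M.quasi_closed[OF m] by (simp add: stable_group_mult[of _ "Suc m"] M.circ_zero)
  show "\<exists>y\<in>carrier ?G. y \<otimes>\<^bsub>?G\<^esub> x = \<one>\<^bsub>?G\<^esub>"
  proof (rule bexI[of _ "M.qinv x"])
    show "M.qinv x \<otimes>\<^bsub>?G\<^esub> x = \<one>\<^bsub>?G\<^esub>"
      unfolding stable_group_one[of "Suc m"]
      using q M.quasi_closed[OF m] M.quasi_closed[OF q(1)] by (simp add: stable_group_mult[of _ "Suc m"])
    show "M.qinv x \<in> carrier ?G" unfolding stable_group_carrier using q(1) by blast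
  qed
next
  interpret M: banach_algebra "mat_alg (Suc 0) A" by (rule mat_banach)
  show "\<one>\<^bsub>stable_group A\<^esub> \<in> carrier (stable_group A)"
    unfolding stable_group_carrier stable_group_one[of "Suc 0"] using M.quasi_zero by blast
qed

lemma stable_group_inv:
  assumes m: "x \<in> quasi (mat_alg (Suc m) A)"
  shows "inv\<^bsub>stable_group A\<^esub> x = banach_algebra.qinv (mat_alg (Suc m) A) x"
proof -
  interpret M: banach_algebra "mat_alg (Suc m) A" by (rule mat_banach)
  note q = M.qinv[OF m]
  have "M.qinv x \<otimes>\<^bsub>stable_group A\<^esub> x = \<one>\<^bsub>stable_group A\<^esub>"
    unfolding stable_group_one[of "Suc m"]
    using q M.quasi_closed[OF m] M.quasi_closed[OF q(1)] by (simp add: stable_group_mult[of _ "Suc m"])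
  then show ?thesis using group.inv_equality[OF stable_group_group] m q(1) unfolding stable_group_carrier by blast
qed

lemma stage_cont_iff:
  "continuous_map Y (stage_top A m) F \<longleftrightarrow> (\<forall>y\<in>topspace Y. F y \<in> quasi (mat_alg (Suc m) A)) \<and>
     (\<forall>i j. continuous_map Y (atop A) (\<lambda>y. F y i j))"
proof -
  interpret M: banach_algebra "mat_alg (Suc m) A" by (rule mat_banach)
  show ?thesis unfolding M.qtop_iff mat_cont_iff using M.quasi_closed by blast
qed

theorem stable_filtered_group: "filtered_group (stable_group A) (stage_top A)"
proof (intro filtered_group.intro filtered_group_axioms.intro stable_group_group)
  interpret G: group "stable_group A" by (rule stable_group_group)
  fix m
  interpret M: banach_algebra "mat_alg (Suc m) A" by (rule mat_banach)
  show "topspace (stage_top A m) \<subseteq> carrier (stable_group A)"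
    unfolding M.topspace_qtop stable_group_def by auto
  show "\<one>\<^bsub>stable_group A\<^esub> \<in> topspace (stage_top A m)"
    unfolding M.topspace_qtop stable_group_one[of "Suc m"] by (rule M.quasi_zero)
  show "stage_top A m = subtopology (stage_top A m') (topspace (stage_top A m))" if le: "m \<le> m'" for m'
  proof -
    have "Suc m \<le> Suc m'" using le by simp
    note q = quasi_mats[OF this] and a = atop_mats[OF this]
    show ?thesis unfolding M.topspace_qtop unfolding qtop_def subtopology_subtopology a
      using q M.quasi_closed by (intro arg_cong[where f = "subtopology (atop (mat_alg (Suc m') A))"]) auto
  qed
  let ?Y = "prod_topology (stage_top A m) (stage_top A m)"
  have fs: "continuous_map ?Y (stage_top A m) fst" "continuous_map ?Y (stage_top A m) snd"
    by (rule continuous_map_fst, rule continuous_map_snd)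
  have "continuous_map ?Y (stage_top A m) (\<lambda>y. circ (mat_alg (Suc m) A) (fst y) (snd y))"
    using fs M.quasi_circ unfolding M.qtop_iff by (auto intro: M.cont_circ)
  then show "continuous_map ?Y (stage_top A m) (\<lambda>(x, y). x \<otimes>\<^bsub>stable_group A\<^esub> y)"
  proof (rule continuous_map_eq)
    fix y assume "y \<in> topspace ?Y"
    then show "circ (mat_alg (Suc m) A) (fst y) (snd y) = (case y of (x, y) \<Rightarrow> x \<otimes>\<^bsub>stable_group A\<^esub> y)"
      using M.quasi_closed by (auto simp: stable_group_mult[of _ "Suc m"])
  qed
  have "continuous_map (stage_top A m) (stage_top A m) (\<lambda>x. M.qinv x)"
    by (rule M.cont_qinv[OF continuous_map_identity])
  then show "continuous_map (stage_top A m) (stage_top A m) (\<lambda>x. inv\<^bsub>stable_group A\<^esub> x)"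
    by (rule continuous_map_eq) (simp add: stable_group_inv)
qed

text \<open>Small matrices are contracted along rays.\<close>

lemma stable_contraction:
  "\<exists>\<O> c. openin (stage_top A m) \<O> \<and> \<one>\<^bsub>stable_group A\<^esub> \<in> \<O> \<and>
     continuous_map (prod_topology (top_of_set {0..1::real}) (subtopology (stage_top A m) \<O>)) (stage_top A m) (\<lambda>(s, a). c s a) \<and>
     (\<forall>a\<in>\<O>. c 0 a = \<one>\<^bsub>stable_group A\<^esub> \<and> c 1 a = a) \<and> (\<forall>s\<in>{0..1}. c s \<one>\<^bsub>stable_group A\<^esub> = \<one>\<^bsub>stable_group A\<^esub>) \<and>
     (\<forall>s\<in>{0..1}. \<forall>a\<in>\<O> \<inter> topspace (stage_top A 0). c s a \<in> path_component_of_set (stage_top A 0) \<one>\<^bsub>stable_group A\<^esub>)"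
proof -
  interpret M: banach_algebra "mat_alg (Suc m) A" by (rule mat_banach)
  interpret M0: banach_algebra "mat_alg (Suc 0) A" by (rule mat_banach)
  let ?one = "\<one>\<^bsub>stable_group A\<^esub>"
  define \<O> where "\<O> = {a \<in> topspace (stage_top A m). anorm (mat_alg (Suc m) A) a \<in> {..<1}}"
  define c where "c s a = ascale (mat_alg (Suc m) A) (of_real s) a" for s :: real and a
  have qc: "continuous_map (stage_top A m) (atop (mat_alg (Suc m) A)) (\<lambda>x. x)"
    using M.qtop_iff continuous_map_identity by blast
  have op: "openin (stage_top A m) \<O>" unfolding \<O>_def
    by (rule openin_continuous_map_preimage[OF M.cont_norm[OF qc]]) simp
  have \<O>: "a \<in> M.C" "anorm (mat_alg (Suc m) A) a < 1" if "a \<in> \<O>" for a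
    using that M.quasi_closed unfolding \<O>_def by auto
  have small: "anorm (mat_alg (Suc m) A) (c s a) < 1" if "a \<in> \<O>" "s \<in> {0..1}" for s a
  proof -
    have "\<bar>s\<bar> * anorm (mat_alg (Suc m) A) a \<le> 1 * anorm (mat_alg (Suc m) A) a"
      using that M.norm_nonneg[OF \<O>(1)[OF that(1)]] by (intro mult_right_mono) auto
    then show ?thesis unfolding c_def using M.norm_scale[OF \<O>(1)[OF that(1)]] \<O>(2)[OF that(1)] by simp
  qed
  have cC: "c s a \<in> M.C" if "a \<in> \<O>" for s a unfolding c_def using \<O>(1)[OF that] by simp
  have cq: "c s a \<in> quasi (mat_alg (Suc m) A)" if "a \<in> \<O>" "s \<in> {0..1}" for s a
    by (rule M.quasi_small[OF cC[OF that(1)] small[OF that]])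
  have one\<O>: "?one \<in> \<O>" unfolding \<O>_def stable_group_one[of "Suc m"] using M.quasi_zero M.norm_zero by simp
  have sc: "continuous_map Y euclidean (\<lambda>y. of_real (s y) :: 'k)" if "continuous_map Y euclideanreal s" for Y :: "'y topology" and s
    using continuous_map_compose[OF that, of euclidean "of_real :: real \<Rightarrow> 'k"] by (simp add: comp_def continuous_on_of_real)
  let ?Y = "prod_topology (top_of_set {0..1::real}) (subtopology (stage_top A m) \<O>)"
  have cont: "continuous_map ?Y (stage_top A m) (\<lambda>(s, a). c s a)"
  proof -
    have "continuous_map ?Y (atop (mat_alg (Suc m) A)) (\<lambda>y. c (fst y) (snd y))" unfolding c_def
    proof (intro M.cont_scale sc)
      show "continuous_map ?Y euclideanreal fst" by (rule continuous_map_into_fulltopology[OF continuous_map_fst])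
      show "continuous_map ?Y (atop (mat_alg (Suc m) A)) snd"
        using continuous_map_compose[OF continuous_map_snd continuous_map_from_subtopology[OF qc]] by (simp add: comp_def)
    qed
    then show ?thesis unfolding M.qtop_iff using cq by (auto simp: case_prod_unfold)
  qed
  have path: "c s a \<in> path_component_of_set (stage_top A 0) ?one" if s: "s \<in> {0..1}" and a: "a \<in> \<O>" "a \<in> topspace (stage_top A 0)" for s a
  proof -
    have a0: "a \<in> M0.C" using a(2) M0.quasi_closed by simp
    have sc0: "c r a = ascale (mat_alg (Suc 0) A) (of_real r) a" for r by (simp add: c_def banach_matI)
    have c0: "c r a \<in> M0.C" for r unfolding sc0 using a0 by simp
    have q0: "c r a \<in> quasi (mat_alg (Suc 0) A)" if "r \<in> {0..1}" for r
      using small[OF a(1) that] norm_mats[of "Suc 0" "Suc m", OF _ c0] by (intro M0.quasi_small c0) simp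
    have "continuous_map (top_of_set {0..1::real}) (stage_top A 0) (\<lambda>r. c (r * s) a)"
      unfolding M0.qtop_iff
    proof (intro conjI ballI)
      show "continuous_map (top_of_set {0..1::real}) (atop (mat_alg (Suc 0) A)) (\<lambda>r. c (r * s) a)"
        unfolding sc0 using a0 by (intro M0.cont_scale sc) (auto intro!: continuous_intros)
      show "c (r * s) a \<in> quasi (mat_alg (Suc 0) A)" if "r \<in> topspace (top_of_set {0..1})" for r
        using that s by (intro q0) (auto simp: mult_le_one)
    qed
    then have "pathin (stage_top A 0) (\<lambda>r. c (r * s) a)" by (simp add: pathin_def)
    moreover have "c (0 * s) a = ?one" unfolding sc0 stable_group_one[of "Suc 0"] using M0.scale_zero[OF a0] by simp
    ultimately show ?thesis unfolding path_component_of_def by (auto intro!: exI[of _ "\<lambda>r. c (r * s) a"])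
  qed
  have "c 0 a = ?one \<and> c 1 a = a" if "a \<in> \<O>" for a
    unfolding c_def stable_group_one[of "Suc m"] using M.scale_zero[OF \<O>(1)[OF that]] M.scale_one[OF \<O>(1)[OF that]] by simp
  moreover have "c s ?one = ?one" for s unfolding c_def stable_group_one[of "Suc m"] by (rule M.zero_scale)
  ultimately show ?thesis using op one\<O> cont path by (intro exI[of _ \<O>] exI[of _ c]) auto
qed

subsection \<open>Comparison with the general linear groups\<close>

text \<open>The map \<open>a \<mapsto> 1 + a\<close>, where \<open>1\<close> is the unit of the algebra if there is one and the adjoined unit
  otherwise.\<close>

definition to_GL :: "'a \<Rightarrow> 'a \<times> 'k" where
  "to_GL a = (if unital A then (aone A \<boxplus> a, 0) else (a, 1))"

definition from_GL :: "'a \<times> 'k \<Rightarrow> 'a" where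
  "from_GL g = (if unital A then fst g \<boxplus> neg (aone A) else fst g)"

lemma unitization_dist:
  "a \<in> C \<Longrightarrow> b \<in> C \<Longrightarrow> adist (unitization A) (a, s) (b, t) = adist A a b + norm (s - t)"
  by (simp add: adist_def unitization_def)

lemma unitization_carrier: "carrier (unitization A) = C \<times> UNIV"
  by (simp add: unitization_def)

lemma unitization_Metric: "Metric_space (C \<times> UNIV) (adist (unitization A))"
proof
  interpret M: Metric_space C "adist A" by (rule Metric)
  have off: "adist (unitization A) x y = 0" if "\<not> (fst x \<in> C \<and> fst y \<in> C)" for x y
    using that by (cases x; cases y) (auto simp: adist_def unitization_carrier)
  have on: "adist (unitization A) x y = adist A (fst x) (fst y) + norm (snd x - snd y)" if "fst x \<in> C" "fst y \<in> C" for x y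
    using unitization_dist[OF that, of "snd x" "snd y"] by simp
  show "0 \<le> adist (unitization A) x y" for x y
    by (cases "fst x \<in> C \<and> fst y \<in> C") (auto simp: on off)
  show "adist (unitization A) x y = adist (unitization A) y x" for x y
    by (cases "fst x \<in> C \<and> fst y \<in> C") (auto simp: on off M.commute norm_minus_commute)
  show "adist (unitization A) x y = 0 \<longleftrightarrow> x = y" if "x \<in> C \<times> UNIV" "y \<in> C \<times> UNIV" for x y
    using that M.nonneg[of "fst x" "fst y"] by (auto simp: on add_nonneg_eq_0_iff prod_eq_iff)
  show "adist (unitization A) x z \<le> adist (unitization A) x y + adist (unitization A) y z"
    if "x \<in> C \<times> UNIV" "y \<in> C \<times> UNIV" "z \<in> C \<times> UNIV" for x y z
    using that M.triangle[of "fst x" "fst y" "fst z"] norm_triangle_ineq[of "snd x - snd y" "snd y - snd z"] by (auto simp: on)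
qed

lemma unitization_slice:
  assumes g: "\<And>y. y \<in> topspace Y \<Longrightarrow> g y \<in> C"
  shows "continuous_map Y (atop (unitization A)) (\<lambda>y. (g y, s)) \<longleftrightarrow> continuous_map Y (atop A) g"
proof -
  interpret M: Metric_space C "adist A" by (rule Metric)
  interpret U: Metric_space "C \<times> UNIV" "adist (unitization A)" by (rule unitization_Metric)
  have "(g w, s) \<in> U.mball (g y, s) e \<longleftrightarrow> g w \<in> M.mball (g y) e" if "w \<in> topspace Y" "y \<in> topspace Y" for w y e
    using g[OF that(1)] g[OF that(2)] by (auto simp: unitization_dist)
  then have "(\<forall>w\<in>V. (g w, s) \<in> U.mball (g y, s) e) \<longleftrightarrow> (\<forall>w\<in>V. g w \<in> M.mball (g y) e)" if "openin Y V" "y \<in> topspace Y" for V y e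
    using openin_subset[OF that(1)] that(2) by blast
  then show ?thesis
    unfolding atop_def unitization_carrier U.continuous_map_to_metric M.continuous_map_to_metric by (metis (no_types, lifting))
qed

lemma aone_unit: "unital A \<Longrightarrow> is_unit_of A (aone A)"
proof -
  assume "unital A"
  then obtain e where e: "is_unit_of A e" unfolding unital_def by blast
  have "f = e" if "is_unit_of A f" for f using e that unfolding is_unit_of_def by metis
  then show ?thesis unfolding aone_def using e by (metis theI)
qed

lemma aone_eq: "is_unit_of A e \<Longrightarrow> aone A = e"
  using aone_unit[unfolded unital_def] unfolding is_unit_of_def by metis

lemma unitization_one: "aone (unitization A) = (Z, 1)"
proof -
  have u: "is_unit_of (unitization A) (Z, 1)"
    unfolding is_unit_of_def unitization_def by (auto simp: zero_mult mult_zero scale_one zero_scale zero_add add_zero)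
  have "f = (Z, 1)" if "is_unit_of (unitization A) f" for f
  proof -
    have "amult (unitization A) f (Z, 1) = (Z, 1)" "amult (unitization A) f (Z, 1) = f"
      using that u unfolding is_unit_of_def by metis+
    then show ?thesis by simp
  qed
  then show ?thesis unfolding aone_def using u by (metis the_equality)
qed

lemma unit_circ:
  assumes e: "is_unit_of A e" and ab: "a \<in> C" "b \<in> C"
  shows "(e \<boxplus> a) \<boxdot> (e \<boxplus> b) = e \<boxplus> (a \<circ>\<^sub>q b)"
  using assms unfolding is_unit_of_def circ_def by (auto simp: mult_add_left mult_add_right add_ac')

lemma to_GL_mem: assumes a: "a \<in> quasi A" shows "to_GL a \<in> GL_set A"
proof -
  note aC = quasi_closed[OF a] and q = qinv[OF a] and bC = quasi_closed[OF qinv(1)[OF a]]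
  show ?thesis
  proof (cases "unital A")
    case True
    note u = aone_unit[OF True]
    then have e: "aone A \<in> C" unfolding is_unit_of_def by blast
    have "aone A \<boxplus> a \<in> ainvertible A" unfolding ainvertible_def
      using unit_circ[OF u aC bC] unit_circ[OF u bC aC] q e aC bC by (auto simp: add_zero intro!: bexI[of _ "aone A \<boxplus> qinv a"])
    then show ?thesis using True by (simp add: to_GL_def GL_set_def)
  next
    case False
    have "amult (unitization A) (x, 1) (y, 1) = (x \<circ>\<^sub>q y, 1)" if "x \<in> C" "y \<in> C" for x y
      using that by (simp add: unitization_def scale_one circ_def add_ac')
    then have "amult (unitization A) (a, 1) (qinv a, 1) = (Z, 1)" "amult (unitization A) (qinv a, 1) (a, 1) = (Z, 1)"
      using q aC bC by simp_all
    then have "(a, 1) \<in> ainvertible (unitization A)" unfolding ainvertible_def unitization_one unitization_carrier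
      using aC bC by blast
    then show ?thesis using False by (simp add: to_GL_def GL_set_def)
  qed
qed

lemma from_GL_mem: assumes g: "g \<in> GL_set A" shows "from_GL g \<in> quasi A" "to_GL (from_GL g) = g"
proof -
  have "from_GL g \<in> quasi A \<and> to_GL (from_GL g) = g"
  proof (cases "unital A")
    case True
    note u = aone_unit[OF True]
    then have e: "aone A \<in> C" unfolding is_unit_of_def by blast
    obtain x y where x: "g = (x, 0)" "x \<in> C" "y \<in> C" "x \<boxdot> y = aone A" "y \<boxdot> x = aone A"
      using g True unfolding GL_set_def ainvertible_def by auto
    let ?a = "x \<boxplus> neg (aone A)" and ?b = "y \<boxplus> neg (aone A)"
    have ab: "?a \<in> C" "?b \<in> C" "aone A \<boxplus> ?a = x" "aone A \<boxplus> ?b = y" using x e by (auto simp: add_left_commute add_minus add_zero)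
    have "aone A \<boxplus> (?a \<circ>\<^sub>q ?b) = aone A \<boxplus> Z" "aone A \<boxplus> (?b \<circ>\<^sub>q ?a) = aone A \<boxplus> Z"
      using unit_circ[OF u ab(1,2)] unit_circ[OF u ab(2,1)] ab x e by (simp_all add: add_zero)
    then have "?a \<circ>\<^sub>q ?b = Z" "?b \<circ>\<^sub>q ?a = Z" using add_cancel e ab by (metis circ_closed zero_closed)+
    then have "?a \<in> quasi A" unfolding quasi_def using ab by blast
    then show ?thesis using True x ab by (simp add: from_GL_def to_GL_def)
  next
    case False
    obtain x y t where x: "g = (x, 1)" "x \<in> C" "y \<in> C" "amult (unitization A) (x, 1) (y, t) = (Z, 1)" "amult (unitization A) (y, t) (x, 1) = (Z, 1)"
      using g False unfolding GL_set_def ainvertible_def unitization_one by (auto simp: unitization_carrier)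
    then have "t = 1" by (simp add: unitization_def)
    then have "x \<circ>\<^sub>q y = Z" "y \<circ>\<^sub>q x = Z" using x by (auto simp: unitization_def circ_def scale_one add_ac')
    then have "x \<in> quasi A" unfolding quasi_def using x by blast
    then show ?thesis using False x by (simp add: from_GL_def to_GL_def)
  qed
  then show "from_GL g \<in> quasi A" "to_GL (from_GL g) = g" by auto
qed

lemma from_to_GL: "a \<in> quasi A \<Longrightarrow> from_GL (to_GL a) = a"
proof -
  assume a: "a \<in> quasi A"
  note aC = quasi_closed[OF a]
  show ?thesis
  proof (cases "unital A")
    case True
    then have e: "aone A \<in> C" using aone_unit[OF True] unfolding is_unit_of_def by blast
    have "aone A \<boxplus> a \<boxplus> neg (aone A) = a \<boxplus> (aone A \<boxplus> neg (aone A))" using e aC by (simp add: add_ac')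
    then show ?thesis using True e aC by (simp add: from_GL_def to_GL_def add_minus add_zero)
  qed (simp add: from_GL_def to_GL_def)
qed

lemma topspace_GL: "topspace (GL A) = GL_set A"
proof -
  interpret U: Metric_space "C \<times> UNIV" "adist (unitization A)" by (rule unitization_Metric)
  have "GL_set A \<subseteq> C \<times> UNIV" unfolding GL_set_def ainvertible_def unitization_carrier by auto
  then show ?thesis unfolding GL_def atop_def unitization_carrier by auto
qed

theorem GL_homeomorphic: "homeomorphic_map (qtop A) (GL A) to_GL" "to_GL Z = GL_one A"
proof -
  have one: "unital A \<Longrightarrow> aone A \<in> C" using aone_unit unfolding is_unit_of_def by blast
  have qc: "continuous_map (qtop A) (atop A) (\<lambda>x. x)" using qtop_iff continuous_map_identity by blast
  have to: "continuous_map (qtop A) (GL A) to_GL"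
    unfolding GL_def continuous_map_in_subtopology
  proof (intro conjI)
    show "continuous_map (qtop A) (atop (unitization A)) to_GL"
    proof (cases "unital A")
      case True
      have "continuous_map (qtop A) (atop (unitization A)) (\<lambda>a. (aone A \<boxplus> a, 0))"
        using one[OF True] quasi_closed by (subst unitization_slice) (auto intro!: cont_add qc)
      then show ?thesis using True by (simp add: to_GL_def[abs_def])
    next
      case False
      have "continuous_map (qtop A) (atop (unitization A)) (\<lambda>a. (a, 1))"
        using quasi_closed by (subst unitization_slice) (auto intro!: qc)
      then show ?thesis using False by (simp add: to_GL_def[abs_def])
    qed
    show "to_GL \<in> topspace (qtop A) \<rightarrow> GL_set A" using to_GL_mem by auto
  qed
  have "continuous_map (GL A) (qtop A) from_GL"
    unfolding qtop_iff
  proof (intro conjI ballI)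
    define s :: 'k where "s = (if unital A then 0 else 1)"
    have snd: "snd g = s" "fst g \<in> C" if "g \<in> topspace (GL A)" for g
      using that unfolding topspace_GL GL_set_def ainvertible_def unitization_carrier s_def by (auto split: if_splits)
    have "continuous_map (GL A) (atop (unitization A)) (\<lambda>g. g)"
      unfolding GL_def by (rule continuous_map_from_subtopology[OF continuous_map_identity])
    then have "continuous_map (GL A) (atop (unitization A)) (\<lambda>g. (fst g, s))"
      by (rule continuous_map_eq) (simp add: prod_eq_iff snd)
    then have f: "continuous_map (GL A) (atop A) fst" using unitization_slice[of "GL A" fst s] snd(2) by blast
    show "continuous_map (GL A) (atop A) from_GL"
    proof (cases "unital A")
      case True
      then show ?thesis using one by (auto simp: from_GL_def[abs_def] intro!: cont_add f)
    next
      case False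
      then show ?thesis using f by (simp add: from_GL_def[abs_def])
    qed
    show "from_GL g \<in> quasi A" if "g \<in> topspace (GL A)" for g using from_GL_mem that topspace_GL by blast
  qed
  then have "homeomorphic_maps (qtop A) (GL A) to_GL from_GL"
    unfolding homeomorphic_maps_def topspace_qtop topspace_GL using to from_to_GL from_GL_mem by blast
  then show "homeomorphic_map (qtop A) (GL A) to_GL" using homeomorphic_map_maps by blast
  show "to_GL Z = GL_one A" using one by (simp add: to_GL_def GL_one_def add_zero)
qed

end

text \<open>Whether the general linear group of a matrix algebra is formed inside the algebra or in its unitization is
  decided in the same way as for the algebra of the entries: the corner entry of a unit is a unit.\<close>

lemma mat_unital_iff:
  assumes "banach_algebra A"
  shows "unital (mat_alg (Suc m) A) \<longleftrightarrow> unital A"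
    and "unital A \<Longrightarrow> aone (mat_alg (Suc m) A) = (\<lambda>i j. if i = j \<and> i < Suc m then aone A else azero A)"
proof -
  interpret banach_algebra A by (rule assms)
  interpret M: banach_algebra "mat_alg (Suc m) A" by (rule mat_banach)
  let ?n = "Suc m"
  have unit: "is_unit_of (mat_alg ?n A) (\<lambda>i j. if i = j \<and> i < ?n then aone A else Z)" if un: "unital A"
  proof -
    have e: "aone A \<in> C" "\<And>x. x \<in> C \<Longrightarrow> aone A \<boxdot> x = x \<and> x \<boxdot> aone A = x"
      using aone_unit[OF un] unfolding is_unit_of_def by auto
    let ?I = "\<lambda>i j. if i = j \<and> i < ?n then aone A else Z"
    have single: "asum A f n = (if k < n then f k else Z)" if "\<And>i. f i \<in> C" "\<And>i. i \<noteq> k \<Longrightarrow> f i = Z" for f k n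
    proof (induction n)
      case (Suc n)
      then show ?case using that by (cases "k < n"; cases "k = n") (auto simp: add_zero zero_add)
    qed simp
    have "?I \<in> mats ?n" using e by (intro matsI) auto
    moreover have "amult (mat_alg ?n A) ?I M = M \<and> amult (mat_alg ?n A) M ?I = M" if M: "M \<in> mats ?n" for M
    proof -
      note MC = mats_entry[OF M] and MO = mats_out[OF M]
      have "asum A (\<lambda>k. ?I i k \<boxdot> M k j) ?n = M i j" for i j
        using single[of "\<lambda>k. ?I i k \<boxdot> M k j" i ?n] e MC MO[of i j] by (auto simp: zero_mult)
      moreover have "asum A (\<lambda>k. M i k \<boxdot> ?I k j) ?n = M i j" for i j
        using single[of "\<lambda>k. M i k \<boxdot> ?I k j" j ?n] e MC MO[of i j] by (auto simp: mult_zero)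
      ultimately show ?thesis by (simp add: banach_matI(4))
    qed
    ultimately show ?thesis unfolding is_unit_of_def by blast
  qed
  show "unital A \<Longrightarrow> aone (mat_alg ?n A) = (\<lambda>i j. if i = j \<and> i < ?n then aone A else azero A)"
    using M.aone_eq[OF unit] .
  have "unital A" if "unital (mat_alg ?n A)"
  proof -
    obtain e where e: "e \<in> mats ?n" "\<And>M. M \<in> mats ?n \<Longrightarrow> amult (mat_alg ?n A) e M = M \<and> amult (mat_alg ?n A) M e = M"
      using \<open>unital (mat_alg ?n A)\<close> unfolding unital_def is_unit_of_def by blast
    note eC = mats_entry[OF e(1)]
    have tail: "asum A f (Suc n) = f 0" if "\<And>i. f i \<in> C" "\<And>i. i > 0 \<Longrightarrow> f i = Z" for f n
      by (induction n) (use that in \<open>auto simp: zero_add add_zero\<close>)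
    have "e 0 0 \<boxdot> x = x \<and> x \<boxdot> e 0 0 = x" if x: "x \<in> C" for x
    proof -
      let ?M = "\<lambda>i j. if i = (0::nat) \<and> j = (0::nat) then x else Z"
      have M: "?M \<in> mats ?n" using x by (intro matsI) auto
      have 1: "asum A (\<lambda>k. e 0 k \<boxdot> ?M k 0) ?n = ?M 0 0" "asum A (\<lambda>k. ?M 0 k \<boxdot> e k 0) ?n = ?M 0 0"
        using fun_cong[OF fun_cong[OF conjunct1[OF e(2)[OF M]]], of 0 0] fun_cong[OF fun_cong[OF conjunct2[OF e(2)[OF M]]], of 0 0]
        unfolding banach_matI(4) by (simp_all del: asum_Suc)
      have "asum A (\<lambda>k. e 0 k \<boxdot> ?M k 0) ?n = e 0 0 \<boxdot> ?M 0 0"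
        by (rule tail[of "\<lambda>k. e 0 k \<boxdot> ?M k 0" m]) (use eC x in \<open>auto simp: mult_zero\<close>)
      moreover have "asum A (\<lambda>k. ?M 0 k \<boxdot> e k 0) ?n = ?M 0 0 \<boxdot> e 0 0"
        by (rule tail[of "\<lambda>k. ?M 0 k \<boxdot> e k 0" m]) (use eC x in \<open>auto simp: zero_mult\<close>)
      ultimately show ?thesis using 1 by simp
    qed
    then show ?thesis unfolding unital_def is_unit_of_def using eC by blast
  qed
  then show "unital (mat_alg ?n A) \<longleftrightarrow> unital A" using unit unfolding unital_def by blast
qed

context banach_algebra begin

abbreviation mat_to_GL :: "nat \<Rightarrow> (nat \<Rightarrow> nat \<Rightarrow> 'a) \<Rightarrow> (nat \<Rightarrow> nat \<Rightarrow> 'a) \<times> 'k" where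
  "mat_to_GL m \<equiv> banach_algebra.to_GL (mat_alg (Suc m) A)"

lemma mat_to_GL_eq:
  "a \<in> mats (Suc m) \<Longrightarrow> mat_to_GL m a =
     (if unital A then (\<lambda>i j. (if i = j \<and> i < Suc m then aone A else Z) \<boxplus> a i j, 0) else (a, 1))"
proof -
  interpret M: banach_algebra "mat_alg (Suc m) A" by (rule mat_banach)
  show "mat_to_GL m a = (if unital A then (\<lambda>i j. (if i = j \<and> i < Suc m then aone A else Z) \<boxplus> a i j, 0) else (a, 1))"
    unfolding M.to_GL_def using mat_unital_iff[OF banach_algebra_axioms, of m] by (simp add: banach_matI(3))
qed

lemma stage_zero_homeomorphic: "homeomorphic_map (stage_top A 0) (qtop A) (\<lambda>a. a 0 0)"
proof -
  interpret M: banach_algebra "mat_alg (Suc 0) A" by (rule mat_banach)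
  let ?e = "\<lambda>x i j. if i = (0::nat) \<and> j = (0::nat) then x else Z"
  have em: "?e x \<in> mats (Suc 0)" if "x \<in> C" for x using that by (intro matsI) auto
  have ee: "?e (a 0 0) = a" if "a \<in> mats (Suc 0)" for a using mats_out[OF that] by (intro ext) auto
  have circ0: "circ (mat_alg (Suc 0) A) a b 0 0 = a 0 0 \<circ>\<^sub>q b 0 0" if "a \<in> mats (Suc 0)" "b \<in> mats (Suc 0)" for a b
    using mats_entry[OF that(1)] mats_entry[OF that(2)] by (simp add: circ_def banach_matI zero_add)
  have circe: "circ (mat_alg (Suc 0) A) (?e x) (?e y) = ?e (x \<circ>\<^sub>q y)" if "x \<in> C" "y \<in> C" for x y
  proof -
    have "circ (mat_alg (Suc 0) A) (?e x) (?e y) = ?e (circ (mat_alg (Suc 0) A) (?e x) (?e y) 0 0)"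
      by (rule ee[OF M.circ_closed[OF em[OF that(1)] em[OF that(2)]], symmetric])
    also have "circ (mat_alg (Suc 0) A) (?e x) (?e y) 0 0 = x \<circ>\<^sub>q y"
      using circ0[OF em[OF that(1)] em[OF that(2)]] by simp
    finally show ?thesis .
  qed
  have zz: "azero (mat_alg (Suc 0) A) = ?e Z" by (simp add: banach_matI)
  have q1: "a 0 0 \<in> quasi A" if a: "a \<in> quasi (mat_alg (Suc 0) A)" for a
  proof -
    note q = M.qinv[OF a] and aC = M.quasi_closed[OF a] and bC = M.quasi_closed[OF M.qinv(1)[OF a]]
    have "a 0 0 \<circ>\<^sub>q M.qinv a 0 0 = Z" "M.qinv a 0 0 \<circ>\<^sub>q a 0 0 = Z"
      using circ0[OF aC bC] circ0[OF bC aC] q by (simp_all add: banach_matI)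
    then show ?thesis unfolding quasi_def using mats_entry[OF aC] mats_entry[OF bC] by blast
  qed
  have q2: "?e x \<in> quasi (mat_alg (Suc 0) A)" if x: "x \<in> quasi A" for x
  proof -
    note q = qinv[OF x] and xC = quasi_closed[OF x] and bC = quasi_closed[OF qinv(1)[OF x]]
    have "circ (mat_alg (Suc 0) A) (?e x) (?e (qinv x)) = azero (mat_alg (Suc 0) A)"
      "circ (mat_alg (Suc 0) A) (?e (qinv x)) (?e x) = azero (mat_alg (Suc 0) A)"
      unfolding zz using circe[OF xC bC] circe[OF bC xC] q by (simp_all add: fun_eq_iff)
    then show ?thesis unfolding quasi_def using em[OF xC] em[OF bC] by blast
  qed
  have "continuous_map (stage_top A 0) (qtop A) (\<lambda>a. a 0 0)"
    unfolding qtop_iff using stage_cont_iff[of "stage_top A 0" 0 "\<lambda>a. a"] continuous_map_identity[of "stage_top A 0"] q1 by simp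
  moreover have "continuous_map (qtop A) (stage_top A 0) ?e"
    unfolding stage_cont_iff
  proof (intro conjI ballI allI)
    show "?e x \<in> quasi (mat_alg (Suc 0) A)" if "x \<in> topspace (qtop A)" for x using q2 that by simp
    have qc: "continuous_map (qtop A) (atop A) (\<lambda>x. x)" using qtop_iff continuous_map_identity by blast
    show "continuous_map (qtop A) (atop A) (\<lambda>x. ?e x i j)" for i j
      by (cases "i = 0 \<and> j = 0") (use qc in auto)
  qed
  ultimately have "homeomorphic_maps (stage_top A 0) (qtop A) (\<lambda>a. a 0 0) ?e"
    unfolding homeomorphic_maps_def using ee M.quasi_closed by auto
  then show ?thesis using homeomorphic_map_maps by blast
qed

interpretation SG: filtered_group "stable_group A" "stage_top A" by (rule stable_filtered_group)

text \<open>In quasi-invertible coordinates the corner embeddings are inclusions. In the unital case this is so because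
  the diagonal ones that are added have the coordinate \<open>0\<close>.\<close>

lemma GL_stage_models: "stage_models (stable_group A) (stage_top A)
   (\<lambda>m. GL (mat_alg (Suc m) A)) (\<lambda>m. GL_one (mat_alg (Suc m) A)) mat_to_GL (\<lambda>m l. corner A (Suc m) (Suc l))
   (GL A) (GL_one A) (\<lambda>a. to_GL (a 0 0)) (mat_one_one A)"
proof (intro stage_models.intro stage_models_axioms.intro stable_filtered_group)
  fix m
  interpret M: banach_algebra "mat_alg (Suc m) A" by (rule mat_banach)
  show "SG.is_model m (GL (mat_alg (Suc m) A)) (GL_one (mat_alg (Suc m) A)) (mat_to_GL m)"
    unfolding SG.is_model_def using M.GL_homeomorphic stable_group_one[of "Suc m"] by simp
  show "corner A (Suc m) (Suc l) (mat_to_GL m a) = mat_to_GL l a" if "m \<le> l" "a \<in> topspace (stage_top A m)" for l a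
  proof -
    have a: "a \<in> mats (Suc m)" "a \<in> mats (Suc l)" using that M.quasi_closed mats_mono[of "Suc m" "Suc l"] by auto
    have one: "unital A \<Longrightarrow> aone A \<in> C" using aone_unit unfolding is_unit_of_def by blast
    show ?thesis unfolding mat_to_GL_eq[OF a(1)] mat_to_GL_eq[OF a(2)] corner_def
      using mats_out[OF a(1)] one that(1) by (auto simp: fun_eq_iff add_zero)
  qed
next
  interpret M: banach_algebra "mat_alg (Suc 0) A" by (rule mat_banach)
  show "SG.is_model 0 (GL A) (GL_one A) (\<lambda>a. to_GL (a 0 0))"
    unfolding SG.is_model_def
    using homeomorphic_map_compose[OF stage_zero_homeomorphic GL_homeomorphic(1)] GL_homeomorphic(2)
    by (simp add: comp_def stable_group_def)
  fix a assume "a \<in> topspace (stage_top A 0)"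
  then have a: "a \<in> mats (Suc 0)" using M.quasi_closed by simp
  have one: "unital A \<Longrightarrow> aone A \<in> C" using aone_unit unfolding is_unit_of_def by blast
  show "mat_one_one A (to_GL (a 0 0)) = mat_to_GL 0 a"
    unfolding mat_to_GL_eq[OF a] mat_one_one_def to_GL_def
    using mats_out[OF a] one by (auto simp: fun_eq_iff add_zero)
qed

interpretation ST: stage_models "stable_group A" "stage_top A"
   "\<lambda>m. GL (mat_alg (Suc m) A)" "\<lambda>m. GL_one (mat_alg (Suc m) A)" mat_to_GL "\<lambda>m l. corner A (Suc m) (Suc l)"
   "GL A" "GL_one A" "\<lambda>a. to_GL (a 0 0)" "mat_one_one A"
  by (rule GL_stage_models)

lemma K_group_eq: "K_group (n + 1) A = ST.colim n"
proof -
  have "GL_stage n A = ST.stg n" "GL_trans n A = ST.trn n"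
    by (simp_all add: fun_eq_iff GL_stage_def ST.stg_def GL_trans_def ST.trn_def)
  then show ?thesis by (simp add: K_group_def ST.colim_def)
qed

lemma natural_map_eq: assumes n: "n > 0" shows "natural_map n A = ST.nat_map n"
proof -
  have st: "GL_stage n A = ST.stg n" "GL_trans n A = ST.trn n"
    by (simp_all add: fun_eq_iff GL_stage_def ST.stg_def GL_trans_def ST.trn_def)
  have "GLo_stage n A = GL_stage n A" "GLo_trans n A = GL_trans n A"
    by (simp_all add: fun_eq_iff GLo_stage_def GL_stage_def GLo_trans_def GL_trans_def GLo_def
        homotopy_group_path_component[OF n] homotopy_map_path_component[OF n])
  then show ?thesis
    unfolding natural_map_def stable_GLo_to_K_def to_stable_GLo_def ST.nat_map_def[abs_def] comp_def st GLo_def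
      homotopy_map_path_component[OF n] by simp
qed

lemma pi_GLo_eq: "n > 0 \<Longrightarrow> homotopy_group n (GLo A) (GL_one A) = homotopy_group n (GL A) (GL_one A)"
  unfolding GLo_def by (rule homotopy_group_path_component)

theorem bott_stable_iff: "bott_stable A \<longleftrightarrow> SG.stable {1}"
proof -
  have "natural_map n A \<in> iso (homotopy_group n (GLo A) (GL_one A)) (K_group (n + 1) A) \<longleftrightarrow>
     (\<forall>x\<in>carrier (homotopy_group n (GL A) (GL_one A)). ST.nat_map n x = \<one>\<^bsub>ST.colim n\<^esub> \<longrightarrow>
        (\<exists>N\<in>{1}. x [^]\<^bsub>homotopy_group n (GL A) (GL_one A)\<^esub> (N::nat) = \<one>\<^bsub>homotopy_group n (GL A) (GL_one A)\<^esub>)) \<and>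
     (\<forall>y\<in>carrier (ST.colim n). \<exists>N\<in>{1}. \<exists>x\<in>carrier (homotopy_group n (GL A) (GL_one A)). y [^]\<^bsub>ST.colim n\<^esub> (N::nat) = ST.nat_map n x)"
    if n: "n > 0" for n
  proof -
    let ?P = "homotopy_group n (GL A) (GL_one A)"
    interpret P: comm_group ?P by (rule SG.model_comm_group[OF ST.modelX n])
    interpret K: comm_group "ST.colim n" by (rule ST.colim_comm_group[OF n])
    have hom: "ST.nat_map n \<in> hom ?P (ST.colim n)" by (rule ST.nat_map_hom[OF n])
    have inj: "inj_on (ST.nat_map n) (carrier ?P) \<longleftrightarrow> (\<forall>x. x \<in> carrier ?P \<longrightarrow> ST.nat_map n x = \<one>\<^bsub>ST.colim n\<^esub> \<longrightarrow> x = \<one>\<^bsub>?P\<^esub>)"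
      by (rule inj_on_one_iff'[OF hom P.is_group K.is_group])
    have surj: "ST.nat_map n ` carrier ?P = carrier (ST.colim n) \<longleftrightarrow> (\<forall>y\<in>carrier (ST.colim n). \<exists>x\<in>carrier ?P. y = ST.nat_map n x)"
      using hom_carrier[OF hom] by blast
    have p1: "x [^]\<^bsub>?P\<^esub> (1::nat) = x" if "x \<in> carrier ?P" for x using that by simp
    have p2: "x [^]\<^bsub>ST.colim n\<^esub> (1::nat) = x" if "x \<in> carrier (ST.colim n)" for x using that by simp
    show ?thesis
      unfolding natural_map_eq[OF n] K_group_eq pi_GLo_eq[OF n] iso_def bij_betw_def mem_Collect_eq inj surj
      using hom p1 p2 by (simp cong: ball_cong del: One_nat_def) blast
  qed
  then show ?thesis unfolding bott_stable_def ST.stable_iff by simp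
qed

theorem rationally_bott_stable_iff: "rationally_bott_stable A \<longleftrightarrow> SG.stable {0<..}"
proof -
  have "tensor_rat_map (K_group (n + 1) A) (natural_map n A)
        \<in> iso (tensor_rat (homotopy_group n (GLo A) (GL_one A))) (tensor_rat (K_group (n + 1) A)) \<longleftrightarrow>
     (\<forall>x\<in>carrier (homotopy_group n (GL A) (GL_one A)). ST.nat_map n x = \<one>\<^bsub>ST.colim n\<^esub> \<longrightarrow>
        (\<exists>N\<in>{0<..}. x [^]\<^bsub>homotopy_group n (GL A) (GL_one A)\<^esub> (N::nat) = \<one>\<^bsub>homotopy_group n (GL A) (GL_one A)\<^esub>)) \<and>
     (\<forall>y\<in>carrier (ST.colim n). \<exists>N\<in>{0<..}. \<exists>x\<in>carrier (homotopy_group n (GL A) (GL_one A)). y [^]\<^bsub>ST.colim n\<^esub> (N::nat) = ST.nat_map n x)"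
    if n: "n > 0" for n
    unfolding natural_map_eq[OF n] K_group_eq pi_GLo_eq[OF n]
    by (rule tensor_rat_map_iso_iff[OF SG.model_comm_group[OF ST.modelX n] ST.colim_comm_group[OF n] ST.nat_map_hom[OF n]])
  then show ?thesis unfolding rationally_bott_stable_def ST.stable_iff by simp
qed

end

section \<open>Algebra homomorphisms on matrices\<close>

text \<open>Homomorphisms are applied to the entries of matrices. This is used for the automorphisms of the fibre and
  for the evaluation of sections at a point of the principal bundle.\<close>

definition mmap :: "('a \<Rightarrow> 'b) \<Rightarrow> (nat \<Rightarrow> nat \<Rightarrow> 'a) \<Rightarrow> nat \<Rightarrow> nat \<Rightarrow> 'b" where
  "mmap \<phi> M = (\<lambda>i j. \<phi> (M i j))"

locale algebra_hom = dom: banach_algebra A + cod: banach_algebra B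
  for A :: "('k::real_or_complex, 'a) normed_alg" and B :: "('k, 'b) normed_alg" +
  fixes \<phi> :: "'a \<Rightarrow> 'b"
  assumes hom_closed: "x \<in> carrier A \<Longrightarrow> \<phi> x \<in> carrier B"
    and hom_add: "x \<in> carrier A \<Longrightarrow> y \<in> carrier A \<Longrightarrow> \<phi> (aadd A x y) = aadd B (\<phi> x) (\<phi> y)"
    and hom_mult: "x \<in> carrier A \<Longrightarrow> y \<in> carrier A \<Longrightarrow> \<phi> (amult A x y) = amult B (\<phi> x) (\<phi> y)"
    and hom_zero: "\<phi> (azero A) = azero B"
begin

lemma hom_asum: "(\<And>i. i < n \<Longrightarrow> f i \<in> carrier A) \<Longrightarrow> \<phi> (asum A f n) = asum B (\<lambda>i. \<phi> (f i)) n"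
  by (induction n) (simp_all add: hom_zero hom_add dom.asum_closed)

lemma mmap_mats: "M \<in> carrier (mat_alg n A) \<Longrightarrow> mmap \<phi> M \<in> carrier (mat_alg n B)"
  unfolding mmap_def by (intro cod.matsI) (simp_all add: hom_closed dom.mats_entry hom_zero dom.mats_out)

lemma mmap_zero: "mmap \<phi> (azero (mat_alg n A)) = azero (mat_alg n B)"
  by (simp add: mmap_def banach_matI hom_zero)

lemma mmap_circ:
  assumes M: "M \<in> carrier (mat_alg n A)" and N: "N \<in> carrier (mat_alg n A)"
  shows "mmap \<phi> (circ (mat_alg n A) M N) = circ (mat_alg n B) (mmap \<phi> M) (mmap \<phi> N)"
proof -
  note c = dom.mats_entry[OF M] dom.mats_entry[OF N] dom.mat_mult_entry_closed[OF M N]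
  show ?thesis
    by (simp add: circ_def mmap_def banach_matI  hom_add c hom_asum hom_mult fun_eq_iff)
qed

lemma mmap_quasi:
  assumes "M \<in> quasi (mat_alg n A)"
  shows "mmap \<phi> M \<in> quasi (mat_alg n B)"
proof -
  obtain N where N: "M \<in> carrier (mat_alg n A)" "N \<in> carrier (mat_alg n A)"
    "circ (mat_alg n A) M N = azero (mat_alg n A)" "circ (mat_alg n A) N M = azero (mat_alg n A)"
    using assms unfolding quasi_def by blast
  then show ?thesis
    unfolding quasi_def using mmap_circ[OF N(1,2)] mmap_circ[OF N(2,1)] mmap_mats mmap_zero by auto
qed

lemma mmap_carrier: "M \<in> carrier (stable_group A) \<Longrightarrow> mmap \<phi> M \<in> carrier (stable_group B)"
  unfolding dom.stable_group_carrier cod.stable_group_carrier using mmap_quasi by blast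

lemma mmap_one: "mmap \<phi> \<one>\<^bsub>stable_group A\<^esub> = \<one>\<^bsub>stable_group B\<^esub>"
  using mmap_zero[of 0] dom.stable_group_one[of 0] cod.stable_group_one[of 0] by simp

lemma mmap_mult:
  assumes "M \<in> carrier (stable_group A)" "N \<in> carrier (stable_group A)"
  shows "mmap \<phi> (M \<otimes>\<^bsub>stable_group A\<^esub> N) = mmap \<phi> M \<otimes>\<^bsub>stable_group B\<^esub> mmap \<phi> N"
proof -
  obtain m where m: "M \<in> quasi (mat_alg (Suc m) A)" "N \<in> quasi (mat_alg (Suc m) A)"
    using dom.stable_group_common[OF assms(1,2,1)] .
  then have M: "M \<in> carrier (mat_alg (Suc m) A)" and N: "N \<in> carrier (mat_alg (Suc m) A)"
    using dom.quasi_mats_sub by auto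
  show ?thesis
    using dom.stable_group_mult[OF M N] cod.stable_group_mult[OF mmap_mats[OF M] mmap_mats[OF N]] mmap_circ[OF M N] by simp
qed

lemma mmap_pow:
  assumes M: "M \<in> carrier (stable_group A)"
  shows "mmap \<phi> (M [^]\<^bsub>stable_group A\<^esub> (N::nat)) = mmap \<phi> M [^]\<^bsub>stable_group B\<^esub> N"
proof -
  interpret GA: group "stable_group A" by (rule dom.stable_group_group)
  interpret GB: group "stable_group B" by (rule cod.stable_group_group)
  show ?thesis using M by (induction N) (simp_all add: mmap_one mmap_mult)
qed

end

section \<open>Bundles of algebras\<close>

lemma topspace_quotient_topology: "topspace (quotient_topology T q) = q ` topspace T"
proof (intro subset_antisym)
  show "topspace (quotient_topology T q) \<subseteq> q ` topspace T"
    using openin_topspace[of "quotient_topology T q"] unfolding openin_quotient_topology by blast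
  have "{x \<in> topspace T. q x \<in> q ` topspace T} = topspace T" by blast
  then have "openin (quotient_topology T q) (q ` topspace T)" unfolding openin_quotient_topology by simp
  then show "q ` topspace T \<subseteq> topspace (quotient_topology T q)" by (rule openin_subset)
qed

lemma continuous_map_locally:
  assumes "\<And>y. y \<in> topspace Y \<Longrightarrow> \<exists>V. openin Y V \<and> y \<in> V \<and> continuous_map (subtopology Y V) Z f"
  shows "continuous_map Y Z f"
proof (rule pasting_lemma[where I = "{V. openin Y V \<and> continuous_map (subtopology Y V) Z f}" and T = id and f = "\<lambda>V. f"])
  show "\<exists>j. j \<in> {V. openin Y V \<and> continuous_map (subtopology Y V) Z f} \<and> x \<in> id j \<and> f x = f x"
    if "x \<in> topspace Y" for x using assms[OF that] by auto
qed auto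

locale algebra_bundle = principal \<xi> + fib: banach_algebra B
  for \<xi> :: "('g, 'x, 'p) pbundle" and B :: "('k::real_or_complex, 'b) normed_alg" +
  fixes \<alpha> :: "'g \<Rightarrow> 'b \<Rightarrow> 'b"
  assumes action: "algebra_action (sgrp \<xi>) (sgtop \<xi>) B \<alpha>"
begin

abbreviation "P \<equiv> topspace (total \<xi>)"

lemma \<alpha>_cont: "continuous_map (prod_topology (sgtop \<xi>) (atop B)) (atop B) (\<lambda>(g, b). \<alpha> g b)"
  and \<alpha>_one: "b \<in> carrier B \<Longrightarrow> \<alpha> \<one>\<^bsub>\<G>\<^esub> b = b"
  and \<alpha>_mult: "g \<in> carrier \<G> \<Longrightarrow> h \<in> carrier \<G> \<Longrightarrow> b \<in> carrier B \<Longrightarrow> \<alpha> (g \<otimes>\<^bsub>\<G>\<^esub> h) b = \<alpha> g (\<alpha> h b)"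
  using action unfolding algebra_action_def by blast+

lemma cm_\<alpha>:
  assumes "continuous_map Y (sgtop \<xi>) g" "continuous_map Y (atop B) b"
  shows "continuous_map Y (atop B) (\<lambda>y. \<alpha> (g y) (b y))"
proof -
  have "continuous_map Y (prod_topology (sgtop \<xi>) (atop B)) (\<lambda>y. (g y, b y))"
    using assms by (simp add: continuous_map_paired)
  from continuous_map_compose[OF this \<alpha>_cont] show ?thesis by (simp add: comp_def)
qed

lemma \<alpha>_closed: "g \<in> carrier \<G> \<Longrightarrow> b \<in> carrier B \<Longrightarrow> \<alpha> g b \<in> carrier B"
  using continuous_map_in[OF \<alpha>_cont, of "(g, b)"] sgtop_carrier fib.topspace_atop by simp

lemma \<alpha>_hom: assumes g: "g \<in> carrier \<G>" shows "algebra_hom B B (\<alpha> g)"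
proof
  have aut: "algebra_automorphism B (\<alpha> g)" using action g unfolding algebra_action_def by blast
  note au = aut[unfolded algebra_automorphism_def]
  show "x \<in> carrier B \<Longrightarrow> \<alpha> g x \<in> carrier B" for x by (rule \<alpha>_closed[OF g])
  show "x \<in> carrier B \<Longrightarrow> y \<in> carrier B \<Longrightarrow> \<alpha> g (aadd B x y) = aadd B (\<alpha> g x) (\<alpha> g y)"
    "x \<in> carrier B \<Longrightarrow> y \<in> carrier B \<Longrightarrow> \<alpha> g (amult B x y) = amult B (\<alpha> g x) (\<alpha> g y)" for x y
    using au by blast+
  have "\<alpha> g (ascale B 0 (azero B)) = ascale B 0 (\<alpha> g (azero B))" using au fib.zero_closed by blast
  then show "\<alpha> g (azero B) = azero B" using fib.scale_zero \<alpha>_closed[OF g] fib.zero_closed by simp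
qed

sublocale fibG: filtered_group "stable_group B" "stage_top B" by (rule fib.stable_filtered_group)

text \<open>The structure group acts on the entries of matrices. As a map into a stage is continuous if its entries
  are, the action on each stage is continuous because the action on the fibre is.\<close>

theorem matrix_bundle: "equivariant_bundle \<xi> (stable_group B) (stage_top B) (\<lambda>g. mmap (\<alpha> g))"
proof (intro equivariant_bundle.intro equivariant_bundle_axioms.intro)
  show "principal \<xi>" by (rule principal_axioms)
  show "filtered_group (stable_group B) (stage_top B)" by (rule fibG.filtered_group_axioms)
  fix g assume g: "g \<in> carrier (sgrp \<xi>)"
  interpret h: algebra_hom B B "\<alpha> g" by (rule \<alpha>_hom[OF g])
  show "a \<in> carrier (stable_group B) \<Longrightarrow> mmap (\<alpha> g) a \<in> carrier (stable_group B)" for a by (rule h.mmap_carrier)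
  show "a \<in> carrier (stable_group B) \<Longrightarrow> b \<in> carrier (stable_group B) \<Longrightarrow>
    mmap (\<alpha> g) (a \<otimes>\<^bsub>stable_group B\<^esub> b) = mmap (\<alpha> g) a \<otimes>\<^bsub>stable_group B\<^esub> mmap (\<alpha> g) b" for a b by (rule h.mmap_mult)
next
  have ent: "a i j \<in> carrier B" if "a \<in> carrier (stable_group B)" for a i j
    using that fib.quasi_mats_sub fib.mats_entry unfolding fib.stable_group_carrier by blast
  show "a \<in> carrier (stable_group B) \<Longrightarrow> mmap (\<alpha> \<one>\<^bsub>\<G>\<^esub>) a = a" for a
    unfolding mmap_def by (simp add: \<alpha>_one ent)
  show "g \<in> carrier \<G> \<Longrightarrow> h \<in> carrier \<G> \<Longrightarrow> a \<in> carrier (stable_group B) \<Longrightarrow>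
    mmap (\<alpha> (g \<otimes>\<^bsub>\<G>\<^esub> h)) a = mmap (\<alpha> g) (mmap (\<alpha> h) a)" for g h a
    unfolding mmap_def by (simp add: \<alpha>_mult ent)
next
  fix m
  let ?Y = "prod_topology (sgtop \<xi>) (stage_top B m)"
  have s: "continuous_map ?Y (stage_top B m) snd" by (rule continuous_map_snd)
  have "continuous_map ?Y (stage_top B m) (\<lambda>y. mmap (\<alpha> (fst y)) (snd y))"
    unfolding fib.stage_cont_iff
  proof (intro conjI ballI allI)
    fix y assume y: "y \<in> topspace ?Y"
    then have g: "fst y \<in> carrier \<G>" using continuous_map_in[OF continuous_map_fst y] sgtop_carrier by simp
    interpret h: algebra_hom B B "\<alpha> (fst y)" by (rule \<alpha>_hom[OF g])
    have "snd y \<in> quasi (mat_alg (Suc m) B)" using s y unfolding fib.stage_cont_iff by blast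
    then show "mmap (\<alpha> (fst y)) (snd y) \<in> quasi (mat_alg (Suc m) B)" by (rule h.mmap_quasi)
  next
    fix i j
    have "continuous_map ?Y (atop B) (\<lambda>y. snd y i j)" using s unfolding fib.stage_cont_iff by blast
    then show "continuous_map ?Y (atop B) (\<lambda>y. mmap (\<alpha> (fst y)) (snd y) i j)"
      unfolding mmap_def by (rule cm_\<alpha>[OF continuous_map_fst])
  qed
  then show "continuous_map ?Y (stage_top B m) (\<lambda>(g, a). mmap (\<alpha> g) a)" by (simp add: case_prod_unfold)
qed (rule fib.stable_contraction)

subsection \<open>Points of the associated bundle\<close>

abbreviation "ET \<equiv> assoc_total \<xi> B \<alpha>"
abbreviation "cls \<equiv> assoc_class \<xi> \<alpha>"

definition val :: "('p \<times> 'b) set \<Rightarrow> 'p \<Rightarrow> 'b" where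
  "val e p = (THE b. (p, b) \<in> e)"

lemma topspace_ET: "topspace ET = cls ` (P \<times> carrier B)"
  unfolding assoc_total_def topspace_quotient_topology by simp

lemma cls_cont: "continuous_map (prod_topology (total \<xi>) (atop B)) ET cls"
  unfolding continuous_map_def
proof (intro conjI allI impI)
  show "cls \<in> topspace (prod_topology (total \<xi>) (atop B)) \<rightarrow> topspace ET" unfolding topspace_ET by simp
  show "openin (prod_topology (total \<xi>) (atop B)) {x \<in> topspace (prod_topology (total \<xi>) (atop B)). cls x \<in> U}"
    if "openin ET U" for U using that unfolding assoc_total_def openin_quotient_topology by (rule conjunct2)
qed

lemma cls_mem: "p \<in> P \<Longrightarrow> (q, c) \<in> cls (p, b) \<longleftrightarrow> (\<exists>g\<in>carrier \<G>. q = ract \<xi> p g \<and> c = \<alpha> (inv\<^bsub>\<G>\<^esub> g) b)"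
  unfolding assoc_class_def by auto

lemma act_free:
  assumes p: "p \<in> P" and g: "g \<in> carrier \<G>" and h: "h \<in> carrier \<G>" and eq: "ract \<xi> p g = ract \<xi> p h"
  shows "g = h"
proof -
  interpret sg: group \<G> by (rule sgroup)
  obtain U \<sigma> \<gamma> where U: "proj \<xi> p \<in> U" "trivial U \<sigma> \<gamma>" using locally_trivial[OF proj_in[OF p]] .
  then have pU: "p \<in> Over U" using p by simp
  have "\<gamma> p \<otimes>\<^bsub>\<G>\<^esub> g = \<gamma> p \<otimes>\<^bsub>\<G>\<^esub> h" using trivialD(8)[OF U(2) pU] g h eq by metis
  then show ?thesis using trivialD(6)[OF U(2) pU] g h by simp
qed

lemma inv_inv_G: "g \<in> carrier \<G> \<Longrightarrow> inv\<^bsub>\<G>\<^esub> (inv\<^bsub>\<G>\<^esub> g) = g"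
  using group.inv_inv[OF sgroup] .

lemma ract_inv: assumes "p \<in> P" "g \<in> carrier \<G>" shows "ract \<xi> (ract \<xi> p g) (inv\<^bsub>\<G>\<^esub> g) = p"
proof -
  interpret sg: group \<G> by (rule sgroup)
  show ?thesis using ract_mult[OF assms(1) assms(2), of "inv\<^bsub>\<G>\<^esub> g"] assms ract_one by simp
qed

lemma act_transitive:
  assumes p: "p \<in> P" and q: "q \<in> P" and pq: "proj \<xi> p = proj \<xi> q"
  obtains g where "g \<in> carrier \<G>" "q = ract \<xi> p g"
proof -
  interpret sg: group \<G> by (rule sgroup)
  obtain U \<sigma> \<gamma> where U: "proj \<xi> p \<in> U" "trivial U \<sigma> \<gamma>" using locally_trivial[OF proj_in[OF p]] .
  then have pU: "p \<in> Over U" and qU: "q \<in> Over U" using p q pq by simp_all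
  note gp = trivialD(6)[OF U(2) pU] and gq = trivialD(6)[OF U(2) qU]
  let ?s = "\<sigma> (proj \<xi> p)"
  have s: "?s \<in> P" using trivialD(4)[OF U(2) U(1)] .
  have "?s = ract \<xi> p (inv\<^bsub>\<G>\<^esub> (\<gamma> p))" using ract_inv[OF s gp] trivialD(7)[OF U(2) pU] by simp
  moreover have "q = ract \<xi> ?s (\<gamma> q)" using trivialD(7)[OF U(2) qU] pq by simp
  ultimately have "q = ract \<xi> p (inv\<^bsub>\<G>\<^esub> (\<gamma> p) \<otimes>\<^bsub>\<G>\<^esub> \<gamma> q)" using ract_mult[OF p _ gq] gp by simp
  moreover have "inv\<^bsub>\<G>\<^esub> (\<gamma> p) \<otimes>\<^bsub>\<G>\<^esub> \<gamma> q \<in> carrier \<G>" using gp gq by simp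
  ultimately show ?thesis using that by blast
qed

lemma val_cls:
  assumes p: "p \<in> P" and b: "b \<in> carrier B" and g: "g \<in> carrier \<G>"
  shows "val (cls (p, b)) (ract \<xi> p g) = \<alpha> (inv\<^bsub>\<G>\<^esub> g) b"
  unfolding val_def
proof (rule the_equality)
  show "(ract \<xi> p g, \<alpha> (inv\<^bsub>\<G>\<^esub> g) b) \<in> cls (p, b)" using cls_mem[OF p] g by blast
  show "c = \<alpha> (inv\<^bsub>\<G>\<^esub> g) b" if c: "(ract \<xi> p g, c) \<in> cls (p, b)" for c
    using c act_free[OF p g] unfolding cls_mem[OF p] by metis
qed

lemma val_cls_self: "p \<in> P \<Longrightarrow> b \<in> carrier B \<Longrightarrow> val (cls (p, b)) p = b"
  using val_cls[of p b "\<one>\<^bsub>\<G>\<^esub>"] ract_one \<alpha>_one group.is_monoid[OF sgroup] group.inv_closed[OF sgroup]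
  by (metis monoid.inv_one monoid.one_closed)

lemma assoc_proj_cls: assumes p: "p \<in> P" and b: "b \<in> carrier B" shows "assoc_proj \<xi> (cls (p, b)) = proj \<xi> p"
  unfolding assoc_proj_def
proof (rule the_equality)
  have one: "\<one>\<^bsub>\<G>\<^esub> \<in> carrier \<G>" using group.is_monoid[OF sgroup] by (rule monoid.one_closed)
  have "(ract \<xi> p \<one>\<^bsub>\<G>\<^esub>, \<alpha> (inv\<^bsub>\<G>\<^esub> \<one>\<^bsub>\<G>\<^esub>) b) \<in> cls (p, b)" using cls_mem[OF p] one by blast
  then show "\<exists>(q, c)\<in>cls (p, b). proj \<xi> q = proj \<xi> p" using proj_ract[OF p one] by blast
  show "x = proj \<xi> p" if "\<exists>(q, c)\<in>cls (p, b). proj \<xi> q = x" for x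
    using that proj_ract[OF p] cls_mem[OF p] by fastforce
qed

text \<open>A point of the associated bundle over \<open>x\<close> is the graph of an equivariant function on the
  fibre of the principal bundle over \<open>x\<close>.\<close>

lemma point_graph:
  assumes e: "e \<in> topspace ET" and p: "p \<in> P" and pe: "proj \<xi> p = assoc_proj \<xi> e"
  shows "val e p \<in> carrier B" "e = cls (p, val e p)" "g \<in> carrier \<G> \<Longrightarrow> val e (ract \<xi> p g) = \<alpha> (inv\<^bsub>\<G>\<^esub> g) (val e p)"
proof -
  interpret sg: group \<G> by (rule sgroup)
  obtain q b where q: "q \<in> P" "b \<in> carrier B" "e = cls (q, b)" using e topspace_ET by auto
  then have "proj \<xi> q = proj \<xi> p" using assoc_proj_cls pe by simp
  then obtain g where g: "g \<in> carrier \<G>" "p = ract \<xi> q g" using act_transitive[OF q(1) p] by blast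
  have v: "val e p = \<alpha> (inv\<^bsub>\<G>\<^esub> g) b" using val_cls[OF q(1,2) g(1)] q(3) g(2) by simp
  show vC: "val e p \<in> carrier B" unfolding v using \<alpha>_closed g q by simp
  show ec: "e = cls (p, val e p)"
  proof (intro subset_antisym subsetI)
    fix y assume "y \<in> e"
    then obtain h where h: "h \<in> carrier \<G>" "y = (ract \<xi> q h, \<alpha> (inv\<^bsub>\<G>\<^esub> h) b)"
      using cls_mem[OF q(1)] q(3) by (metis surj_pair)
    let ?k = "inv\<^bsub>\<G>\<^esub> g \<otimes>\<^bsub>\<G>\<^esub> h"
    have k: "?k \<in> carrier \<G>" using g h by simp
    have "ract \<xi> p ?k = ract \<xi> q (g \<otimes>\<^bsub>\<G>\<^esub> ?k)" using ract_mult[OF q(1) g(1) k] g(2) by simp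
    also have "g \<otimes>\<^bsub>\<G>\<^esub> ?k = h" using g h by (simp add: sg.m_assoc[symmetric])
    finally have 1: "ract \<xi> p ?k = ract \<xi> q h" .
    have "\<alpha> (inv\<^bsub>\<G>\<^esub> ?k) (val e p) = \<alpha> (inv\<^bsub>\<G>\<^esub> ?k \<otimes>\<^bsub>\<G>\<^esub> inv\<^bsub>\<G>\<^esub> g) b"
      unfolding v using \<alpha>_mult[of "inv\<^bsub>\<G>\<^esub> ?k" "inv\<^bsub>\<G>\<^esub> g" b] g k q by simp
    also have "inv\<^bsub>\<G>\<^esub> ?k \<otimes>\<^bsub>\<G>\<^esub> inv\<^bsub>\<G>\<^esub> g = inv\<^bsub>\<G>\<^esub> h" using g h by (simp add: sg.inv_mult_group sg.m_assoc)
    finally show "y \<in> cls (p, val e p)" using h(2) 1 k cls_mem[OF p] by metis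
  next
    fix y assume "y \<in> cls (p, val e p)"
    then obtain h where h: "h \<in> carrier \<G>" "y = (ract \<xi> p h, \<alpha> (inv\<^bsub>\<G>\<^esub> h) (val e p))"
      using cls_mem[OF p] by (metis surj_pair)
    have "ract \<xi> p h = ract \<xi> q (g \<otimes>\<^bsub>\<G>\<^esub> h)" using ract_mult[OF q(1) g(1) h(1)] g(2) by simp
    moreover have "\<alpha> (inv\<^bsub>\<G>\<^esub> h) (val e p) = \<alpha> (inv\<^bsub>\<G>\<^esub> (g \<otimes>\<^bsub>\<G>\<^esub> h)) b"
      unfolding v using \<alpha>_mult[of "inv\<^bsub>\<G>\<^esub> h" "inv\<^bsub>\<G>\<^esub> g" b] g h q by (simp add: sg.inv_mult_group)
    ultimately have "y \<in> cls (q, b)" using h cls_mem[OF q(1), of "fst y" "snd y" b] g by auto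
    then show "y \<in> e" using q(3) by simp
  qed
  show "g \<in> carrier \<G> \<Longrightarrow> val e (ract \<xi> p g) = \<alpha> (inv\<^bsub>\<G>\<^esub> g) (val e p)" for g
    using val_cls[OF p vC] ec by metis
qed

lemma point_mem:
  assumes e: "e \<in> topspace ET"
  shows "(p, b) \<in> e \<longleftrightarrow> p \<in> P \<and> proj \<xi> p = assoc_proj \<xi> e \<and> b = val e p" (is "?L \<longleftrightarrow> ?R")
proof
  assume L: ?L
  obtain q c where q: "q \<in> P" "c \<in> carrier B" "e = cls (q, c)" using e topspace_ET by auto
  then obtain g where g: "g \<in> carrier \<G>" "p = ract \<xi> q g" "b = \<alpha> (inv\<^bsub>\<G>\<^esub> g) c" using L cls_mem[OF q(1)] by blast
  show ?R using q g val_cls[OF q(1,2) g(1)] ract_closed[OF q(1) g(1)] proj_ract[OF q(1) g(1)] assoc_proj_cls[OF q(1,2)] by simp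
next
  assume R: ?R
  then have "e = cls (p, val e p)" "val e p \<in> carrier B" using point_graph[OF e] by blast+
  then have "(p, val e p) \<in> e \<longleftrightarrow> (\<exists>g\<in>carrier \<G>. p = ract \<xi> p g \<and> val e p = \<alpha> (inv\<^bsub>\<G>\<^esub> g) (val e p))"
    using cls_mem[of p p "val e p" "val e p"] R by metis
  moreover have "\<one>\<^bsub>\<G>\<^esub> \<in> carrier \<G>" "inv\<^bsub>\<G>\<^esub> \<one>\<^bsub>\<G>\<^esub> = \<one>\<^bsub>\<G>\<^esub>" using group.is_monoid[OF sgroup]
    by (simp_all add: monoid.inv_one monoid.one_closed)
  moreover have "\<alpha> \<one>\<^bsub>\<G>\<^esub> (val e p) = val e p" "ract \<xi> p \<one>\<^bsub>\<G>\<^esub> = p"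
    using \<alpha>_one[OF \<open>val e p \<in> carrier B\<close>] R ract_one by simp_all
  ultimately have "(p, val e p) \<in> e" by metis
  then show ?L using R by simp
qed

definition graph :: "('p \<Rightarrow> 'b) \<Rightarrow> 'x \<Rightarrow> ('p \<times> 'b) set" where
  "graph w x = {(p, w p) | p. p \<in> P \<and> proj \<xi> p = x}"

lemma graph_val:
  assumes e: "e \<in> topspace ET" and w: "\<And>p. p \<in> P \<Longrightarrow> proj \<xi> p = assoc_proj \<xi> e \<Longrightarrow> w p = val e p"
  shows "graph w (assoc_proj \<xi> e) = e"
proof (intro subset_antisym subsetI)
  show "y \<in> graph w (assoc_proj \<xi> e)" if "y \<in> e" for y
    using that w point_mem[OF e] unfolding graph_def by (cases y) auto
  show "y \<in> e" if "y \<in> graph w (assoc_proj \<xi> e)" for y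
    using that w point_mem[OF e] unfolding graph_def by auto
qed

lemma graph_cls:
  assumes p: "p \<in> P" and wc: "w p \<in> carrier B"
    and eq: "\<And>g. g \<in> carrier \<G> \<Longrightarrow> w (ract \<xi> p g) = \<alpha> (inv\<^bsub>\<G>\<^esub> g) (w p)"
  shows "graph w (proj \<xi> p) = cls (p, w p)"
proof -
  have e: "cls (p, w p) \<in> topspace ET" using topspace_ET p wc by blast
  have "w q = val (cls (p, w p)) q" if q: "q \<in> P" "proj \<xi> q = assoc_proj \<xi> (cls (p, w p))" for q
  proof -
    have "proj \<xi> p = proj \<xi> q" using q assoc_proj_cls[OF p wc] by simp
    then obtain g where "g \<in> carrier \<G>" "q = ract \<xi> p g" using act_transitive[OF p q(1)] by blast
    then show ?thesis using val_cls[OF p wc] eq by simp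
  qed
  from graph_val[OF e this] show ?thesis using assoc_proj_cls[OF p wc] by simp
qed

lemma fibre_point: assumes x: "x \<in> topspace (base \<xi>)" obtains p where "p \<in> P" "proj \<xi> p = x"
proof -
  obtain U \<sigma> \<gamma> where "x \<in> U" "trivial U \<sigma> \<gamma>" using locally_trivial[OF x] .
  then show ?thesis using that trivialD(3,4) by blast
qed

text \<open>Locally \<open>graph w (r y)\<close> is the class of \<open>(\<sigma> (r y), w (\<sigma> (r y)) y)\<close> for a local section \<open>\<sigma>\<close>, and this
  depends continuously on \<open>y\<close>.\<close>

lemma graph_cont:
  assumes r: "continuous_map Y (base \<xi>) r"
    and w: "continuous_map (prod_topology (total \<xi>) Y) (atop B) (\<lambda>a. w (fst a) (snd a))"
    and eq: "\<And>p y g. p \<in> P \<Longrightarrow> y \<in> topspace Y \<Longrightarrow> g \<in> carrier \<G> \<Longrightarrow> w (ract \<xi> p g) y = \<alpha> (inv\<^bsub>\<G>\<^esub> g) (w p y)"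
  shows "continuous_map Y ET (\<lambda>y. graph (\<lambda>p. w p y) (r y))"
proof (rule continuous_map_locally)
  fix y0 assume y0: "y0 \<in> topspace Y"
  have wc: "w p y \<in> carrier B" if "p \<in> P" "y \<in> topspace Y" for p y
    using fib.cont_closed[OF w, of "(p, y)"] that by simp
  obtain U \<sigma> \<gamma> where U: "r y0 \<in> U" "trivial U \<sigma> \<gamma>" using locally_trivial[OF continuous_map_in[OF r y0]] .
  note t = trivialD[OF U(2)]
  define V where "V = {y \<in> topspace Y. r y \<in> U}"
  have V: "openin Y V" unfolding V_def by (rule openin_continuous_map_preimage[OF r t(1)])
  have tV: "topspace (subtopology Y V) = V" unfolding V_def by auto
  have rV: "continuous_map (subtopology Y V) (subtopology (base \<xi>) U) r"
    unfolding continuous_map_in_subtopology tV using continuous_map_from_subtopology[OF r] unfolding V_def by auto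
  have s: "continuous_map (subtopology Y V) (total \<xi>) (\<lambda>y. \<sigma> (r y))"
    using continuous_map_compose[OF rV t(2)] by (simp add: comp_def)
  have "continuous_map (subtopology Y V) (prod_topology (total \<xi>) Y) (\<lambda>y. (\<sigma> (r y), y))"
    using s continuous_map_from_subtopology[OF continuous_map_identity] by (simp add: continuous_map_paired)
  from continuous_map_compose[OF this w]
  have "continuous_map (subtopology Y V) (atop B) (\<lambda>y. w (\<sigma> (r y)) y)" by (simp add: comp_def)
  then have "continuous_map (subtopology Y V) (prod_topology (total \<xi>) (atop B)) (\<lambda>y. (\<sigma> (r y), w (\<sigma> (r y)) y))"
    using s by (simp add: continuous_map_paired)
  from continuous_map_compose[OF this cls_cont]
  have "continuous_map (subtopology Y V) ET (\<lambda>y. cls (\<sigma> (r y), w (\<sigma> (r y)) y))" by (simp add: comp_def)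
  moreover have "cls (\<sigma> (r y), w (\<sigma> (r y)) y) = graph (\<lambda>p. w p y) (r y)" if "y \<in> topspace (subtopology Y V)" for y
  proof -
    have y: "y \<in> topspace Y" "r y \<in> U" using that unfolding tV V_def by auto
    show ?thesis using graph_cls[OF t(4)[OF y(2)], of "\<lambda>p. w p y"] wc[OF t(4)[OF y(2)] y(1)] eq[OF t(4)[OF y(2)] y(1)] t(3)[OF y(2)] by simp
  qed
  ultimately have "continuous_map (subtopology Y V) ET (\<lambda>y. graph (\<lambda>p. w p y) (r y))"
    by (rule continuous_map_eq)
  then show "\<exists>V. openin Y V \<and> y0 \<in> V \<and> continuous_map (subtopology Y V) ET (\<lambda>y. graph (\<lambda>p. w p y) (r y))"
    using V y0 U(1) unfolding V_def by blast
qed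

text \<open>The open sets of the associated bundle that a trivialization makes visible.\<close>

definition chart :: "'x set \<Rightarrow> ('x \<Rightarrow> 'p) \<Rightarrow> 'b set \<Rightarrow> ('p \<times> 'b) set set" where
  "chart U \<sigma> O' = {e \<in> topspace ET. assoc_proj \<xi> e \<in> U \<and> val e (\<sigma> (assoc_proj \<xi> e)) \<in> O'}"

lemma openin_chart:
  assumes U: "trivial U \<sigma> \<gamma>" and O': "openin (atop B) O'"
  shows "openin ET (chart U \<sigma> O')"
proof -
  note t = trivialD[OF U]
  let ?Q = "prod_topology (total \<xi>) (atop B)"
  let ?R = "prod_topology (over U) (atop B)"
  have RQ: "?R = subtopology ?Q (Over U \<times> carrier B)"
    using prod_topology_subtopology(1)[of "total \<xi>" "{p \<in> P. proj \<xi> p \<in> U}" "atop B"] fib.topspace_atop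
    unfolding over_def[symmetric] topspace_over by simp
  have op: "openin ?Q (Over U \<times> carrier B)"
    using openin_over[OF t(1) openin_subset[OF t(1)]] openin_topspace[of "atop B"] fib.topspace_atop
    unfolding over_topspace by (simp add: openin_prod_Times_iff)
  have c: "continuous_map ?R (atop B) (\<lambda>y. \<alpha> (\<gamma> (fst y)) (snd y))"
    using continuous_map_compose[OF continuous_map_fst t(5)] by (intro cm_\<alpha> continuous_map_snd) (simp add: comp_def)
  have "openin ?R {y \<in> topspace ?R. \<alpha> (\<gamma> (fst y)) (snd y) \<in> O'}" by (rule openin_continuous_map_preimage[OF c O'])
  then have "openin (subtopology ?Q (Over U \<times> carrier B)) {y \<in> topspace ?R. \<alpha> (\<gamma> (fst y)) (snd y) \<in> O'}"
    by (rule subst[OF RQ])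
  from openin_trans_full[OF this op]
  have op2: "openin ?Q {y \<in> topspace ?R. \<alpha> (\<gamma> (fst y)) (snd y) \<in> O'}" .
  have "{y \<in> topspace ?Q. cls y \<in> chart U \<sigma> O'} = {y \<in> topspace ?R. \<alpha> (\<gamma> (fst y)) (snd y) \<in> O'}"
  proof -
    have "cls (p, b) \<in> chart U \<sigma> O' \<longleftrightarrow> proj \<xi> p \<in> U \<and> \<alpha> (\<gamma> p) b \<in> O'" if p: "p \<in> P" and b: "b \<in> carrier B" for p b
    proof (cases "proj \<xi> p \<in> U")
      case True
      then have pU: "p \<in> Over U" using p by simp
      have g: "\<gamma> p \<in> carrier \<G>" using t(6)[OF pU] .
      have "\<sigma> (proj \<xi> p) = ract \<xi> p (inv\<^bsub>\<G>\<^esub> (\<gamma> p))"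
        using ract_inv[OF t(4)[OF True] g] t(7)[OF pU] by simp
      then have "val (cls (p, b)) (\<sigma> (proj \<xi> p)) = \<alpha> (\<gamma> p) b"
        using val_cls[OF p b group.inv_closed[OF sgroup g]] inv_inv_G[OF g] by simp
      then show ?thesis using True assoc_proj_cls[OF p b] topspace_ET p b unfolding chart_def by simp
    next
      case False
      then show ?thesis using assoc_proj_cls[OF p b] unfolding chart_def by simp
    qed
    then show ?thesis by auto
  qed
  moreover have "chart U \<sigma> O' \<subseteq> cls ` topspace ?Q" using topspace_ET unfolding chart_def by auto
  ultimately show ?thesis using op2 unfolding assoc_total_def openin_quotient_topology by simp
qed

end

section \<open>Algebras of sections\<close>

locale section_bundle = algebra_bundle \<xi> B \<alpha>
  for \<xi> :: "('g, 'x, 'p) pbundle" and B :: "('k::real_or_complex, 'b) normed_alg" and \<alpha> :: "'g \<Rightarrow> 'b \<Rightarrow> 'b" +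
  fixes N :: "('x \<Rightarrow> ('p \<times> 'b) set) \<Rightarrow> real"
  assumes norm: "section_norm \<xi> B \<alpha> N"
begin

abbreviation "S \<equiv> sections \<xi> B \<alpha>"
abbreviation "A \<equiv> section_algebra \<xi> B \<alpha> N"

sublocale sec: banach_algebra "section_algebra \<xi> B \<alpha> N"
  using norm unfolding section_norm_def by blast

lemma carrier_A: "carrier A = S"
  by (simp add: section_algebra_def)

text \<open>Sections are treated as equivariant functions on the total space of the principal bundle.\<close>

definition ev :: "('x \<Rightarrow> ('p \<times> 'b) set) \<Rightarrow> 'p \<Rightarrow> 'b" where
  "ev s p = val (s (proj \<xi> p)) p"

definition mk :: "('p \<Rightarrow> 'b) \<Rightarrow> 'x \<Rightarrow> ('p \<times> 'b) set" where
  "mk w = (\<lambda>x\<in>topspace (base \<xi>). graph w x)"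

lemma section_point:
  assumes s: "s \<in> S" and x: "x \<in> topspace (base \<xi>)"
  shows "s x \<in> topspace ET" "assoc_proj \<xi> (s x) = x"
proof -
  have c: "continuous_map (base \<xi>) ET s" using s unfolding sections_def by blast
  show "s x \<in> topspace ET" by (rule continuous_map_in[OF c x])
  show "assoc_proj \<xi> (s x) = x" using s x unfolding sections_def by blast
qed

lemma ev_closed: assumes s: "s \<in> S" and p: "p \<in> P" shows "ev s p \<in> carrier B"
  unfolding ev_def using point_graph(1)[OF section_point(1)[OF s proj_in[OF p]] p] section_point(2)[OF s proj_in[OF p]] by simp

lemma ev_ract: assumes s: "s \<in> S" and p: "p \<in> P" and g: "g \<in> carrier \<G>"
  shows "ev s (ract \<xi> p g) = \<alpha> (inv\<^bsub>\<G>\<^esub> g) (ev s p)"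
  unfolding ev_def proj_ract[OF p g]
  using point_graph(3)[OF section_point(1)[OF s proj_in[OF p]] p _ g] section_point(2)[OF s proj_in[OF p]] by simp

lemma section_graph: assumes s: "s \<in> S" and x: "x \<in> topspace (base \<xi>)" shows "graph (ev s) x = s x"
  using graph_val[OF section_point(1)[OF s x], of "ev s"] section_point(2)[OF s x] unfolding ev_def by simp

lemma section_eqI:
  assumes s: "s \<in> S" and t: "t \<in> S" and eq: "\<And>p. p \<in> P \<Longrightarrow> ev s p = ev t p"
  shows "s = t"
proof (rule extensionalityI)
  show "s \<in> extensional (topspace (base \<xi>))" "t \<in> extensional (topspace (base \<xi>))" using s t unfolding sections_def by blast+
  have "graph (ev s) x = graph (ev t) x" for x unfolding graph_def using eq by auto
  then show "s x = t x" if "x \<in> topspace (base \<xi>)" for x using section_graph[OF s that] section_graph[OF t that] by simp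
qed

lemma mk_section:
  assumes w: "continuous_map (total \<xi>) (atop B) w"
    and eq: "\<And>p g. p \<in> P \<Longrightarrow> g \<in> carrier \<G> \<Longrightarrow> w (ract \<xi> p g) = \<alpha> (inv\<^bsub>\<G>\<^esub> g) (w p)"
  shows "mk w \<in> S" "p \<in> P \<Longrightarrow> ev (mk w) p = w p"
proof -
  note wc = fib.cont_closed[OF w]
  have mkp: "mk w (proj \<xi> p) = cls (p, w p)" if p: "p \<in> P" for p
    unfolding mk_def using graph_cls[where w = w, OF p wc[OF p] eq[OF p]] proj_in[OF p] by simp
  have "continuous_map (prod_topology (total \<xi>) (base \<xi>)) (atop B) (\<lambda>a. w (fst a))"
    using continuous_map_compose[OF continuous_map_fst w] by (simp add: comp_def)
  then have "continuous_map (base \<xi>) ET (\<lambda>x. graph (\<lambda>p. w p) x)"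
    by (intro graph_cont[OF continuous_map_identity]) (use eq in simp_all)
  then have "continuous_map (base \<xi>) ET (mk w)"
    by (rule continuous_map_eq) (simp add: mk_def)
  moreover have "assoc_proj \<xi> (mk w x) = x" if x: "x \<in> topspace (base \<xi>)" for x
  proof -
    obtain p where p: "p \<in> P" "proj \<xi> p = x" using fibre_point[OF x] .
    then show ?thesis using mkp[OF p(1)] assoc_proj_cls[OF p(1) wc[OF p(1)]] by simp
  qed
  ultimately show "mk w \<in> S" unfolding sections_def mk_def by simp
  show "p \<in> P \<Longrightarrow> ev (mk w) p = w p" unfolding ev_def using mkp val_cls_self wc by simp
qed

lemma val_eqI: "(\<And>c. (p, c) \<in> e \<longleftrightarrow> c = b) \<Longrightarrow> val e p = b"
  unfolding val_def by (rule the_equality) simp_all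

lemma ev_hom:
  assumes p: "p \<in> P"
  shows "algebra_hom A B (\<lambda>s. ev s p)"
proof (intro algebra_hom.intro algebra_hom_axioms.intro)
  show "banach_algebra A" "banach_algebra B" by (rule sec.banach_algebra_axioms fib.banach_algebra_axioms)+
  have mem: "(p, b) \<in> s (proj \<xi> p) \<longleftrightarrow> b = ev s p" if "s \<in> S" for s b
    unfolding ev_def using point_mem[OF section_point(1)[OF that proj_in[OF p]], of p b]
      section_point(2)[OF that proj_in[OF p]] p by simp
  show "x \<in> carrier A \<Longrightarrow> ev x p \<in> carrier B" for x unfolding carrier_A by (rule ev_closed[OF _ p])
  show "ev (azero A) p = azero B"
    unfolding ev_def using p proj_in[OF p] by (intro val_eqI) (auto simp: section_algebra_def fib_zero_def)
  fix s t assume "s \<in> carrier A" "t \<in> carrier A"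
  then have st: "s \<in> S" "t \<in> S" unfolding carrier_A .
  show "ev (aadd A s t) p = aadd B (ev s p) (ev t p)"
    unfolding ev_def[of "aadd A s t"] using proj_in[OF p] mem[OF st(1)] mem[OF st(2)]
    by (intro val_eqI) (simp add: section_algebra_def fib_add_def)
  show "ev (amult A s t) p = amult B (ev s p) (ev t p)"
    unfolding ev_def[of "amult A s t"] using proj_in[OF p] mem[OF st(1)] mem[OF st(2)]
    by (intro val_eqI) (simp add: section_algebra_def fib_mult_def)
qed

text \<open>By the definition of a section norm the section algebra carries the compact-open topology, and continuity
  can be tested on a subbasis of it.\<close>

lemma compact_open_cont:
  "continuous_map Y (atop A) F \<longleftrightarrow> (\<forall>y\<in>topspace Y. F y \<in> S) \<and>
     (\<forall>K U. compactin (base \<xi>) K \<longrightarrow> openin ET U \<longrightarrow> openin Y {y \<in> topspace Y. F y ` K \<subseteq> U})"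
proof -
  let ?C = "{{f. f ` K \<subseteq> U} | K U. compactin (base \<xi>) K \<and> openin ET U}"
  have "{f :: 'x \<Rightarrow> ('p \<times> 'b) set. f ` {} \<subseteq> {}} \<in> ?C" by blast
  then have "(UNIV :: ('x \<Rightarrow> ('p \<times> 'b) set) set) \<in> ?C" by simp
  then have un: "\<Union>?C = UNIV" by blast
  have pre: "F -` {f. f ` K \<subseteq> U} \<inter> topspace Y = {y \<in> topspace Y. F y ` K \<subseteq> U}" for K U by auto
  have "continuous_map Y (compact_open (base \<xi>) ET) F \<longleftrightarrow> (\<forall>V\<in>?C. openin Y (F -` V \<inter> topspace Y))"
    unfolding compact_open_def continuous_on_generated_topo_iff un by simp
  also have "\<dots> \<longleftrightarrow> (\<forall>K U. compactin (base \<xi>) K \<longrightarrow> openin ET U \<longrightarrow> openin Y {y \<in> topspace Y. F y ` K \<subseteq> U})"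
  proof (intro iffI allI impI ballI)
    fix K U assume all: "\<forall>V\<in>?C. openin Y (F -` V \<inter> topspace Y)" and KU: "compactin (base \<xi>) K" "openin ET U"
    have "{f. f ` K \<subseteq> U} \<in> ?C" using KU by blast
    then have "openin Y ((\<lambda>y. F y) -` {f. f ` K \<subseteq> U} \<inter> topspace Y)" by (rule bspec[OF all])
    then show "openin Y {y \<in> topspace Y. F y ` K \<subseteq> U}" unfolding pre .
  next
    fix V assume all: "\<forall>K U. compactin (base \<xi>) K \<longrightarrow> openin ET U \<longrightarrow> openin Y {y \<in> topspace Y. F y ` K \<subseteq> U}" and "V \<in> ?C"
    then obtain K U where KU: "V = {f. f ` K \<subseteq> U}" "compactin (base \<xi>) K" "openin ET U" by blast
    then show "openin Y (F -` V \<inter> topspace Y)" unfolding KU(1) pre using all by blast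
  qed
  finally have co: "continuous_map Y (compact_open (base \<xi>) ET) F \<longleftrightarrow>
    (\<forall>K U. compactin (base \<xi>) K \<longrightarrow> openin ET U \<longrightarrow> openin Y {y \<in> topspace Y. F y ` K \<subseteq> U})" .
  have at: "atop A = subtopology (compact_open (base \<xi>) ET) S" using norm unfolding section_norm_def by blast
  show ?thesis unfolding at continuous_map_in_subtopology co by blast
qed

text \<open>Half of the exponential law for the compact-open topology: by the tube lemma, if \<open>F y\<close> maps a compact set
  into an open one, then so does \<open>F y\<^sub>1\<close> for \<open>y\<^sub>1\<close> near \<open>y\<close>.\<close>

lemma cont_of_ev:
  assumes F: "\<And>y. y \<in> topspace Y \<Longrightarrow> F y \<in> S"
    and c: "continuous_map (prod_topology (total \<xi>) Y) (atop B) (\<lambda>a. ev (F (snd a)) (fst a))"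
  shows "continuous_map Y (atop A) F"
  unfolding compact_open_cont
proof (intro conjI ballI allI impI)
  show "F y \<in> S" if "y \<in> topspace Y" for y by (rule F[OF that])
  fix K U assume K: "compactin (base \<xi>) K" and U: "openin ET U"
  let ?Y = "prod_topology (base \<xi>) Y"
  have KX: "K \<subseteq> topspace (base \<xi>)" using K by (rule compactin_subset_topspace)
  have "continuous_map (prod_topology (total \<xi>) ?Y) (prod_topology (total \<xi>) Y) (\<lambda>a. (fst a, snd (snd a)))"
    unfolding continuous_map_paired
    using continuous_map_compose[OF continuous_map_snd continuous_map_snd, of "total \<xi>" "base \<xi>" Y]
    by (intro conjI continuous_map_fst) (simp add: comp_def)
  from continuous_map_compose[OF this c]
  have "continuous_map (prod_topology (total \<xi>) ?Y) (atop B) (\<lambda>a. ev (F (snd (snd a))) (fst a))" by (simp add: comp_def)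
  then have "continuous_map ?Y ET (\<lambda>a. graph (\<lambda>p. ev (F (snd a)) p) (fst a))"
    by (intro graph_cont[OF continuous_map_fst]) (use ev_ract F in auto)
  then have \<Psi>: "continuous_map ?Y ET (\<lambda>a. F (snd a) (fst a))"
    by (rule continuous_map_eq) (use section_graph F in auto)
  let ?W = "{a \<in> topspace ?Y. F (snd a) (fst a) \<in> U}"
  have W: "openin ?Y ?W" by (rule openin_continuous_map_preimage[OF \<Psi> U])
  show "openin Y {y \<in> topspace Y. F y ` K \<subseteq> U}"
  proof (subst openin_subopen, intro ballI)
    fix y assume y: "y \<in> {y \<in> topspace Y. F y ` K \<subseteq> U}"
    then have "K \<times> {y} \<subseteq> ?W" using KX by auto
    then obtain O1 V where V: "openin Y V" "K \<subseteq> O1" "y \<in> V" "O1 \<times> V \<subseteq> ?W"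
      using tube_lemma_left[OF W K, of y] y by blast
    have "V \<subseteq> {y \<in> topspace Y. F y ` K \<subseteq> U}"
    proof
      fix v assume v: "v \<in> V"
      have "F v x \<in> U" if "x \<in> K" for x using subsetD[OF V(4), of "(x, v)"] V(2) v that by auto
      then show "v \<in> {y \<in> topspace Y. F y ` K \<subseteq> U}" using openin_subset[OF V(1)] v by auto
    qed
    then show "\<exists>T. openin Y T \<and> y \<in> T \<and> T \<subseteq> {y \<in> topspace Y. F y ` K \<subseteq> U}" using V by blast
  qed
qed

text \<open>The other half, which needs compact neighbourhoods in the base: the compact-open topology controls the
  sections near \<open>F y\<close> on all of such a neighbourhood at once. Along a local section \<open>\<sigma>\<close> this gives continuity of the
  coordinate \<open>k\<close>; the other points of the principal bundle are reached by equivariance.\<close>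

lemma ev_cont:
  assumes X: "compact_space (base \<xi>)" "regular_space (base \<xi>)"
    and F: "continuous_map Y (atop A) F"
  shows "continuous_map (prod_topology (total \<xi>) Y) (atop B) (\<lambda>a. ev (F (snd a)) (fst a))"
proof (rule continuous_map_locally)
  have FS: "F y \<in> S" if "y \<in> topspace Y" for y using F that unfolding compact_open_cont by blast
  have FC: "continuous_map (base \<xi>) ET (F y)" if "y \<in> topspace Y" for y using FS[OF that] unfolding sections_def by blast
  fix a assume "a \<in> topspace (prod_topology (total \<xi>) Y)"
  then have p0: "fst a \<in> P" and y0: "snd a \<in> topspace Y" by auto
  obtain U \<sigma> \<gamma> where U: "proj \<xi> (fst a) \<in> U" "trivial U \<sigma> \<gamma>" using locally_trivial[OF proj_in[OF p0]] .
  note t = trivialD[OF U(2)]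
  have UX: "U \<subseteq> topspace (base \<xi>)" by (rule openin_subset[OF t(1)])
  define k where "k x y = val (F y x) (\<sigma> x)" for x y
  let ?R = "prod_topology (subtopology (base \<xi>) U) Y"
  have tR: "topspace ?R = U \<times> topspace Y" using UX by auto
  have kc: "k x y \<in> carrier B" if "x \<in> U" "y \<in> topspace Y" for x y
  proof -
    have x: "x \<in> topspace (base \<xi>)" using that UX by blast
    show ?thesis unfolding k_def
      using point_graph(1)[OF section_point(1)[OF FS[OF that(2)] x] t(4)[OF that(1)]] section_point(2)[OF FS[OF that(2)] x] t(3)[OF that(1)] by simp
  qed
  have chart_k: "F y x \<in> chart U \<sigma> O' \<longleftrightarrow> x \<in> U \<and> k x y \<in> O'" if "x \<in> topspace (base \<xi>)" "y \<in> topspace Y" for x y O'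
    unfolding chart_def k_def using section_point[OF FS[OF that(2)] that(1)] by auto
  have "continuous_map ?R (atop B) (\<lambda>r. k (fst r) (snd r))"
    unfolding continuous_map_def
  proof (intro conjI allI impI)
    show "(\<lambda>r. k (fst r) (snd r)) \<in> topspace ?R \<rightarrow> topspace (atop B)"
      unfolding tR fib.topspace_atop using kc by auto
    fix O' assume O': "openin (atop B) O'"
    have ch: "openin ET (chart U \<sigma> O')" by (rule openin_chart[OF U(2) O'])
    have Fo: "openin Y {y \<in> topspace Y. F y ` K \<subseteq> chart U \<sigma> O'}" if "compactin (base \<xi>) K" for K
      using F[unfolded compact_open_cont, THEN conjunct2, rule_format, OF that ch] .
    show "openin ?R {r \<in> topspace ?R. k (fst r) (snd r) \<in> O'}"
    proof (subst openin_subopen, intro ballI)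
      fix r assume "r \<in> {r \<in> topspace ?R. k (fst r) (snd r) \<in> O'}"
      then have r: "fst r \<in> U" "snd r \<in> topspace Y" "k (fst r) (snd r) \<in> O'" unfolding tR by auto
      let ?D = "{x \<in> topspace (base \<xi>). F (snd r) x \<in> chart U \<sigma> O'}"
      have D: "openin (base \<xi>) ?D" by (rule openin_continuous_map_preimage[OF FC[OF r(2)] ch])
      have rD: "fst r \<in> ?D" using chart_k r UX by blast
      have sep: "closedin (base \<xi>) (topspace (base \<xi>) - ?D) \<and> fst r \<in> topspace (base \<xi>) - (topspace (base \<xi>) - ?D)"
        using D rD by blast
      obtain V V' where V: "openin (base \<xi>) V" "openin (base \<xi>) V'" "fst r \<in> V" "topspace (base \<xi>) - ?D \<subseteq> V'" "disjnt V V'"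
        using X(2)[unfolded regular_space_def, rule_format, OF sep] by (elim exE conjE)
      let ?K = "topspace (base \<xi>) - V'"
      have K: "compactin (base \<xi>) ?K" using V(2) by (intro closedin_compact_space[OF X(1)]) blast
      have VK: "V \<subseteq> ?K" using V(5) openin_subset[OF V(1)] unfolding disjnt_def by blast
      have KD: "?K \<subseteq> ?D" using V(4) by blast
      let ?Z = "{y \<in> topspace Y. F y ` ?K \<subseteq> chart U \<sigma> O'}"
      have Z: "openin Y ?Z" by (rule Fo[OF K])
      have rZ: "snd r \<in> ?Z" using r(2) KD by blast
      have VU: "V \<subseteq> U" using VK KD chart_k[OF _ r(2)] by blast
      have "openin ?R (V \<times> ?Z)"
        unfolding openin_prod_Times_iff using Z VU openin_subset_topspace_eq V(1) by (metis openin_open_subtopology t(1))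
      moreover have "V \<times> ?Z \<subseteq> {r \<in> topspace ?R. k (fst r) (snd r) \<in> O'}"
      proof
        fix q assume "q \<in> V \<times> ?Z"
        then have q: "fst q \<in> V" "snd q \<in> topspace Y" "F (snd q) ` ?K \<subseteq> chart U \<sigma> O'" by auto
        then have "fst q \<in> ?K" using VK by blast
        then have "F (snd q) (fst q) \<in> chart U \<sigma> O'" using q(3) by blast
        then show "q \<in> {r \<in> topspace ?R. k (fst r) (snd r) \<in> O'}"
          using chart_k[of "fst q" "snd q"] q VU UX unfolding tR by (auto simp: mem_Times_iff)
      qed
      moreover have "r \<in> V \<times> ?Z" using V(3) rZ by (simp add: mem_Times_iff)
      ultimately show "\<exists>T. openin ?R T \<and> r \<in> T \<and> T \<subseteq> {r \<in> topspace ?R. k (fst r) (snd r) \<in> O'}" by blast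
    qed
  qed
  note k_cont = this
  let ?Q = "prod_topology (over U) Y"
  have pr: "continuous_map (over U) (subtopology (base \<xi>) U) (proj \<xi>)"
    unfolding continuous_map_in_subtopology using proj_over_cont by auto
  have "continuous_map ?Q ?R (\<lambda>a. (proj \<xi> (fst a), snd a))"
    unfolding continuous_map_paired using continuous_map_compose[OF continuous_map_fst pr, of Y]
    by (intro conjI continuous_map_snd) (simp add: comp_def)
  from continuous_map_compose[OF this k_cont]
  have k1: "continuous_map ?Q (atop B) (\<lambda>a. k (proj \<xi> (fst a)) (snd a))" by (simp add: comp_def)
  have "continuous_map ?Q (sgtop \<xi>) (\<lambda>a. inv\<^bsub>\<G>\<^esub> (\<gamma> (fst a)))"
    using continuous_map_compose[OF continuous_map_compose[OF continuous_map_fst t(5)] sinv_cont] by (simp add: comp_def)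
  from cm_\<alpha>[OF this k1]
  have "continuous_map ?Q (atop B) (\<lambda>a. \<alpha> (inv\<^bsub>\<G>\<^esub> (\<gamma> (fst a))) (k (proj \<xi> (fst a)) (snd a)))" .
  moreover have "\<alpha> (inv\<^bsub>\<G>\<^esub> (\<gamma> (fst a))) (k (proj \<xi> (fst a)) (snd a)) = ev (F (snd a)) (fst a)" if "a \<in> topspace ?Q" for a
  proof -
    have pU: "fst a \<in> Over U" and y: "snd a \<in> topspace Y" using that by auto
    then have xU: "proj \<xi> (fst a) \<in> U" by simp
    have "ev (F (snd a)) (ract \<xi> (\<sigma> (proj \<xi> (fst a))) (\<gamma> (fst a))) = \<alpha> (inv\<^bsub>\<G>\<^esub> (\<gamma> (fst a))) (ev (F (snd a)) (\<sigma> (proj \<xi> (fst a))))"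
      by (rule ev_ract[OF FS[OF y] t(4)[OF xU] t(6)[OF pU]])
    then show ?thesis using t(7)[OF pU] t(3)[OF xU] unfolding k_def ev_def by simp
  qed
  ultimately have ev: "continuous_map ?Q (atop B) (\<lambda>a. ev (F (snd a)) (fst a))" by (rule continuous_map_eq)
  have Q: "?Q = subtopology (prod_topology (total \<xi>) Y) (Over U \<times> topspace Y)"
    unfolding topspace_over unfolding over_def by (rule prod_topology_subtopology(1))
  have "openin (prod_topology (total \<xi>) Y) (Over U \<times> topspace Y)"
    using openin_over[OF t(1) UX] unfolding over_topspace openin_prod_Times_iff by simp
  moreover have "a \<in> Over U \<times> topspace Y" using p0 y0 U(1) by (simp add: mem_Times_iff)
  ultimately show "\<exists>V. openin (prod_topology (total \<xi>) Y) V \<and> a \<in> V \<and>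
     continuous_map (subtopology (prod_topology (total \<xi>) Y) V) (atop B) (\<lambda>a. ev (F (snd a)) (fst a))"
    using ev[unfolded Q] by (intro exI conjI)
qed

end

context section_bundle begin

interpretation EB: equivariant_bundle \<xi> "stable_group B" "stage_top B" "\<lambda>g. mmap (\<alpha> g)" by (rule matrix_bundle)
interpretation secG: filtered_group "stable_group A" "stage_top A" by (rule sec.stable_filtered_group)

subsection \<open>Matrices of sections as equivariant matrices\<close>

abbreviation "evm p M \<equiv> mmap (\<lambda>s. ev s p) M"
abbreviation "mkm h \<equiv> (\<lambda>i j. mk (\<lambda>p. h p i j))"

lemma section_matrix_eqI:
  assumes "\<And>i j. M i j \<in> S" "\<And>i j. M' i j \<in> S" and eq: "\<And>p. p \<in> P \<Longrightarrow> evm p M = evm p M'"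
  shows "M = M'"
proof (rule ext, rule ext)
  fix i j
  show "M i j = M' i j"
  proof (rule section_eqI[OF assms(1,2)])
    show "ev (M i j) p = ev (M' i j) p" if "p \<in> P" for p
      using fun_cong[OF fun_cong[OF eq[OF that]], of i j] by (simp add: mmap_def)
  qed
qed

lemma stable_entry: "M \<in> carrier (stable_group A) \<Longrightarrow> M i j \<in> S"
  using sec.quasi_mats_sub sec.mats_entry carrier_A unfolding sec.stable_group_carrier by blast

lemma stable_eqI:
  assumes "M \<in> carrier (stable_group A)" "M' \<in> carrier (stable_group A)" "\<And>p. p \<in> P \<Longrightarrow> evm p M = evm p M'"
  shows "M = M'"
  using assms by (intro section_matrix_eqI stable_entry)

lemma evm_cont:
  assumes X: "compact_space (base \<xi>)" "regular_space (base \<xi>)" and u: "continuous_map Y (stage_top A m) u"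
  shows "continuous_map (prod_topology (total \<xi>) Y) (stage_top B m) (\<lambda>a. evm (fst a) (u (snd a)))"
  unfolding fib.stage_cont_iff
proof (intro conjI ballI allI)
  fix a assume a: "a \<in> topspace (prod_topology (total \<xi>) Y)"
  then have p: "fst a \<in> P" and y: "snd a \<in> topspace Y" by auto
  interpret h: algebra_hom A B "\<lambda>s. ev s (fst a)" by (rule ev_hom[OF p])
  show "evm (fst a) (u (snd a)) \<in> quasi (mat_alg (Suc m) B)"
    using u y unfolding sec.stage_cont_iff by (intro h.mmap_quasi) simp
next
  fix i j
  have "continuous_map Y (atop A) (\<lambda>y. u y i j)" using u unfolding sec.stage_cont_iff by simp
  from ev_cont[OF X this]
  show "continuous_map (prod_topology (total \<xi>) Y) (atop B) (\<lambda>a. evm (fst a) (u (snd a)) i j)" by (simp add: mmap_def)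
qed

lemma evm_Fo:
  assumes X: "compact_space (base \<xi>)" "regular_space (base \<xi>)" and p: "p \<in> P" and M: "M \<in> secG.Fo"
  shows "evm p M \<in> fibG.Fo"
proof -
  interpret h: algebra_hom A B "\<lambda>s. ev s p" by (rule ev_hom[OF p])
  obtain f where f: "continuous_map (top_of_set {0..1::real}) (stage_top A 0) f" "f 0 = \<one>\<^bsub>stable_group A\<^esub>" "f 1 = M"
    using secG.Fo_path[OF M] .
  have "continuous_map (top_of_set {0..1::real}) (prod_topology (total \<xi>) (top_of_set {0..1})) (\<lambda>r. (p, r))"
    using p by (simp add: continuous_map_paired continuous_map_identity)
  from continuous_map_compose[OF this evm_cont[OF X f(1)]]
  have "continuous_map (top_of_set {0..1::real}) (stage_top B 0) (\<lambda>r. evm p (f r))" by (simp add: comp_def)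
  from fibG.Fo_pathI[OF this] show ?thesis using f h.mmap_one by simp
qed

lemma family_of_rel:
  assumes X: "compact_space (base \<xi>)" "regular_space (base \<xi>)" and u: "secG.rel_loop m n u"
  shows "EB.family (Suc n) n (topspace (base \<xi>)) m (\<lambda>p z. evm p (u z))"
proof (rule EB.familyI)
  have uc: "continuous_map (cube (Suc n)) (stage_top A m) u"
    and ua: "\<And>z. z \<in> Cube (Suc n) \<Longrightarrow> secG.admissible secG.Fo n z (u z)"
    using u unfolding secG.rel_loop_def by blast+
  show "continuous_map (prod_topology (over (topspace (base \<xi>))) (cube (Suc n))) (stage_top B m) (\<lambda>y. evm (fst y) (u (snd y)))"
    unfolding over_topspace by (rule evm_cont[OF X uc])
  fix p z assume "p \<in> Over (topspace (base \<xi>))" and z: "z \<in> Cube (Suc n)"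
  then have p: "p \<in> P" unfolding over_topspace by simp
  interpret h: algebra_hom A B "\<lambda>s. ev s p" by (rule ev_hom[OF p])
  show "fibG.admissible fibG.Fo n z (evm p (u z))"
    using ua[OF z] evm_Fo[OF X p] h.mmap_one unfolding secG.admissible_def fibG.admissible_def by metis
  have uS: "u z i j \<in> S" for i j by (rule stable_entry[OF secG.cm_closed[OF uc z]])
  show "evm (ract \<xi> p g) (u z) = mmap (\<alpha> (inv\<^bsub>\<G>\<^esub> g)) (evm p (u z))" if "g \<in> carrier \<G>" for g
    unfolding mmap_def using ev_ract[OF uS p that] by simp
qed

lemma mkm_entry:
  assumes h: "EB.family k n (topspace (base \<xi>)) m h" and z: "z \<in> Cube k"
  shows "mkm (\<lambda>p. h p z) i j \<in> S" "p \<in> P \<Longrightarrow> evm p (mkm (\<lambda>p. h p z)) = h p z"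
proof -
  have hc: "continuous_map (prod_topology (total \<xi>) (cube k)) (stage_top B m) (\<lambda>y. h (fst y) (snd y))"
    using EB.family_cont[OF h] unfolding over_topspace .
  have "continuous_map (prod_topology (total \<xi>) (cube k)) (atop B) (\<lambda>y. h (fst y) (snd y) i j)" for i j
    using hc unfolding fib.stage_cont_iff by simp
  moreover have "continuous_map (total \<xi>) (prod_topology (total \<xi>) (cube k)) (\<lambda>p. (p, z))"
    using z by (simp add: continuous_map_paired continuous_map_identity)
  ultimately have c: "continuous_map (total \<xi>) (atop B) (\<lambda>p. h p z i j)" for i j
    using continuous_map_compose[of "total \<xi>" "prod_topology (total \<xi>) (cube k)" "\<lambda>p. (p, z)" "atop B" "\<lambda>y. h (fst y) (snd y) i j"]
    by (simp add: comp_def)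
  have eq: "h (ract \<xi> p g) z i j = \<alpha> (inv\<^bsub>\<G>\<^esub> g) (h p z i j)" if "p \<in> P" "g \<in> carrier \<G>" for p g i j
    using EB.family_equi[OF h _ z that(2), unfolded over_topspace, OF that(1)] by (simp add: mmap_def)
  show "mkm (\<lambda>p. h p z) i j \<in> S" using mk_section(1)[OF c eq] .
  show "p \<in> P \<Longrightarrow> evm p (mkm (\<lambda>p. h p z)) = h p z"
    unfolding mmap_def using mk_section(2)[OF c eq] by simp
qed

text \<open>The pointwise quasi-inverses again form a continuous equivariant family, so they come from a matrix of
  sections.\<close>

lemma family_quasi:
  assumes h: "EB.family k n (topspace (base \<xi>)) m h" and z: "z \<in> Cube k"
  shows "mkm (\<lambda>p. h p z) \<in> quasi (mat_alg (Suc m) A)"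
proof -
  let ?A = "mat_alg (Suc m) A" and ?B = "mat_alg (Suc m) B"
  interpret MB: banach_algebra ?B by (rule fib.mat_banach)
  interpret MA: banach_algebra ?A by (rule sec.mat_banach)
  let ?k = "\<lambda>p z. inv\<^bsub>stable_group B\<^esub> (h p z)"
  have k: "EB.family k n (topspace (base \<xi>)) m ?k" by (rule EB.family_inv[OF h])
  have in_q: "f p z \<in> quasi ?B" if f: "EB.family k n (topspace (base \<xi>)) m f" and p: "p \<in> P" for f p
    using continuous_map_in[OF EB.family_cont[OF f], of "(p, z)"] p z unfolding over_topspace MB.topspace_qtop by simp
  have mat: "mkm (\<lambda>p. f p z) \<in> carrier ?A" if f: "EB.family k n (topspace (base \<xi>)) m f" for f
  proof (rule sec.matsI)
    show "mkm (\<lambda>p. f p z) i j \<in> carrier A" for i j unfolding carrier_A by (rule mkm_entry(1)[OF f z])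
    fix i j assume ij: "\<not> (i < Suc m \<and> j < Suc m)"
    show "mkm (\<lambda>p. f p z) i j = azero A"
    proof (rule section_eqI)
      show "mkm (\<lambda>p. f p z) i j \<in> S" by (rule mkm_entry(1)[OF f z])
      show "azero A \<in> S" using sec.zero_closed unfolding carrier_A .
      fix p assume p: "p \<in> P"
      interpret e: algebra_hom A B "\<lambda>s. ev s p" by (rule ev_hom[OF p])
      have "ev (mkm (\<lambda>p. f p z) i j) p = f p z i j"
        using fun_cong[OF fun_cong[OF mkm_entry(2)[OF f z p]], of i j] by (simp add: mmap_def)
      also have "\<dots> = azero B" using in_q[OF f p] fib.quasi_mats_sub ij by (intro fib.mats_out[of _ "Suc m"]) blast+
      finally show "ev (mkm (\<lambda>p. f p z) i j) p = ev (azero A) p" using e.hom_zero by simp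
    qed
  qed
  have prod: "circ ?A (mkm (\<lambda>p. f p z)) (mkm (\<lambda>p. f' p z)) = azero ?A"
    if f: "EB.family k n (topspace (base \<xi>)) m f" and f': "EB.family k n (topspace (base \<xi>)) m f'"
      and ff': "\<And>p. p \<in> P \<Longrightarrow> circ ?B (f p z) (f' p z) = azero ?B" for f f'
  proof (rule section_matrix_eqI)
    show "circ ?A (mkm (\<lambda>p. f p z)) (mkm (\<lambda>p. f' p z)) i j \<in> S" "azero ?A i j \<in> S" for i j
      using sec.mats_entry[OF MA.circ_closed[OF mat[OF f] mat[OF f']]] sec.mats_entry[OF MA.zero_closed] unfolding carrier_A by blast+
    fix p assume p: "p \<in> P"
    interpret e: algebra_hom A B "\<lambda>s. ev s p" by (rule ev_hom[OF p])
    show "evm p (circ ?A (mkm (\<lambda>p. f p z)) (mkm (\<lambda>p. f' p z))) = evm p (azero ?A)"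
      unfolding e.mmap_circ[OF mat[OF f] mat[OF f']] e.mmap_zero mkm_entry(2)[OF f z p] mkm_entry(2)[OF f' z p] by (rule ff'[OF p])
  qed
  have i: "circ ?B (h p z) (?k p z) = azero ?B" "circ ?B (?k p z) (h p z) = azero ?B" if "p \<in> P" for p
    using MB.qinv[OF in_q[OF h that]] fib.stable_group_inv[OF in_q[OF h that]] by simp_all
  show ?thesis
    unfolding quasi_def using mat[OF h] mat[OF k] prod[OF h k i(1)] prod[OF k h i(2)] by blast
qed

lemma mkm_cont:
  assumes h: "EB.family k n (topspace (base \<xi>)) m h"
  shows "continuous_map (cube k) (stage_top A m) (\<lambda>z. mkm (\<lambda>p. h p z))"
  unfolding sec.stage_cont_iff
proof (intro conjI ballI allI)
  show "mkm (\<lambda>p. h p z) \<in> quasi (mat_alg (Suc m) A)" if "z \<in> Cube k" for z by (rule family_quasi[OF h that])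
  fix i j
  have "continuous_map (prod_topology (total \<xi>) (cube k)) (atop B) (\<lambda>y. h (fst y) (snd y) i j)"
    using EB.family_cont[OF h] unfolding over_topspace fib.stage_cont_iff by simp
  moreover have "h (fst y) (snd y) i j = ev (mkm (\<lambda>p. h p (snd y)) i j) (fst y)"
    if "y \<in> topspace (prod_topology (total \<xi>) (cube k))" for y
  proof -
    have y: "fst y \<in> P" "snd y \<in> Cube k" using that by auto
    show ?thesis using fun_cong[OF fun_cong[OF mkm_entry(2)[OF h y(2,1)]], of i j] by (simp add: mmap_def)
  qed
  ultimately have "continuous_map (prod_topology (total \<xi>) (cube k)) (atop B) (\<lambda>y. ev (mkm (\<lambda>p. h p (snd y)) i j) (fst y))"
    by (rule continuous_map_eq)
  then show "continuous_map (cube k) (atop A) (\<lambda>z. mkm (\<lambda>p. h p z) i j)"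
    by (intro cont_of_ev mkm_entry(1)[OF h])
qed

lemma null_rel_loop_of_families:
  assumes u: "secG.rel_loop m n u"
    and null_family: "EB.null_family n (topspace (base \<xi>)) (\<lambda>p z. evm p (u z) [^]\<^bsub>stable_group B\<^esub> (N'::nat))"
  shows "\<exists>m'. secG.null_rel_loop (topspace (stage_top A 0)) m' n (\<lambda>z. u z [^]\<^bsub>stable_group A\<^esub> N')"
proof -
  have uc: "continuous_map (cube (Suc n)) (stage_top A m) u" using u unfolding secG.rel_loop_def by blast
  obtain m' h where "EB.contracts n (topspace (base \<xi>)) m' h (\<lambda>p z. evm p (u z) [^]\<^bsub>stable_group B\<^esub> N')"
    using EB.null_familyE[OF null_family] .
  note h = EB.contractsD(1)[OF this] and h0 = EB.contractsD(2)[OF this, unfolded over_topspace]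
    and h1 = EB.contractsD(3)[OF this, unfolded over_topspace]
  let ?h = "\<lambda>z. mkm (\<lambda>p. h p z)"
  have hG: "?h z \<in> carrier (stable_group A)" if "z \<in> Cube (Suc (Suc n))" for z
    using family_quasi[OF h that] sec.stable_group_carrier by blast
  have h_one: "?h z = \<one>\<^bsub>stable_group A\<^esub>"
    if z: "z \<in> Cube (Suc (Suc n))" and one: "\<And>p. p \<in> P \<Longrightarrow> h p z = \<one>\<^bsub>stable_group B\<^esub>" for z
  proof (rule stable_eqI[OF hG[OF z] secG.one_closed])
    fix p assume p: "p \<in> P"
    interpret e: algebra_hom A B "\<lambda>s. ev s p" by (rule ev_hom[OF p])
    show "evm p (?h z) = evm p \<one>\<^bsub>stable_group A\<^esub>" unfolding mkm_entry(2)[OF h z p] e.mmap_one by (rule one[OF p])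
  qed
  have h_adm: "fibG.admissible fibG.Fo n z (h p z)" if "p \<in> P" "z \<in> Cube (Suc (Suc n))" for p z
    using EB.family_adm[OF h _ that(2), unfolded over_topspace, OF that(1)] .
  show ?thesis unfolding secG.null_rel_loop_def
  proof (intro exI conjI ballI impI)
    show "continuous_map (cube (Suc (Suc n))) (stage_top A m') ?h" by (rule mkm_cont[OF h])
    fix z assume z: "z \<in> Cube (Suc (Suc n))"
    show "secG.admissible (topspace (stage_top A 0)) n z (?h z)"
      unfolding secG.admissible_def
    proof (intro conjI impI)
      assume "z 0 = 0 \<or> (\<exists>i\<in>{1..n}. z i = 0 \<or> z i = 1)"
      then have "h p z = \<one>\<^bsub>stable_group B\<^esub>" if "p \<in> P" for p using h_adm[OF that z] unfolding fibG.admissible_def by blast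
      then show "?h z = \<one>\<^bsub>stable_group A\<^esub>" by (rule h_one[OF z])
    next
      assume z1: "z 0 = 1"
      interpret MA: banach_algebra "mat_alg (Suc 0) A" by (rule sec.mat_banach)
      interpret MB: banach_algebra "mat_alg (Suc 0) B" by (rule fib.mat_banach)
      have hq: "h p z \<in> carrier (mat_alg (Suc 0) B)" if "p \<in> P" for p
        using h_adm[OF that z] z1 fibG.Fo_sub MB.quasi_closed unfolding fibG.admissible_def MB.topspace_qtop by blast
      have "?h z \<in> carrier (mat_alg (Suc 0) A)"
      proof (rule sec.matsI)
        show "?h z i j \<in> carrier A" for i j unfolding carrier_A by (rule mkm_entry(1)[OF h z])
        fix i j assume ij: "\<not> (i < Suc 0 \<and> j < Suc 0)"
        show "?h z i j = azero A"
        proof (rule section_eqI)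
          show "?h z i j \<in> S" by (rule mkm_entry(1)[OF h z])
          show "azero A \<in> S" using sec.zero_closed unfolding carrier_A .
          fix p assume p: "p \<in> P"
          interpret e: algebra_hom A B "\<lambda>s. ev s p" by (rule ev_hom[OF p])
          have "ev (?h z i j) p = h p z i j"
            using fun_cong[OF fun_cong[OF mkm_entry(2)[OF h z p]], of i j] by (simp add: mmap_def)
          also have "\<dots> = azero B" by (rule fib.mats_out[OF hq[OF p] ij])
          finally show "ev (?h z i j) p = ev (azero A) p" using e.hom_zero by simp
        qed
      qed
      then show "?h z \<in> topspace (stage_top A 0)"
        unfolding MA.topspace_qtop using family_quasi[OF h z] sec.quasi_mats[of "Suc 0" "Suc m'"] by simp
    qed
    show "?h z = \<one>\<^bsub>stable_group A\<^esub>" if "z (Suc n) = 0" by (rule h_one[OF z h0[OF _ z that]])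
    assume z1: "z (Suc n) = 1"
    have z': "z(Suc n := 0) \<in> Cube (Suc n)" by (rule secG.cube_drop[OF z])
    have uz: "u (z(Suc n := 0)) \<in> carrier (stable_group A)" by (rule secG.cm_closed[OF uc z'])
    show "?h z = u (z(Suc n := 0)) [^]\<^bsub>stable_group A\<^esub> N'"
    proof (rule stable_eqI[OF hG[OF z]])
      show "u (z(Suc n := 0)) [^]\<^bsub>stable_group A\<^esub> N' \<in> carrier (stable_group A)" using uz by (rule secG.nat_pow_closed)
      fix p assume p: "p \<in> P"
      interpret e: algebra_hom A B "\<lambda>s. ev s p" by (rule ev_hom[OF p])
      show "evm p (?h z) = evm p (u (z(Suc n := 0)) [^]\<^bsub>stable_group A\<^esub> N')"
        unfolding mkm_entry(2)[OF h z p] e.mmap_pow[OF uz] by (rule h1[OF p z z1])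
    qed
  qed
qed

text \<open>The fibrewise contractions needed in \<open>families_null\<close> are the relative form of the stability of \<open>B\<close>, and its
  conclusion is the relative form of the stability of the section algebra.\<close>

theorem stable_sections:
  assumes X: "compact_space (base \<xi>)" "metrizable_space (base \<xi>)" "finite_dimensional_space (base \<xi>)"
    and Q: "mult_closed Q" and B: "fibG.stable Q"
  shows "filtered_group.stable (stable_group A) (stage_top A) Q"
proof (rule secG.null_rel_loop_imp_stable)
  fix m n u assume u: "secG.rel_loop m n u"
  have reg: "regular_space (base \<xi>)" using X(2) by (rule metrizable_imp_regular_space)
  have fibre: "\<exists>N\<in>Q. \<exists>m'. fibG.null_rel_loop fibG.Fo m' n (\<lambda>z. w z [^]\<^bsub>stable_group B\<^esub> (N::nat))" if "fibG.rel_loop m n w" for m n w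
    by (rule fibG.stable_imp_null_rel_loop[OF B Q that])
  obtain N' where "N' \<in> Q" "EB.null_family n (topspace (base \<xi>)) (\<lambda>p z. evm p (u z) [^]\<^bsub>stable_group B\<^esub> N')"
    using EB.families_null[OF X Q _ family_of_rel[OF X(1) reg u]] fibre by blast
  then show "\<exists>N'\<in>Q. \<exists>m'. secG.null_rel_loop (topspace (stage_top A 0)) m' n (\<lambda>z. u z [^]\<^bsub>stable_group A\<^esub> (N'::nat))"
    using null_rel_loop_of_families[OF u] by blast
qed

end

theorem theoremC:
  fixes \<xi> :: "('g, 'x, 'p) pbundle"
    and B :: "('k::real_or_complex, 'b) normed_alg"
    and \<alpha> :: "'g \<Rightarrow> 'b \<Rightarrow> 'b"
    and N :: "('x \<Rightarrow> ('p \<times> 'b) set) \<Rightarrow> real"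
  assumes "compact_space (base \<xi>)" and "metrizable_space (base \<xi>)"
    and "finite_dimensional_space (base \<xi>)"
    and "banach_algebra B"
    and "principal_bundle \<xi>"
    and "algebra_action (sgrp \<xi>) (sgtop \<xi>) B \<alpha>"
    and "standard_bundle TYPE('y) TYPE('q) \<xi> B \<alpha>"
    and "section_norm \<xi> B \<alpha> N"
  shows "(bott_stable B \<longrightarrow> bott_stable (section_algebra \<xi> B \<alpha> N)) \<and>
         (rationally_bott_stable B \<longrightarrow> rationally_bott_stable (section_algebra \<xi> B \<alpha> N))"
proof -
  interpret section_bundle \<xi> B \<alpha> N
    by (intro section_bundle.intro algebra_bundle.intro principal.intro algebra_bundle_axioms.intro
        section_bundle_axioms.intro assms)
  have "mult_closed {1}" "mult_closed {0<..}" unfolding mult_closed_def by auto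
  then show ?thesis
    unfolding sec.bott_stable_iff sec.rationally_bott_stable_iff fib.bott_stable_iff fib.rationally_bott_stable_iff
    using stable_sections[OF assms(1-3)] by blast
qed

end
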